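(* Let $f:S^1\to S^2$ be a CaTherine wheel and let $h:S^1\to S^1$, $H:S^2\to S^2$ be orientation-preserving homeomorphisms with $f\circ h=H\circ f$. Then: (1) some finite power $h^n$ ($n\ge1$) of $h$ is either the identity, or has a finite, even, positive number of fixed points on $S^1$, with dynamics alternating between sources and sinks; (2) up to replacing $h^n$ by $h^{-n}$ if necessary, the attracting fixed points are joined by leaves of $\mathcal{L}^+(f)$ and the repelling fixed points are joined by leaves of $\mathcal{L}^-(f)$; (3) if $h^n$ has at least 4 fixed points, then the images in $S^2$ of the attracting (resp. repelling) fixed points of $h^n$ are the unique fixed points of $H$, and are attracting (resp. repelling) for $H$; (4) if $h^n$ has exactly 2 fixed points, then the images in $S^2$ of these fixed points are the unique fixed points of $H$, and either (a) they are distinct and are attracting/repelling for $H$, or (b) they are equal in $S^2$ and the restriction of $H$ to the complement of this unique fixed point is conjugate to a translation of the plane.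
   Context: $S^1,S^2$ are oriented. A closed interval $I\subset S^1$ is a closed subset homeomorphic to $[0,1]$, oriented from $S^1$; $[p,q]$ is the oriented interval from $p$ to $q$. A CaTherine wheel is a continuous surjection $f:S^1\to S^2$ such that for every closed interval $I$, $f(I)$ is a closed disk and $f(\partial I)\subset\partial f(I)$. For each $I$, each component $Y$ of $\partial f(I)\setminus f(\partial I)$ has a unique (canonical) orientation making $f:I\cap f^{-1}(Y)\to Y$ monotone increasing; $Z^+(I)$ is the component (or $\emptyset$) whose canonical orientation agrees with its boundary orientation as part of $\partial f(I)$, $f(I)\subset S^2$. $I$ is degenerate if $f(\partial I)$ is a single point, positively degenerate if also $Z^+(I)=\emptyset$, and negatively degenerate otherwise. $\mathcal{L}^+(f)$ (resp. $\mathcal{L}^-(f)$) is the set of unordered pairs $\{p,q\}$ of distinct points ("leaves") with $[p,q]$ positively (resp. negatively) degenerate. *)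

theory Defs
  imports "HOL-Analysis.Analysis" "HOL-Complex_Analysis.Complex_Analysis" "HOL-Homology.Homology"
begin

text \<open>S^1 is the unit circle in the complex plane, oriented counterclockwise;
  S^2 is the unit sphere in R^3, oriented by the outward normal.\<close>

definition S1 :: "complex set" where
  "S1 = sphere 0 1"

definition S2 :: "(real^3) set" where
  "S2 = sphere 0 1"

text \<open>Counterclockwise angle from p to q, in [0, 2 pi), and the oriented closed
  interval [p,q] of S^1 (for p \<noteq> q this is the closed arc going counterclockwise
  from p to q; every closed interval of S^1 is of this form).\<close>

definition ccw_angle :: "complex \<Rightarrow> complex \<Rightarrow> real" where
  "ccw_angle p q = Arg2pi (q / p)"

definition arc :: "complex \<Rightarrow> complex \<Rightarrow> complex set" where
  "arc p q = {p * cis t | t. 0 \<le> t \<and> t \<le> ccw_angle p q}"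

definition closed_disk :: "(real^3) set \<Rightarrow> bool" where
  "closed_disk D \<longleftrightarrow> D \<subseteq> S2 \<and> D homeomorphic (cball (0::complex) 1)"

text \<open>Boundary of a subset of S^2 (its frontier relative to S^2); for a closed
  disk this is the boundary circle.\<close>

definition bdry :: "(real^3) set \<Rightarrow> (real^3) set" where
  "bdry D = D \<inter> closure (S2 - D)"

text \<open>Orientation-preserving stereographic projection from the north pole (0,0,1)
  onto the complex plane (S^2 oriented by its outward normal).\<close>

definition stereo :: "real^3 \<Rightarrow> complex" where
  "stereo v = Complex (v$1) (- (v$2)) / complex_of_real (1 - v$3)"

definition north :: "real^3" where
  "north = vector [0, 0, 1]"

text \<open>A parametrization \<open>\<delta>\<close> of the boundary circle of a closed disk D, defined on S^1,
  is positively oriented (i.e. induces the boundary orientation of \<open>\<partial>D\<close> as the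
  boundary of \<open>D \<subseteq> S^2\<close>) if, after rotating a point of \<open>S^2 - D\<close> to the north pole
  and projecting stereographically, it winds once positively around the image of
  an interior point of D.\<close>

definition pos_oriented :: "(real^3) set \<Rightarrow> (complex \<Rightarrow> real^3) \<Rightarrow> bool" where
  "pos_oriented D \<delta> \<longleftrightarrow>
     (\<exists>N \<in> S2 - D. \<exists>R. orthogonal_transformation R \<and> det (matrix R) = 1 \<and> R N = north \<and>
        (\<exists>w \<in> D - bdry D.
           winding_number (\<lambda>t. stereo (R (\<delta> (cis (2 * pi * t))))) (stereo (R w)) = 1))"

definition catherine_wheel :: "(complex \<Rightarrow> real^3) \<Rightarrow> bool" where
  "catherine_wheel f \<longleftrightarrow>
     continuous_on S1 f \<and> f ` S1 = S2 \<and>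
     (\<forall>p \<in> S1. \<forall>q \<in> S1. p \<noteq> q \<longrightarrow>
        closed_disk (f ` arc p q) \<and> {f p, f q} \<subseteq> bdry (f ` arc p q))"

text \<open>For the interval I = [p,q] and a component Y of \<open>\<partial>f(I) - f(\<partial>I)\<close>:
  the canonical orientation of Y agrees with its boundary orientation iff
  f restricted to \<open>I \<inter> f^{-1}(Y)\<close> is monotone (non-decreasing) from the order of I
  (from p to q) to the order of Y induced by the boundary orientation of \<open>\<partial>f(I)\<close>.
  The latter order is read off a positively oriented parametrization \<open>\<delta>\<close> with
  inverse \<open>\<delta>'\<close>, starting from any base point z of the boundary circle outside Y.\<close>

definition canon_agrees ::
    "(complex \<Rightarrow> real^3) \<Rightarrow> complex \<Rightarrow> complex \<Rightarrow> (real^3) set \<Rightarrow> bool" where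
  "canon_agrees f p q Y \<longleftrightarrow>
     (let D = f ` arc p q in
      \<forall>\<delta> \<delta>'. homeomorphism S1 (bdry D) \<delta> \<delta>' \<and> pos_oriented D \<delta> \<longrightarrow>
        (\<forall>z \<in> bdry D - Y. \<forall>s1 s2.
           s1 \<in> arc p q \<and> s2 \<in> arc p q \<and> f s1 \<in> Y \<and> f s2 \<in> Y \<and> s1 \<in> arc p s2
           \<longrightarrow> \<delta>' (f s1) \<in> arc (\<delta>' z) (\<delta>' (f s2))))"

definition Zplus_empty :: "(complex \<Rightarrow> real^3) \<Rightarrow> complex \<Rightarrow> complex \<Rightarrow> bool" where
  "Zplus_empty f p q \<longleftrightarrow>
     \<not> (\<exists>Y \<in> components (bdry (f ` arc p q) - {f p, f q}). canon_agrees f p q Y)"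

definition degenerate :: "(complex \<Rightarrow> real^3) \<Rightarrow> complex \<Rightarrow> complex \<Rightarrow> bool" where
  "degenerate f p q \<longleftrightarrow> p \<in> S1 \<and> q \<in> S1 \<and> p \<noteq> q \<and> f p = f q"

definition pos_degenerate :: "(complex \<Rightarrow> real^3) \<Rightarrow> complex \<Rightarrow> complex \<Rightarrow> bool" where
  "pos_degenerate f p q \<longleftrightarrow> degenerate f p q \<and> Zplus_empty f p q"

definition neg_degenerate :: "(complex \<Rightarrow> real^3) \<Rightarrow> complex \<Rightarrow> complex \<Rightarrow> bool" where
  "neg_degenerate f p q \<longleftrightarrow> degenerate f p q \<and> \<not> Zplus_empty f p q"

definition Lplus :: "(complex \<Rightarrow> real^3) \<Rightarrow> complex set set" where
  "Lplus f = {{p, q} | p q. pos_degenerate f p q}"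

definition Lminus :: "(complex \<Rightarrow> real^3) \<Rightarrow> complex set set" where
  "Lminus f = {{p, q} | p q. neg_degenerate f p q}"

definition emb2 :: "complex \<Rightarrow> nat \<Rightarrow> real" where
  "emb2 z = (\<lambda>i. if i = 0 then Re z else if i = 1 then Im z else 0)"

definition unemb2 :: "(nat \<Rightarrow> real) \<Rightarrow> complex" where
  "unemb2 x = Complex (x 0) (x 1)"

definition emb3 :: "real^3 \<Rightarrow> nat \<Rightarrow> real" where
  "emb3 v = (\<lambda>i. if i = 0 then v$1 else if i = 1 then v$2 else if i = 2 then v$3 else 0)"

definition unemb3 :: "(nat \<Rightarrow> real) \<Rightarrow> real^3" where
  "unemb3 x = vector [x 0, x 1, x 2]"

definition op_homeo_S1 :: "(complex \<Rightarrow> complex) \<Rightarrow> bool" where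
  "op_homeo_S1 h \<longleftrightarrow> (\<exists>h'. homeomorphism S1 S1 h h') \<and>
     Brouwer_degree2 1 (emb2 \<circ> h \<circ> unemb2) = 1"

definition op_homeo_S2 :: "(real^3 \<Rightarrow> real^3) \<Rightarrow> bool" where
  "op_homeo_S2 H \<longleftrightarrow> (\<exists>H'. homeomorphism S2 S2 H H') \<and>
     Brouwer_degree2 2 (emb3 \<circ> H \<circ> unemb3) = 1"

definition attracting :: "'a::metric_space set \<Rightarrow> ('a \<Rightarrow> 'a) \<Rightarrow> 'a \<Rightarrow> bool" where
  "attracting X g x \<longleftrightarrow> x \<in> X \<and> g x = x \<and>
     (\<forall>e>0. \<exists>d>0. \<forall>y\<in>X. dist y x < d \<longrightarrow> (\<forall>k. dist ((g ^^ k) y) x < e)) \<and>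
     (\<exists>d>0. \<forall>y\<in>X. dist y x < d \<longrightarrow> (\<lambda>k. (g ^^ k) y) \<longlonglongrightarrow> x)"

definition repelling :: "'a::metric_space set \<Rightarrow> ('a \<Rightarrow> 'a) \<Rightarrow> 'a \<Rightarrow> bool" where
  "repelling X g x \<longleftrightarrow> attracting X (inv_into X g) x"

definition consecutive :: "complex set \<Rightarrow> complex \<Rightarrow> complex \<Rightarrow> bool" where
  "consecutive F x y \<longleftrightarrow> x \<in> F \<and> y \<in> F \<and> x \<noteq> y \<and>
     (\<forall>w \<in> F. w \<in> arc x y \<longrightarrow> w = x \<or> w = y)"

end

theory Submission imports Defs begin

text \<open>
Lift the wheel to the line, \<open>F t = f (cis t)\<close>, and \<open>h\<close> to an increasing map. Two complementary
images \<open>F ` {s..t}\<close> and \<open>F ` {t..s + 2 * pi}\<close> are disks with a common boundary, and three consecutive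
images covering the sphere share at most two points (a planarity argument with theta curves).
By Brouwer degree \<open>H\<close> fixes a point \<open>c\<close>; if \<open>h\<close> had no periodic points, a minimal set in the
invariant fibre over \<open>c\<close> would contradict this planarity, so a power of \<open>h\<close> lifts to \<open>l\<close> with fixed points.
All forward orbits of \<open>l\<close> converge to one point \<open>a\<close> of the sphere and all backward orbits to
one point \<open>r\<close>. If \<open>a \<noteq> r\<close>, the fixed points of \<open>l\<close> alternate between the fibres of \<open>a\<close> and \<open>r\<close>, and the
boundary circles of interleaved disks carry opposite canonical orientations, because their two
arcs recombine into loops that are null-homotopic off a common interior point. If \<open>a = r\<close>,
there is one source and one sink, and tiling the two half planes by the disks between a point of the
fibre and its image conjugates \<open>H\<close> to a translation.
\<close>

subsection \<open>Stereographic projection\<close>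

text \<open>The wheel axioms speak of single disks, so all planarity has to be extracted from images
  of neighbouring intervals: the union of two of them has connected complement, which makes their
  intersection a continuum (Janiszewski), and three that cover the sphere share at most two points.
  Together these facts cut the boundary circle of a disk into arcs at prescribed points. Two
  features of the statement shape the rest. The circle dynamics is claimed for a power of
  \<open>h\<close>, the sphere dynamics for \<open>H\<close> itself; hence \<open>wheel_root\<close>
  carries two commuting lifts, and the translation case has to find a lift of \<open>h\<close>, not
  only of the power, that keeps the fixed points. Further, \<open>pos_oriented\<close> asks for some
  chart while \<open>canon_agrees\<close> ranges over all positive parametrisations; evaluating them
  requires winding numbers independent of the chart, obtained from Moebius changes of coordinates,
  and the existence of a positive parametrisation, obtained by complex conjugation if necessary. The
  degree on the circle serves only to exclude decreasing lifts.\<close>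

definition unstereo :: "complex => real^3" where
 "unstereo z = vector [2 * Re z / (1+(norm z)\<^sup>2), - 2 * Im z / (1+(norm z)\<^sup>2),
            ((norm z)\<^sup>2 - 1) / (1+(norm z)\<^sup>2)]"

lemma norm_real3: "norm (v::real^3) = sqrt ((v$1)\<^sup>2+(v$2)\<^sup>2+(v$3)\<^sup>2)"
 by (simp add: norm_vec_def L2_set_def sum_3)

lemma S2_iff: "(v::real^3) : S2 \<longleftrightarrow> (v$1)\<^sup>2+(v$2)\<^sup>2+(v$3)\<^sup>2 = 1"
 by (simp add: S2_def norm_real3)

lemma vec3_eq_iff: "(v::real^3) = w \<longleftrightarrow> v$1 = w$1 & v$2 = w$2 & v$3 = w$3"
 by (simp add: vec_eq_iff forall_3)

lemma S2_third_lt_1: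
 fixes v :: "real^3"
 assumes "v : S2" "v ~= north" shows "v$3 < 1"
proof -
 have 1: "(v$1)\<^sup>2+(v$2)\<^sup>2+(v$3)\<^sup>2 = 1" using assms by (simp add: S2_iff)
 then have le: "(v$3)\<^sup>2 <= 1" by (smt (verit) zero_le_power2)
 then have "v$3 <= 1" using abs_le_square_iff[of "v$3" 1] by auto
 moreover have "v$3 ~= 1"
 proof
  assume "v$3 = 1"
  with 1 have "(v$1)\<^sup>2+(v$2)\<^sup>2 = 0" by simp
  then have "v$1 = 0" "v$2 = 0" by (simp_all add: sum_power2_eq_zero_iff)
  with \<open>v$3 = 1\<close> assms(2) show False by (simp add: vec3_eq_iff north_def)
 qed
 ultimately show ?thesis by simp
qed

lemma stereo_homeomorphism: "homeomorphism (S2 - {north}) UNIV stereo unstereo"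
proof (rule homeomorphismI)
 show "continuous_on (S2 - {north}) stereo"
 proof -
  have eq: "stereo = (%v::real^3. (of_real (v$1) - \<i> * of_real (v$2)) / complex_of_real (1 - v$3))"
   by (rule ext) (simp add: stereo_def complex_eq_iff)
  show ?thesis unfolding eq
   by (intro continuous_intros) (use S2_third_lt_1 in fastforce)
 qed
 have pos: "1+(norm (z::complex))\<^sup>2 ~= 0" for z
  by (smt (verit) zero_le_power2)
 have unst: "unstereo z = (2 * Re z / (1+(norm z)\<^sup>2)) *\<^sub>R axis 1 1+(- 2 * Im z / (1+(norm z)\<^sup>2)) *\<^sub>R axis 2 1 +
            (((norm z)\<^sup>2 - 1) / (1+(norm z)\<^sup>2)) *\<^sub>R axis 3 1" for z
  by (simp add: vec3_eq_iff unstereo_def axis_def)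
 show "continuous_on UNIV unstereo"
  unfolding unst by (intro continuous_intros) (use pos in auto)
 show "stereo ` (S2 - {north}) <= UNIV" by simp
 have n2: "(norm z)\<^sup>2 = (Re z)\<^sup>2+(Im z)\<^sup>2" for z :: complex
  by (simp add: cmod_power2)
 show "unstereo ` UNIV <= S2 - {north}"
 proof
  fix x assume "x : range unstereo"
  then obtain z where x: "x = unstereo z" by auto
  define N where "N = (norm z)\<^sup>2"
  have N: "1 + N ~= 0" using pos N_def by simp
  have "(2 * Re z / (1 + N))\<^sup>2+(- 2 * Im z / (1 + N))\<^sup>2+((N - 1) / (1 + N))\<^sup>2
    = (4 * N+(N - 1)\<^sup>2) / (1 + N)\<^sup>2"
   by (simp add: power_divide add_divide_distrib[symmetric] N_def n2 power_mult_distrib)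
  also have "4 * N+(N - 1)\<^sup>2 = (1 + N)\<^sup>2" by (simp add: power2_eq_square algebra_simps)
  also have "(1 + N)\<^sup>2 / (1 + N)\<^sup>2 = 1" using N by simp
  finally have "x : S2" by (simp add: S2_iff x unstereo_def N_def)
  moreover have "x ~= north"
   using N by (auto simp: x unstereo_def north_def vec3_eq_iff N_def field_simps)
  ultimately show "x : S2 - {north}" by simp
 qed
 show "unstereo (stereo v) = v" if "v : S2 - {north}" for v :: "real^3"
 proof -
  have lt: "v$3 < 1" using S2_third_lt_1 that by auto
  have 1: "(v$1)\<^sup>2+(v$2)\<^sup>2 = 1 - (v$3)\<^sup>2" using that by (simp add: S2_iff)
  have R: "Re (stereo v) = v$1 / (1 - v$3)" "Im (stereo v) = - (v$2) / (1 - v$3)"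
   by (simp_all add: stereo_def Re_divide_of_real Im_divide_of_real)
  have "(norm (stereo v))\<^sup>2 = ((v$1)\<^sup>2+(v$2)\<^sup>2) / (1 - v$3)\<^sup>2"
   by (simp add: n2 R power_divide add_divide_distrib)
  also have "\<dots> = (1 + v$3) / (1 - v$3)"
  proof -
   have "1 - (v$3)\<^sup>2 = (1 + v$3) * (1 - v$3)" by (simp add: power2_eq_square algebra_simps)
   then show ?thesis unfolding 1 using lt by (simp add: power2_eq_square)
  qed
  finally have N: "(norm (stereo v))\<^sup>2 = (1 + v$3) / (1 - v$3)" .
  have N1: "1+(norm (stereo v))\<^sup>2 = 2 / (1 - v$3)" unfolding N using lt by (simp add: field_simps)
  have N2: "(norm (stereo v))\<^sup>2 - 1 = 2 * v$3 / (1 - v$3)" unfolding N using lt by (simp add: field_simps)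
  show ?thesis using lt unfolding vec3_eq_iff unstereo_def N1 N2 R by (simp add: field_simps)
 qed
 show "stereo (unstereo z) = z" for z
 proof -
  define N where "N = (norm z)\<^sup>2"
  have N: "1 + N ~= 0" using pos N_def by simp
  have e: "1 - (N - 1) / (1 + N) = 2 / (1 + N)" using N by (simp add: field_simps)
  show ?thesis
   using N by (simp add: stereo_def unstereo_def N_def[symmetric] e complex_eq_iff Re_divide_of_real Im_divide_of_real)
 qed
qed

lemma orthogonal_transformation_homeomorphism_S2:
 fixes R :: "real^3 => real^3"
 assumes "orthogonal_transformation R" shows "homeomorphism S2 S2 R (inv_into UNIV R)"
proof (rule homeomorphismI)
 have l: "linear R" using assms orthogonal_transformation_linear by blast
 have b: "bij R" using assms orthogonal_transformation_bij by blast
 have io: "orthogonal_transformation (inv_into UNIV R)" using assms by (rule orthogonal_transformation_inv)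
 then have li: "linear (inv_into UNIV R)" using orthogonal_transformation_linear by blast
 show "continuous_on S2 R" "continuous_on S2 (inv_into UNIV R)" using l li by (simp_all add: linear_continuous_on linear_linear)
 show "R ` S2 <= S2" "inv_into UNIV R ` S2 <= S2"
  using assms io by (auto simp: S2_def orthogonal_transformation_norm)
 show "inv_into UNIV R (R x) = x" "R (inv_into UNIV R x) = x" for x using b by (simp_all add: bij_is_inj bij_is_surj surj_f_inv_f)
qed

lemma rotated_stereo_homeomorphism:
 fixes R :: "real^3 => real^3"
 assumes "orthogonal_transformation R" "N : S2" "R N = north"
 shows "homeomorphism (S2 - {N}) UNIV (%v. stereo (R v)) (%z. inv_into UNIV R (unstereo z))"
proof -
 have b: "bij R" using assms orthogonal_transformation_bij by blast
 have "homeomorphism (S2 - {N}) (S2 - {north}) R (inv_into UNIV R)"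
 proof (rule homeomorphism_of_subsets[OF orthogonal_transformation_homeomorphism_S2[OF assms(1)]])
  have "R ` (S2 - {N}) = R ` S2 - R ` {N}" using b by (simp add: image_set_diff bij_is_inj)
  also have "\<dots> = S2 - {north}"
   using assms orthogonal_transformation_homeomorphism_S2[OF assms(1)] by (simp add: homeomorphism_def)
  finally show "R ` (S2 - {N}) = S2 - {north}" .
 qed auto
 from homeomorphism_compose[OF this stereo_homeomorphism] show ?thesis by (simp add: o_def)
qed

lemma stereographic_chart:
 assumes "N : S2"
 obtains R where "orthogonal_transformation R" "det (matrix R) = 1" "R N = north"
  "homeomorphism (S2 - {N}) (UNIV::complex set) (%v. stereo (R v)) (%z. inv_into UNIV R (unstereo z))"
proof -
 have "norm N = norm north" using assms by (simp add: S2_def norm_real3 north_def)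
 then obtain R where "orthogonal_transformation R" "det (matrix R) = 1" "R N = north"
  using rotation_exists[of N north] by auto
 with rotated_stereo_homeomorphism assms that show thesis by blast
qed

lemma punctured_S2_homeomorphism:
 assumes "N : S2"
 obtains sg tu where "homeomorphism (S2 - {N}) (UNIV::complex set) sg tu"
 using stereographic_chart[OF assms] by metis

text \<open>Projection from \<open>a\<close> turns the set into the plane, punctured if
  \<open>b\<close> is another point of the sphere. Since \<open>b\<close> is arbitrary,
  \<open>source_sink\<close> can remove \<open>{a, r}\<close> before it is known whether the two
  points differ.\<close>

lemma connected_S2_minus_two:
 assumes "a : S2" shows "connected (S2 - {a, b})"
proof (cases "b : S2 & b ~= a")
 case True
 obtain sg tu where h: "homeomorphism (S2 - {a}) (UNIV::complex set) sg tu"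
  using punctured_S2_homeomorphism assms by blast
 have "connected (- {sg b})" by (rule connected_punctured_universe) simp
 moreover have "continuous_on (- {sg b}) tu" using h by (meson continuous_on_subset homeomorphism_def top_greatest)
 ultimately have "connected (tu ` (- {sg b}))" by (rule connected_continuous_image[rotated])
 moreover have "tu ` (- {sg b}) = S2 - {a, b}"
 proof
  have "tu z : S2 - {a}" "sg (tu z) = z" for z using h by (auto simp: homeomorphism_def)
  then show "tu ` (- {sg b}) <= S2 - {a, b}" by auto
  show "S2 - {a, b} <= tu ` (- {sg b})"
  proof
   fix x assume x: "x : S2 - {a, b}"
   then have "x = tu (sg x)" "b = tu (sg b)" using h True by (auto simp: homeomorphism_def)
   with x show "x : tu ` (- {sg b})" by auto
  qed
 qed
 ultimately show ?thesis by simp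
next
 case False
 then have "S2 - {a, b} = S2 - {a}" by auto
 moreover obtain sg tu where h: "homeomorphism (S2 - {a}) (UNIV::complex set) sg tu"
  using punctured_S2_homeomorphism assms by blast
 ultimately show ?thesis
  by (metis connected_UNIV connected_continuous_image homeomorphism_cont2 homeomorphism_image2)
qed

lemma north_in_S2: "north : S2" "- north : S2" "north ~= - north"
 by (auto simp: S2_iff north_def vec3_eq_iff)

lemma openin_S2_punctured_chart:
 assumes "homeomorphism (S2 - {N}) (UNIV::complex set) sg tu" "U <= S2 - {N}"
 shows "openin (top_of_set S2) U \<longleftrightarrow> open (sg ` U)"
proof -
 have o: "openin (top_of_set S2) (S2 - {N})" by (simp add: openin_delete)
 have im: "tu ` (sg ` U) = U" 
 proof -
  have "tu (sg x) = x" if "x : U" for x using homeomorphism_apply1[OF assms(1)] assms(2) that by blast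
  then show ?thesis by (simp add: image_image)
 qed
 show ?thesis
 proof
  assume "openin (top_of_set S2) U"
  then have "openin (top_of_set (S2 - {N})) U"
   using assms(2) openin_subset_trans by blast
  then show "open (sg ` U)"
   using homeomorphism_imp_open_map[OF assms(1)] by simp
 next
  assume "open (sg ` U)"
  then have "openin (top_of_set UNIV) (sg ` U)" by simp
  then have "openin (top_of_set (S2 - {N})) (tu ` sg ` U)"
   using homeomorphism_imp_open_map[of UNIV "S2 - {N}" tu sg] assms(1) homeomorphism_symD by blast
  then show "openin (top_of_set S2) U" using o openin_trans im by metis
 qed
qed

subsection \<open>Closed disks in the sphere\<close>

text \<open>\<open>closed_disk\<close> fixes only a homeomorphism type, while \<open>bdry\<close> is
  a frontier in the sphere; invariance of domain identifies this frontier with the image of the unit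
  circle. The open round disk has open image, and a circle point with a spherical neighbourhood
  inside \<open>D\<close> would pull back to an interior point of the round disk.\<close>

lemma closed_disk_param:
 assumes "closed_disk D"
 obtains \<phi> \<psi> where "homeomorphism (cball (0::complex) 1) D \<phi> \<psi>"
  "\<phi> ` sphere 0 1 = bdry D" "\<phi> ` ball 0 1 = D - bdry D" "openin (top_of_set S2) (D - bdry D)"
proof -
 obtain \<psi> \<phi> where h0: "homeomorphism D (cball (0::complex) 1) \<psi> \<phi>"
  using assms by (auto simp: closed_disk_def homeomorphic_def)
 then have h: "homeomorphism (cball 0 1) D \<phi> \<psi>" by (rule homeomorphism_symD)
 have DS: "D <= S2" using assms by (simp add: closed_disk_def)
 have cphi: "continuous_on (cball 0 1) \<phi>" and cpsi: "continuous_on D \<psi>"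
  and im: "\<phi> ` cball 0 1 = D" "\<psi> ` D = cball 0 1"
  and inv1: "!!x. x : cball 0 1 ==> \<psi> (\<phi> x) = x" and inv2: "!!y. y : D ==> \<phi> (\<psi> y) = y"
  using h by (auto simp: homeomorphism_def)
 have inj: "inj_on \<phi> (cball 0 1)" by (metis inj_on_inverseI inv1)
 \<comment> \<open>No single chart covers the sphere, so openness is shown off one point
   \<open>N\<close>; the choices \<open>north\<close> and \<open>- north\<close> together cover the
   whole image.\<close>
 have openpart: "openin (top_of_set S2) (\<phi> ` ball 0 1 - {N})" if N: "N : S2" for N
 proof -
  obtain sg tu where s: "homeomorphism (S2 - {N}) (UNIV::complex set) sg tu"
   using punctured_S2_homeomorphism N by blast
  define W where "W = {b : ball 0 1. \<phi> b ~= N}"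
  have cb: "continuous_on (ball 0 1) \<phi>" using cphi continuous_on_subset ball_subset_cball by blast
  have "open W" unfolding W_def
   using continuous_open_preimage[OF cb open_ball, of "- {N}"] by (simp add: vimage_def Int_def open_Compl)
  have W: "\<phi> ` W = \<phi> ` ball 0 1 - {N}" by (auto simp: W_def)
  have sub: "\<phi> ` W <= S2 - {N}" using im DS ball_subset_cball by (auto simp: W_def)
  have "open ((sg \<circ> \<phi>) ` W)"
  proof (rule invariance_of_domain)
   show "continuous_on W (sg \<circ> \<phi>)"
    by (intro continuous_on_compose continuous_on_subset[OF cb] continuous_on_subset[OF homeomorphism_cont1[OF s]] sub)
      (auto simp: W_def)
   show "open W" by fact
   have "inj_on sg (S2 - {N})" using s by (metis homeomorphism_def inj_on_inverseI)
   then have "inj_on sg (\<phi> ` W)" using sub inj_on_subset by blast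
   moreover have "inj_on \<phi> W" by (rule inj_on_subset[OF inj]) (auto simp: W_def)
   ultimately show "inj_on (sg \<circ> \<phi>) W" by (rule comp_inj_on[rotated])
  qed
  then have "open (sg ` (\<phi> ` W))" by (simp add: image_comp)
  then show ?thesis using openin_S2_punctured_chart[OF s sub] W by simp
 qed
 have "\<phi> ` ball 0 1 = (\<phi> ` ball 0 1 - {north}) Un (\<phi> ` ball 0 1 - {- north})"
  using north_in_S2 by auto
 then have op: "openin (top_of_set S2) (\<phi> ` ball 0 1)"
  using openpart north_in_S2 openin_Un by metis
 have b1: "\<phi> ` ball 0 1 Int bdry D = {}"
 proof -
  obtain V where V: "open V" "\<phi> ` ball 0 1 = S2 Int V" using op by (auto simp: openin_open)
  have "\<phi> ` ball 0 1 <= D" using im ball_subset_cball by blast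
  then have "V Int (S2 - D) = {}" using V by auto
  then have "V Int closure (S2 - D) = {}" using V open_Int_closure_eq_empty by blast
  then show ?thesis using V by (auto simp: bdry_def)
 qed
 have b2: "\<phi> ` sphere 0 1 <= bdry D"
 proof
  fix z assume "z : \<phi> ` sphere 0 1"
  then obtain s where s: "s : sphere 0 1" "z = \<phi> s" by auto
  then have zD: "z : D" using im by auto
  show "z : bdry D"
  proof (rule ccontr)
   assume "z ~: bdry D"
   then have zn: "z ~: closure (S2 - D)" using zD by (simp add: bdry_def)
   define V where "V = - closure (S2 - D)"
   have V: "open V" "z : V" using zn by (auto simp: V_def)
   have VD: "V Int S2 <= D" using closure_subset[of "S2 - D"] by (auto simp: V_def)
   obtain N where N: "N : S2" "N ~= z" using north_in_S2 by metis
   obtain sg tu where st: "homeomorphism (S2 - {N}) (UNIV::complex set) sg tu"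
    using punctured_S2_homeomorphism N by blast
   define U where "U = V Int S2 - {N}"
   have U: "openin (top_of_set S2) U" unfolding U_def
    using V by (simp add: inf_commute openin_delete openin_open_Int)
   have US: "U <= S2 - {N}" by (auto simp: U_def)
   then have oU: "open (sg ` U)" using openin_S2_punctured_chart[OF st US] U by simp
   have tU: "tu ` (sg ` U) <= D"
   proof -
    have "tu (sg x) = x" if "x : U" for x using homeomorphism_apply1[OF st] US that by blast
    moreover have "U <= D" using VD by (auto simp: U_def)
    ultimately show ?thesis by auto
   qed
   have "open ((\<psi> \<circ> tu) ` (sg ` U))"
   proof (rule invariance_of_domain)
    show "continuous_on (sg ` U) (\<psi> \<circ> tu)"
     by (intro continuous_on_compose continuous_on_subset[OF homeomorphism_cont2[OF st]] continuous_on_subset[OF cpsi] tU) auto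
    have "inj_on tu UNIV" using st by (metis homeomorphism_def inj_on_inverseI)
    moreover have "inj_on \<psi> D" by (metis inj_on_inverseI inv2)
    ultimately show "inj_on (\<psi> \<circ> tu) (sg ` U)"
     using tU by (meson comp_inj_on inj_on_subset top_greatest)
   qed fact
   moreover have "(\<psi> \<circ> tu) ` (sg ` U) <= cball 0 1" using tU im by (auto simp: image_comp[symmetric])
   ultimately have "(\<psi> \<circ> tu) ` (sg ` U) <= ball 0 1"
    by (metis interior_cball interior_maximal)
   moreover have "s : (\<psi> \<circ> tu) ` (sg ` U)"
   proof -
    have "z : U" using V N zD DS by (auto simp: U_def)
    moreover have "tu (sg z) = z" using homeomorphism_apply1[OF st] \<open>z : U\<close> US by blast
    moreover have "\<psi> z = s" using s inv1 by auto
    ultimately show ?thesis by force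
   qed
   ultimately have "s : ball 0 1" by blast
   then show False using s by simp
  qed
 qed
 have un: "cball 0 1 = ball (0::complex) 1 Un sphere 0 1" by auto
 have bd: "bdry D = \<phi> ` sphere 0 1"
 proof
  show "bdry D <= \<phi> ` sphere 0 1"
   using b1 im by (auto simp: bdry_def un image_Un)
 qed (rule b2)
 moreover have "D - bdry D = \<phi> ` ball 0 1"
 proof -
  have "\<phi> ` ball 0 1 Int \<phi> ` sphere 0 1 = {}" using b1 bd by simp
  then show ?thesis using im bd by (auto simp: un image_Un)
 qed
 ultimately show thesis using that[OF h] op by simp
qed

subsection \<open>Arcs and subcontinua of a simple closed curve\<close>

text \<open>The parameters \<open>l\<close> and \<open>m\<close> cut the loop into two closed pieces
  that share only \<open>gm l\<close> and \<open>gm m\<close>, neither in \<open>P\<close>. A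
  connected \<open>P\<close> lies in one piece, which must be the one through the base
  point.\<close>

lemma simple_loop_gap:
 fixes gm :: "real => 'a::real_normed_vector"
 assumes sp: "simple_path gm" and st: "pathstart gm = c" and P: "closed P" "connected P" "P <= path_image gm" "c : P"
  and lm: "0 < l" "l < m" "m < 1" "gm l ~: P" "gm m ~: P"
 shows "P Int gm ` {l..m} = {}"
proof -
 have c: "continuous_on {0..1} gm" and lf: "loop_free gm" using sp by (auto simp: simple_path_def path_def)
 have cl1: "closed (gm ` {l..m})"
  by (intro compact_imp_closed compact_continuous_image continuous_on_subset[OF c]) (use lm in auto)
 have cl2: "closed (gm ` ({0..l} Un {m..1}))"
  by (intro compact_imp_closed compact_continuous_image continuous_on_subset[OF c] compact_Un) (use lm in auto)
 have cov: "P <= gm ` {l..m} Un gm ` ({0..l} Un {m..1})"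
 proof
  fix x assume "x : P"
  then obtain t where t: "t : {0..1}" "x = gm t" using P by (auto simp: path_image_def)
  then have "t : {l..m} | t : {0..l} Un {m..1}" using lm by auto
  then show "x : gm ` {l..m} Un gm ` ({0..l} Un {m..1})" using t by blast
 qed
 have dis: "gm ` {l..m} Int gm ` ({0..l} Un {m..1}) Int P = {}"
 proof -
  have "gm t ~: P" if t: "t : {l..m}" "t' : {0..l} Un {m..1}" "gm t = gm t'" for t t'
  proof -
   have "t : {0..1}" "t' : {0..1}" using t lm by auto
   then have "t = t' | t = 0 & t' = 1 | t = 1 & t' = 0" using lf t by (simp add: loop_free_def)
   then have "t = l | t = m" using t lm by auto
   then show ?thesis using lm by auto
  qed
  then show ?thesis by fastforce
 qed
 have c2: "gm ` ({0..l} Un {m..1}) Int P ~= {}"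
 proof -
  have "gm 0 = c" using st by (simp add: pathstart_def)
  then have "c : gm ` ({0..l} Un {m..1})" using lm by (metis UnCI atLeastAtMost_iff imageI less_eq_real_def)
  then show ?thesis using P by auto
 qed
 show ?thesis
  using connected_closedD[OF P(2) dis cov cl1 cl2] c2 by auto
qed

text \<open>Around a parameter \<open>tu\<close> missed by \<open>P\<close>, take the last parameter
  \<open>a\<close> of \<open>P\<close> before it and the first parameter \<open>b\<close> after it.
  A missed parameter below \<open>a\<close> or above \<open>b\<close> would separate
  \<open>gm a\<close> or \<open>gm b\<close> from the base point, against
  \<open>simple_loop_gap\<close>.\<close>

lemma simple_loop_subcontinuum:
 fixes gm :: "real => 'a::real_normed_vector"
 assumes sp: "simple_path gm" and st: "pathstart gm = c" "pathfinish gm = c"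
  and P: "closed P" "connected P" "P <= path_image gm" "c : P"
 obtains a b where "0 <= a" "a <= b" "b <= 1" "P = gm ` ({0..a} Un {b..1})"
proof (cases "P = path_image gm")
 case True
 have "{0..1/2} Un {1/2..1} = {0..1::real}" by auto
 then show thesis using True that[of "1/2" "1/2"] by (simp add: path_image_def)
next
 case False
 have c: "continuous_on {0..1} gm" using sp by (auto simp: simple_path_def path_def)
 have g01: "gm 0 = c" "gm 1 = c" using st by (auto simp: pathstart_def pathfinish_def)
 obtain tu where tu: "tu : {0..1}" "gm tu ~: P" using False P unfolding path_image_def by blast
 then have tu01: "0 < tu" "tu < 1" using g01 P by (auto simp: less_le)
 define T where "T = {0..1} Int gm -` P"
 have "closed T" unfolding T_def using c P by (simp add: continuous_closed_preimage)
 define a where "a = Sup (T Int {0..tu})"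
 define b where "b = Inf (T Int {tu..1})"
 have 0: "0 : T Int {0..tu}" and 1: "1 : T Int {tu..1}" using g01 P tu01 by (auto simp: T_def)
 have bd: "bdd_above (T Int {0..tu})" "bdd_below (T Int {tu..1})" by (auto intro: bdd_aboveI bdd_belowI)
 have a: "a : T Int {0..tu}" unfolding a_def
  by (rule closed_contains_Sup) (use 0 bd \<open>closed T\<close> in auto)
 have b: "b : T Int {tu..1}" unfolding b_def
  by (rule closed_contains_Inf) (use 1 bd \<open>closed T\<close> in auto)
 have an: "a ~= tu" "b ~= tu" using a b tu by (auto simp: T_def)
 have A: "u : T" if "u : {0..a}" for u
 proof (rule ccontr)
  assume u: "u ~: T"
  then have "0 < u" "u < a" using that 0 a by (auto simp: less_le)
  moreover have "gm u ~: P" using u that a tu01 by (auto simp: T_def)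
  ultimately have "P Int gm ` {u..tu} = {}"
   by (intro simple_loop_gap[OF sp st(1) P]) (use tu tu01 a in auto)
  moreover have "gm a : P Int gm ` {u..tu}" using a \<open>u < a\<close> by (auto simp: T_def)
  ultimately show False by blast
 qed
 have B: "u : T" if "u : {b..1}" for u
 proof (rule ccontr)
  assume u: "u ~: T"
  then have "u < 1" "b < u" using that 1 b by (auto simp: less_le)
  moreover have "gm u ~: P" using u that b tu01 by (auto simp: T_def)
  ultimately have "P Int gm ` {tu..u} = {}"
   by (intro simple_loop_gap[OF sp st(1) P]) (use tu tu01 b an in auto)
  moreover have "gm b : P Int gm ` {tu..u}" using b \<open>b < u\<close> by (auto simp: T_def)
  ultimately show False by blast
 qed
 have "P = gm ` ({0..a} Un {b..1})"
 proof
  show "gm ` ({0..a} Un {b..1}) <= P" using A B by (auto simp: T_def)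
  show "P <= gm ` ({0..a} Un {b..1})"
  proof
   fix x assume x: "x : P"
   then obtain t where t: "t : {0..1}" "x = gm t" using P by (auto simp: path_image_def)
   then have tT: "t : T" using x by (simp add: T_def)
   have "t : {0..a} Un {b..1}"
   proof (cases "t <= tu")
    case True
    then have "t <= a" unfolding a_def using tT t by (intro cSup_upper bd) auto
    then show ?thesis using t by auto
   next
    case False
    then have "b <= t" unfolding b_def using tT t by (intro cInf_lower bd) auto
    then show ?thesis using t by auto
   qed
   then show "x : gm ` ({0..a} Un {b..1})" using t by blast
  qed
 qed
 then show thesis using that[of a b] a b by auto
qed

lemma simple_loop_inj:
 assumes "simple_path gm" "gm s = gm t" "s : {0..1}" "t : {0..1}" "t ~= 0" "t ~= 1"
 shows "s = t"
 using assms unfolding simple_path_def loop_free_def by blast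

text \<open>The three inner quarter points of \<open>{a..b}\<close> have three different
  images.\<close>

lemma simple_loop_image_subset_pair:
 assumes sp: "simple_path gm" and "0 <= a" "a < b" "b <= 1" "gm ` {a..b} <= {c, d}"
 shows False
proof -
 define m where "m k = a+(b - a) * k / 4" for k :: real
 have m: "m k : {a..b}" "0 < m k" "m k < 1" if "0 < k" "k < 4" for k
 proof -
  have p: "0 < (b - a) * k / 4" "(b - a) * k / 4 < (b - a) * 4 / 4"
   using that assms mult_strict_left_mono[of k 4 "b - a"] by auto
  then show "m k : {a..b}" "0 < m k" "m k < 1" using assms by (auto simp: m_def)
 qed
 have inj: "m j ~= m k" if "j ~= k" for j k using that assms by (simp add: m_def)
 have "gm (m j) ~= gm (m k)" if "j ~= k" "j : {1,2,3}" "k : {1,2,3}" for j k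
 proof
  assume e: "gm (m j) = gm (m k)"
  have "m j : {0..1}" "m k : {0..1}" "m k ~= 0" "m k ~= 1"
   using m[of j] m[of k] that by auto
  then have "m j = m k" using simple_loop_inj[OF sp e] by simp
  then show False using inj that by blast
 qed
 then have "gm (m 1) ~= gm (m 2)" "gm (m 1) ~= gm (m 3)" "gm (m 2) ~= gm (m 3)" by auto
 moreover have "gm (m 1) : {c,d}" "gm (m 2) : {c,d}" "gm (m 3) : {c,d}"
  by (rule subsetD[OF assms(5)], rule imageI, rule m; simp)+
 ultimately show False by auto
qed

text \<open>Each continuum is the image of two end segments of the parameter interval. Overlap at a
  common end would put an arc into \<open>{c, d}\<close>, so \<open>P\<close> and \<open>Q\<close>
  occupy opposite ends and meet at one interior parameter. That \<open>d\<close> lies on the loop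
  and differs from \<open>c\<close> is a result.\<close>

lemma simple_loop_two_arcs:
 fixes gm :: "real => 'a::real_normed_vector"
 assumes sp: "simple_path gm" and st: "pathstart gm = c" "pathfinish gm = c"
  and P0: "closed P" "connected P" "c : P" "P ~= {c}"
  and Q0: "closed Q" "connected Q" "c : Q" "Q ~= {c}"
  and PQ: "P Un Q = path_image gm" "P Int Q <= {c, d}"
 obtains tu where "0 < tu" "tu < 1" "gm tu = d" "P = gm ` {0..tu} & Q = gm ` {tu..1} | P = gm ` {tu..1} & Q = gm ` {0..tu}"
proof -
 \<comment> \<open>Neither continuum is the whole loop: the other would lie in the finite set
   \<open>{c, d}\<close> and, being connected, reduce to \<open>{c}\<close>.\<close>
 have aux0: "X ~= path_image gm" if Y: "connected Y" "c : Y" "Y ~= {c}" "Y <= path_image gm" "X Int Y <= {c, d}" for X Y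
 proof
  assume "X = path_image gm"
  then have "Y <= {c, d}" using that by auto
  then have "finite Y" by (rule finite_subset) simp
  then obtain x where "Y = {x}" using Y(1,2) connected_finite_iff_sing[of Y] by auto
  then show False using that by auto
 qed
 have P: "closed P" "connected P" "c : P" "P ~= path_image gm"
  using P0 aux0[of Q P] Q0 PQ by auto
 have Q: "closed Q" "connected Q" "c : Q" "Q ~= path_image gm"
  using Q0 aux0[of P Q] P0 PQ by (auto simp: Int_commute)
 have g01: "gm 0 = c" "gm 1 = c" using st by (auto simp: pathstart_def pathfinish_def)
 obtain a b where ab: "0 <= a" "a <= b" "b <= 1" "P = gm ` ({0..a} Un {b..1})"
  using simple_loop_subcontinuum[OF sp st P(1,2) _ P(3)] PQ by blast
 obtain a' b' where ab': "0 <= a'" "a' <= b'" "b' <= 1" "Q = gm ` ({0..a'} Un {b'..1})"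
  using simple_loop_subcontinuum[OF sp st Q(1,2) _ Q(3)] PQ by blast
 have aux: "EX tu. 0 < tu & tu < 1 & gm tu = d & X = gm ` {tu..1} & Y = gm ` {0..tu}"
  if X: "X = gm ` ({0..0} Un {b..1})" "0 <= b" "b <= 1" "X ~= path_image gm"
   and Y: "Y = gm ` ({0..a'} Un {1..1})" "0 <= a'" "a' <= 1" "Y ~= path_image gm"
   and XY: "X Un Y = path_image gm" "X Int Y <= {c,d}" for X Y b a'
 proof -
  have X': "X = gm ` {b..1}"
  proof -
   have "gm 0 = gm 1" "1 : {b..1}" using g01 X by auto
   then show ?thesis unfolding X(1) by (auto simp: image_Un)
  qed
  have Y': "Y = gm ` {0..a'}"
  proof -
   have "gm 1 = gm 0" "0 : {0..a'}" using g01 Y by auto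
   then show ?thesis unfolding Y(1) by (auto simp: image_Un)
  qed
  have b0: "0 < b" using X X' by (auto simp: path_image_def less_le)
  have a1: "a' < 1" using Y Y' by (auto simp: path_image_def less_le)
  have "b <= a'"
  proof (rule ccontr)
   assume "~ b <= a'"
   define u where "u = (a' + b) / 2"
   have u: "a' < u" "u < b" "0 < u" "u < 1" using \<open>~ b <= a'\<close> X Y by (auto simp: u_def)
   have "gm u : X Un Y" using XY u by (auto simp: path_image_def)
   then obtain t where t: "t : {b..1} Un {0..a'}" "gm u = gm t" unfolding X' Y' by blast
   have "t = u" by (rule simple_loop_inj[OF sp t(2)[symmetric]]) (use t u X Y in auto)
   then show False using t u by auto
  qed
  have "b = a'"
  proof (rule ccontr)
   assume "b ~= a'"
   then have "b < a'" using \<open>b <= a'\<close> by simp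
   have "{b..a'} <= {b..1}" "{b..a'} <= {0..a'}" using X Y by auto
   then have "gm ` {b..a'} <= X Int Y" unfolding X' Y' by (simp add: image_mono)
   then have "gm ` {b..a'} <= {c,d}" using XY(2) by (rule subset_trans)
   then show False using simple_loop_image_subset_pair[OF sp _ \<open>b < a'\<close>] X Y by auto
  qed
  have "gm b : X Int Y" using X' Y' \<open>b = a'\<close> X Y by auto
  then have "gm b = c | gm b = d" using XY by auto
  moreover have "gm b ~= c"
   using simple_loop_inj[OF sp, of 0 b] g01 b0 a1 \<open>b = a'\<close> by auto
  ultimately show ?thesis using X' Y' \<open>b = a'\<close> b0 a1 by auto
 qed
 have nPc: "P ~= {c}" "Q ~= {c}" using P0 Q0 by auto
 have a1: "a < 1" "a' < 1" using ab ab' P Q by (auto simp: path_image_def less_le)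
 have b0: "0 < b" "0 < b'" using ab ab' P Q by (auto simp: path_image_def less_le)
 have amin: "a = 0 | a' = 0"
 proof (rule ccontr)
  assume "~ (a = 0 | a' = 0)"
  then have m: "0 < min a a'" using ab ab' by auto
  have "gm ` {0..min a a'} <= P Int Q" unfolding ab(4) ab'(4) by auto
  then have "gm ` {0..min a a'} <= {c, d}" using PQ(2) by (rule subset_trans)
  moreover have "min a a' <= 1" using a1 by linarith
  ultimately show False using simple_loop_image_subset_pair[OF sp _ m] by blast
 qed
 have bmax: "b = 1 | b' = 1"
 proof (rule ccontr)
  assume "~ (b = 1 | b' = 1)"
  then have m: "max b b' < 1" using ab ab' by auto
  have "gm ` {max b b'..1} <= P Int Q" unfolding ab(4) ab'(4) by auto
  then have "gm ` {max b b'..1} <= {c, d}" using PQ(2) by (rule subset_trans)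
  moreover have "0 <= max b b'" using b0 by linarith
  ultimately show False using simple_loop_image_subset_pair[OF sp _ m] by blast
 qed
 have n1: "~ (a = 0 & b = 1)" using nPc(1) ab(4) g01 by auto
 have n2: "~ (a' = 0 & b' = 1)" using nPc(2) ab'(4) g01 by auto
 consider "a = 0" "b' = 1" | "a' = 0" "b = 1" using amin bmax n1 n2 by blast
 then show thesis
 proof cases
  case 1
  have "EX tu. 0 < tu & tu < 1 & gm tu = d & P = gm ` {tu..1} & Q = gm ` {0..tu}"
   
  proof (rule aux[of P b Q a'])
   show "P = gm ` ({0..0} Un {b..1})" using ab(4) 1 by simp
   show "Q = gm ` ({0..a'} Un {1..1})" using ab'(4) 1 by simp
  qed (use ab(1-3) ab'(1-3) P(4) Q(4) PQ in auto)
  then show thesis using that by blast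
 next
  case 2
  have "EX tu. 0 < tu & tu < 1 & gm tu = d & Q = gm ` {tu..1} & P = gm ` {0..tu}"
   
  proof (rule aux[of Q b' P a])
   show "Q = gm ` ({0..0} Un {b'..1})" using ab'(4) 2 by simp
   show "P = gm ` ({0..a} Un {1..1})" using ab(4) 2 by simp
  qed (use ab(1-3) ab'(1-3) P(4) Q(4) PQ in auto)
  then show thesis using that by blast
 qed
qed

text \<open>Otherwise \<open>simple_loop_two_arcs\<close> with \<open>d = c\<close> would place
  \<open>c\<close> at an interior parameter of a simple loop.\<close>

lemma simple_loop_cover_meets_twice:
 fixes gm :: "real => 'a::real_normed_vector"
 assumes sp: "simple_path gm" and st: "pathstart gm = c" "pathfinish gm = c"
  and P: "closed P" "connected P" "c : P" "P ~= {c}"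
  and Q: "closed Q" "connected Q" "c : Q" "Q ~= {c}"
  and PQ: "P Un Q = path_image gm"
 shows "EX d. d ~= c & d : P Int Q"
proof (rule ccontr)
 assume "\<nexists>d. d ~= c & d : P Int Q"
 then have sub: "P Int Q <= {c, c}" by auto
 obtain tu where tu: "0 < tu" "tu < 1" "gm tu = c"
  using simple_loop_two_arcs[OF sp st P Q PQ sub] by metis
 have "gm 0 = gm tu" using st tu by (simp add: pathstart_def)
 then show False using simple_loop_inj[OF sp, of 0 tu] tu by auto
qed

subsection \<open>Three disks with disjoint interiors share at most two points\<close>

lemma connected_unbounded_subset_outside:
 assumes "connected X" "~ bounded X" "X Int S = {}"
 shows "X <= outside S"
proof
 fix x assume x: "x : X"
 then have "X <= connected_component_set (- S) x"
  using assms by (intro connected_component_maximal) auto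
 then have "~ bounded (connected_component_set (- S) x)" using assms bounded_subset by blast
 then show "x : outside S" using x assms by (auto simp: outside_def)
qed

text \<open>If the loop \<open>a\<close>, \<open>c\<close> wound around a point inside the loop
  \<open>a\<close>, \<open>b\<close>, the whole inside of the latter, which misses \<open>c\<close>,
  would lie inside the former. So would its frontier point \<open>b0\<close>, which is assumed
  outside.\<close>

lemma theta_inside_step:
 fixes a b c :: "real => complex"
 assumes ab: "simple_path (a +++ reversepath b)" "pathfinish a = pathfinish b" "pathstart a = pathstart b"
  and cout: "path_image c - {pathstart a, pathfinish a} <= outside (path_image a Un path_image b)"
  and ends: "pathstart c = pathstart a" "pathfinish c = pathfinish a" "path a" "path c" "path b"
  and b0: "b0 : path_image b" "b0 ~: path_image a Un path_image c"
  and bout: "b0 : outside (path_image a Un path_image c)"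
  and ou: "ou : inside (path_image a Un path_image b)"
 shows "winding_number (a +++ reversepath c) ou = 0"
proof (rule ccontr)
 assume nz: "winding_number (a +++ reversepath c) ou ~= 0"
 have pim: "path_image (a +++ reversepath b) = path_image a Un path_image b"
  using ab by (simp add: path_image_join)
 have pim2: "path_image (a +++ reversepath c) = path_image a Un path_image c"
  using ends by (simp add: path_image_join)
 note J = Jordan_inside_outside[OF ab(1)]
 have J1: "connected (inside (path_image a Un path_image b))"
   "frontier (inside (path_image a Un path_image b)) = path_image a Un path_image b"
  using J ab by (auto simp: pim)
 have dis: "inside (path_image a Un path_image b) Int (path_image a Un path_image c) = {}"
 proof -
  have "inside (path_image a Un path_image b) Int (path_image a Un path_image b) = {}" by simp
  moreover have "inside (path_image a Un path_image b) Int outside (path_image a Un path_image b) = {}" by simp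
  moreover have "pathstart a : path_image a" "pathfinish a : path_image a" by auto
  ultimately show ?thesis using cout by blast
 qed
 have "ou ~: outside (path_image a Un path_image c)"
  using nz winding_number_zero_in_outside[of "a +++ reversepath c" ou] pim2 ends by auto
 moreover have "ou ~: path_image a Un path_image c" using ou dis by blast
 ultimately have oin: "ou : inside (path_image a Un path_image c)" by (auto simp: inside_outside)
 have sub: "inside (path_image a Un path_image b) <= inside (path_image a Un path_image c)"
 proof
  fix x assume x: "x : inside (path_image a Un path_image b)"
  have "inside (path_image a Un path_image b) <= connected_component_set (- (path_image a Un path_image c)) ou"
   using J1 ou dis by (intro connected_component_maximal) auto
  then have "connected_component (- (path_image a Un path_image c)) ou x" using x by auto
  then show "x : inside (path_image a Un path_image c)" using oin inside_same_component by blast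
 qed
 have "b0 : closure (inside (path_image a Un path_image b))"
  using J1(2) b0 by (auto simp: frontier_def)
 then have "b0 : closure (inside (path_image a Un path_image c))" using sub closure_mono by blast
 moreover have "closure (inside (path_image a Un path_image c)) <= inside (path_image a Un path_image c) Un (path_image a Un path_image c)"
  using closure_inside_subset[of "path_image a Un path_image c"] closed_path_image[OF ends(3)] closed_path_image[OF ends(4)]
  by auto
 ultimately have "b0 : inside (path_image a Un path_image c)" using b0 by blast
 then show False using bout inside_Int_outside by blast
qed

text \<open>In a theta graph in the plane one of the three arcs lies inside the circle of the other two,
  because the winding numbers of the three circles add up to zero.\<close>

lemma no_theta_all_outside:
 fixes a b c :: "real => complex"
 assumes arcs: "Path_Connected.arc a" "Path_Connected.arc b" "Path_Connected.arc c"
  and ends: "pathstart a = p" "pathfinish a = q" "pathstart b = p" "pathfinish b = q" "pathstart c = p" "pathfinish c = q"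
  and meet: "path_image a Int path_image b <= {p, q}" "path_image a Int path_image c <= {p, q}" "path_image b Int path_image c <= {p, q}"
  and aout: "path_image a - {p, q} <= outside (path_image b Un path_image c)"
  and bout: "path_image b - {p, q} <= outside (path_image a Un path_image c)"
  and cout: "path_image c - {p, q} <= outside (path_image a Un path_image b)"
 shows False
proof -
 have pa: "path a" "path b" "path c" using arcs arc_imp_path by auto
 have pq: "p ~= q" using arcs ends arc_distinct_ends by metis
 have sp: "simple_path (a +++ reversepath b)"
  by (rule simple_path_join_loop) (use arcs ends meet in \<open>auto intro: arc_reversepath\<close>)
 have sp': "simple_path (b +++ reversepath a)"
  by (rule simple_path_join_loop) (use arcs ends meet in \<open>auto intro: arc_reversepath\<close>)
 have mid: "EX x:path_image d. x ~: {p, q}" if "Path_Connected.arc d" for d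
 proof -
  have "inj_on d {0..1}" using that by (simp add: Path_Connected.arc_def)
  then have "infinite (path_image d)" unfolding path_image_def
   using finite_imageD[of d "{0..1}"] infinite_Icc[of 0 "1::real"] by auto
  then show ?thesis by (metis finite.emptyI finite.insertI finite_subset subsetI)
 qed
 obtain a0 where a0: "a0 : path_image a" "a0 ~: {p, q}" using mid arcs by blast
 obtain b0 where b0: "b0 : path_image b" "b0 ~: {p, q}" using mid arcs by blast
 have pim: "path_image (a +++ reversepath b) = path_image a Un path_image b"
  using ends by (simp add: path_image_join)
 have "inside (path_image a Un path_image b) ~= {}"
  using Jordan_inside_outside[OF sp] ends by (auto simp: pim)
 then obtain ou where ou: "ou : inside (path_image a Un path_image b)" by blast
 have oab: "ou ~: path_image a" "ou ~: path_image b"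
  using ou inside_no_overlap[of "path_image a Un path_image b"] by blast+
 have oc: "ou ~: path_image c"
 proof
  assume "ou : path_image c"
  moreover have "ou ~: {p, q}" using oab ends by (metis insert_iff pathfinish_in_path_image pathstart_in_path_image singletonD)
  ultimately have "ou : outside (path_image a Un path_image b)" using cout by blast
  then show False using ou inside_Int_outside by blast
 qed
 have wa: "winding_number (a +++ reversepath c) ou = 0"
  by (rule theta_inside_step[of a b c b0]) (use sp pa ends cout b0 bout ou meet in auto)
 have wb: "winding_number (b +++ reversepath c) ou = 0"
  by (rule theta_inside_step[of b a c a0]) (use sp' pa ends cout a0 aout ou meet in \<open>auto simp: Un_commute\<close>)
 have "winding_number a ou - winding_number c ou = 0" "winding_number b ou - winding_number c ou = 0"
  using wa wb pa oab oc ends by (simp_all add: winding_number_join winding_number_reversepath)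
 then have "winding_number (a +++ reversepath b) ou = 0"
  using pa oab ends by (simp add: winding_number_join winding_number_reversepath)
 moreover have "norm (winding_number (a +++ reversepath b) ou) = 1"
  using simple_closed_path_norm_winding_number_inside[OF sp] ou pim by simp
 ultimately show False by simp
qed

lemma closed_disk_chord:
 assumes D: "closed_disk D" and t: "t1 : bdry D" "t2 : bdry D" "t1 ~= t2"
 obtains af where "Path_Connected.arc af" "pathstart af = t1" "pathfinish af = t2"
  "path_image af <= (D - bdry D) Un {t1, t2}"
proof -
 obtain \<phi> \<psi> where h: "homeomorphism (cball (0::complex) 1) D \<phi> \<psi>"
  "\<phi> ` sphere 0 1 = bdry D" "\<phi> ` ball 0 1 = D - bdry D"
  using closed_disk_param[OF D] by metis
 obtain x y where xy: "x : sphere 0 1" "y : sphere 0 1" "t1 = \<phi> x" "t2 = \<phi> y"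
 proof -
  have "t1 : \<phi> ` sphere 0 1" "t2 : \<phi> ` sphere 0 1" using h t by simp_all
  then show thesis using that by blast
 qed
 have "x ~= y" using xy t by auto
 define af where "af = \<phi> \<circ> linepath x y"
 have seg: "closed_segment x y <= cball 0 1"
  using xy by (intro closed_segment_subset) auto
 have inj: "inj_on \<phi> (cball 0 1)" by (metis h(1) homeomorphism_def inj_on_inverseI)
 have "Path_Connected.arc af" unfolding af_def Path_Connected.arc_def
 proof
  show "path (\<phi> \<circ> linepath x y)" using h(1) seg
   by (intro path_continuous_image) (auto intro: continuous_on_subset homeomorphism_cont1)
  have "inj_on (linepath x y) {0..1}" using \<open>x ~= y\<close> arc_linepath[of x y] by (simp add: Path_Connected.arc_def)
  moreover have "inj_on \<phi> (linepath x y ` {0..1})"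
   using inj seg by (metis inj_on_subset path_image_def path_image_linepath)
  ultimately show "inj_on (\<phi> \<circ> linepath x y) {0..1}" by (rule comp_inj_on)
 qed
 moreover have "path_image af <= (D - bdry D) Un {t1, t2}"
 proof -
  have "open_segment x y <= ball 0 1"
  proof
   fix z assume "z : open_segment x y"
   then have "dist 0 z < dist 0 x | dist 0 z < dist 0 y" by (rule dist_decreases_open_segment)
   then show "z : ball 0 1" using xy by auto
  qed
  then have "closed_segment x y <= ball 0 1 Un {x, y}" by (auto simp: open_segment_def)
  then have "\<phi> ` closed_segment x y <= \<phi> ` ball 0 1 Un {t1, t2}" using xy by blast
  then show ?thesis by (simp add: af_def path_image_compose h)
 qed
 ultimately show thesis using that[of af] xy by (simp add: af_def pathstart_compose pathfinish_compose)
qed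

text \<open>Sending \<open>t3\<close> to infinity makes each open disk connected and unbounded.
  Chords from \<open>t1\<close> to \<open>t2\<close> through the three disks form a theta graph in
  the plane, and each open chord lies outside the circle of the other two because it sits in an
  unbounded connected set avoiding them.\<close>

lemma three_disks_at_most_two_points:
 assumes D: "closed_disk A" "closed_disk B" "closed_disk C"
  and dis: "(A - bdry A) Int (B Un C) = {}" "(B - bdry B) Int (A Un C) = {}" "(C - bdry C) Int (A Un B) = {}"
  and t: "{t1, t2, t3} <= A Int B Int C" "t1 ~= t2" "t1 ~= t3" "t2 ~= t3"
 shows False
proof -
 have tb: "{t1, t2, t3} <= bdry A" "{t1, t2, t3} <= bdry B" "{t1, t2, t3} <= bdry C"
  using t dis by blast+
 have "t3 : S2" using t D by (auto simp: closed_disk_def)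
 then obtain sg tu where s: "homeomorphism (S2 - {t3}) (UNIV::complex set) sg tu"
  using punctured_S2_homeomorphism by blast
 have inj: "inj_on sg (S2 - {t3})" by (metis s homeomorphism_def inj_on_inverseI)
 have unb: "~ bounded (sg ` (X - bdry X)) & connected (sg ` (X - bdry X))"
  if X: "closed_disk X" "t3 : bdry X" for X
 proof -
  obtain \<phi> \<psi> where h: "homeomorphism (cball (0::complex) 1) X \<phi> \<psi>"
   "\<phi> ` sphere 0 1 = bdry X" "\<phi> ` ball 0 1 = X - bdry X"
   using closed_disk_param[OF X(1)] by metis
  have XS: "X - bdry X <= S2 - {t3}" using X by (auto simp: closed_disk_def)
  have "connected (\<phi> ` ball 0 1)"
   using h(1) by (intro connected_continuous_image continuous_on_subset[OF homeomorphism_cont1[OF h(1)]]) auto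
  then have "connected (sg ` (X - bdry X))" unfolding h(3)
   by (intro connected_continuous_image continuous_on_subset[OF homeomorphism_cont1[OF s]] XS)
  moreover have "~ bounded (sg ` (X - bdry X))"
  proof
   assume "bounded (sg ` (X - bdry X))"
   then have "compact (closure (sg ` (X - bdry X)))" by simp
   then have "compact (tu ` closure (sg ` (X - bdry X)))"
    by (intro compact_continuous_image continuous_on_subset[OF homeomorphism_cont2[OF s]]) auto
   then have cl: "closed (tu ` closure (sg ` (X - bdry X)))" by (rule compact_imp_closed)
   have "X - bdry X <= tu ` closure (sg ` (X - bdry X))"
   proof
    fix x assume x: "x : X - bdry X"
    then have "x : S2 - {t3}" using XS by (rule subsetD[rotated])
    then have "x = tu (sg x)" by (rule homeomorphism_apply1[OF s, symmetric])
    moreover have "sg x : closure (sg ` (X - bdry X))" using x closure_subset[of "sg ` (X - bdry X)"] by blast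
    ultimately show "x : tu ` closure (sg ` (X - bdry X))" by (rule image_eqI)
   qed
   then have "closure (X - bdry X) <= tu ` closure (sg ` (X - bdry X))" using cl by (rule closure_minimal)
   moreover have "t3 : closure (X - bdry X)"
   proof -
    have "\<phi> ` closure (ball 0 1) <= closure (\<phi> ` ball 0 1)"
     by (rule image_closure_subset) (use homeomorphism_cont1[OF h(1)] closure_subset[of "\<phi> ` ball 0 1"] in auto)
    moreover have "bdry X <= \<phi> ` closure (ball 0 1)" unfolding h(2)[symmetric] by (intro image_mono) auto
    ultimately show ?thesis using X h(3) by auto
   qed
   moreover have "t3 ~: range tu" using homeomorphism_image2[OF s] by auto
   ultimately show False by blast
  qed
  ultimately show ?thesis by blast
 qed
 have chord: "EX af. Path_Connected.arc af & pathstart af = sg t1 & pathfinish af = sg t2 &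
   path_image af <= sg ` (X - bdry X) Un {sg t1, sg t2}" if X: "closed_disk X" "{t1, t2, t3} <= bdry X" for X
 proof -
  obtain af where a: "Path_Connected.arc af" "pathstart af = t1" "pathfinish af = t2"
   "path_image af <= (X - bdry X) Un {t1, t2}"
   using closed_disk_chord[OF X(1), of t1 t2] X t by auto
  have XS: "path_image af <= S2 - {t3}"
  proof -
   have "X - bdry X <= S2 - {t3}" "{t1, t2} <= S2 - {t3}" using X t by (auto simp: closed_disk_def bdry_def)
   then show ?thesis using a(4) by blast
  qed
  have "Path_Connected.arc (sg \<circ> af)" unfolding Path_Connected.arc_def
  proof
   show "path (sg \<circ> af)"
    by (intro path_continuous_image arc_imp_path[OF a(1)] continuous_on_subset[OF homeomorphism_cont1[OF s]] XS)
   have "inj_on af {0..1}" using a by (simp add: Path_Connected.arc_def)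
   moreover have "inj_on sg (af ` {0..1})" using inj XS by (metis inj_on_subset path_image_def)
   ultimately show "inj_on (sg \<circ> af) {0..1}" by (rule comp_inj_on)
  qed
  moreover have "path_image (sg \<circ> af) <= sg ` (X - bdry X) Un {sg t1, sg t2}"
   using a(4) by (auto simp: path_image_compose)
  ultimately show ?thesis using a by (metis pathfinish_compose pathstart_compose)
 qed
 obtain a where a: "Path_Connected.arc a" "pathstart a = sg t1" "pathfinish a = sg t2"
   "path_image a <= sg ` (A - bdry A) Un {sg t1, sg t2}" using chord[OF D(1) tb(1)] by blast
 obtain b where b: "Path_Connected.arc b" "pathstart b = sg t1" "pathfinish b = sg t2"
   "path_image b <= sg ` (B - bdry B) Un {sg t1, sg t2}" using chord[OF D(2) tb(2)] by blast
 obtain c where c: "Path_Connected.arc c" "pathstart c = sg t1" "pathfinish c = sg t2"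
   "path_image c <= sg ` (C - bdry C) Un {sg t1, sg t2}" using chord[OF D(3) tb(3)] by blast
 have sdis: "sg ` X Int sg ` Y = {}" if "X Int Y = {}" "X <= S2 - {t3}" "Y <= S2 - {t3}" for X Y
  using inj that inj_on_image_Int[OF inj that(2,3)] by auto
 have XS: "A - bdry A <= S2 - {t3}" "B - bdry B <= S2 - {t3}" "C - bdry C <= S2 - {t3}" "{t1, t2} <= S2 - {t3}"
  using D tb t by (auto simp: closed_disk_def)
 have d1: "sg ` (A - bdry A) Int sg ` (B - bdry B) = {}" "sg ` (A - bdry A) Int sg ` (C - bdry C) = {}"
   "sg ` (B - bdry B) Int sg ` (C - bdry C) = {}"
   "sg ` (A - bdry A) Int sg ` {t1, t2} = {}" "sg ` (B - bdry B) Int sg ` {t1, t2} = {}" "sg ` (C - bdry C) Int sg ` {t1, t2} = {}"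
  using dis tb by (intro sdis XS; blast)+
 define a0 b0 c0 where "a0 = sg ` (A - bdry A)" and "b0 = sg ` (B - bdry B)" and "c0 = sg ` (C - bdry C)"
 have d2: "a0 Int b0 = {}" "a0 Int c0 = {}" "b0 Int c0 = {}" "sg t1 ~: a0" "sg t2 ~: a0" "sg t1 ~: b0" "sg t2 ~: b0" "sg t1 ~: c0" "sg t2 ~: c0"
  using d1 unfolding a0_def[symmetric] b0_def[symmetric] c0_def[symmetric] by auto
 have pi: "path_image a <= a0 Un {sg t1, sg t2}" "path_image b <= b0 Un {sg t1, sg t2}" "path_image c <= c0 Un {sg t1, sg t2}"
  using a(4) b(4) c(4) by (simp_all add: a0_def b0_def c0_def)
 have out: "sg ` (X - bdry X) <= outside S" if "closed_disk X" "t3 : bdry X" "sg ` (X - bdry X) Int S = {}" for X S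
  using connected_unbounded_subset_outside[OF conjunct2 conjunct1, OF unb unb that(3), OF that(1,2) that(1,2)] .
 have oa: "a0 <= outside (path_image b Un path_image c)" unfolding a0_def
 proof (rule out[OF D(1)])
  show "t3 : bdry A" using tb(1) by blast
  show "sg ` (A - bdry A) Int (path_image b Un path_image c) = {}"
   unfolding a0_def[symmetric] using pi(1) pi(2) pi(3) d2 by blast
 qed
 have ob: "b0 <= outside (path_image a Un path_image c)" unfolding b0_def
 proof (rule out[OF D(2)])
  show "t3 : bdry B" using tb(2) by blast
  show "sg ` (B - bdry B) Int (path_image a Un path_image c) = {}"
   unfolding b0_def[symmetric] using pi(1) pi(2) pi(3) d2 by blast
 qed
 have oc: "c0 <= outside (path_image a Un path_image b)" unfolding c0_def
 proof (rule out[OF D(3)])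
  show "t3 : bdry C" using tb(3) by blast
  show "sg ` (C - bdry C) Int (path_image a Un path_image b) = {}"
   unfolding c0_def[symmetric] using pi(1) pi(2) pi(3) d2 by blast
 qed
 show False
 proof (rule no_theta_all_outside[OF a(1) b(1) c(1) a(2,3) b(2,3) c(2,3)])
  show "path_image a Int path_image b <= {sg t1, sg t2}" "path_image a Int path_image c <= {sg t1, sg t2}"
   "path_image b Int path_image c <= {sg t1, sg t2}"
   using pi d2 by blast+
  show "path_image a - {sg t1, sg t2} <= outside (path_image b Un path_image c)"
   "path_image b - {sg t1, sg t2} <= outside (path_image a Un path_image c)"
   "path_image c - {sg t1, sg t2} <= outside (path_image a Un path_image b)"
   using pi oa ob oc by blast+
 qed
qed

section \<open>Punctured disks, boundary loops and connected intersections on the sphere\<close>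

lemma closed_disk_minus_boundary_point_connected:
 assumes D: "closed_disk D" and c: "c : bdry D"
 shows "connected (D - {c})"
proof -
 obtain \<phi> \<psi> where h: "homeomorphism (cball (0::complex) 1) D \<phi> \<psi>"
  using closed_disk_param[OF D] by metis
 have cD: "c : D" using c by (simp add: bdry_def)
 have "connected (cball (0::complex) 1 - {\<psi> c})"
  by (rule connected_punctured_convex) (simp_all add: aff_dim_cball)
 then have "connected (\<phi> ` (cball 0 1 - {\<psi> c}))"
  by (intro connected_continuous_image continuous_on_subset[OF homeomorphism_cont1[OF h]]) auto
 moreover have "\<phi> ` (cball 0 1 - {\<psi> c}) = D - {c}"
 proof -
  have inj: "inj_on \<phi> (cball 0 1)" by (metis h homeomorphism_def inj_on_inverseI)
  have "\<psi> c : cball 0 1" using homeomorphism_image2[OF h] cD by blast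
  then have "\<phi> ` (cball 0 1 - {\<psi> c}) = \<phi> ` cball 0 1 - \<phi> ` {\<psi> c}"
   using inj by (simp add: inj_on_image_set_diff)
  then show ?thesis using homeomorphism_image1[OF h] homeomorphism_apply2[OF h cD] by simp
 qed
 ultimately show ?thesis by simp
qed

lemma closed_disk_interior_facts:
 assumes D: "closed_disk D"
 shows "connected (D - bdry D)" "connected (D - bdry D - {N})" "D - bdry D ~= {}" "openin (top_of_set S2) (D - bdry D)"
  "infinite (bdry D)" "connected (bdry D)" "compact D"
proof -
 obtain \<phi> \<psi> where h: "homeomorphism (cball (0::complex) 1) D \<phi> \<psi>" "\<phi> ` sphere 0 1 = bdry D"
   "\<phi> ` ball 0 1 = D - bdry D" "openin (top_of_set S2) (D - bdry D)"
  using closed_disk_param[OF D] by metis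
 have inj: "inj_on \<phi> (cball 0 1)" by (metis h(1) homeomorphism_def inj_on_inverseI)
 have cont: "continuous_on (ball 0 1) \<phi>"
  by (rule continuous_on_subset[OF homeomorphism_cont1[OF h(1)]]) auto
 have conts: "continuous_on (sphere 0 1) \<phi>"
  by (rule continuous_on_subset[OF homeomorphism_cont1[OF h(1)]]) auto
 show con: "connected (D - bdry D)" unfolding h(3)[symmetric]
  by (intro connected_continuous_image cont) auto
 show "connected (D - bdry D - {N})"
 proof (cases "N : D - bdry D")
  case True
  then obtain x where x: "x : ball 0 1" "N = \<phi> x" unfolding h(3)[symmetric] by auto
  have "connected (ball (0::complex) 1 - {x})"
   by (rule connected_punctured_convex) (simp_all add: aff_dim_open)
  then have "connected (\<phi> ` (ball 0 1 - {x}))"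
   by (intro connected_continuous_image continuous_on_subset[OF cont]) auto
  moreover have "\<phi> ` (ball 0 1 - {x}) = \<phi> ` ball 0 1 - \<phi> ` {x}"
   by (rule inj_on_image_set_diff[OF inj]) (use x in auto)
  ultimately show ?thesis using x h(3) by simp
 qed (use con in simp)
 have "ball (0::complex) 1 ~= {}" by simp
 then show "D - bdry D ~= {}" unfolding h(3)[symmetric] by blast
 show "openin (top_of_set S2) (D - bdry D)" by fact
 have "infinite (sphere (0::complex) 1)"
 proof
  assume "finite (sphere (0::complex) 1)"
  moreover have "connected (sphere (0::complex) 1)" by (simp add: connected_sphere)
  ultimately have "sphere (0::complex) 1 = {} | (EX x. sphere (0::complex) 1 = {x})"
   using connected_finite_iff_sing by blast
  moreover have "1 : sphere (0::complex) 1" "-1 : sphere (0::complex) 1" by auto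
  ultimately have "(1::complex) = -1" by (metis empty_iff singletonD)
  then show False by simp
 qed
 moreover have "inj_on \<phi> (sphere 0 1)" by (rule inj_on_subset[OF inj]) auto
 ultimately show "infinite (bdry D)" unfolding h(2)[symmetric] using finite_imageD by blast
 have "connected (sphere (0::complex) 1)" by (simp add: connected_sphere)
 then show "connected (bdry D)" unfolding h(2)[symmetric] by (intro connected_continuous_image conts)
 show "compact D" using homeomorphism_image1[OF h(1)] homeomorphism_cont1[OF h(1)] compact_continuous_image compact_cball by metis
qed

lemma closed_disk_boundary_loop:
 assumes D: "closed_disk D" and c: "c : bdry D"
 obtains gm where "simple_path gm" "pathstart gm = c" "pathfinish gm = c" "path_image gm = bdry D"
proof -
 obtain \<phi> \<psi> where h: "homeomorphism (cball (0::complex) 1) D \<phi> \<psi>" "\<phi> ` sphere 0 1 = bdry D"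
  using closed_disk_param[OF D] by metis
 have inj: "inj_on \<phi> (cball 0 1)" by (metis h(1) homeomorphism_def inj_on_inverseI)
 have conts: "continuous_on (sphere 0 1) \<phi>"
  by (rule continuous_on_subset[OF homeomorphism_cont1[OF h(1)]]) auto
 obtain x where x: "x : sphere 0 1" "c = \<phi> x" using c unfolding h(2)[symmetric] by auto
 define e where "e = (%t. x * cis (2*pi * t))"
 have e1: "e t : sphere 0 1" for t using x by (simp add: e_def norm_mult)
 have x0: "x ~= 0" using x by auto
 have ec: "continuous_on {0..1} e" unfolding e_def by (intro continuous_intros)
 have img: "e ` {0..1} = sphere 0 1"
 proof
  show "sphere 0 1 <= e ` {0..1}"
  proof
   fix y :: complex assume y: "y : sphere 0 1"
   define \<theta> where "\<theta> = Arg2pi (y / x)"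
   have n: "norm (y / x) = 1" using x y by (simp add: norm_divide)
   have th: "0 <= \<theta>" "\<theta> < 2*pi" "y / x = cis \<theta>"
    using Arg2pi[of "y/x"] n by (simp_all add: \<theta>_def cis_conv_exp is_Arg_def)
   have "y = e (\<theta> / (2*pi))" using th x0 by (simp add: e_def field_simps)
   moreover have "\<theta> / (2*pi) : {0..1}" using th by (simp add: field_simps)
   ultimately show "y : e ` {0..1}" by blast
  qed
 qed (use e1 in auto)
 have loop: "loop_free (\<phi> \<circ> e)" unfolding loop_free_def
 proof (intro ballI impI)
  fix s t assume st: "s : {0..1::real}" "t : {0..1::real}" "(\<phi> \<circ> e) s = (\<phi> \<circ> e) t"
  have "e s = e t" using inj_onD[OF inj, of "e s" "e t"] st e1 by (auto simp: sphere_def cball_def)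
  then have "cis (2*pi * s) = cis (2*pi * t)" using x0 by (simp add: e_def)
  then have "sin (2*pi * s) = sin (2*pi * t) & cos (2*pi * s) = cos (2*pi * t)"
   by (metis cis.sel)
  then obtain n where n: "2*pi * s = 2*pi * t+2 * of_int n * pi"
   using sin_cos_eq_iff[of "2*pi * s" "2*pi * t"] by auto
  then have "pi * (2 * s) = pi * (2 * t+2 * of_int n)" by (simp add: algebra_simps)
  then have "s - t = of_int n" by simp
  moreover have "- 1 <= s - t" "s - t <= 1" using st by auto
  ultimately have "- 1 <= n" "n <= 1" by linarith+
  then have "n = -1 | n = 0 | n = 1" by linarith
  then show "s = t | s = 0 & t = 1 | s = 1 & t = 0"
   using \<open>s - t = of_int n\<close> st by auto
 qed
 have "path (\<phi> \<circ> e)" unfolding path_def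
  by (intro continuous_on_compose ec continuous_on_subset[OF conts]) (simp add: img)
 moreover have "pathstart (\<phi> \<circ> e) = c" "pathfinish (\<phi> \<circ> e) = c"
  by (simp_all add: pathstart_def pathfinish_def e_def x)
 moreover have "path_image (\<phi> \<circ> e) = bdry D" unfolding path_image_def image_comp[symmetric] img by (rule h(2))
 ultimately show thesis using that loop by (simp add: simple_path_def)
qed

text \<open>The planar theorem is applied after projection from \<open>N\<close>; this is why
  \<open>N\<close> lies off both sets and is removed from their complement.\<close>

lemma sphere_Janiszewski_dual:
 assumes A: "compact A" "connected A" "A <= S2" and B: "compact B" "connected B" "B <= S2"
  and N: "N : S2" "N ~: A Un B" and con: "connected (S2 - (A Un B) - {N})"
 shows "connected (A Int B)"
proof -
 obtain sg tu where s: "homeomorphism (S2 - {N}) (UNIV::complex set) sg tu"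
  using punctured_S2_homeomorphism N by blast
 have inj: "inj_on sg (S2 - {N})" by (metis s homeomorphism_def inj_on_inverseI)
 have sub: "A <= S2 - {N}" "B <= S2 - {N}" using A B N by auto
 have cs: "continuous_on X sg" if "X <= S2 - {N}" for X
  using that continuous_on_subset[OF homeomorphism_cont1[OF s]] by blast
 have "- (sg ` A Un sg ` B) = sg ` (S2 - (A Un B) - {N})"
 proof -
  have "sg ` (S2 - {N} - (A Un B)) = sg ` (S2 - {N}) - sg ` (A Un B)"
   by (rule inj_on_image_set_diff[OF inj]) (use sub in auto)
  moreover have "S2 - {N} - (A Un B) = S2 - (A Un B) - {N}" by auto
  ultimately show ?thesis using homeomorphism_image1[OF s] by (auto simp: image_Un)
 qed
 moreover have "connected (sg ` (S2 - (A Un B) - {N}))"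
  by (intro connected_continuous_image con cs) auto
 ultimately have "connected (- (sg ` A Un sg ` B))" by simp
 then have "connected (sg ` A Int sg ` B)"
  by (intro Janiszewski_dual compact_continuous_image connected_continuous_image A B cs sub)
 moreover have "sg ` A Int sg ` B = sg ` (A Int B)" using inj_on_image_Int[OF inj sub] by simp
 ultimately have "connected (sg ` (A Int B))" by simp
 then have "connected (tu ` (sg ` (A Int B)))"
  by (rule connected_continuous_image[rotated]) (rule continuous_on_subset[OF homeomorphism_cont2[OF s]], simp)
 moreover have "tu ` sg ` (A Int B) = A Int B"
 proof -
  have "tu (sg x) = x" if "x : A Int B" for x using homeomorphism_apply1[OF s, of x] sub that by blast
  then show ?thesis by (simp add: image_image)
 qed
 ultimately show ?thesis by simp
qed

subsection \<open>Wheels on the line\<close>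

text \<open>A CaTherine wheel precomposed with the universal covering of the circle; intervals of the circle
  are images of intervals \<open>{s..t}\<close> with \<open>s < t < s + 2 * pi\<close>.\<close>

locale wheel =
 fixes F :: "real => real^3"
 assumes cont: "continuous_on UNIV F"
  and per: "F (t+2*pi) = F t"
  and surj: "range F = S2"
  and disk: "s < t ==> t < s+2*pi ==> closed_disk (F ` {s..t})"
  and ends: "s < t ==> t < s+2*pi ==> F s : bdry (F ` {s..t}) & F t : bdry (F ` {s..t})"
begin

lemma per_int: "F (t+2*pi * of_int k) = F t"
proof (induction k rule: int_induct[where k = 0])
 case base then show ?case by simp
next
 case (step1 i)
 have "t+2*pi * of_int (i+1) = (t+2*pi * of_int i)+2*pi" by (simp add: algebra_simps)
 then show ?case using per step1 by metis
next
 case (step2 i)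
 have "t+2*pi * of_int i = (t+2*pi * of_int (i - 1))+2*pi" by (simp add: algebra_simps)
 then show ?case using per step2 by metis
qed

lemma per_minus: "F (t - 2*pi) = F t" using per[of "t - 2*pi"] by simp

lemma cont_on: "continuous_on A F" using cont continuous_on_subset by blast

lemma F_in: "F t : S2" using surj by auto

lemma shift_image: "F ` {s+2*pi..t+2*pi} = F ` {s..t}"
proof -
 have "{s+2*pi..t+2*pi} = (%x. x+2*pi) ` {s..t}" by simp
 then show ?thesis by (simp only: image_image per)
qed

lemma compact_im: "compact (F ` {s..t})" by (intro compact_continuous_image cont_on) simp

lemma closed_im: "closed (F ` {s..t})" using compact_im by (rule compact_imp_closed)

lemma connected_im: "connected (F ` {s..t})" by (intro connected_continuous_image cont_on) simp

lemma representative: "EX k. s <= x+2*pi * of_int k & x+2*pi * of_int k < s+2*pi"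
proof -
 define k where "k = - \<lfloor>(x - s) / (2*pi)\<rfloor>"
 have "- of_int k * (2*pi) <= x - s" "x - s < (- of_int k+1) * (2*pi)"
  using floor_divide_lower[of "2*pi" "x - s"] floor_divide_upper[of "2*pi" "x - s"] by (simp_all add: k_def)
 then show ?thesis by (intro exI[of _ k]) (simp add: algebra_simps)
qed

lemma full_image: "F ` {s..s+2*pi} = S2"
proof
 show "S2 <= F ` {s..s+2*pi}"
 proof
  fix y assume "y : S2"
  then obtain x where x: "y = F x" using surj by auto
  obtain k where k: "s <= x+2*pi * of_int k" "x+2*pi * of_int k < s+2*pi" using representative by blast
  have "y = F (x+2*pi * of_int k)" using per_int x by simp
  then show "y : F ` {s..s+2*pi}" using k by auto
 qed
qed (use F_in in auto)

lemma image_split: "s <= t ==> t <= u ==> F ` {s..u} = F ` {s..t} Un F ` {t..u}"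
 by (metis image_Un ivl_disj_un_two_touch(4))

text \<open>The inclusion from right to left uses a longer interval: a point \<open>F x\<close> of
  the complementary image is an end of \<open>{s..x}\<close>, hence a boundary point of that image,
  whose complement is contained in the complement of the image of \<open>{s..t}\<close>.\<close>

lemma bdry_eq:
 assumes "s < t" "t < s+2*pi"
 shows "bdry (F ` {s..t}) = F ` {s..t} Int F ` {t..s+2*pi}"
proof
 have cov: "F ` {s..t} Un F ` {t..s+2*pi} = S2" using image_split[of s t "s+2*pi"] full_image assms by simp
 have "closure (S2 - F ` {s..t}) <= F ` {t..s+2*pi}"
  by (rule closure_minimal) (use cov compact_imp_closed[OF compact_im] in auto)
 then show "bdry (F ` {s..t}) <= F ` {s..t} Int F ` {t..s+2*pi}" by (auto simp: bdry_def)
 show "F ` {s..t} Int F ` {t..s+2*pi} <= bdry (F ` {s..t})"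
 proof
  fix y assume y: "y : F ` {s..t} Int F ` {t..s+2*pi}"
  then obtain x where x: "t <= x" "x <= s+2*pi" "y = F x" by auto
  consider "x = t" | "x = s+2*pi" | "t < x" "x < s+2*pi" using x by linarith
  then show "y : bdry (F ` {s..t})"
  proof cases
   case 1 then show ?thesis using ends assms x by blast
  next
   case 2 then show ?thesis using ends assms x per by metis
  next
   case 3
   then have "F x : bdry (F ` {s..x})" using ends[of s x] assms by simp
   then have "F x : closure (S2 - F ` {s..x})" by (simp add: bdry_def)
   moreover have "closure (S2 - F ` {s..x}) <= closure (S2 - F ` {s..t})"
    by (intro closure_mono Diff_mono image_mono) (use 3 in auto)
   ultimately show ?thesis using y x by (auto simp: bdry_def)
  qed
 qed
qed

lemma interior_eq:
 assumes "s < t" "t < s+2*pi"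
 shows "F ` {s..t} - bdry (F ` {s..t}) = S2 - F ` {t..s+2*pi}"
proof -
 have "F ` {s..t} Un F ` {t..s+2*pi} = S2" using image_split[of s t "s+2*pi"] full_image assms by simp
 then show ?thesis unfolding bdry_eq[OF assms] by auto
qed

lemma complement_eq:
 assumes "s < t" "t < s+2*pi"
 shows "F ` {t..s+2*pi} - bdry (F ` {t..s+2*pi}) = S2 - F ` {s..t}"
 using interior_eq[of t "s+2*pi"] shift_image[of s t] assms by simp

text \<open>Janiszewski: the complement of the union is the open disk of the remaining interval, and
  it stays connected when the projection centre is removed.\<close>

lemma connected_Int_consecutive:
 assumes "s < t" "t < u" "u < s+2*pi"
 shows "connected (F ` {s..t} Int F ` {t..u})"
proof -
 have un: "F ` {s..t} Un F ` {t..u} = F ` {s..u}" using image_split[of s t u] assms by simp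
 have eq: "F ` {u..s+2*pi} - bdry (F ` {u..s+2*pi}) = S2 - F ` {s..u}" using complement_eq assms by simp
 have d: "closed_disk (F ` {u..s+2*pi})" using disk assms by simp
 obtain N where N: "N : S2 - F ` {s..u}" using closed_disk_interior_facts(3)[OF d] unfolding eq by blast
 have con: "connected (S2 - F ` {s..u} - {N})" using closed_disk_interior_facts(2)[OF d] unfolding eq by blast
 show ?thesis
  by (rule sphere_Janiszewski_dual[of _ _ N])
    (use N con F_in compact_im connected_im in \<open>auto simp: un simp del: image_Un\<close>)
qed

text \<open>By \<open>interior_eq\<close> the interior of each of the three disks is the complement
  of the other two, so the theta graph obstruction applies.\<close>

lemma triple_at_most_two:
 assumes "s < t" "t < u" "u < s+2*pi"
  and "{t1, t2, t3} <= F ` {s..t} Int F ` {t..u} Int F ` {u..s+2*pi}" "t1 ~= t2" "t1 ~= t3"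
 shows "t2 = t3"
proof (rule ccontr)
 assume "t2 ~= t3"
 have i1: "F ` {s..t} - bdry (F ` {s..t}) = S2 - (F ` {t..u} Un F ` {u..s+2*pi})"
  using interior_eq[of s t] image_split[of t u "s+2*pi"] assms by simp
 have i2: "F ` {t..u} - bdry (F ` {t..u}) = S2 - (F ` {u..s+2*pi} Un F ` {s..t})"
  using interior_eq[of t u] image_split[of u "s+2*pi" "t+2*pi"] shift_image[of s t] assms by simp
 have i3: "F ` {u..s+2*pi} - bdry (F ` {u..s+2*pi}) = S2 - (F ` {s..t} Un F ` {t..u})"
  using complement_eq[of s u] image_split[of s t u] assms by simp
 show False
  by (rule three_disks_at_most_two_points[of "F ` {s..t}" "F ` {t..u}" "F ` {u..s+2*pi}" t1 t2 t3])
    (use assms \<open>t2 ~= t3\<close> disk i1 i2 i3 in auto)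
qed

lemma infinite_im: assumes "s < t" shows "infinite (F ` {s..t})"
proof -
 define t' where "t' = min t (s + pi)"
 have t': "s < t'" "t' < s+2*pi" "t' <= t" using assms pi_gt_zero unfolding t'_def by linarith+
 have "infinite (bdry (F ` {s..t'}))" using closed_disk_interior_facts(5) disk t' by blast
 moreover have "bdry (F ` {s..t'}) <= F ` {s..t}" using t' by (auto simp: bdry_def)
 ultimately show ?thesis using finite_subset by blast
qed

text \<open>If \<open>F t\<close> were the only common point, removing it would disconnect the disk
  over \<open>{s..u}\<close>; a boundary point never does.\<close>

lemma consecutive_Int_nontrivial:
 assumes "s < t" "t < u" "u < s+2*pi" and c: "F t : bdry (F ` {s..u})"
 shows "EX z:F ` {s..t} Int F ` {t..u}. z ~= F t"
proof (rule ccontr)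
 assume "~ ?thesis"
 then have dis: "F ` {s..t} Int F ` {t..u} Int (F ` {s..u} - {F t}) = {}" by blast
 have un: "F ` {s..u} = F ` {s..t} Un F ` {t..u}" using image_split[of s t u] assms by simp
 have "connected (F ` {s..u} - {F t})"
  using closed_disk_minus_boundary_point_connected[OF disk c] assms by simp
 then have "F ` {s..t} Int (F ` {s..u} - {F t}) = {} | F ` {t..u} Int (F ` {s..u} - {F t}) = {}"
  by (rule connected_closedD[OF _ dis]) (use un closed_im in auto)
 then have "F ` {s..t} <= {F t} | F ` {t..u} <= {F t}" using un by blast
 then show False using infinite_im[of s t] infinite_im[of t u] assms finite_subset by blast
qed

lemma boundary_cover:
 assumes "s < t" "t < u" "u < s+2*pi"
 shows "bdry (F ` {s..t}) = (F ` {s..t} Int F ` {t..u}) Un (F ` {s..t} Int F ` {u..s+2*pi})"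
 using bdry_eq[of s t] image_split[of t u "s+2*pi"] assms by auto

lemma connected_Int_consecutive':
 assumes "s < t" "t < u" "u < s+2*pi"
 shows "connected (F ` {s..t} Int F ` {u..s+2*pi})"
 using connected_Int_consecutive[of u "s+2*pi" "t+2*pi"] shift_image[of s t] assms by (simp add: Int_commute)

text \<open>The boundary circle of the first disk is covered by its intersections with the other
  two. Both are continua that contain \<open>c\<close> and more, so they meet again.\<close>

lemma third_point:
 assumes q: "q1 < q2" "q2 < q3" "q3 < q1+2*pi" and c: "F q1 = c" "F q2 = c" "F q3 = c"
 shows "EX d. d ~= c & d : F ` {q1..q2} & d : F ` {q2..q3} & d : F ` {q3..q1+2*pi}"
proof -
 have d: "closed_disk (F ` {q1..q2})" using disk q by simp
 have cb: "c : bdry (F ` {q1..q2})" using ends[of q1 q2] q c by simp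
 obtain gm where g: "simple_path gm" "pathstart gm = c" "pathfinish gm = c" "path_image gm = bdry (F ` {q1..q2})"
  using closed_disk_boundary_loop[OF d cb] by blast
 have in1: "c : F ` {q1..q2}" "c : F ` {q2..q3}" "c : F ` {q3..q1+2*pi}"
  using image_eqI[of c F q1 "{q1..q2}"] image_eqI[of c F q2 "{q2..q3}"] image_eqI[of c F q3 "{q3..q1+2*pi}"] q c by auto
 have 1: "EX z:F ` {q1..q2} Int F ` {q2..q3}. z ~= c"
  using consecutive_Int_nontrivial[of q1 q2 q3] ends[of q1 q3] q c by simp
 have "EX z:F ` {q3..q1+2*pi} Int F ` {q1+2*pi..q2+2*pi}. z ~= F (q1+2*pi)"
  by (rule consecutive_Int_nontrivial) (use ends[of q3 "q2+2*pi"] q c per in auto)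
 then have 2: "EX z:F ` {q1..q2} Int F ` {q3..q1+2*pi}. z ~= c" using shift_image per c by auto
 have "EX d. d ~= c & d : (F ` {q1..q2} Int F ` {q2..q3}) Int (F ` {q1..q2} Int F ` {q3..q1+2*pi})"
 proof (rule simple_loop_cover_meets_twice[OF g(1-3)])
  show "closed (F ` {q1..q2} Int F ` {q2..q3})" "closed (F ` {q1..q2} Int F ` {q3..q1+2*pi})"
   by (auto intro: closed_Int closed_im)
  show "connected (F ` {q1..q2} Int F ` {q2..q3})" using connected_Int_consecutive q by simp
  show "connected (F ` {q1..q2} Int F ` {q3..q1+2*pi})" using connected_Int_consecutive' q by simp
  show "F ` {q1..q2} Int F ` {q2..q3} Un F ` {q1..q2} Int F ` {q3..q1+2*pi} = path_image gm"
   using boundary_cover[of q1 q2 q3] g q by simp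
 qed (use 1 2 in1 in auto)
 then show ?thesis by blast
qed

lemma triple_subset_pair:
 assumes "s < t" "t < u" "u < s+2*pi" and c: "c : F ` {s..t} Int F ` {t..u} Int F ` {u..s+2*pi}"
 obtains d where "F ` {s..t} Int F ` {t..u} Int F ` {u..s+2*pi} <= {c, d}"
proof (cases "EX d. d ~= c & d : F ` {s..t} Int F ` {t..u} Int F ` {u..s+2*pi}")
 case True
 then obtain d where d: "d ~= c" "d : F ` {s..t} Int F ` {t..u} Int F ` {u..s+2*pi}" by blast
 have "x = d" if "x : F ` {s..t} Int F ` {t..u} Int F ` {u..s+2*pi}" "x ~= c" for x
  using triple_at_most_two[OF assms(1-3), of c x d] that d c by blast
 then show thesis using that[of d] by blast
next
 case False
 then show thesis using that[of c] by blast
qed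

text \<open>The configuration excluded here is a planar \<open>K\<^sub>5\<close> on \<open>c\<close> and the four disks.\<close>

lemma unlinked:
 assumes q: "q1 < q2" "q2 < q3" "q3 < q4" "q4 < q1+2*pi"
  and c: "F q1 = c" "F q2 = c" "F q3 = c" "F q4 = c"
  and z: "z : F ` {q1..q2}" "z : F ` {q3..q4}" "z ~= c"
  and w: "w : F ` {q2..q3}" "w : F ` {q4..q1+2*pi}" "w ~= c"
 shows "z = w"
proof -
 define E1 E2 E3 E4 E12 E34 where "E1 = F ` {q1..q2}" and "E2 = F ` {q2..q3}" and "E3 = F ` {q3..q4}"
  and "E4 = F ` {q4..q1+2*pi}" and "E12 = F ` {q1..q3}" and "E34 = F ` {q3..q1+2*pi}"
 note E = E1_def E2_def E3_def E4_def E12_def E34_def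
 have e12: "E12 = E1 Un E2" and e34: "E34 = E3 Un E4"
  unfolding E using image_split[of q1 q2 q3] image_split[of q3 q4 "q1+2*pi"] q by auto
 have cl: "closed E1" "closed E2" "closed E3" "closed E4" "closed E12" "closed E34"
  unfolding E by (rule closed_im)+
 have cin: "c : E1" "c : E2" "c : E3" "c : E4"
  using image_eqI[of c F q1 "{q1..q2}"] image_eqI[of c F q2 "{q2..q3}"] image_eqI[of c F q3 "{q3..q4}"]
   image_eqI[of c F q4 "{q4..q1+2*pi}"] q c unfolding E by auto
 have sh: "F ` {q1+2*pi..q3+2*pi} = E12" "F ` {q1+2*pi..q2+2*pi} = E1"
  unfolding E by (rule shift_image)+
 have d12: "closed_disk E12" unfolding E using disk q by simp
 have cb: "c : bdry E12" unfolding E using ends[of q1 q3] q c by simp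
 obtain gm where g: "simple_path gm" "pathstart gm = c" "pathfinish gm = c" "path_image gm = bdry E12"
  using closed_disk_boundary_loop[OF d12 cb] by blast
 have bd: "path_image gm = E12 Int E34" unfolding g(4) unfolding E using bdry_eq q by simp
 have g01: "gm 0 = c" "gm 1 = c" using g by (auto simp: pathstart_def pathfinish_def)
 have lt: "q3 < q1+2*pi" "q1+2*pi < q3+2*pi" using q by auto
 have c1: "c : F ` {q1..q2} Int F ` {q2..q3} Int F ` {q3..q1+2*pi}"
  using cin e34 unfolding E by blast
 obtain d1 where d1: "E1 Int E2 Int E34 <= {c, d1}"
  using triple_subset_pair[OF q(1,2) lt(1) c1] unfolding E by blast
 obtain d3 where d3: "E3 Int E4 Int E12 <= {c, d3}"
 proof -
  have "c : F ` {q3..q4} Int F ` {q4..q1+2*pi} Int F ` {q1+2*pi..q3+2*pi}"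
   using cin e12 shift_image[of q1 q3] unfolding E by blast
  from triple_subset_pair[OF q(3,4) lt(2) this] shift_image[of q1 q3] show thesis
   using that unfolding E by metis
 qed
 have conP: "connected (E1 Int E34)" unfolding E using connected_Int_consecutive' q by simp
 have conQ: "connected (E2 Int E34)" unfolding E using connected_Int_consecutive q by simp
 have conX: "connected (E3 Int E12)"
  using connected_Int_consecutive'[of q3 q4 "q1+2*pi"] shift_image[of q1 q3] q unfolding E by simp
 have conY: "connected (E4 Int E12)"
  using connected_Int_consecutive[of q4 "q1+2*pi" "q3+2*pi"] shift_image[of q1 q3] q unfolding E by simp
 have con23: "connected (E2 Int E3)" unfolding E using connected_Int_consecutive q by simp
 have con14: "connected (E1 Int E4)"
  using connected_Int_consecutive[of q4 "q1+2*pi" "q2+2*pi"] shift_image[of q1 q2] q unfolding E by (simp add: Int_commute)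
 have zw: "z : E1" "z : E3" "w : E2" "w : E4" using z w unfolding E by auto
 \<comment> \<open>The boundary circle of \<open>E12\<close> is cut in two ways: at
   \<open>t1\<close> into the parts of \<open>E1\<close> and \<open>E2\<close>, at \<open>t3\<close>
   into those of \<open>E3\<close> and \<open>E4\<close>.\<close>
 obtain t1 where t1: "0 < t1" "t1 < 1" "E1 Int E34 = gm ` {0..t1} & E2 Int E34 = gm ` {t1..1} | E1 Int E34 = gm ` {t1..1} & E2 Int E34 = gm ` {0..t1}"
 proof (rule simple_loop_two_arcs[OF g(1-3), of "E1 Int E34" "E2 Int E34" d1])
  show "E1 Int E34 Un E2 Int E34 = path_image gm" using bd e12 by blast
 qed (use cl conP conQ cin zw z(3) w(3) e34 d1 that in \<open>auto intro: closed_Int\<close>)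
 obtain t3 where t3: "0 < t3" "t3 < 1" "E3 Int E12 = gm ` {0..t3} & E4 Int E12 = gm ` {t3..1} | E3 Int E12 = gm ` {t3..1} & E4 Int E12 = gm ` {0..t3}"
 proof (rule simple_loop_two_arcs[OF g(1-3), of "E3 Int E12" "E4 Int E12" d3])
  show "E3 Int E12 Un E4 Int E12 = path_image gm" using bd e34 by blast
 qed (use cl conX conY cin zw z(3) w(3) e12 d3 that in \<open>auto intro: closed_Int\<close>)
 have param: "EX x. 0 < x & x < 1 & v = gm x" if v: "v : path_image gm" "v ~= c" for v
 proof -
  obtain x where x: "x : {0..1}" "v = gm x" using v by (auto simp: path_image_def)
  then have "x ~= 0" "x ~= 1" using v g01 by auto
  then show ?thesis using x by (intro exI[of _ x]) auto
 qed
 have mem: "x : {a..b}" if mm: "gm x : gm ` {a..b}" "0 < x" "x < 1" "0 <= a" "b <= 1" for x a b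
 proof -
  obtain y where y: "y : {a..b}" "gm x = gm y" using mm by auto
  have "y = x" by (rule simple_loop_inj[OF g(1) y(2)[symmetric]]) (use y mm in auto)
  then show ?thesis using y by simp
 qed
 \<comment> \<open>Arcs starting at \<open>c\<close> from opposite ends of the loop and overlapping
   in between meet in \<open>c\<close> and a segment away from it, a disconnected set.\<close>
 have bad: False if ab: "0 < a" "a <= b" "b < 1" and S: "closed S" "connected S" "c : S" "S = gm ` {a..1} Int gm ` {0..b}" for a b S
 proof -
  have S1: "gm x ~: S" if x: "0 < x" "x < 1" "x < a | b < x" for x
  proof
   assume "gm x : S"
   then have "x : {a..1}" "x : {0..b}" using mem[of x a 1] mem[of x 0 b] S x ab by auto
   then show False using x by auto
  qed
  have "S Int gm ` {a / 2..(b+1) / 2} = {}"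
  proof (rule simple_loop_gap[OF g(1,2) S(1,2) _ S(3)])
   show "S <= path_image gm" unfolding S(4) path_image_def using ab by auto
   show "gm (a / 2) ~: S" "gm ((b+1) / 2) ~: S" by (rule S1; use ab in simp)+
  qed (use ab in auto)
  moreover have "gm a : S" unfolding S(4) using ab by auto
  moreover have "gm a : gm ` {a / 2..(b+1) / 2}" using ab by auto
  ultimately show False by blast
 qed
 obtain \<zeta> where ze: "0 < \<zeta>" "\<zeta> < 1" "z = gm \<zeta>" using param[of z] z(3) zw bd e12 e34 by blast
 obtain \<omega> where om: "0 < \<omega>" "\<omega> < 1" "w = gm \<omega>" using param[of w] w(3) zw bd e12 e34 by blast
 have zP: "gm \<zeta> : E1 Int E34" "gm \<zeta> : E3 Int E12" "gm \<omega> : E2 Int E34" "gm \<omega> : E4 Int E12"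
  using ze(3) om(3) zw e12 e34 by auto
 have QX: "(E2 Int E34) Int (E3 Int E12) = E2 Int E3" "(E1 Int E34) Int (E4 Int E12) = E1 Int E4"
  using e12 e34 by auto
 \<comment> \<open>If \<open>E1\<close> and \<open>E3\<close> took the same end of the loop,
   \<open>E2\<close> and \<open>E3\<close> or \<open>E1\<close> and \<open>E4\<close> would meet in
   such a disconnected set, although neighbouring images meet in continua.\<close>
 have no1: False if "E1 Int E34 = gm ` {0..t1}" "E2 Int E34 = gm ` {t1..1}" "E3 Int E12 = gm ` {0..t3}" "E4 Int E12 = gm ` {t3..1}"
 proof (cases "t1 <= t3")
  case True
  show False by (rule bad[OF t1(1) True t3(2), of "E2 Int E3"]) (use cl con23 cin QX that in auto)
 next
  case False
  then have "t3 <= t1" by simp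
  show False by (rule bad[OF t3(1) \<open>t3 <= t1\<close> t1(2), of "E1 Int E4"]) (use cl con14 cin QX that in auto)
 qed
 have no2: False if "E1 Int E34 = gm ` {t1..1}" "E2 Int E34 = gm ` {0..t1}" "E3 Int E12 = gm ` {t3..1}" "E4 Int E12 = gm ` {0..t3}"
 proof (cases "t1 <= t3")
  case True
  show False by (rule bad[OF t1(1) True t3(2), of "E1 Int E4"]) (use cl con14 cin QX that in auto)
 next
  case False
  then have "t3 <= t1" by simp
  show False by (rule bad[OF t3(1) \<open>t3 <= t1\<close> t1(2), of "E2 Int E3"]) (use cl con23 cin QX that in auto)
 qed
 \<comment> \<open>In the two remaining layouts \<open>\<zeta>\<close> and \<open>\<omega>\<close>
   lie between \<open>t1\<close> and \<open>t3\<close>, but in opposite orders; this forces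
   \<open>t1 = t3\<close> and both parameters equal it.\<close>
 have "\<zeta> = \<omega>"
  using t1(3) t3(3)
 proof (elim disjE conjE)
  assume a: "E1 Int E34 = gm ` {0..t1}" "E2 Int E34 = gm ` {t1..1}" "E3 Int E12 = gm ` {t3..1}" "E4 Int E12 = gm ` {0..t3}"
  show ?thesis using mem[of \<zeta> 0 t1] mem[of \<zeta> t3 1] mem[of \<omega> t1 1] mem[of \<omega> 0 t3] zP ze om t1 t3 unfolding a by auto
 next
  assume a: "E1 Int E34 = gm ` {t1..1}" "E2 Int E34 = gm ` {0..t1}" "E3 Int E12 = gm ` {0..t3}" "E4 Int E12 = gm ` {t3..1}"
  show ?thesis using mem[of \<zeta> t1 1] mem[of \<zeta> 0 t3] mem[of \<omega> 0 t1] mem[of \<omega> t3 1] zP ze om t1 t3 unfolding a by auto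
 qed (use no1 no2 in blast)+
 then show ?thesis using ze om by simp
qed

end

subsection \<open>Degrees of maps without fixed points\<close>

definition NS :: "nat => (nat => real) set" where
 "NS n = {x. (\<Sum>i\<le>n. x i ^ 2) = 1 & (ALL i>n. x i = 0)}"

lemma nsphere_eq: "nsphere n = top_of_set (NS n)"
 by (simp add: nsphere NS_def euclidean_product_topology)

lemma continuous_map_nsphere_iff: "continuous_map (nsphere n) (nsphere n) f \<longleftrightarrow> continuous_on (NS n) f & f ` NS n <= NS n"
 unfolding nsphere_eq using continuous_map_subtopology_eu[of "NS n" "NS n" f] by auto

text \<open>The segment from \<open>f x\<close> to \<open>- x\<close> meets the origin only at its
  midpoint and only if \<open>f x = x\<close>; otherwise it can be normalised.\<close>

lemma no_fixpoint_homotopic_uminus: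
 fixes f :: "'a::real_normed_vector => 'a"
 assumes f: "continuous_on (sphere 0 1) f" "f ` sphere 0 1 <= sphere 0 1" and nf: "!!x. x : sphere 0 1 ==> f x ~= x"
 shows "homotopic_with_canon (%_. True) (sphere 0 1) (sphere 0 1) f uminus"
proof -
 define k where "k = (%(t::real, x). (1 - t) *\<^sub>R f x - t *\<^sub>R x)"
 have nz: "k (t, x) ~= 0" if "t : {0..1}" "x : sphere 0 1" for t x
 proof
  assume "k (t, x) = 0"
  then have e: "(1 - t) *\<^sub>R f x = t *\<^sub>R x" by (simp add: k_def)
  have "f x : sphere 0 1" using that f(2) by blast
  then have "norm (f x) = 1" "norm x = 1" using that by auto
  then have "\<bar>1 - t\<bar> = \<bar>t\<bar>" using arg_cong[OF e, of norm] by simp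
  then have t: "t = 1/2" using that by auto
  have "(1/2) *\<^sub>R f x = (1/2::real) *\<^sub>R x" using e unfolding t by simp
  then have "f x = x" by simp
  then show False using nf that by blast
 qed
 have cf: "continuous_on ({0..1} \<times> sphere 0 1) (%p. f (snd p))"
  by (rule continuous_on_compose2[OF f(1)]) (auto intro: continuous_intros)
 have ck: "continuous_on ({0..1} \<times> sphere 0 1) k"
  unfolding k_def case_prod_unfold by (intro continuous_intros cf)
 show ?thesis
 proof (subst homotopic_with, simp, intro exI[of _ "%p. k p /\<^sub>R norm (k p)"] conjI ballI allI)
  have "continuous_on ({0..1} \<times> sphere 0 1) (%p. k p /\<^sub>R norm (k p))"
   by (intro continuous_intros ck) (use nz in auto)
  moreover have "k p /\<^sub>R norm (k p) : sphere 0 1" if "p : {0..1} \<times> sphere 0 1" for p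
   using nz[of "fst p" "snd p"] that by auto
  ultimately show "continuous_map (prod_topology (top_of_set {0..1}) (top_of_set (sphere 0 1))) (top_of_set (sphere 0 1)) (%p. k p /\<^sub>R norm (k p))"
   by (simp add: prod_topology_subtopology_eu continuous_map_subtopology_eu Pi_iff)
  show "k (0, x) /\<^sub>R norm (k (0, x)) = f x" if "x : topspace (top_of_set (sphere 0 1))" for x
  proof -
   have "x : sphere 0 1" using that by simp
   then have "f x : sphere 0 1" using f(2) by blast
   then have "norm (f x) = 1" by simp
   then show ?thesis by (simp add: k_def)
  qed
  show "k (1, x) /\<^sub>R norm (k (1, x)) = - x" if "x : topspace (top_of_set (sphere 0 1))" for x
   using that by (simp add: k_def)
 qed auto
qed

text \<open>A swap of coordinates conjugates the reflection to the one in coordinate 0, and the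
  degree of the swap has square 1.\<close>

lemma degree_involution_conj_reflection:
 assumes "k <= n"
 shows "Brouwer_degree2 n (%x i. if i = k then - x i else x i) = -1"
proof -
 define r where "r = (%(x::nat=>real) i. if i = (0::nat) then - x i else x i)"
 define s where "s = (%(x::nat=>real) i. x (Transposition.transpose 0 k i))"
 have cr: "continuous_map (nsphere n) (nsphere n) r" unfolding r_def by (rule continuous_map_nsphere_reflection)
 have sN: "s x : NS n" if "x : NS n" for x
 proof -
  have b: "bij_betw (Transposition.transpose 0 k) {..n} {..n}"
   using assms by (intro bij_betw_byWitness[where f' = "Transposition.transpose 0 k"]) (auto simp: Transposition.transpose_def)
  have "(\<Sum>i\<le>n. (s x i)\<^sup>2) = (\<Sum>i\<le>n. (x i)\<^sup>2)"
   unfolding s_def using sum.reindex_bij_betw[OF b, of "%i. (x i)\<^sup>2"] by simp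
  moreover have "s x i = 0" if "i > n" for i
   using \<open>x : NS n\<close> that assms by (auto simp: s_def NS_def Transposition.transpose_def)
  ultimately show ?thesis using that by (simp add: NS_def)
 qed
 have "continuous_on (NS n) s" unfolding s_def
  by (intro continuous_on_coordinatewise_then_product continuous_on_product_coordinates[THEN continuous_on_subset]) auto
 then have cs: "continuous_map (nsphere n) (nsphere n) s"
  using sN by (auto simp: continuous_map_nsphere_iff)
 have ss: "s \<circ> s = id" by (auto simp: s_def fun_eq_iff)
 have eq: "(%x i. if i = k then - x i else x i) = s \<circ> (r \<circ> s)"
  by (auto simp: fun_eq_iff s_def r_def Transposition.transpose_def)
 have "Brouwer_degree2 n s * Brouwer_degree2 n s = 1"
  using Brouwer_degree2_compose[OF cs cs] ss by simp
 moreover have "Brouwer_degree2 n (s \<circ> (r \<circ> s)) = Brouwer_degree2 n s * (Brouwer_degree2 n r * Brouwer_degree2 n s)"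
  using Brouwer_degree2_compose[OF cs cr] Brouwer_degree2_compose[OF continuous_map_compose[OF cs cr] cs] by simp
 moreover have "Brouwer_degree2 n r = -1" unfolding r_def by (rule Brouwer_degree2_reflection)
 ultimately show ?thesis unfolding eq by (simp add: mult.commute mult.left_commute)
qed

lemma emb3_continuous: "continuous_on A emb3" "emb3 ` S2 <= NS 2"
proof -
 have "continuous_on A (%v. emb3 v i)" for i
  by (cases "i = 0"; cases "i = 1"; cases "i = 2") (auto simp: emb3_def intro!: continuous_intros)
 then show "continuous_on A emb3" by (intro continuous_on_coordinatewise_then_product)
 show "emb3 ` S2 <= NS 2" by (auto simp: NS_def emb3_def S2_iff numeral_2_eq_2)
qed

lemma unemb3_continuous: "continuous_on A unemb3" "unemb3 ` NS 2 <= S2"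
proof -
 have e: "unemb3 = (%x. x 0 *\<^sub>R axis 1 1 + x 1 *\<^sub>R axis 2 1 + x 2 *\<^sub>R axis 3 1)"
  by (rule ext) (simp add: unemb3_def vec3_eq_iff axis_def)
 show "continuous_on A unemb3" unfolding e
  by (intro continuous_intros continuous_on_product_coordinates[THEN continuous_on_subset]) auto
 show "unemb3 ` NS 2 <= S2" by (auto simp: NS_def unemb3_def S2_iff numeral_2_eq_2)
qed

text \<open>Without a fixed point \<open>H\<close> would be homotopic to the antipodal map, a
  product of three reflections and thus of degree -1.\<close>

lemma op_homeo_S2_fixed_point:
 assumes "op_homeo_S2 H" obtains c where "c : S2" "H c = c"
proof -
 obtain H' where hH: "homeomorphism S2 S2 H H'" and deg: "Brouwer_degree2 2 (emb3 \<circ> H \<circ> unemb3) = 1"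
  using assms by (auto simp: op_homeo_S2_def)
 show thesis
 proof (rule ccontr)
  assume nt: "~ thesis"
  have "homotopic_with_canon (%_. True) (sphere 0 1) (sphere 0 1) H uminus"
   by (rule no_fixpoint_homotopic_uminus)
     (use hH nt that in \<open>auto simp: S2_def[symmetric] homeomorphism_def\<close>)
  then have h1: "homotopic_with_canon (%_. True) S2 S2 H uminus" by (simp add: S2_def)
  have h2: "homotopic_with (%_. True) (top_of_set S2) (nsphere 2) (emb3 \<circ> H) (emb3 \<circ> uminus)"
   by (rule homotopic_with_compose_continuous_map_left[OF h1])
     (use emb3_continuous in \<open>auto simp: nsphere_eq continuous_map_subtopology_eu\<close>)
  have "homotopic_with (%_. True) (nsphere 2) (nsphere 2) ((emb3 \<circ> H) \<circ> unemb3) ((emb3 \<circ> uminus) \<circ> unemb3)"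
   by (rule homotopic_with_compose_continuous_map_right[OF h2])
     (use unemb3_continuous in \<open>auto simp: nsphere_eq continuous_map_subtopology_eu\<close>)
  then have "Brouwer_degree2 2 ((emb3 \<circ> uminus) \<circ> unemb3) = 1"
   using Brouwer_degree2_homotopic deg by metis
  moreover have "Brouwer_degree2 2 ((emb3 \<circ> uminus) \<circ> unemb3) = -1"
  proof -
   define r where "r = (%k (x::nat=>real) i. if i = (k::nat) then - x i else x i)"
   have cr: "continuous_map (nsphere 2) (nsphere 2) (r k)" for k
    unfolding r_def by (rule continuous_map_nsphere_reflection)
   have dr: "Brouwer_degree2 2 (r k) = -1" if "k <= 2" for k
    unfolding r_def using degree_involution_conj_reflection that by simp
   have "Brouwer_degree2 2 ((emb3 \<circ> uminus) \<circ> unemb3) = Brouwer_degree2 2 (r 0 \<circ> (r 1 \<circ> r 2))"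
   proof (rule Brouwer_degree2_eq)
    fix x assume "x : topspace (nsphere 2)"
    then have "x i = 0" if "i > 2" for i using that by (simp add: nsphere_eq NS_def)
    then show "((emb3 \<circ> uminus) \<circ> unemb3) x = (r 0 \<circ> (r 1 \<circ> r 2)) x"
     by (auto simp: fun_eq_iff emb3_def unemb3_def r_def)
   qed
   also have "\<dots> = -1"
    using Brouwer_degree2_compose[OF cr[of 2] cr[of 1]] Brouwer_degree2_compose[OF continuous_map_compose[OF cr[of 2] cr[of 1]] cr[of 0]] dr
    by simp
   finally show ?thesis .
  qed
  ultimately show False by simp
 qed
qed

definition deg1 :: "(complex => complex) => int" where
 "deg1 q = Brouwer_degree2 1 (emb2 \<circ> q \<circ> unemb2)"

lemma emb2_continuous: "continuous_on A emb2" "emb2 ` S1 <= NS 1" "unemb2 (emb2 z) = z"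
proof -
 have "continuous_on A (%v. emb2 v i)" for i
  by (cases "i = 0"; cases "i = 1") (auto simp: emb2_def intro!: continuous_intros)
 then show "continuous_on A emb2" by (intro continuous_on_coordinatewise_then_product)
 have "(Re z)\<^sup>2+(Im z)\<^sup>2 = 1" if "norm z = 1" for z
  using that cmod_power2[of z] by simp
 then show "emb2 ` S1 <= NS 1" by (auto simp: NS_def emb2_def S1_def)
 show "unemb2 (emb2 z) = z" by (simp add: emb2_def unemb2_def)
qed

lemma unemb2_continuous: "continuous_on A unemb2" "unemb2 ` NS 1 <= S1"
proof -
 have e: "unemb2 = (%x. of_real (x 0) + \<i> * of_real (x 1))"
  by (rule ext) (simp add: unemb2_def complex_eq_iff)
 show "continuous_on A unemb2" unfolding e
  by (intro continuous_intros continuous_on_product_coordinates[THEN continuous_on_subset]) auto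
 show "unemb2 ` NS 1 <= S1" by (auto simp: NS_def unemb2_def S1_def cmod_def)
qed

lemma deg1_continuous_map:
 assumes "continuous_on S1 q" "q ` S1 <= S1"
 shows "continuous_map (nsphere 1) (nsphere 1) (emb2 \<circ> q \<circ> unemb2)"
 unfolding continuous_map_nsphere_iff
proof
 have "continuous_on (NS 1) (q \<circ> unemb2)"
  using unemb2_continuous assms by (intro continuous_on_compose) (auto intro: continuous_on_subset)
 then show "continuous_on (NS 1) (emb2 \<circ> q \<circ> unemb2)"
  using emb2_continuous by (metis continuous_on_compose comp_assoc)
 show "(emb2 \<circ> q \<circ> unemb2) ` NS 1 <= NS 1"
  using unemb2_continuous(2) emb2_continuous(2) assms(2) by (fastforce simp: image_subset_iff)
qed

lemma deg1_compose:
 assumes "continuous_on S1 q" "q ` S1 <= S1" "continuous_on S1 p" "p ` S1 <= S1"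
 shows "deg1 (q \<circ> p) = deg1 q * deg1 p"
proof -
 have "emb2 \<circ> (q \<circ> p) \<circ> unemb2 = (emb2 \<circ> q \<circ> unemb2) \<circ> (emb2 \<circ> p \<circ> unemb2)"
  by (auto simp: fun_eq_iff emb2_continuous)
 then show ?thesis unfolding deg1_def
  using Brouwer_degree2_compose[OF deg1_continuous_map[OF assms(3,4)] deg1_continuous_map[OF assms(1,2)]] by simp
qed

lemma deg1_cong:
 assumes "!!z. z : S1 ==> p z = q z" shows "deg1 p = deg1 q"
 unfolding deg1_def
proof (rule Brouwer_degree2_eq)
 fix x assume "x : topspace (nsphere 1)"
 then have "unemb2 x : S1" using unemb2_continuous by (auto simp: nsphere_eq)
 then show "(emb2 \<circ> p \<circ> unemb2) x = (emb2 \<circ> q \<circ> unemb2) x" using assms by simp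
qed

lemma deg1_reflection: "deg1 cnj = -1" "deg1 uminus = 1" "deg1 id = 1"
proof -
 define r where "r = (%k (x::nat=>real) i. if i = (k::nat) then - x i else x i)"
 have cr: "continuous_map (nsphere 1) (nsphere 1) (r k)" for k
  unfolding r_def by (rule continuous_map_nsphere_reflection)
 have dr: "Brouwer_degree2 1 (r k) = -1" if "k <= 1" for k
  unfolding r_def using degree_involution_conj_reflection that by simp
 have z: "x i = 0" if "x : topspace (nsphere 1)" "i > 1" for x :: "nat => real" and i
  using that by (simp add: nsphere_eq NS_def)
 have "deg1 cnj = Brouwer_degree2 1 (r 1)" unfolding deg1_def
  by (rule Brouwer_degree2_eq) (use z in \<open>auto simp: fun_eq_iff emb2_def unemb2_def r_def\<close>)
 then show "deg1 cnj = -1" using dr by simp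
 have "deg1 uminus = Brouwer_degree2 1 (r 0 \<circ> r 1)" unfolding deg1_def
  by (rule Brouwer_degree2_eq) (use z in \<open>auto simp: fun_eq_iff emb2_def unemb2_def r_def\<close>)
 then show "deg1 uminus = 1" using Brouwer_degree2_compose[OF cr[of 1] cr[of 0]] dr by simp
 have "deg1 id = Brouwer_degree2 1 id" unfolding deg1_def
  by (rule Brouwer_degree2_eq) (use z in \<open>auto simp: fun_eq_iff emb2_def unemb2_def\<close>)
 then show "deg1 id = 1" by simp
qed

text \<open>On the circle the antipodal map is a product of two reflections, so the homotopy yields
  degree 1.\<close>

lemma deg1_no_fixpoint:
 assumes q: "continuous_on S1 q" "q ` S1 <= S1" and nf: "!!z. z : S1 ==> q z ~= z"
 shows "deg1 q = 1"
proof -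
 have "homotopic_with_canon (%_. True) (sphere 0 1) (sphere 0 1) q uminus"
  by (rule no_fixpoint_homotopic_uminus) (use q nf in \<open>auto simp: S1_def[symmetric]\<close>)
 then have h1: "homotopic_with_canon (%_. True) S1 S1 q uminus" by (simp add: S1_def)
 have h2: "homotopic_with (%_. True) (top_of_set S1) (nsphere 1) (emb2 \<circ> q) (emb2 \<circ> uminus)"
  by (rule homotopic_with_compose_continuous_map_left[OF h1])
    (use emb2_continuous in \<open>auto simp: nsphere_eq continuous_map_subtopology_eu\<close>)
 have "homotopic_with (%_. True) (nsphere 1) (nsphere 1) ((emb2 \<circ> q) \<circ> unemb2) ((emb2 \<circ> uminus) \<circ> unemb2)"
  by (rule homotopic_with_compose_continuous_map_right[OF h2])
    (use unemb2_continuous in \<open>auto simp: nsphere_eq continuous_map_subtopology_eu\<close>)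
 then have "deg1 q = deg1 uminus" unfolding deg1_def by (rule Brouwer_degree2_homotopic)
 then show ?thesis by (simp add: deg1_reflection)
qed

subsection \<open>Lifting circle homeomorphisms to the line\<close>

lemma S1_iff_cis: "z : S1 \<longleftrightarrow> (EX t. z = cis t)"
proof
 assume "z : S1"
 then have "z = cis (Arg z)" by (metis S1_def cis_Arg mem_sphere_0 norm_zero sgn_eq zero_neq_one div_by_1 of_real_1)
 then show "EX t. z = cis t" by blast
qed (auto simp: S1_def)

lemma cis_in_S1 [simp]: "cis t : S1" by (simp add: S1_def)

lemma cis_eq_iff: "cis s = cis t \<longleftrightarrow> (EX k::int. s = t+2*pi * of_int k)"
proof
 assume "cis s = cis t"
 then have "sin s = sin t & cos s = cos t" by (metis cis.sel)
 then obtain n where "s = t+2 * of_int n * pi" using sin_cos_eq_iff[of s t] by auto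
 then show "EX k::int. s = t+2*pi * of_int k" by (auto intro!: exI[of _ n])
next
 assume "EX k::int. s = t+2*pi * of_int k"
 then obtain n :: int where "s = t+2 * of_int n * pi" by auto
 then have "sin s = sin t & cos s = cos t" using sin_cos_eq_iff[of s t] by auto
 then show "cis s = cis t" by (simp add: complex_eq_iff)
qed

lemma cis_eq_near: "cis s = cis t ==> \<bar>s - t\<bar> < 2*pi ==> s = t"
proof -
 assume a: "cis s = cis t" "\<bar>s - t\<bar> < 2*pi"
 then obtain k :: int where k: "s = t+2*pi * of_int k" using cis_eq_iff by blast
 then have "2*pi * \<bar>of_int k\<bar> < 2*pi * 1" using a by (simp add: abs_mult)
 then have "\<bar>of_int k :: real\<bar> < 1" using pi_gt_zero mult_less_cancel_left_pos[of "2*pi"] by (metis mult_pos_pos zero_less_numeral)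
 then have "k = 0" by linarith
 then show ?thesis using k by simp
qed

lemma cis_periodic: "cis (t+2*pi) = cis t" using cis_eq_iff[of "t+2*pi" t] by (metis mult_1_right of_int_1)

text \<open>The displacement \<open>u\<close> oscillates by less than \<open>2*pi\<close>, since an
  increasing lift does not gain a full turn within a period. A suitable rotation therefore removes
  all fixed points; the rotated map and the rotation both have degree 1.\<close>

lemma deg1_increasing_lift:
 assumes q: "continuous_on S1 q" "q ` S1 <= S1"
  and l: "continuous_on UNIV l" "strict_mono l" "!!t. l (t+2*pi) = l t+2*pi" "!!t. q (cis t) = cis (l t)"
 shows "deg1 q = 1"
proof -
 define u where "u = (%t. l t - t)"
 have cu: "continuous_on {0..2*pi} u" unfolding u_def
  by (intro continuous_intros continuous_on_subset[OF l(1)]) auto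
 obtain a where a: "a : {0..2*pi}" "!!t. t : {0..2*pi} ==> u a <= u t"
  using continuous_attains_inf[OF _ _ cu] by auto
 obtain b where b: "b : {0..2*pi}" "!!t. t : {0..2*pi} ==> u t <= u b"
  using continuous_attains_sup[OF _ _ cu] by auto
 have ub: "u b < u a+2*pi"
 proof (cases "a <= b")
  case True
  then have "b < a+2*pi | a = 0 & b = 2*pi" using a b by auto
  then show ?thesis
  proof
   assume "b < a+2*pi"
   then have "l b < l a+2*pi" using strict_monoD[OF l(2), of b "a+2*pi"] l(3)[of a] by simp
   then show ?thesis using True by (simp add: u_def)
  next
   assume "a = 0 & b = 2*pi"
   then show ?thesis using l(3)[of 0] by (simp add: u_def)
  qed
 next
  case False
  then have "l b < l a" using strict_monoD[OF l(2), of b a] by simp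
  then show ?thesis using a b False by (simp add: u_def)
 qed
 \<comment> \<open>Centres the range of \<open>u + af\<close> between 0 and \<open>2*pi\<close>,
   with half of the slack on either side.\<close>
 define af where "af = - u a+(2*pi - (u b - u a)) / 2"
 have rng: "0 < u t + af" "u t + af < 2*pi" if "t : {0..2*pi}" for t
  using a(2)[OF that] b(2)[OF that] ub by (auto simp: af_def field_simps)
 define rot where "rot = (%z. cis af * z)"
 have cr: "continuous_on S1 rot" "rot ` S1 <= S1" unfolding rot_def
  by (intro continuous_intros) (auto simp: S1_def norm_mult)
 have rep: "EX t:{0..2*pi}. z = cis t" if "z : S1" for z
 proof -
  have "norm z = 1" using that by (simp add: S1_def)
  then have "z = cis (Arg2pi z)" "0 <= Arg2pi z" "Arg2pi z < 2*pi"
   using Arg2pi[of z] by (auto simp: is_Arg_def cis_conv_exp)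
  then show ?thesis by (intro bexI[of _ "Arg2pi z"]) auto
 qed
 have "deg1 (rot \<circ> q) = 1"
 proof (rule deg1_no_fixpoint)
  show "continuous_on S1 (rot \<circ> q)" using q cr by (intro continuous_on_compose) (auto intro: continuous_on_subset)
  show "(rot \<circ> q) ` S1 <= S1" using q cr by auto
  fix z assume "z : S1"
  then obtain t where t: "t : {0..2*pi}" "z = cis t" using rep by blast
  have "(rot \<circ> q) z = cis (af + l t)" using l(4) t by (simp add: rot_def cis_mult)
  moreover have "cis (af + l t) ~= cis t"
   using cis_eq_near[of "af + l t" t] rng[OF t(1)] by (auto simp: u_def)
  ultimately show "(rot \<circ> q) z ~= z" using t by simp
 qed
 moreover have "deg1 rot = 1"
 proof (cases "cis af = 1")
  case True
  then have "deg1 rot = deg1 id" by (intro deg1_cong) (simp add: rot_def)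
  then show ?thesis by (simp add: deg1_reflection)
 next
  case False
  show ?thesis by (rule deg1_no_fixpoint[OF cr]) (use False in \<open>auto simp: rot_def S1_def\<close>)
 qed
 ultimately show ?thesis using deg1_compose[OF cr q] by simp
qed

text \<open>A continuous logarithm of \<open>h (cis t)\<close> gives \<open>l\<close>, and
  injectivity of \<open>h\<close> makes its increment over a period one turn up to sign. The degree
  decides the sign: for decreasing \<open>l\<close> the map \<open>cnj \<circ> h\<close> would have
  an increasing lift, hence degree 1, and \<open>h\<close> degree -1.\<close>

lemma homeomorphism_S1_lift:
 assumes h: "homeomorphism S1 S1 h h'" and deg: "deg1 h = 1"
 obtains l where "continuous_on UNIV l" "strict_mono l" "!!t. l (t+2*pi) = l t+2*pi" "!!t. h (cis t) = cis (l t)"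
proof -
 have ch: "continuous_on S1 h" and hS: "h ` S1 = S1" using h by (auto simp: homeomorphism_def)
 have hS': "h (cis t) : S1" for t using hS cis_in_S1 by blast
 have hinj: "cis s = cis t" if "h (cis s) = h (cis t)" for s t
  using homeomorphism_apply1[OF h] cis_in_S1 that by metis
 have "continuous_on UNIV (%t. h (cis t))"
  by (rule continuous_on_compose2[OF ch]) (auto intro: continuous_intros)
 moreover have "h (cis t) ~= 0" for t using hS'[of t] by (auto simp: S1_def)
 ultimately obtain g where g: "continuous_on UNIV g" "!!t. h (cis t) = exp (g t)"
  using continuous_logarithm_on_contractible[of UNIV "%t::real. h (cis t)"] by (metis UNIV_I contractible_UNIV)
 define l where "l = (%t. Im (g t))"
 have cl: "continuous_on UNIV l" unfolding l_def by (intro continuous_intros g)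
 have hl: "h (cis t) = cis (l t)" for t
 proof -
  have "norm (exp (g t)) = 1" using hS'[of t] g by (simp add: S1_def)
  then have "Re (g t) = 0" by simp
  then have "exp (g t) = cis (l t)" by (simp add: exp_eq_polar l_def)
  then show ?thesis using g by simp
 qed
 define m where "m = (%t. l (t+2*pi) - l t)"
 have cm: "continuous_on UNIV m" unfolding m_def
  by (intro continuous_intros continuous_on_compose2[OF cl]) auto
 have mk: "EX k::int. m t = 2*pi * of_int k" for t
 proof -
  have "cis (l (t+2*pi)) = cis (l t)" using hl cis_periodic by metis
  then show ?thesis using cis_eq_iff[of "l (t+2*pi)" "l t"] by (auto simp: m_def)
 qed
 have "m constant_on UNIV"
 proof (rule continuous_discrete_range_constant[OF _ cm])
  show "EX e>0. ALL y. y : UNIV & m y ~= m x --> e <= norm (m y - m x)" for x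
  proof (intro exI[of _ "2*pi"] conjI allI impI)
   fix y assume ne: "y : UNIV & m y ~= m x"
   obtain k k' :: int where k: "m x = 2*pi * of_int k" "m y = 2*pi * of_int k'" using mk by meson
   then have "k ~= k'" using ne by auto
   then have "1 <= \<bar>of_int (k' - k) :: real\<bar>" by linarith
   moreover have "m y - m x = 2*pi * of_int (k' - k)" using k by (simp add: algebra_simps)
   ultimately show "2*pi <= norm (m y - m x)" by (simp add: abs_mult)
  qed simp
 qed auto
 then obtain mm where "!!t. m t = mm" by (auto simp: constant_on_def)
 then obtain k :: int where k: "!!t. l (t+2*pi) = l t+2*pi * of_int k"
  using mk[of 0] by (auto simp: m_def algebra_simps)
 have inj1: "s = t" if "l s = l t" "\<bar>s - t\<bar> < 2*pi" for s t
  using cis_eq_near hinj hl that by metis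
 \<comment> \<open>With increment 0 an intermediate value is taken on both halves of the period;
   with two or more turns the value one turn away from \<open>l 0\<close> is taken before the period
   ends. Either repeats a value of \<open>h\<close>.\<close>
 have k1: "\<bar>k\<bar> = 1"
 proof (rule ccontr)
  assume "\<bar>k\<bar> ~= 1"
  have e: "l (2*pi) = l 0+2*pi * of_int k" using k[of 0] by simp
  consider "k = 0" | "k >= 2" | "k <= -2" using \<open>\<bar>k\<bar> ~= 1\<close> by linarith
  then show False
  proof cases
   case 1
   have "l pi ~= l 0" using inj1[of pi 0] by auto
   define y where "y = (l 0 + l pi) / 2"
   have "EX x:{0..pi}. l x = y"
    using IVT'[of l 0 y pi] IVT2'[of l pi y 0] continuous_on_subset[OF cl] \<open>l pi ~= l 0\<close>
    by (cases "l 0 <= l pi") (auto simp: y_def field_simps)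
   then obtain x where x: "x : {0..pi}" "l x = y" by blast
   have "EX x:{pi..2*pi}. l x = y"
    using IVT'[of l pi y "2*pi"] IVT2'[of l "2*pi" y pi] continuous_on_subset[OF cl] \<open>l pi ~= l 0\<close> e 1
    by (cases "l 0 <= l pi") (auto simp: y_def field_simps)
   then obtain x' where x': "x' : {pi..2*pi}" "l x' = y" by blast
   have nx: "x ~= 0" "x ~= pi" "x' ~= pi" using x x' \<open>l pi ~= l 0\<close> by (auto simp: y_def field_simps)
   then have "x = x'" using inj1[of x x'] x x' by auto
   then show False using x x' nx by auto
  next
   case 2
   then have "l 0+2*pi <= l (2*pi)" unfolding e by (simp add: mult_left_mono)
   then obtain x where x: "0 <= x" "x <= 2*pi" "l x = l 0+2*pi"
    using IVT'[of l 0 "l 0+2*pi" "2*pi"] continuous_on_subset[OF cl] by auto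
   then have "h (cis x) = h (cis 0)" using hl cis_periodic by metis
   then have "cis x = cis 0" by (rule hinj)
   moreover have "x ~= 0" "x ~= 2*pi" using x e 2 by auto
   ultimately show False using cis_eq_near[of x 0] x by auto
  next
   case 3
   then have "of_int k <= (-2::real)" by linarith
   then have "2*pi * of_int k <= 2*pi * (-1)" by (intro mult_left_mono) auto
   then have "l (2*pi) <= l 0 - 2*pi" unfolding e by simp
   then obtain x where x: "0 <= x" "x <= 2*pi" "l x = l 0 - 2*pi"
    using IVT2'[of l "2*pi" "l 0 - 2*pi" 0] continuous_on_subset[OF cl] by auto
   then have "l 0 = l x+2*pi" by simp
   then have "h (cis 0) = h (cis x)" using hl cis_periodic by metis
   then have "cis x = cis 0" using hinj by metis
   moreover have "x ~= 0" using x by auto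
   moreover have "x ~= 2*pi"
   proof
    assume "x = 2*pi"
    then have "pi * real_of_int k = pi * (-1)" using x e by simp
    then have "real_of_int k = -1" using mult_left_cancel[OF pi_neq_zero] by blast
    then show False using 3 by simp
   qed
   ultimately show False using cis_eq_near[of x 0] x by auto
  qed
 qed
 have kint: "l (t+2*pi * of_int j) = l t+2*pi * of_int k * of_int j" for t j
 proof (induction j rule: int_induct[where k = 0])
  case base then show ?case by simp
 next
  case (step1 i)
  have "t+2*pi * of_int (i+1) = (t+2*pi * of_int i)+2*pi" by (simp add: algebra_simps)
  then show ?case using k step1 by (metis (no_types, lifting) add.assoc distrib_left mult.right_neutral of_int_1 of_int_add)
 next
  case (step2 i)
  have "t+2*pi * of_int i = (t+2*pi * of_int (i - 1))+2*pi" by (simp add: algebra_simps)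
  then have "l (t+2*pi * of_int i) = l (t+2*pi * of_int (i - 1))+2*pi * of_int k" using k by metis
  then show ?case using step2 by (simp add: algebra_simps)
 qed
 have linj: "inj l"
 proof (rule injI)
  fix s t assume e: "l s = l t"
  then have "cis s = cis t" using hinj hl by metis
  then obtain j :: int where j: "s = t+2*pi * of_int j" using cis_eq_iff by blast
  then have "2*pi * of_int k * of_int j = 0" using kint[of t j] e by simp
  then have "j = 0" using k1 by auto
  then show "s = t" using j by simp
 qed
 have mono: "strict_mono l | strict_antimono_on UNIV l"
  using injective_eq_monotone_map[of UNIV l] cl linj by auto
 show thesis
 proof (cases "strict_mono l")
  case True
  then have "l 0 < l (0+2*pi)" by (simp add: strict_monoD)
  then have "0 < 2*pi * of_int k" using k[of 0] by simp
  then have "k > 0" by (simp add: zero_less_mult_iff)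
  then have "k = 1" using k1 by simp
  then show thesis using that[of l] cl True k hl by simp
 next
  case False
  then have am: "strict_antimono_on UNIV l" using mono by simp
  have dec: "l t < l s" if "s < t" for s t using am that by (auto simp: monotone_on_def)
  then have "l (0+2*pi) < l 0" by simp
  then have "2*pi * of_int k < 0" using k[of 0] by simp
  then have "k < 0" by (simp add: mult_less_0_iff)
  then have "k = -1" using k1 by simp
  have cc: "continuous_on S1 (cnj \<circ> h)" "(cnj \<circ> h) ` S1 <= S1"
   using ch hS by (auto intro!: continuous_intros simp: S1_def o_def)
  have "deg1 (cnj \<circ> h) = 1"
  proof (rule deg1_increasing_lift[OF cc, of "%t. - l t"])
   show "continuous_on UNIV (%t. - l t)" using cl by (intro continuous_intros)
   show "strict_mono (%t. - l t)" using dec by (auto simp: strict_mono_def)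
  qed (use k \<open>k = -1\<close> hl in \<open>auto simp: cis_cnj\<close>)
  moreover have "deg1 (cnj \<circ> h) = deg1 cnj * deg1 h"
   by (rule deg1_compose) (use ch hS in \<open>auto intro!: continuous_intros simp: S1_def\<close>)
  ultimately show thesis using deg deg1_reflection by simp
 qed
qed

lemma arc_cis:
 assumes "s <= t" "t < s+2*pi" shows "arc (cis s) (cis t) = cis ` {s..t}" "ccw_angle (cis s) (cis t) = t - s"
proof -
 have "cis t / cis s = cis (t - s)" by (simp add: cis_divide)
 moreover have "Arg2pi (cis (t - s)) = t - s"
  by (rule Arg2pi_unique[of 1]) (use assms in \<open>auto simp: cis_conv_exp\<close>)
 ultimately show a: "ccw_angle (cis s) (cis t) = t - s" by (simp add: ccw_angle_def)
 show "arc (cis s) (cis t) = cis ` {s..t}"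
 proof
  show "arc (cis s) (cis t) <= cis ` {s..t}"
  proof
   fix z assume "z : arc (cis s) (cis t)"
   then obtain u where "0 <= u" "u <= t - s" "z = cis (s + u)" by (auto simp: arc_def a cis_mult)
   then show "z : cis ` {s..t}" by (intro image_eqI[of _ _ "s + u"]) auto
  qed
  show "cis ` {s..t} <= arc (cis s) (cis t)"
  proof
   fix z assume "z : cis ` {s..t}"
   then obtain x where x: "s <= x" "x <= t" "z = cis x" by auto
   then have "z = cis s * cis (x - s)" by (simp add: cis_mult)
   then show "z : arc (cis s) (cis t)" using x by (auto simp: arc_def a)
  qed
 qed
qed

lemma catherine_wheel_lift:
 assumes "catherine_wheel f" shows "wheel (%t. f (cis t))"
proof
 have cf: "continuous_on S1 f" "f ` S1 = S2" using assms by (auto simp: catherine_wheel_def)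
 show "continuous_on UNIV (%t. f (cis t))"
  by (rule continuous_on_compose2[OF cf(1)]) (auto intro: continuous_intros)
 show "f (cis (t+2*pi)) = f (cis t)" for t by (simp only: cis_periodic)
 have "range (%t. f (cis t)) = f ` range cis" by (simp add: image_image)
 moreover have "range cis = S1" using S1_iff_cis by auto
 ultimately show "range (%t. f (cis t)) = S2" using cf by simp
 fix s t :: real assume st: "s < t" "t < s+2*pi"
 have im: "f ` arc (cis s) (cis t) = (%t. f (cis t)) ` {s..t}"
  using arc_cis[of s t] st by (simp add: image_image)
 have "cis s ~= cis t" using cis_eq_near[of s t] st by auto
 then have "closed_disk (f ` arc (cis s) (cis t)) & {f (cis s), f (cis t)} <= bdry (f ` arc (cis s) (cis t))"
  using assms cis_in_S1 unfolding catherine_wheel_def by blast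
 then show "closed_disk ((%t. f (cis t)) ` {s..t})"
  "f (cis s) : bdry ((%t. f (cis t)) ` {s..t}) & f (cis t) : bdry ((%t. f (cis t)) ` {s..t})"
  unfolding im by auto
qed

text \<open>Lets the second half plane of the translation case be treated by the construction for
  the first.\<close>

lemma (in wheel) wheel_reflect: "wheel (%t. F (- t))"
proof
 show "continuous_on UNIV (%t. F (- t))"
  by (rule continuous_on_compose2[OF cont]) (auto intro: continuous_intros)
 show "F (- (t+2*pi)) = F (- t)" for t using per_minus[of "- t"] by simp
 show "range (%t. F (- t)) = S2"
 proof -
  have "F t : range (%t. F (- t))" for t by (rule image_eqI[of _ _ "- t"]) auto
  then have "range F <= range (%t. F (- t))" by blast
  then show ?thesis using surj F_in by blast
 qed
 fix s t :: real assume st: "s < t" "t < s+2*pi"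
 have im: "(%t. F (- t)) ` {s..t} = F ` {- t..- s}"
 proof -
  have "uminus ` {s..t} = {- t..- s}" by simp
  then show ?thesis by (metis image_image)
 qed
 show "closed_disk ((%t. F (- t)) ` {s..t})" unfolding im using disk st by simp
 show "F (- s) : bdry ((%t. F (- t)) ` {s..t}) & F (- t) : bdry ((%t. F (- t)) ` {s..t})"
  unfolding im using ends[of "- t" "- s"] st by simp
qed

subsection \<open>Equivariant wheels\<close>

text \<open>The ends are the last point of \<open>S\<close> before \<open>t\<close> and the first
  one after it; periodicity supplies points on both sides and bounds the length.\<close>

lemma closed_periodic_gap:
 fixes S :: "real set"
 assumes cl: "closed S" and ne: "x0 : S" and per: "!!x (k::int). x : S ==> x+2*pi * of_int k : S" and t: "t ~: S"
 obtains u v where "u : S" "v : S" "u < t" "t < v" "v <= u+2*pi" "!!x. u < x ==> x < v ==> x ~: S"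
proof -
 define u where "u = Sup (S Int {..t})"
 define v where "v = Inf (S Int {t..})"
 have e1: "EX x:S. x <= t"
 proof -
  obtain n :: nat where "x0 - t < real n * (2*pi)" using reals_Archimedean3[of "2*pi"] by auto
  then have "x0+2*pi * of_int (- int n) <= t" by (simp add: algebra_simps)
  then show ?thesis using per ne by blast
 qed
 have e2: "EX x:S. t <= x"
 proof -
  obtain n :: nat where "t - x0 < real n * (2*pi)" using reals_Archimedean3[of "2*pi"] by auto
  then have "t <= x0+2*pi * of_int (int n)" by (simp add: algebra_simps)
  then show ?thesis using per ne by blast
 qed
 have bd: "bdd_above (S Int {..t})" "bdd_below (S Int {t..})" by (auto intro: bdd_aboveI bdd_belowI)
 have u: "u : S Int {..t}" unfolding u_def by (rule closed_contains_Sup) (use e1 bd cl in auto)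
 have v: "v : S Int {t..}" unfolding v_def by (rule closed_contains_Inf) (use e2 bd cl in auto)
 have gap: "x ~: S" if "u < x" "x < v" for x
 proof
  assume x: "x : S"
  show False
  proof (cases "x <= t")
   case True
   then have "x <= u" unfolding u_def using x bd by (intro cSup_upper) auto
   then show False using that by simp
  next
   case False
   then have "v <= x" unfolding v_def using x bd by (intro cInf_lower) auto
   then show False using that by simp
  qed
 qed
 have ut: "u < t" "t < v" using u v t by (auto simp: less_le)
 have "u+2*pi : S" using per[of u 1] u by simp
 then have "v <= u+2*pi" using gap[of "u+2*pi"] pi_gt_zero by fastforce
 then show thesis using that[of u v] u v ut gap by auto
qed

text \<open>Here \<open>l\<close> is a lift of a circle map and \<open>H\<close> the induced map of
  the sphere. Inverses, powers, lifts shifted by full turns and the reversed parameter are again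
  instances, so later arguments need only one direction.\<close>

locale wheel_map = wheel F for F +
 fixes l l' :: "real => real" and H H' :: "real^3 => real^3"
 assumes l_mono: "strict_mono l" and l_cont: "continuous_on UNIV l" and l_per: "l (t+2*pi) = l t+2*pi"
  and l'l: "l' (l t) = t" and ll': "l (l' t) = t"
  and FH: "F (l t) = H (F t)" and hom: "homeomorphism S2 S2 H H'"
begin

lemma l_less [simp]: "l s < l t \<longleftrightarrow> s < t" using l_mono by (simp add: strict_mono_less)
lemma l_le [simp]: "l s <= l t \<longleftrightarrow> s <= t" using l_mono by (simp add: strict_mono_less_eq)
lemma l_eq [simp]: "l s = l t \<longleftrightarrow> s = t" using l_mono by (simp add: strict_mono_eq)

lemma H'H: "y : S2 ==> H' (H y) = y" and HH': "y : S2 ==> H (H' y) = y"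
 using homeomorphism_apply1[OF hom] homeomorphism_apply2[OF hom] by auto

lemma H_in: "y : S2 ==> H y : S2" and H'_in: "y : S2 ==> H' y : S2"
 using homeomorphism_image1[OF hom] homeomorphism_image2[OF hom] by auto

lemma H_inj: "x : S2 ==> y : S2 ==> H x = H y \<longleftrightarrow> x = y" using H'H by metis

lemma FH': "F (l' t) = H' (F t)" using FH[of "l' t"] H'H F_in ll' by metis

lemma wheel_map_inverse: "wheel_map F l' l H' H"
proof
 have less: "l' s < l' t \<longleftrightarrow> s < t" for s t using l_less[of "l' s" "l' t"] by (simp add: ll')
 then show "strict_mono l'" by (simp add: strict_mono_def)
 show "continuous_on UNIV l'"
 proof -
  have "l ` UNIV = UNIV" using ll' by (metis surjI)
  moreover have "inj l" using l_eq by (simp add: inj_def)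
  ultimately obtain g where g: "homeomorphism UNIV UNIV l g"
   using invariance_of_domain_homeomorphism[of UNIV l] l_cont by auto
  have "g t = l' t" for t using homeomorphism_apply1[OF g, of "l' t"] by (simp add: ll')
  then show ?thesis using homeomorphism_cont2[OF g] by (metis ext)
 qed
 show "l' (t+2*pi) = l' t+2*pi" for t using l_per[of "l' t"] l'l ll' by metis
 show "l (l' t) = t" "l' (l t) = t" for t by (rule ll', rule l'l)
 show "F (l' t) = H' (F t)" for t by (rule FH')
 show "homeomorphism S2 S2 H' H" using hom by (rule homeomorphism_symD)
qed

lemma pow_mono: "strict_mono (l ^^ n)" by (induction n) (auto simp: strict_mono_def)

lemma pow_per: "(l ^^ n) (t+2*pi) = (l ^^ n) t+2*pi" by (induction n) (auto simp: l_per)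

lemma pow_cont: "continuous_on UNIV (l ^^ n)"
proof (induction n)
 case 0 then show ?case by (simp add: id_def)
next
 case (Suc n)
 then show ?case using continuous_on_compose2[OF l_cont Suc] by (simp add: o_def)
qed

lemma pow_FH: "F ((l ^^ n) t) = (H ^^ n) (F t)" by (induction n) (auto simp: FH)

lemma pow_in: "y : S2 ==> (H ^^ n) y : S2" by (induction n) (auto simp: H_in)

lemma pow_commute: "(l ^^ n) (l t) = l ((l ^^ n) t)" by (simp add: funpow_swap1)

lemma l_per_int: "l (t+2*pi * of_int k) = l t+2*pi * of_int k"
proof (induction k rule: int_induct[where k = 0])
 case base then show ?case by simp
next
 case (step1 i)
 have "t+2*pi * of_int (i+1) = (t+2*pi * of_int i)+2*pi" by (simp add: algebra_simps)
 then have "l (t+2*pi * of_int (i+1)) = l (t+2*pi * of_int i)+2*pi" using l_per by metis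
 then show ?case using step1 by (simp add: algebra_simps)
next
 case (step2 i)
 have "t+2*pi * of_int i = (t+2*pi * of_int (i - 1))+2*pi" by (simp add: algebra_simps)
 then have "l (t+2*pi * of_int i) = l (t+2*pi * of_int (i - 1))+2*pi" using l_per by metis
 then show ?case using step2 by (simp add: algebra_simps)
qed

lemma pow_per_int: "(l ^^ n) (t+2*pi * of_int k) = (l ^^ n) t+2*pi * of_int k"
 by (induction n) (auto simp: l_per_int)

lemma wheel_map_pow: "wheel_map F (l ^^ n) (l' ^^ n) (H ^^ n) (H' ^^ n)"
proof
 have inv: "(f ^^ n) ((g ^^ n) t) = t" if "!!t. f (g t) = t" for f g :: "real => real" and t
  by (induction n arbitrary: t) (auto simp: funpow_swap1 that)
 show "(l' ^^ n) ((l ^^ n) t) = t" "(l ^^ n) ((l' ^^ n) t) = t" for t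
  by (rule inv, rule l'l) (rule inv, rule ll')
 show "homeomorphism S2 S2 (H ^^ n) (H' ^^ n)"
 proof (induction n)
  case 0 then show ?case by (simp add: homeomorphism_def id_def)
 next
  case (Suc n)
  have "homeomorphism S2 S2 (H \<circ> H ^^ n) (H' ^^ n \<circ> H')" using homeomorphism_compose[OF Suc hom] .
  moreover have "H' ^^ n \<circ> H' = H' \<circ> H' ^^ n" by (simp add: fun_eq_iff funpow_swap1)
  ultimately show ?case by (simp only: funpow.simps)
 qed
qed (auto simp: pow_mono pow_cont pow_per pow_FH)

lemma wheel_map_shift: "wheel_map F (%t. l t+2*pi * of_int k) (%t. l' (t - 2*pi * of_int k)) H H'"
proof
 show "strict_mono (%t. l t+2*pi * of_int k)" by (simp add: strict_mono_def)
 show "continuous_on UNIV (%t. l t+2*pi * of_int k)" by (intro continuous_intros l_cont)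
qed (auto simp: l_per l'l ll' per_int FH hom)

lemma wheel_map_reflect: "wheel_map (%t. F (- t)) (%t. - l (- t)) (%t. - l' (- t)) H H'"
proof -
 interpret R: wheel "%t. F (- t)" by (rule wheel_reflect)
 show ?thesis
 proof
  show "strict_mono (%t. - l (- t))" by (simp add: strict_mono_def)
  show "continuous_on UNIV (%t. - l (- t))"
   by (intro continuous_intros continuous_on_compose2[OF l_cont]) auto
  show "- l (- (t+2*pi)) = - l (- t)+2*pi" for t using l_per[of "- t - 2*pi"] by simp
 qed (auto simp: l'l ll' FH hom)
qed

lemma no_fixed_sign:
 assumes "!!x. (l ^^ m) x+2*pi * of_int k ~= x" "(l ^^ m) y+2*pi * of_int k > y"
 shows "(l ^^ m) x+2*pi * of_int k > x"
proof (rule ccontr)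
 assume n: "~ ?thesis"
 define d where "d = (%x. (l ^^ m) x+2*pi * of_int k - x)"
 have cd: "continuous_on S d" for S unfolding d_def by (intro continuous_intros continuous_on_subset[OF pow_cont]) auto
 have "d x <= 0" "0 <= d y" using n assms(2) by (auto simp: d_def)
 then have "EX z. d z = 0"
  using IVT'[of d x 0 y] IVT2'[of d x 0 y] cd by (metis linear)
 then show False using assms(1) by (auto simp: d_def)
qed

text \<open>A circle homeomorphism without periodic points would translate, along a minimal set in the fibre
  of a fixed point, a pair of points with the same image into a linked pair.\<close>

lemma periodic_point_exists:
 assumes c: "c : S2" "H c = c"
 shows "EX n>=1. EX x k. (l ^^ n) x = x+2*pi * of_int k"
proof (rule ccontr)
 assume "~ ?thesis"
 then have np: "!!n x (k::int). n >= 1 ==> (l ^^ n) x ~= x+2*pi * of_int k" by blast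
 \<comment> \<open>Closure under full turns keeps these sets full preimages of closed, forward
   invariant sets of the circle.\<close>
 define invs where "invs = (%S. closed S & S ~= {} & (ALL x:S. ALL k::int. x+2*pi * of_int k : S) & (ALL x:S. l x : S))"
 define K where "K = {t. F t = c}"
 have "closed K" unfolding K_def using continuous_closed_preimage_constant[of UNIV F c] cont by simp
 have invK: "invs K"
 proof -
  obtain x where "F x = c" using c surj by (metis imageE)
  then have "K ~= {}" by (auto simp: K_def)
  then show ?thesis using \<open>closed K\<close> by (auto simp: invs_def K_def per_int FH c)
 qed
 \<comment> \<open>Zorn's lemma provides maximal elements, so a minimal invariant set is sought
   among complements.\<close>
 have "EX N:{- S |S. invs S & S <= K}. ALL X:{- S |S. invs S & S <= K}. N <= X --> X = N"
 proof (rule subset_Zorn_nonempty)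
  show "{- S |S. invs S & S <= K} ~= {}" using invK by blast
  fix \<C> assume ne: "\<C> ~= {}" and ch: "subset.chain {- S |S. invs S & S <= K} \<C>"
  have mem: "invs (- X)" "- X <= K" if "X : \<C>" for X
   using ch that by (auto simp: subset_chain_def)
  define S where "S = (\<Inter>X\<in>\<C>. - X)"
  have "S ~= {}"
  proof -
   have "(\<Inter>X\<in>\<C>. - X Int {0..2*pi}) ~= {}"
   proof (rule compact_chain)
    show "compact T" if "T : (%X. - X Int {0..2*pi}) ` \<C>" for T
     using that mem by (auto simp: invs_def intro: closed_Int_compact)
    show "{} ~: (%X. - X Int {0..2*pi}) ` \<C>"
    proof
     assume "{} : (%X. - X Int {0..2*pi}) ` \<C>"
     then obtain X where X: "X : \<C>" "- X Int {0..2*pi} = {}" by blast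
     obtain x where x: "x : - X" using mem(1)[OF X(1)] by (auto simp: invs_def)
     obtain k where "0 <= x+2*pi * of_int k" "x+2*pi * of_int k < 0+2*pi" using representative by blast
     then have "x+2*pi * of_int k : {0..2*pi}" by simp
     moreover have "x+2*pi * of_int k : - X" using mem(1)[OF X(1)] x unfolding invs_def by blast
     ultimately show False using X by blast
    qed
    show "T <= T' | T' <= T" if TT: "T : (%X. - X Int {0..2*pi}) ` \<C> & T' : (%X. - X Int {0..2*pi}) ` \<C>" for T T'
    proof -
     obtain X X' where X: "X : \<C>" "X' : \<C>" "T = - X Int {0..2*pi}" "T' = - X' Int {0..2*pi}" using TT by blast
     then have "X <= X' | X' <= X" using ch by (auto simp: subset_chain_def)
     then show ?thesis using X by blast
    qed
   qed
   then show ?thesis using ne by (auto simp: S_def)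
  qed
  moreover have "closed S" unfolding S_def using mem by (intro closed_INT) (auto simp: invs_def)
  moreover have "x+2*pi * of_int k : S" "l x : S" if xS: "x : S" for x k
  proof -
   have "x+2*pi * of_int k : - X & l x : - X" if X: "X : \<C>" for X
   proof -
    have "x : - X" using xS X by (auto simp: S_def)
    then show ?thesis using mem(1)[OF X] unfolding invs_def by blast
   qed
   then show "x+2*pi * of_int k : S" "l x : S" by (auto simp: S_def)
  qed
  ultimately have "invs S" by (simp add: invs_def)
  moreover have "S <= K" using mem ne by (auto simp: S_def)
  moreover have "\<Union>\<C> = - S" by (auto simp: S_def)
  ultimately show "\<Union>\<C> : {- S |S. invs S & S <= K}" by blast
 qed
 then obtain N where N: "N : {- S |S. invs S & S <= K}" and Nmax: "ALL X:{- S |S. invs S & S <= K}. N <= X --> X = N"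
  by (elim bexE)
 from N obtain M where M: "invs M" "M <= K" and NM: "N = - M" by auto
 have min0: "- S = - M" if S: "invs S" "S <= K" "- M <= - S" for S
 proof -
  have "- S : {- S |S. invs S & S <= K}" using S by auto
  with Nmax have "N <= - S --> - S = N" by (rule bspec)
  then show ?thesis using S(3) unfolding NM by (rule mp)
 qed
 have minM: "S = M" if "invs S" "S <= M" for S
  using min0[of S] that M by blast
 have Mcl: "closed M" and Mne: "M ~= {}" and Mper: "!!x (k::int). x : M ==> x+2*pi * of_int k : M" and Ml: "!!x. x : M ==> l x : M"
  using M(1) by (auto simp: invs_def)
 have Mpow: "(l ^^ n) x : M" if "x : M" for n x using that by (induction n) (auto simp: Ml)
 have FM: "F x = c" if "x : M" for x using M that by (auto simp: K_def)
 \<comment> \<open>The closure of an orbit tail, taken with all full turns, is invariant and so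
   equals the minimal set. The lower bound \<open>m\<close> on the exponent keeps later differences
   of exponents positive.\<close>
 have dense: "EX n>=m. EX k::int. \<bar>(l ^^ n) v+2*pi * of_int k - w\<bar> < e"
  if v: "v : M" and w: "w : M" and e: "e > 0" for v w e m
 proof -
  define Or where "Or = {(l ^^ n) v+2*pi * of_int k |n (k::int). n >= m}"
  have Or_l: "l ` Or <= Or"
  proof
   fix y assume "y : l ` Or"
   then obtain n and k :: int where n: "n >= m" "y = l ((l ^^ n) v+2*pi * of_int k)" by (auto simp: Or_def)
   then have "y = (l ^^ (Suc n)) v+2*pi * of_int k" by (simp add: l_per_int)
   moreover have "Suc n >= m" using n(1) by simp
   ultimately show "y : Or" unfolding Or_def by blast
  qed
  have "invs (closure Or)"
   unfolding invs_def
  proof (intro conjI ballI allI)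
   show "closed (closure Or)" by simp
   have "(l ^^ m) v+2*pi * of_int 0 : Or" unfolding Or_def by blast
   then show "closure Or ~= {}" by auto
   fix x assume x: "x : closure Or"
   have "l ` closure Or <= closure Or"
    by (rule image_closure_subset) (use Or_l closure_subset continuous_on_subset[OF l_cont] in \<open>auto\<close>)
   then show "l x : closure Or" using x by blast
   fix k :: int
   have "(%x. x+2*pi * of_int k) ` closure Or <= closure Or"
   proof (rule image_closure_subset)
    show "continuous_on (closure Or) (%x. x+2*pi * of_int k)" by (intro continuous_intros)
    show "(%x. x+2*pi * of_int k) ` Or <= closure Or"
    proof
     fix y assume "y : (%x. x+2*pi * of_int k) ` Or"
     then obtain n and j :: int where n: "n >= m" "y = (l ^^ n) v+2*pi * of_int j+2*pi * of_int k" by (auto simp: Or_def)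
     then have "y = (l ^^ n) v+2*pi * of_int (j + k)" by (simp add: algebra_simps)
     then have "y : Or" using n(1) unfolding Or_def by blast
     then show "y : closure Or" using closure_subset by blast
    qed
   qed simp
   then show "x+2*pi * of_int k : closure Or" using x by blast
  qed
  moreover have "closure Or <= M"
   by (rule closure_minimal) (use Mpow Mper v Mcl in \<open>auto simp: Or_def\<close>)
  ultimately have "closure Or = M" by (rule minM)
  then have "w : closure Or" using w by simp
  then obtain y where "y : Or" "dist y w < e" using e closure_approachable by blast
  then show ?thesis by (auto simp: Or_def dist_real_def)
 qed
 have perfect: "EX y:M. y ~= w & \<bar>y - w\<bar> < e" if w: "w : M" "e > 0" for w e
 proof -
  obtain n and k :: int where nk: "n >= 1" "\<bar>(l ^^ n) w+2*pi * of_int k - w\<bar> < e" using dense[OF w(1) w(1) w(2), of 1] by blast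
  have "(l ^^ n) w ~= w+2*pi * of_int (- k)" using np nk by blast
  then have "(l ^^ n) w+2*pi * of_int k ~= w" by auto
  then show ?thesis using nk Mpow Mper w by blast
 qed
 obtain x0 where x0: "x0 : M" using Mne by blast
 have "M ~= UNIV"
 proof
  assume "M = UNIV"
  then have "F ` {0..1} <= {c}" using FM by blast
  then show False using infinite_im[of 0 1] finite_subset by (metis finite.emptyI finite_insert zero_less_one)
 qed
 then obtain t0 where "t0 ~: M" by blast
 then obtain u v where uv: "u : M" "v : M" "u < t0" "t0 < v" "v <= u+2*pi" "!!x. u < x ==> x < v ==> x ~: M"
  using closed_periodic_gap[OF Mcl x0 Mper] by metis
 have right: "EX y:M. v < y & y < v + e" if e: "e > 0" for e
 proof -
  obtain y where "y : M" "y ~= v" "\<bar>y - v\<bar> < min e (v - u)" using perfect[OF uv(2), of "min e (v - u)"] e uv by auto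
  moreover have "~ y < v" using uv(6)[of y] calculation by auto
  ultimately show ?thesis by (intro bexI[of _ y]) auto
 qed
 have left: "EX y:M. u - e < y & y < u" if e: "e > 0" for e
 proof -
  obtain y where "y : M" "y ~= u" "\<bar>y - u\<bar> < min e (v - u)" using perfect[OF uv(1), of "min e (v - u)"] e uv by auto
  moreover have "~ u < y" using uv(6)[of y] calculation by auto
  ultimately show ?thesis by (intro bexI[of _ y]) auto
 qed
 have vu: "v < u+2*pi"
 proof (rule ccontr)
  assume "~ v < u+2*pi"
  then have e: "v = u+2*pi" using uv by simp
  obtain y where y: "y : M" "v < y" "y < v+(v - u)" using right[of "v - u"] uv by auto
  have "y - 2*pi : M" using Mper[OF y(1), of "-1"] by simp
  then show False using uv(6)[of "y - 2*pi"] y e by auto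
 qed
 \<comment> \<open>A power of \<open>l\<close>, corrected by full turns, that moves all points
   forward but \<open>a\<close> not as far as \<open>b\<close>. Bring \<open>v\<close> to a point
   \<open>y1\<close> between \<open>a\<close> and \<open>b\<close>, take a point \<open>y'\<close>
   of \<open>M\<close> slightly to its right and approximate \<open>y'\<close> by a later iterate of
   \<open>v\<close>. The difference of the exponents moves \<open>y1\<close> forward a little and,
   having no fixed point, moves every point forward.\<close>
 have shiftex: "EX m>=1. EX k::int. (ALL x. x < (l ^^ m) x+2*pi * of_int k) & (l ^^ m) a+2*pi * of_int k < b"
  if w: "w : M" "a < w" "w < b" for a b w
 proof -
  obtain n1 and k1 :: int where n1: "\<bar>(l ^^ n1) v+2*pi * of_int k1 - w\<bar> < min (w - a) (b - w)"
   using dense[OF uv(2) w(1), of "min (w - a) (b - w)" 0] w by auto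
  define y1 where "y1 = (l ^^ n1) v+2*pi * of_int k1"
  have y1: "a < y1" "y1 < b" using n1 by (auto simp: y1_def)
  have "continuous_on UNIV (%x. (l ^^ n1) x+2*pi * of_int k1)" by (intro continuous_intros pow_cont)
  then have "isCont (%x. (l ^^ n1) x+2*pi * of_int k1) v" by (simp add: continuous_on_eq_continuous_at)
  then have "ALL \<epsilon>>0. EX \<delta>>0. ALL x'. norm (x' - v) < \<delta> --> \<bar>(l ^^ n1) x'+2*pi * of_int k1 - y1\<bar> < \<epsilon>"
   unfolding continuous_at_real_range y1_def[symmetric] .
  moreover have "b - y1 > 0" using y1 by simp
  ultimately obtain d where d: "d > 0" "ALL x. norm (x - v) < d --> \<bar>(l ^^ n1) x+2*pi * of_int k1 - y1\<bar> < b - y1"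
   by blast
  obtain y where y: "y : M" "v < y" "y < v + d" using right[OF d(1)] by blast
  define y' where "y' = (l ^^ n1) y+2*pi * of_int k1"
  have y': "y1 < y'" "y' < b" "y' : M"
   using d(2)[rule_format, of y] y pow_mono[of n1] Mper Mpow by (auto simp: y'_def y1_def strict_mono_def)
  obtain n2 and k2 :: int where n2: "n2 >= n1+1" "\<bar>(l ^^ n2) v+2*pi * of_int k2 - y'\<bar> < min (y' - y1) (b - y')"
   using dense[OF uv(2) y'(3), of "min (y' - y1) (b - y')" "n1+1"] y' by auto
  define m where "m = n2 - n1"
  define k where "k = k2 - k1"
  have T: "(l ^^ m) y1+2*pi * of_int k = (l ^^ n2) v+2*pi * of_int k2"
  proof -
   have "(l ^^ m) ((l ^^ n1) v) = (l ^^ n2) v" using n2 by (simp add: m_def funpow_add[symmetric, THEN fun_cong, unfolded o_def])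
   then show ?thesis unfolding y1_def pow_per_int by (simp add: k_def algebra_simps)
  qed
  have m1: "m >= 1" using n2 by (simp add: m_def)
  have nofix: "(l ^^ m) x+2*pi * of_int k ~= x" for x
   using np[OF m1, of x "- k"] by auto
  have pos: "x < (l ^^ m) x+2*pi * of_int k" for x
   by (rule no_fixed_sign[of m k y1]) (use nofix T n2 in auto)
  have "(l ^^ m) a < (l ^^ m) y1" using pow_mono[of m] y1 by (simp add: strict_mono_def)
  then have "(l ^^ m) a+2*pi * of_int k < b" using T n2 by auto
  then show ?thesis using m1 pos by blast
 qed
 have dD: "closed_disk (F ` {u..v})" using disk uv vu by simp
 \<comment> \<open>A boundary point of the disk over the gap from \<open>u\<close> to
   \<open>v\<close> has a second lift \<open>s'\<close> beyond it, which lies in another gap from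
   \<open>u'\<close> to \<open>v'\<close>. These two gaps are to be linked with their own
   images.\<close>
 obtain z where z: "z : bdry (F ` {u..v})" "z ~= c"
  using closed_disk_interior_facts(5)[OF dD] by (metis finite.emptyI finite_insert finite_subset insertCI subsetI)
 then have "z : F ` {u..v}" "z : F ` {v..u+2*pi}" using bdry_eq[of u v] uv vu by auto
 then obtain s s' where s: "u <= s" "s <= v" "z = F s" and s': "v <= s'" "s' <= u+2*pi" "z = F s'" by auto
 have Fc: "F u = c" "F v = c" "F (u+2*pi) = c" using FM uv per by auto
 have s1: "u < s" "s < v" using s z Fc by (auto simp: less_le)
 have s'1: "v < s'" "s' < u+2*pi" using s' z Fc by (auto simp: less_le)
 have "s' ~: M" using FM s' z by auto
 then obtain u' v' where uv': "u' : M" "v' : M" "u' < s'" "s' < v'" "!!x. u' < x ==> x < v' ==> x ~: M"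
  using closed_periodic_gap[OF Mcl x0 Mper] by metis
 have u2M: "u+2*pi : M" using Mper[OF uv(1), of 1] by simp
 have o1: "v < u'"
 proof (rule ccontr)
  assume n: "~ v < u'"
  obtain y where y: "y : M" "v < y" "y < v+(s' - v)" using right[of "s' - v"] s'1 by auto
  then show False using uv'(5)[of y] n uv'(4) by auto
 qed
 have o2: "v' < u+2*pi"
 proof (rule ccontr)
  assume n: "~ v' < u+2*pi"
  obtain y where y: "y : M" "u - (u+2*pi - s') < y" "y < u" using left[of "u+2*pi - s'"] s'1 by auto
  have "y+2*pi : M" using Mper[OF y(1), of 1] by simp
  then show False using uv'(5)[of "y+2*pi"] n uv'(3) y by auto
 qed
 obtain y where y: "y : M" "v < y" "y < v+(u' - v)" using right[of "u' - v"] o1 by auto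
 obtain m1 and k1 :: int where T1: "m1 >= 1" "!!x. x < (l ^^ m1) x+2*pi * of_int k1" "(l ^^ m1) v+2*pi * of_int k1 < u'"
  using shiftex[of y v u'] y by auto
 obtain y2 where y2: "y2 : M" "u - (u+2*pi - v') < y2" "y2 < u" using left[of "u+2*pi - v'"] o2 by auto
 have "y2+2*pi : M" using Mper[OF y2(1), of 1] by simp
 then obtain m2 and k2 :: int where T2: "m2 >= 1" "!!x. x < (l ^^ m2) x+2*pi * of_int k2" "(l ^^ m2) v'+2*pi * of_int k2 < u+2*pi"
  using shiftex[of "y2+2*pi" v' "u+2*pi"] y2 by auto
 \<comment> \<open>One shift has to work for both gaps. If neither candidate does, the two agree
   somewhere between \<open>v\<close> and \<open>v'\<close>. Different exponents then give a
   periodic point; equal ones make the difference constant, so it cannot change sign.\<close>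
 have "EX m>=1. EX k::int. (ALL x. x < (l ^^ m) x+2*pi * of_int k) & (l ^^ m) v+2*pi * of_int k < u' & (l ^^ m) v'+2*pi * of_int k < u+2*pi"
 proof (rule ccontr)
  assume n: "~ ?thesis"
  define d where "d = (%x. ((l ^^ m1) x+2*pi * of_int k1) - ((l ^^ m2) x+2*pi * of_int k2))"
  have cd: "continuous_on S d" for S unfolding d_def by (intro continuous_intros continuous_on_subset[OF pow_cont]) auto
  have "~ (l ^^ m1) v'+2*pi * of_int k1 < u+2*pi" "~ (l ^^ m2) v+2*pi * of_int k2 < u'"
   using n T1 T2 by blast+
  then have dd: "d v < 0" "0 < d v'" using T1 T2 by (auto simp: d_def)
  have "v <= v'" using o1 uv' by simp
  then obtain w where w: "d w = 0" using IVT'[of d v 0 v'] dd cd by (metis less_imp_le)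
  then have e: "(l ^^ m1) w+2*pi * of_int k1 = (l ^^ m2) w+2*pi * of_int k2" by (simp add: d_def)
  have aux: False if "m < m'" "(l ^^ m') w = (l ^^ m) w+2*pi * of_int k" for m m' and k :: int
  proof -
   have "(l ^^ m') w = (l ^^ (m' - m)) ((l ^^ m) w)" using that by (simp add: funpow_add[symmetric, THEN fun_cong, unfolded o_def])
   moreover have "m' - m >= 1" using that by simp
   ultimately show False using np[of "m' - m" "(l ^^ m) w" k] that by simp
  qed
  consider "m1 < m2" | "m2 < m1" | "m1 = m2" by linarith
  then show False
  proof cases
   case 1 then show False using aux[of m1 m2 "k1 - k2"] e by (simp add: algebra_simps)
  next
   case 2 then show False using aux[of m2 m1 "k2 - k1"] e by (simp add: algebra_simps)
  next
   case 3 then show False using dd by (simp add: d_def)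
  qed
 qed
 then obtain m and k :: int where m: "m >= 1" and Tx: "!!x. x < (l ^^ m) x+2*pi * of_int k"
  and Tv: "(l ^^ m) v+2*pi * of_int k < u'" and Tv': "(l ^^ m) v'+2*pi * of_int k < u+2*pi" by blast
 define T where "T = (%x. (l ^^ m) x+2*pi * of_int k)"
 have Tmono: "T x < T y" if "x < y" for x y using that pow_mono[of m] by (simp add: T_def strict_mono_def)
 have TM: "T x : M" if "x : M" for x using Mpow Mper that by (simp add: T_def)
 have FT: "F (T x) = (H ^^ m) (F x)" for x by (simp add: T_def per_int pow_FH)
 have Tu: "v <= T u" using uv(6)[of "T u"] TM[OF uv(1)] Tx[of u] by (fastforce simp: T_def)
 have Tu': "v' <= T u'" using uv'(5)[of "T u'"] TM[OF uv'(1)] Tx[of u'] by (fastforce simp: T_def)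
 define w where "w = (H ^^ m) z"
 have wpow: "(H ^^ i) z ~= c" for i
 proof (induction i)
  case (Suc i)
  have "(H ^^ i) z : S2" using pow_in s F_in by simp
  then show ?case using Suc H_inj[of "(H ^^ i) z" c] c by auto
 qed (use z in simp)
 \<comment> \<open>The shift carries the first gap into \<open>{v..u'}\<close> and the second into
   \<open>{v'..u+2*pi}\<close>, so the lifts of \<open>w\<close> cross those of
   \<open>z\<close>.\<close>
 have "z = w"
 proof (rule unlinked[of u v u' v' c])
  show "z : F ` {u..v}" by (rule image_eqI[of z F s]) (use s in auto)
  show "z : F ` {u'..v'}" by (rule image_eqI[of z F s']) (use s'(3) uv' in auto)
  have "T s : {v..u'}" using Tmono[OF s1(1)] Tmono[OF s1(2)] Tu Tv by (simp add: T_def)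
  moreover have "w = F (T s)" by (simp add: FT w_def s)
  ultimately show "w : F ` {v..u'}" by blast
  have "T s' : {v'..u+2*pi}" using Tmono[OF uv'(3)] Tmono[OF uv'(4)] Tu' Tv' by (simp add: T_def)
  moreover have "w = F (T s')" using s' by (simp add: FT w_def)
  ultimately show "w : F ` {v'..u+2*pi}" by blast
  show "w ~= c" using wpow by (simp add: w_def)
 qed (use uv uv' o1 o2 FM z in auto)
 then have Hm: "(H ^^ m) z = z" by (simp add: w_def)
 \<comment> \<open>Now \<open>z\<close> is periodic under \<open>H\<close>, so the parameters over
   its orbit form a closed set invariant in both directions; it avoids \<open>u\<close> because the
   orbit avoids \<open>c\<close>.\<close>
 define Y where "Y = (\<Union>i<m. {t. F t = (H ^^ i) z})"
 have memY: "x : Y \<longleftrightarrow> (EX i<m. F x = (H ^^ i) z)" for x by (auto simp: Y_def)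
 have Ycl: "closed Y" unfolding Y_def
  using continuous_closed_preimage_constant[of UNIV F] cont by (intro closed_UN) auto
 have Yper: "x+2*pi * of_int j : Y" if "x : Y" for x and j :: int using that by (auto simp: Y_def per_int)
 have Yl: "l x : Y" if xY: "x : Y" for x
 proof -
  obtain i where i: "i < m" "F x = (H ^^ i) z" using xY unfolding memY by blast
  then have e: "F (l x) = (H ^^ (Suc i)) z" by (simp add: FH)
  show ?thesis
  proof (cases "Suc i < m")
   case True then show ?thesis using e unfolding memY by blast
  next
   case False
   then have "Suc i = m" using i by simp
   then have "F (l x) = (H ^^ 0) z" using e Hm by simp
   then show ?thesis unfolding memY using m by (intro exI[of _ 0]) auto
  qed
 qed
 have Yl': "x : Y" if xY: "l x : Y" for x
 proof -
  obtain i where i: "i < m" "H (F x) = (H ^^ i) z" using xY unfolding memY FH by blast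
  have zS: "(H ^^ j) z : S2" for j using pow_in s F_in by simp
  show ?thesis
  proof (cases i)
   case 0
   then have "H (F x) = H ((H ^^ (m - 1)) z)" using i Hm m by (metis One_nat_def Suc_pred' funpow.simps(2) funpow_0 less_eq_Suc_le o_apply)
   then have "F x = (H ^^ (m - 1)) z" using H_inj F_in zS by blast
   then show ?thesis unfolding memY using m by (intro exI[of _ "m - 1"]) auto
  next
   case (Suc j)
   then have "H (F x) = H ((H ^^ j) z)" using i by simp
   then have "F x = (H ^^ j) z" using H_inj F_in zS by blast
   then show ?thesis unfolding memY using i Suc by (intro exI[of _ j]) auto
  qed
 qed
 have sY: "s : Y" unfolding memY using m s by (intro exI[of _ 0]) auto
 have "u ~: Y" unfolding memY using Fc(1) wpow by metis
 then obtain af \<beta> where ab: "af : Y" "\<beta> : Y" "af < u" "u < \<beta>" "!!x. af < x ==> x < \<beta> ==> x ~: Y"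
  using closed_periodic_gap[OF Ycl sY Yper] by metis
 \<comment> \<open>Recurrence returns \<open>u\<close> to its own gap of \<open>Y\<close>. An
   increasing map that preserves \<open>Y\<close> and does so fixes the left end \<open>af\<close>
   of this gap, a periodic point after all.\<close>
 obtain n and j :: int where n: "n >= 1" "\<bar>(l ^^ n) u+2*pi * of_int j - u\<bar> < min (u - af) (\<beta> - u)"
  using dense[OF uv(1) uv(1), of "min (u - af) (\<beta> - u)" 1] ab by auto
 define \<phi> where "\<phi> = (%x. (l ^^ n) x+2*pi * of_int j)"
 have ph: "af < \<phi> u" "\<phi> u < \<beta>" using n by (auto simp: \<phi>_def)
 have phl: "\<phi> x < \<phi> y \<longleftrightarrow> x < y" for x y using pow_mono[of n] by (simp add: \<phi>_def strict_mono_less)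
 have Yiff: "l x : Y \<longleftrightarrow> x : Y" for x using Yl Yl' by blast
 have powY: "(l ^^ i) x : Y \<longleftrightarrow> x : Y" for i x by (induction i) (simp_all add: Yiff)
 have phY: "\<phi> x : Y \<longleftrightarrow> x : Y" for x
  using powY[of n x] Yper[of "(l ^^ n) x" j] Yper[of "\<phi> x" "- j"] by (auto simp: \<phi>_def)
 have "\<phi> af < \<phi> u" using phl ab by simp
 then have le: "\<phi> af <= af" using ab(5)[of "\<phi> af"] phY[of af] ab(1) ph by fastforce
 have "\<phi> af = af"
 proof (rule ccontr)
  assume "\<phi> af ~= af"
  then have lt: "\<phi> af < af" using le by simp
  have "continuous_on {af..u} \<phi>" unfolding \<phi>_def by (intro continuous_intros continuous_on_subset[OF pow_cont]) auto
  then obtain y where y: "af <= y" "y <= u" "\<phi> y = af" using IVT'[of \<phi> af af u] lt ph ab by auto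
  then have "y : Y" using phY[of y] ab by simp
  moreover have "y ~= af" using y lt by auto
  ultimately show False using ab(5)[of y] y ab by auto
 qed
 then show False using np[OF n(1), of af "- j"] by (simp add: \<phi>_def)
qed

end

subsection \<open>Attracting fixed points\<close>

text \<open>The orbit increases below \<open>v\<close>; its limit is a fixed point, and
  \<open>up\<close> leaves only \<open>v\<close>.\<close>

lemma iterate_tendsto_up:
 fixes l :: "real => real"
 assumes c: "continuous_on UNIV l" and m: "strict_mono l" and v: "l v = v" and t: "t < v" and up: "!!x. t <= x ==> x < v ==> x < l x"
 shows "(%n. (l ^^ n) t) \<longlonglongrightarrow> v"
proof -
 have r: "t <= (l ^^ n) t & (l ^^ n) t < v" for n
 proof (induction n)
  case (Suc n)
  have "l ((l ^^ n) t) < l v" using Suc m by (simp add: strict_mono_less)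
  moreover have "(l ^^ n) t < l ((l ^^ n) t)" using up Suc by simp
  ultimately show ?case using Suc v by auto
 qed (use t in simp)
 have inc: "incseq (%n. (l ^^ n) t)" by (rule incseq_SucI) (use up r in \<open>auto intro: less_imp_le\<close>)
 obtain L where L: "(%n. (l ^^ n) t) \<longlonglongrightarrow> L" "ALL n. (l ^^ n) t <= L"
  using incseq_convergent[OF inc, of v] r by (auto intro: less_imp_le)
 have Lv: "L <= v" using L(1) r by (intro LIMSEQ_le_const2[OF L(1)]) (auto intro: less_imp_le)
 have tL: "t <= L" using L(2) by (metis funpow_0)
 have "isCont l L" using c by (simp add: continuous_on_eq_continuous_at)
 then have "(%n. l ((l ^^ n) t)) \<longlonglongrightarrow> l L" using L(1) by (rule isCont_tendsto_compose)
 moreover have "(%n. l ((l ^^ n) t)) \<longlonglongrightarrow> L" using LIMSEQ_Suc[OF L(1)] by simp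
 ultimately have "l L = L" using LIMSEQ_unique by blast
 then have "L = v" using up[of L] tL Lv by fastforce
 then show ?thesis using L by simp
qed

lemma iterate_tendsto_down:
 fixes l :: "real => real"
 assumes c: "continuous_on UNIV l" and m: "strict_mono l" and v: "l v = v" and t: "v < t" and dn: "!!x. v < x ==> x <= t ==> l x < x"
 shows "(%n. (l ^^ n) t) \<longlonglongrightarrow> v"
proof -
 define k where "k = (%x. - l (- x))"
 have "(%n. (k ^^ n) (- t)) \<longlonglongrightarrow> - v"
 proof (rule iterate_tendsto_up)
  show "continuous_on UNIV k" unfolding k_def by (intro continuous_intros continuous_on_compose2[OF c]) auto
  show "strict_mono k" using m by (auto simp: k_def strict_mono_def)
  show "x < k x" if "- t <= x" "x < - v" for x using dn[of "- x"] that by (simp add: k_def)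
 qed (use v t in \<open>auto simp: k_def\<close>)
 moreover have "(k ^^ n) (- t) = - (l ^^ n) t" for n by (induction n) (auto simp: k_def)
 ultimately have "(%n. - (l ^^ n) t) \<longlonglongrightarrow> - v" by simp
 from tendsto_minus[OF this] show ?thesis by simp
qed

text \<open>Circle points near \<open>cis x\<close> avoid the compact complementary arc
  \<open>S\<close>, so they have a lift near \<open>x\<close>. The cap \<open>pi\<close> on
  \<open>e\<close> keeps this arc nonempty.\<close>

lemma cis_local_inverse:
 assumes "0 < \<delta>"
 obtains d where "d > 0" "!!z. z : S1 ==> dist z (cis x) < d ==> EX s. z = cis s & \<bar>s - x\<bar> < \<delta>"
proof -
 define e where "e = min \<delta> pi"
 have e: "0 < e" "e <= \<delta>" "e <= pi" using assms pi_gt_zero by (auto simp: e_def)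
 define S where "S = cis ` {x + e..x+2*pi - e}"
 have "compact S" unfolding S_def by (intro compact_continuous_image continuous_intros) auto
 then have "open (- S)" using compact_imp_closed by blast
 moreover have "cis x ~: S"
 proof
  assume "cis x : S"
  then obtain y where y: "cis x = cis y" "x + e <= y" "y <= x+2*pi - e" by (auto simp: S_def)
  then have "x = y" using cis_eq_near[of x y] e by auto
  then show False using y e by auto
 qed
 ultimately obtain d where d: "d > 0" "ball (cis x) d <= - S" using openE[of "- S" "cis x"] by auto
 have "EX s. z = cis s & \<bar>s - x\<bar> < \<delta>" if z: "z : S1" "dist z (cis x) < d" for z
 proof -
  have zS: "z ~: S" using d z by (auto simp: dist_commute)
  obtain t where t: "z = cis t" using z S1_iff_cis by auto
  define k where "k = - \<lfloor>(t - (x - e)) / (2*pi)\<rfloor>"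
  define s where "s = t+2*pi * of_int k"
  have "- of_int k * (2*pi) <= t - (x - e)" "t - (x - e) < (- of_int k+1) * (2*pi)"
   using floor_divide_lower[of "2*pi" "t - (x - e)"] floor_divide_upper[of "2*pi" "t - (x - e)"] by (simp_all add: k_def)
  then have s: "x - e <= s" "s < x - e+2*pi" by (simp_all add: s_def algebra_simps)
  have zs: "z = cis s" using t cis_eq_iff[of s t] by (auto simp: s_def)
  have "s < x + e" using zS zs s by (force simp: S_def)
  moreover have "s ~= x - e"
  proof
   assume "s = x - e"
   moreover have "x - e+2*pi = x+2*pi - e" by simp
   ultimately have "z = cis (x+2*pi - e)" using zs cis_periodic[of "x - e"] by metis
   then show False using zS e by (auto simp: S_def)
  qed
  ultimately show ?thesis using zs s e by (intro exI[of _ s]) auto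
 qed
 then show thesis using that d by blast
qed

lemma dist_cis_le: "dist (cis s) (cis t) <= \<bar>s - t\<bar>"
proof -
 have "dist (cis s) (cis t) = norm (cis t * (cis (s - t) - 1))" by (simp add: dist_norm cis_mult algebra_simps)
 also have "\<dots> = norm (exp (\<i> * of_real (s - t)) - 1)" by (simp add: norm_mult cis_conv_exp)
 also have "\<dots> = 2 * \<bar>sin ((s - t) / 2)\<bar>" by (rule dist_exp_i_1)
 also have "\<dots> <= 2 * \<bar>(s - t) / 2\<bar>" using abs_sin_x_le_abs_x[of "(s - t) / 2"] by simp
 finally show ?thesis by simp
qed

lemma contracting_iterates:
 fixes l :: "real => real"
 assumes c: "continuous_on UNIV l" and m: "strict_mono l" and x: "l x = x"
  and con: "!!y. 0 < \<bar>y - x\<bar> ==> \<bar>y - x\<bar> < \<epsilon> ==> \<bar>l y - x\<bar> < \<bar>y - x\<bar>" and y: "\<bar>y - x\<bar> < \<epsilon>"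
 shows "\<bar>(l ^^ k) y - x\<bar> <= \<bar>y - x\<bar>" "(%n. (l ^^ n) y) \<longlonglongrightarrow> x"
proof -
 show "\<bar>(l ^^ k) y - x\<bar> <= \<bar>y - x\<bar>"
 proof (induction k)
  case (Suc k)
  then show ?case using con[of "(l ^^ k) y"] y x by (cases "(l ^^ k) y = x") auto
 qed simp
 consider "y < x" | "y = x" | "x < y" by linarith
 then show "(%n. (l ^^ n) y) \<longlonglongrightarrow> x"
 proof cases
  case 1
  show ?thesis
  proof (rule iterate_tendsto_up[OF c m x 1])
   fix z assume z: "y <= z" "z < x"
   have "l z < x" using strict_monoD[OF m z(2)] x by simp
   then show "z < l z" using con[of z] z y by auto
  qed
 next
  case 2
  have "(l ^^ n) x = x" for n by (induction n) (auto simp: x)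
  then show ?thesis using 2 by simp
 next
  case 3
  show ?thesis
  proof (rule iterate_tendsto_down[OF c m x 3])
   fix z assume z: "x < z" "z <= y"
   have "x < l z" using strict_monoD[OF m z(1)] x by simp
   then show "l z < z" using con[of z] z y by auto
  qed
 qed
qed

lemma attracting_S1_lift:
 assumes c: "continuous_on UNIV l" and m: "strict_mono l" and x: "l x = x" and q: "!!t. q (cis t) = cis (l t)"
  and e: "\<epsilon> > 0" and con: "!!y. 0 < \<bar>y - x\<bar> ==> \<bar>y - x\<bar> < \<epsilon> ==> \<bar>l y - x\<bar> < \<bar>y - x\<bar>"
 shows "attracting S1 q (cis x)"
 unfolding attracting_def
proof (intro conjI allI impI)
 have qk: "(q ^^ k) (cis t) = cis ((l ^^ k) t)" for k t by (induction k) (auto simp: q)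
 show "cis x : S1" "q (cis x) = cis x" by (simp_all add: q x)
 show "EX d>0. ALL y:S1. dist y (cis x) < d --> (ALL k. dist ((q ^^ k) y) (cis x) < e')" if e': "e' > 0" for e'
 proof -
  obtain d where d: "d > 0" "!!z. z : S1 ==> dist z (cis x) < d ==> EX s. z = cis s & \<bar>s - x\<bar> < min \<epsilon> e'"
   using cis_local_inverse[of "min \<epsilon> e'" x] e e' by auto
  have "dist ((q ^^ k) y) (cis x) < e'" if y: "y : S1" "dist y (cis x) < d" for y k
  proof -
   obtain s where s: "y = cis s" "\<bar>s - x\<bar> < min \<epsilon> e'" using d(2)[OF y] by blast
   have "\<bar>(l ^^ k) s - x\<bar> <= \<bar>s - x\<bar>"
    by (rule contracting_iterates(1)[OF c m x con]) (use s in auto)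
   then show ?thesis using dist_cis_le[of "(l ^^ k) s" x] s qk by simp
  qed
  then show ?thesis using d(1) by blast
 qed
 obtain d where d: "d > 0" "!!z. z : S1 ==> dist z (cis x) < d ==> EX s. z = cis s & \<bar>s - x\<bar> < \<epsilon>"
  using cis_local_inverse[OF e, of x] by metis
 have "(%k. (q ^^ k) y) \<longlonglongrightarrow> cis x" if y: "y : S1" "dist y (cis x) < d" for y
 proof -
  obtain s where s: "y = cis s" "\<bar>s - x\<bar> < \<epsilon>" using d(2)[OF y] by blast
  have "(%n. (l ^^ n) s) \<longlonglongrightarrow> x"
   by (rule contracting_iterates(2)[OF c m x con]) (use s in auto)
  then show ?thesis unfolding s qk by (intro tendsto_intros)
 qed
 then show "EX d>0. ALL y:S1. dist y (cis x) < d --> (%k. (q ^^ k) y) \<longlonglongrightarrow> cis x" using d(1) by blast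
qed

text \<open>Write the exponent as \<open>k mod n + n * (k div n)\<close>: the second part is a power
  of \<open>H ^^ n\<close>, the first is one of finitely many iterates that are continuous at the
  fixed point.\<close>

lemma attracting_power:
 fixes H :: "'a::metric_space => 'a"
 assumes A: "attracting X (H ^^ n) x" and n: "n >= 1" and c: "continuous_on X H" and im: "H ` X <= X" and fx: "H x = x"
 shows "attracting X H x"
proof -
 have xX: "x : X" using A by (simp add: attracting_def)
 have pin: "(H ^^ i) y : X" if "y : X" for i y using that im by (induction i) auto
 have pc: "continuous_on X (H ^^ i)" for i
 proof (induction i)
  case 0 then show ?case by (simp add: id_def)
 next
  case (Suc i)
  have "continuous_on X (%y. H ((H ^^ i) y))" by (rule continuous_on_compose2[OF c Suc]) (use pin in auto)
  then show ?case by (simp add: o_def)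
 qed
 have px: "(H ^^ i) x = x" for i by (induction i) (auto simp: fx)
 have small: "EX d>0. ALL i<n. ALL y:X. dist y x < d --> dist ((H ^^ i) y) x < e" if "e > 0" for e
 proof -
  have "EX d>0. ALL y:X. dist y x < d --> dist ((H ^^ i) y) x < e" for i
   using pc[of i] xX \<open>e > 0\<close> px[of i] unfolding continuous_on_iff by metis
  then obtain d where d: "!!i. d i > 0" "!!i y. y : X ==> dist y x < d i ==> dist ((H ^^ i) y) x < e" by metis
  define D where "D = Min (d ` {..<n})"
  have "{..<n} ~= {}" using n by (auto simp: lessThan_empty_iff)
  then have "D > 0" unfolding D_def using d by (subst Min_gr_iff) auto
  moreover have "D <= d i" if "i < n" for i unfolding D_def using that by (intro Min_le) auto
  ultimately show ?thesis using d(2) by (intro exI[of _ D]) (meson order_less_le_trans)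
 qed
 have split: "(H ^^ k) y = (H ^^ (k mod n)) (((H ^^ n) ^^ (k div n)) y)" for k y
 proof -
  have "H ^^ k = H ^^ (k mod n + n * (k div n))" by simp
  also have "\<dots> = H ^^ (k mod n) \<circ> H ^^ (n * (k div n))" by (rule funpow_add)
  also have "H ^^ (n * (k div n)) = (H ^^ n) ^^ (k div n)" by (simp only: funpow_mult)
  finally have "H ^^ k = H ^^ (k mod n) \<circ> (H ^^ n) ^^ (k div n)" .
  from fun_cong[OF this, of y] show ?thesis by (simp only: o_apply)
 qed
 show ?thesis unfolding attracting_def
 proof (intro conjI allI impI xX fx)
  fix e :: real assume "e > 0"
  then obtain d1 where d1: "d1 > 0" "!!i y. i < n ==> y : X ==> dist y x < d1 ==> dist ((H ^^ i) y) x < e" using small by meson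
  obtain d where d: "d > 0" "ALL y:X. dist y x < d --> (ALL k. dist (((H ^^ n) ^^ k) y) x < d1)"
   using A d1(1) unfolding attracting_def by blast
  have pinn: "((H ^^ n) ^^ k) y : X" if "y : X" for k y using that pin by (induction k) auto
  have "dist ((H ^^ k) y) x < e" if y: "y : X" "dist y x < d" for y k
   by (subst split, rule d1(2)) (use d(2) y pinn n in auto)
  then show "EX d>0. ALL y:X. dist y x < d --> (ALL k. dist ((H ^^ k) y) x < e)" using d(1) by blast
 next
  obtain d0 where d0: "d0 > 0" "ALL y:X. dist y x < d0 --> (%k. ((H ^^ n) ^^ k) y) \<longlonglongrightarrow> x"
   using A unfolding attracting_def by blast
  have pinn: "((H ^^ n) ^^ k) y : X" if "y : X" for k y using that pin by (induction k) auto
  have "(%k. (H ^^ k) y) \<longlonglongrightarrow> x" if y: "y : X" "dist y x < d0" for y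
  proof (rule metric_LIMSEQ_I)
   fix e :: real assume "e > 0"
   then obtain d1 where d1: "d1 > 0" "!!i y. i < n ==> y : X ==> dist y x < d1 ==> dist ((H ^^ i) y) x < e" using small by meson
   obtain N where N: "!!k. k >= N ==> dist (((H ^^ n) ^^ k) y) x < d1"
    using d0(2) y d1(1) metric_LIMSEQ_D by blast
   have "dist ((H ^^ k) y) x < e" if "k >= N * n" for k
   proof -
    have "k div n >= N" using that n by (simp add: less_eq_div_iff_mult_less_eq)
    then show ?thesis by (subst split, intro d1(2)) (use N pinn y n in auto)
   qed
   then show "EX no. ALL k>=no. dist ((H ^^ k) y) x < e" by blast
  qed
  then show "EX d>0. ALL y:X. dist y x < d --> (%k. (H ^^ k) y) \<longlonglongrightarrow> x" using d0(1) by blast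
 qed
qed

text \<open>Push a nearby \<open>y\<close> forward until it is very close to \<open>x\<close>;
  stability of the inverse keeps the whole way back nearer to \<open>x\<close> than \<open>y\<close>
  is, yet this way ends at \<open>y\<close>.\<close>

lemma attracting_not_repelling:
 fixes g :: "'a::metric_space => 'a"
 assumes A: "attracting X g x" and R: "repelling X g x" and inj: "inj_on g X" and im: "g ` X <= X"
  and acc: "!!d. d > 0 ==> EX y:X. y ~= x & dist y x < d"
 shows False
proof -
 obtain d where d: "d > 0" "ALL y:X. dist y x < d --> (%k. (g ^^ k) y) \<longlonglongrightarrow> x"
  using A unfolding attracting_def by blast
 obtain y where y: "y : X" "y ~= x" "dist y x < d" using acc[OF d(1)] by blast
 have "dist y x > 0" using y by simp
 then obtain d' where d': "d' > 0" "ALL z:X. dist z x < d' --> (ALL k. dist ((inv_into X g ^^ k) z) x < dist y x)"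
  using R unfolding repelling_def attracting_def by blast
 have "(%k. (g ^^ k) y) \<longlonglongrightarrow> x" using d y by blast
 then obtain k where k: "dist ((g ^^ k) y) x < d'" using d'(1) by (meson metric_LIMSEQ_D order_refl)
 have pin: "(g ^^ i) y : X" for i using y im by (induction i) auto
 have "(inv_into X g ^^ i) ((g ^^ i) y) = y" for i
 proof (induction i)
  case (Suc i)
  have "(inv_into X g ^^ Suc i) ((g ^^ Suc i) y) = (inv_into X g ^^ i) (inv_into X g (g ((g ^^ i) y)))"
   by (simp add: funpow_swap1)
  then show ?case using Suc inv_into_f_f[OF inj pin] by simp
 qed simp
 then have "dist y x < dist y x" using d'(2) pin k by metis
 then show False by simp
qed

section \<open>Transferring contraction from the line to the sphere\<close>

context wheel
begin

lemma F_uniform: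
 assumes "e > 0" obtains d where "d > 0" "!!s t. \<bar>s - t\<bar> < d ==> dist (F s) (F t) < e"
proof -
 have "uniformly_continuous_on {-1..2*pi+1} F"
  by (intro compact_uniformly_continuous cont_on) simp
 then obtain d where d: "d > 0" "!!s t. s : {-1..2*pi+1} ==> t : {-1..2*pi+1} ==> dist s t < d ==> dist (F s) (F t) < e"
  using assms unfolding uniformly_continuous_on_def by metis
 have "dist (F s) (F t) < e" if "\<bar>s - t\<bar> < min d 1" for s t
 proof -
  obtain k where k: "0 <= s+2*pi * of_int k" "s+2*pi * of_int k < 0+2*pi" using representative by blast
  have "dist (F (s+2*pi * of_int k)) (F (t+2*pi * of_int k)) < e"
   by (rule d(2)) (use k that in \<open>auto simp: dist_real_def\<close>)
  then show ?thesis by (simp add: per_int)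
 qed
 then show thesis using that[of "min d 1"] d(1) by auto
qed

text \<open>By compactness a point of the sphere near \<open>a\<close> has a lift near some
  parameter over \<open>a\<close>. Since it is not known which one, the radius
  \<open>\<epsilon>\<close> of contraction is uniform over the fibre.\<close>

lemma attracting_S2_lift:
 assumes c: "continuous_on UNIV l" and m: "strict_mono l" and q: "!!t. q (F t) = F (l t)" and a: "a : S2"
  and e: "\<epsilon> > 0" and fx: "!!x. F x = a ==> l x = x"
  and con: "!!x y. F x = a ==> 0 < \<bar>y - x\<bar> ==> \<bar>y - x\<bar> < \<epsilon> ==> \<bar>l y - x\<bar> < \<bar>y - x\<bar>"
 shows "attracting S2 q a"
proof -
 have qk: "(q ^^ k) (F t) = F ((l ^^ k) t)" for k t by (induction k) (auto simp: q)
 obtain x0 where x0: "F x0 = a" using a surj by (metis imageE)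
 have near: "EX d>0. ALL y:S2. dist y a < d --> (EX t x. y = F t & F x = a & \<bar>t - x\<bar> < \<delta>)" if "\<delta> > 0" for \<delta>
 proof -
  define Y where "Y = {0..2*pi} - (\<Union>x\<in>{x. F x = a}. ball x \<delta>)"
  have "compact Y" unfolding Y_def by (intro compact_diff open_UN) auto
  then have "compact (F ` Y)" by (intro compact_continuous_image cont_on)
  then have "open (- (F ` Y))" using compact_imp_closed by blast
  moreover have "a ~: F ` Y" using that by (auto simp: Y_def)
  ultimately obtain d where d: "d > 0" "ball a d <= - (F ` Y)" using openE[of "- (F ` Y)" a] by auto
  have "EX t x. y = F t & F x = a & \<bar>t - x\<bar> < \<delta>" if y: "y : S2" "dist y a < d" for y
  proof -
   have "y : F ` {0..0+2*pi}" using y full_image[of 0] by blast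
   then obtain t where t: "t : {0..2*pi}" "y = F t" by auto
   moreover have "t ~: Y" using d y t by (auto simp: dist_commute)
   ultimately obtain x where "F x = a" "t : ball x \<delta>" by (auto simp: Y_def)
   then show ?thesis using t by (auto simp: dist_real_def abs_minus_commute)
  qed
  then show ?thesis using d(1) by blast
 qed
 show ?thesis unfolding attracting_def
 proof (intro conjI allI impI a)
  show "q a = a" using q[of x0] x0 fx by simp
  fix e' :: real assume "e' > 0"
  then obtain \<delta> where \<delta>: "\<delta> > 0" "!!s t. \<bar>s - t\<bar> < \<delta> ==> dist (F s) (F t) < e'" using F_uniform by metis
  obtain d where d: "d > 0" "ALL y:S2. dist y a < d --> (EX t x. y = F t & F x = a & \<bar>t - x\<bar> < min \<delta> \<epsilon>)"
   using near[of "min \<delta> \<epsilon>"] \<delta>(1) e by auto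
  have "dist ((q ^^ k) y) a < e'" if y: "y : S2" "dist y a < d" for y k
  proof -
   obtain t x where t: "y = F t" "F x = a" "\<bar>t - x\<bar> < min \<delta> \<epsilon>" using d y by blast
   have "\<bar>(l ^^ k) t - x\<bar> <= \<bar>t - x\<bar>"
    by (rule contracting_iterates(1)[OF c m fx con, of x \<epsilon>]) (use t in auto)
   then show ?thesis using \<delta>(2)[of "(l ^^ k) t" x] t by (simp add: qk)
  qed
  then show "EX d>0. ALL y:S2. dist y a < d --> (ALL k. dist ((q ^^ k) y) a < e')" using d(1) by blast
 next
  obtain d where d: "d > 0" "ALL y:S2. dist y a < d --> (EX t x. y = F t & F x = a & \<bar>t - x\<bar> < \<epsilon>)"
   using near[OF e] by blast
  have "(%k. (q ^^ k) y) \<longlonglongrightarrow> a" if y: "y : S2" "dist y a < d" for y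
  proof -
   obtain t x where t: "y = F t" "F x = a" "\<bar>t - x\<bar> < \<epsilon>" using d y by blast
   have "(%n. (l ^^ n) t) \<longlonglongrightarrow> x"
    by (rule contracting_iterates(2)[OF c m fx con, of x \<epsilon>]) (use t in auto)
   moreover have "isCont F x" using cont by (simp add: continuous_on_eq_continuous_at)
   ultimately have "(%n. F ((l ^^ n) t)) \<longlonglongrightarrow> F x" by (rule isCont_tendsto_compose[rotated])
   then show ?thesis using t by (simp add: qk)
  qed
  then show "EX d>0. ALL y:S2. dist y a < d --> (%k. (q ^^ k) y) \<longlonglongrightarrow> a" using d(1) by blast
 qed
qed

lemma image_periodic_compact:
 assumes "closed X" "!!x (k::int). x : X ==> x+2*pi * of_int k : X"
 shows "compact (F ` X)"
proof -
 have "F ` X = F ` (X Int {0..2*pi})"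
 proof
  show "F ` X <= F ` (X Int {0..2*pi})"
  proof
   fix y assume "y : F ` X"
   then obtain x where x: "x : X" "y = F x" by blast
   obtain k where k: "0 <= x+2*pi * of_int k" "x+2*pi * of_int k < 0+2*pi" using representative by blast
   have "y = F (x+2*pi * of_int k)" using x per_int by simp
   moreover have "x+2*pi * of_int k : X Int {0..2*pi}" using assms(2) x k by simp
   ultimately show "y : F ` (X Int {0..2*pi})" by (rule image_eqI)
  qed
 qed auto
 moreover have "compact (X Int {0..2*pi})" using assms(1) by (simp add: closed_Int_compact)
 ultimately show ?thesis using compact_continuous_image[OF cont_on] by metis
qed

end

subsection \<open>Source-sink dynamics\<close>

locale wheel_fix = wheel_map +
 assumes fixp: "EX x. l x = x" and nontriv: "EX x. l x ~= x"
begin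

definition snk :: "real => real" where "snk t = lim (%n. (l ^^ n) t)"
definition src :: "real => real" where "src t = lim (%n. (l' ^^ n) t)"

lemma l'_mono: "strict_mono l'" and l'_cont: "continuous_on UNIV l'" and l'_per: "l' (t+2*pi) = l' t+2*pi"
 using wheel_map_inverse by (auto simp: wheel_map_def wheel_map_axioms_def)

lemma l'_fix: "l' x = x \<longleftrightarrow> l x = x" using l'l ll' by metis

lemma wheel_fix_inverse: "wheel_fix F l' l H' H"
proof -
 interpret I: wheel_map F l' l H' H by (rule wheel_map_inverse)
 obtain x y where "l x = x" "l y ~= y" using fixp nontriv by blast
 then have "l' x = x" "l' y ~= y" using l'_fix by blast+
 then show ?thesis by unfold_locales blast+
qed

lemma closed_fix: "closed {t. l t = t}"
proof -
 have "closed {t. l t - t = 0}"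
  using continuous_closed_preimage_constant[of UNIV "%t. l t - t" 0] by (simp add: continuous_intros l_cont)
 then show ?thesis by simp
qed

lemma fix_per: "l t = t ==> l (t+2*pi * of_int k) = t+2*pi * of_int k"
 by (simp add: l_per_int)

text \<open>Between neighbouring fixed points \<open>l x - x\<close> keeps its sign, so the whole
  gap flows from one end to the other.\<close>

lemma gap_cases:
 assumes "l t ~= t"
 obtains u v where "u < t" "t < v" "l u = u" "l v = v" "v <= u+2*pi"
  "(ALL x. u < x --> x < v --> x < l x & snk x = v & src x = u) | (ALL x. u < x --> x < v --> l x < x & snk x = u & src x = v)"
proof -
 obtain x0 where x0: "l x0 = x0" using fixp by blast
 obtain u v where uv: "u : {t. l t = t}" "v : {t. l t = t}" "u < t" "t < v" "v <= u+2*pi"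
   "!!x. u < x ==> x < v ==> x ~: {t. l t = t}"
  using closed_periodic_gap[OF closed_fix, of x0 t] x0 fix_per assms by auto
 have nf: "l x ~= x" if "u < x" "x < v" for x using uv(6) that by auto
 have sgn: "(x < l x) = (t < l t)" if x: "u < x" "x < v" for x
 proof (rule ccontr)
  assume ne: "(x < l x) ~= (t < l t)"
  define d where "d = (%x. l x - x)"
  have cd: "continuous_on S d" for S unfolding d_def by (intro continuous_intros continuous_on_subset[OF l_cont]) auto
  have "d x <= 0 & 0 <= d t | 0 <= d x & d t <= 0" using ne by (auto simp: d_def)
  then have "EX y. (x <= y & y <= t | t <= y & y <= x) & d y = 0"
   using IVT'[of d x 0 t] IVT2'[of d t 0 x] IVT'[of d t 0 x] IVT2'[of d x 0 t] cd by (metis linear)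
  then obtain y where "x <= y & y <= t | t <= y & y <= x" "d y = 0" by blast
  then show False using nf[of y] uv x by (auto simp: d_def)
 qed
 have lu: "l u = u" "l v = v" using uv by auto
 then have lu': "l' u = u" "l' v = v" by (simp_all add: l'_fix)
 show thesis
 proof (cases "t < l t")
  case True
  have "x < l x & snk x = v & src x = u" if x: "u < x" "x < v" for x
  proof -
   have up: "y < l y" if "u < y" "y < v" for y using sgn[of y] that True by simp
   have dn: "l' y < y" if "u < y" "y < v" for y
   proof -
    have "u < l' y" "l' y < v" using strict_monoD[OF l'_mono that(1)] strict_monoD[OF l'_mono that(2)] lu' by auto
    then show ?thesis using up[of "l' y"] by (simp add: ll')
   qed
   have "(%n. (l ^^ n) x) \<longlonglongrightarrow> v"
    by (rule iterate_tendsto_up[OF l_cont l_mono lu(2) x(2)]) (use up x in auto)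
   moreover have "(%n. (l' ^^ n) x) \<longlonglongrightarrow> u"
    by (rule iterate_tendsto_down[OF l'_cont l'_mono lu'(1) x(1)]) (use dn x in auto)
   ultimately show ?thesis using up x by (simp add: snk_def src_def limI)
  qed
  then show thesis using that[of u v] uv lu by blast
 next
  case False
  have "l x < x & snk x = u & src x = v" if x: "u < x" "x < v" for x
  proof -
   have dn: "l y < y" if "u < y" "y < v" for y using sgn[of y] nf[of y] that False by auto
   have up: "y < l' y" if "u < y" "y < v" for y
   proof -
    have "u < l' y" "l' y < v" using strict_monoD[OF l'_mono that(1)] strict_monoD[OF l'_mono that(2)] lu' by auto
    then show ?thesis using dn[of "l' y"] by (simp add: ll')
   qed
   have "(%n. (l ^^ n) x) \<longlonglongrightarrow> u"
    by (rule iterate_tendsto_down[OF l_cont l_mono lu(1) x(1)]) (use dn x in auto)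
   moreover have "(%n. (l' ^^ n) x) \<longlonglongrightarrow> v"
    by (rule iterate_tendsto_up[OF l'_cont l'_mono lu'(2) x(2)]) (use up x in auto)
   ultimately show ?thesis using dn x by (simp add: snk_def src_def limI)
  qed
  then show thesis using that[of u v] uv lu by blast
 qed
qed

lemma orbit_limits:
 assumes "l t ~= t"
 shows "(%n. (l ^^ n) t) \<longlonglongrightarrow> snk t" "(%n. (l' ^^ n) t) \<longlonglongrightarrow> src t" "l (snk t) = snk t" "l (src t) = src t"
proof -
 obtain u v where uv: "u < t" "t < v" "l u = u" "l v = v" "v <= u+2*pi"
  and c: "(ALL x. u < x --> x < v --> x < l x & snk x = v & src x = u) | (ALL x. u < x --> x < v --> l x < x & snk x = u & src x = v)"
  by (rule gap_cases[OF assms])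
 have lu': "l' u = u" "l' v = v" using uv by (simp_all add: l'_fix)
 have inn: "u < l' y" "l' y < v" if "u < y" "y < v" for y
  using strict_monoD[OF l'_mono that(1)] strict_monoD[OF l'_mono that(2)] lu' by auto
 have "snk t = v & src t = u | snk t = u & src t = v" using c uv(1,2) by blast
 then show "l (snk t) = snk t" "l (src t) = src t" using uv by auto
 from c show "(%n. (l ^^ n) t) \<longlonglongrightarrow> snk t"
 proof
  assume c: "ALL x. u < x --> x < v --> x < l x & snk x = v & src x = u"
  then have "snk t = v" using uv by blast
  then show ?thesis by (simp only:) (rule iterate_tendsto_up[OF l_cont l_mono uv(4) uv(2)], use c uv in auto)
 next
  assume c: "ALL x. u < x --> x < v --> l x < x & snk x = u & src x = v"
  then have "snk t = u" using uv by blast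
  then show ?thesis by (simp only:) (rule iterate_tendsto_down[OF l_cont l_mono uv(3) uv(1)], use c uv in auto)
 qed
 from c show "(%n. (l' ^^ n) t) \<longlonglongrightarrow> src t"
 proof
  assume c: "ALL x. u < x --> x < v --> x < l x & snk x = v & src x = u"
  then have s: "src t = u" using uv by blast
  have "l' y < y" if "u < y" "y < v" for y using c inn[OF that] ll' by metis
  then show ?thesis unfolding s by (intro iterate_tendsto_down[OF l'_cont l'_mono lu'(1) uv(1)]) (use uv in auto)
 next
  assume c: "ALL x. u < x --> x < v --> l x < x & snk x = u & src x = v"
  then have s: "src t = v" using uv by blast
  have "y < l' y" if "u < y" "y < v" for y using c inn[OF that] ll' by metis
  then show ?thesis unfolding s by (intro iterate_tendsto_up[OF l'_cont l'_mono lu'(2) uv(2)]) (use uv in auto)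
 qed
qed

lemma pow_FH': "F ((l' ^^ n) t) = (H' ^^ n) (F t)" by (induction n) (auto simp: FH')

lemma F_limits:
 assumes "l t ~= t"
 shows "(%n. (H ^^ n) (F t)) \<longlonglongrightarrow> F (snk t)" "(%n. (H' ^^ n) (F t)) \<longlonglongrightarrow> F (src t)"
proof -
 have "isCont F x" for x using cont by (simp add: continuous_on_eq_continuous_at)
 then have "(%n. F ((l ^^ n) t)) \<longlonglongrightarrow> F (snk t)" "(%n. F ((l' ^^ n) t)) \<longlonglongrightarrow> F (src t)"
  using orbit_limits[OF assms] isCont_tendsto_compose by blast+
 then show "(%n. (H ^^ n) (F t)) \<longlonglongrightarrow> F (snk t)" "(%n. (H' ^^ n) (F t)) \<longlonglongrightarrow> F (src t)"
  by (simp_all add: pow_FH pow_FH')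
qed

lemma same_image_same_limits:
 assumes "l t ~= t" "l t' ~= t'" "F t = F t'"
 shows "F (snk t) = F (snk t')" "F (src t) = F (src t')"
 using F_limits[OF assms(1)] F_limits[OF assms(2)] assms(3) LIMSEQ_unique by metis+

lemma H_fixed_limits:
 assumes "l t ~= t" "H (F t) = F t"
 shows "F (snk t) = F t" "F (src t) = F t"
proof -
 have "(H ^^ n) (F t) = F t" for n by (induction n) (auto simp: assms)
 then have "(%n::nat. F t) \<longlonglongrightarrow> F (snk t)" using F_limits(1)[OF assms(1)] by simp
 then show "F (snk t) = F t" by (simp add: LIMSEQ_const_iff)
 have "H' (F t) = F t" using assms(2) H'H F_in by metis
 then have "(H' ^^ n) (F t) = F t" for n by (induction n) auto
 then have "(%n::nat. F t) \<longlonglongrightarrow> F (src t)" using F_limits(2)[OF assms(1)] by simp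
 then show "F (src t) = F t" by (simp add: LIMSEQ_const_iff)
qed

text \<open>The images of the forward and backward limits depend only on the image of the starting
  parameter. Hence the closure of the set \<open>B\<close> of parameters with the same limits as
  \<open>t1\<close>, and the complement of \<open>B\<close>, have compact images that overlap only
  in \<open>{a, r}\<close>. The sphere minus these points is connected, so the complement of
  \<open>B\<close> maps into \<open>{a, r}\<close>.\<close>

lemma source_sink:
 obtains a r where "a : S2" "r : S2" "!!t. l t ~= t ==> F (snk t) = a & F (src t) = r" "!!t. l t = t ==> F t : {a, r}"
proof -
 obtain t1 where t1: "l t1 ~= t1" using nontriv by blast
 define a r where "a = F (snk t1)" and "r = F (src t1)"
 have ar: "a : S2" "r : S2" by (simp_all add: a_def r_def F_in)
 define B where "B = {t. l t ~= t & F (snk t) = a & F (src t) = r}"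
 define Z where "Z = {t. l t = t}"
 have gap: "EX u v. u < t & t < v & l u = u & l v = v & {u, v} = {src t, snk t} & (ALL x. u < x --> x < v --> l x ~= x & (x : B \<longleftrightarrow> t : B))"
  if t: "l t ~= t" for t
 proof -
  obtain u v where uv: "u < t" "t < v" "l u = u" "l v = v" "v <= u+2*pi"
   and c: "(ALL x. u < x --> x < v --> x < l x & snk x = v & src x = u) | (ALL x. u < x --> x < v --> l x < x & snk x = u & src x = v)"
   by (rule gap_cases[OF t])
  have same: "snk x = snk t & src x = src t & l x ~= x" if x: "u < x" "x < v" for x
   using c
  proof
   assume c: "ALL x. u < x --> x < v --> x < l x & snk x = v & src x = u"
   from c[rule_format, OF x] c[rule_format, OF uv(1,2)] show ?thesis by simp
  next
   assume c: "ALL x. u < x --> x < v --> l x < x & snk x = u & src x = v"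
   from c[rule_format, OF x] c[rule_format, OF uv(1,2)] show ?thesis by simp
  qed
  have ends: "{u, v} = {src t, snk t}" using c
  proof
   assume c: "ALL x. u < x --> x < v --> x < l x & snk x = v & src x = u"
   from c[rule_format, OF uv(1,2)] show ?thesis by simp
  next
   assume c: "ALL x. u < x --> x < v --> l x < x & snk x = u & src x = v"
   from c[rule_format, OF uv(1,2)] show ?thesis by auto
  qed
  have "ALL x. u < x --> x < v --> l x ~= x & (x : B \<longleftrightarrow> t : B)"
  proof (intro allI impI)
   fix x assume "u < x" "x < v"
   from same[OF this] show "l x ~= x & (x : B \<longleftrightarrow> t : B)" using t unfolding B_def by simp
  qed
  then show ?thesis using uv(1-4) ends by (intro exI[of _ u] exI[of _ v] conjI)
 qed
 have opB: "open B"
 proof (rule openI)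
  fix t assume t: "t : B"
  then obtain u v where uv: "u < t" "t < v" "ALL x. u < x --> x < v --> x : B" using gap[of t] by (auto simp: B_def)
  then have "t : {u<..<v}" "{u<..<v} <= B" by auto
  then show "EX e>0. ball t e <= B" by (meson open_greaterThanLessThan openE subset_trans)
 qed
 have opN: "open (- Z - B)"
 proof (rule openI)
  fix t assume t: "t : - Z - B"
  then obtain u v where uv: "u < t" "t < v" "ALL x. u < x --> x < v --> l x ~= x & x ~: B" using gap[of t] by (auto simp: Z_def)
  then have "t : {u<..<v}" "{u<..<v} <= - Z - B" by (auto simp: Z_def)
  then show "EX e>0. ball t e <= - Z - B" by (meson open_greaterThanLessThan openE subset_trans)
 qed
 have powper: "(l ^^ n) (t+2*pi * of_int k) = (l ^^ n) t+2*pi * of_int k"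
  "(l' ^^ n) (t+2*pi * of_int k) = (l' ^^ n) t+2*pi * of_int k" for n t and k :: int
  using pow_per_int wheel_map.pow_per_int[OF wheel_map_inverse] by auto
 have Bper: "t+2*pi * of_int k : B" if tB: "t : B" for t and k :: int
 proof -
  have lt: "l t ~= t" "F (snk t) = a" "F (src t) = r" using tB by (auto simp: B_def)
  then have lk: "l (t+2*pi * of_int k) ~= t+2*pi * of_int k" by (simp add: l_per_int)
  have "F (t+2*pi * of_int k) = F t" by (rule per_int)
  then show ?thesis using same_image_same_limits[OF lk lt(1)] lk lt by (simp add: B_def)
 qed
 have nBper: "t+2*pi * of_int k : - B" if "t : - B" for t and k :: int
  using Bper[of "t+2*pi * of_int k" "- k"] that by auto
 define C1 where "C1 = F ` closure B"
 define C2 where "C2 = F ` (- B)"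
 have "compact C1" unfolding C1_def
 proof (rule image_periodic_compact)
  fix x and k :: int assume x: "x : closure B"
  have "(%x. x+2*pi * of_int k) ` closure B <= closure B"
   by (rule image_closure_subset) (use Bper closure_subset[of B] in \<open>auto intro!: continuous_intros\<close>)
  then show "x+2*pi * of_int k : closure B" using x by blast
 qed simp
 have "compact C2" unfolding C2_def
  by (rule image_periodic_compact) (use opB nBper in auto)
 \<comment> \<open>Such a fixed parameter is approximated by ends of gaps contained in
   \<open>B\<close>, and these map to \<open>a\<close> or \<open>r\<close>.\<close>
 have Fclo: "F t : {a, r}" if t: "t : closure B" "l t = t" for t
 proof -
  have "t : closure {s. F s : {a, r}}"
  proof (subst closure_approachable, intro allI impI)
   fix e :: real assume "e > 0"
   then obtain b where b: "b : B" "dist b t < e" using t closure_approachable by blast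
   then have lb: "l b ~= b" "F (snk b) = a" "F (src b) = r" by (auto simp: B_def)
   obtain u v where uv: "u < b" "b < v" "{u, v} = {src b, snk b}" "ALL x. u < x --> x < v --> l x ~= x"
    using gap[OF lb(1)] by blast
   have "F u : {a, r}" "F v : {a, r}" using uv(3) lb by (auto simp: doubleton_eq_iff)
   moreover have "t <= u | v <= t" using uv(4) t(2) by force
   then have "dist u t < e | dist v t < e" using b uv by (auto simp: dist_real_def)
   ultimately show "EX y:{s. F s : {a, r}}. dist y t < e" by auto
  qed
  moreover have "closed {s. F s : {a, r}}"
   using continuous_closed_preimage[OF cont, of "{a, r}"] by (simp add: vimage_def)
  ultimately show ?thesis by simp
 qed
 have dis: "C1 Int C2 Int (S2 - {a, r}) = {}"
 proof -
  have False if tt: "t : closure B" "t' ~: B" "F t = F t'" "F t ~: {a, r}" for t t'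
  proof -
   have nf: "l t ~= t" using Fclo tt by blast
   have "t : B"
   proof (rule ccontr)
    assume "t ~: B"
    then have "t : - Z - B" using nf by (simp add: Z_def)
    then have "t ~: closure B" using opN open_Int_closure_eq_empty[OF opN, of B] by blast
    then show False using tt by simp
   qed
   then have B: "F (snk t) = a" "F (src t) = r" by (auto simp: B_def)
   show False
   proof (cases "l t' = t'")
    case True
    then have "H (F t) = F t" using tt(3) FH[of t'] by simp
    then show False using H_fixed_limits[OF nf] B tt by simp
   next
    case False
    then show False using same_image_same_limits[OF False nf] tt B by (simp add: B_def)
   qed
  qed
  then show ?thesis unfolding C1_def C2_def by blast
 qed
 have cov: "S2 - {a, r} <= C1 Un C2"
 proof
  fix y assume "y : S2 - {a, r}"
  then obtain t where "y = F t" using surj by blast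
  then show "y : C1 Un C2" unfolding C1_def C2_def using closure_subset[of B] by blast
 qed
 have "C1 Int (S2 - {a, r}) = {} | C2 Int (S2 - {a, r}) = {}"
  by (rule connected_closedD[OF connected_S2_minus_two[OF ar(1)] dis cov])
    (use \<open>compact C1\<close> \<open>compact C2\<close> compact_imp_closed in auto)
 moreover have interval_out: "EX x. u < x & x < v & F x ~: {a, r}" if uv: "u < v" for u v
 proof (rule ccontr)
  assume "~ ?thesis"
  then have out: "F x : {a, r}" if "u < x" "x < v" for x using that by blast
  define p q where "p = u+(v - u) / 3" and "q = u+(v - u) / 2"
  have pq: "u < p" "p < q" "q < v" using uv by (auto simp: p_def q_def field_simps)
  have "F x : {a, r}" if "x : {p..q}" for x by (rule out) (use that pq in auto)
  then have "F ` {p..q} <= {a, r}" by blast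
  then have "finite (F ` {p..q})" by (rule finite_subset) simp
  then show False using infinite_im[OF pq(2)] by blast
 qed
 moreover have "C1 Int (S2 - {a, r}) ~= {}"
 proof -
  have "t1 : B" using t1 by (simp add: B_def a_def r_def)
  then obtain u v where uv: "u < t1" "t1 < v" "ALL x. u < x --> x < v --> x : B" using gap[OF t1] by blast
  obtain x where "u < x" "x < v" "F x ~: {a, r}" using interval_out[of u v] uv by auto
  then have "F x : C1 Int (S2 - {a, r})" using uv closure_subset[of B] F_in unfolding C1_def by blast
  then show ?thesis by blast
 qed
 ultimately have C2: "C2 Int (S2 - {a, r}) = {}" by blast
 have out: "F t : {a, r}" if "t ~: B" for t
  using C2 that F_in unfolding C2_def by blast
 show thesis
 proof (rule that[OF ar])
  fix t assume t: "l t ~= t"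
  have "t : B"
  proof (rule ccontr)
   assume n: "t ~: B"
   obtain u v where uv: "u < t" "t < v" "ALL x. u < x --> x < v --> x ~: B" using gap[OF t] n by blast
   obtain x where "u < x" "x < v" "F x ~: {a, r}" using interval_out[of u v] uv by auto
   then show False using out uv by blast
  qed
  then show "F (snk t) = a & F (src t) = r" by (simp add: B_def)
 next
  fix t assume "l t = t"
  then have "t ~: B" by (simp add: B_def)
  then show "F t : {a, r}" by (rule out)
 qed
qed

text \<open>Between two fixed parameters lies a gap whose ends map to \<open>a\<close> and
  \<open>r\<close>, so uniform continuity of \<open>F\<close> keeps them apart. The image of a fixed
  parameter then decides whether the gaps on both sides flow towards it or away from it.\<close>

lemma fix_isolated:
 assumes ar: "a ~= r" and lim: "!!t. l t ~= t ==> F (snk t) = a & F (src t) = r" and fx: "!!t. l t = t ==> F t : {a, r}"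
 obtains \<epsilon> where "\<epsilon> > 0" "!!x y. l x = x ==> 0 < \<bar>y - x\<bar> ==> \<bar>y - x\<bar> < \<epsilon> ==>
  l y ~= y & (F x = a --> \<bar>l y - x\<bar> < \<bar>y - x\<bar>) & (F x = r --> \<bar>l' y - x\<bar> < \<bar>y - x\<bar>)"
proof -
 obtain \<epsilon> where e: "\<epsilon> > 0" "!!s t. \<bar>s - t\<bar> < \<epsilon> ==> dist (F s) (F t) < dist a r"
  using F_uniform[of "dist a r"] ar by auto
 have gapF: "EX u v. u < t & t < v & l u = u & l v = v &
   (F u = r & F v = a & (ALL x. u < x --> x < v --> x < l x) | F u = a & F v = r & (ALL x. u < x --> x < v --> l x < x))"
  if t: "l t ~= t" for t
 proof -
  obtain u v where uv: "u < t" "t < v" "l u = u" "l v = v" "v <= u+2*pi"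
   and c: "(ALL x. u < x --> x < v --> x < l x & snk x = v & src x = u) | (ALL x. u < x --> x < v --> l x < x & snk x = u & src x = v)"
   by (rule gap_cases[OF t])
  from c have "F u = r & F v = a & (ALL x. u < x --> x < v --> x < l x) | F u = a & F v = r & (ALL x. u < x --> x < v --> l x < x)"
  proof
   assume c: "ALL x. u < x --> x < v --> x < l x & snk x = v & src x = u"
   then have "snk t = v" "src t = u" using uv(1,2) by blast+
   then show ?thesis using lim[OF t] c by blast
  next
   assume c: "ALL x. u < x --> x < v --> l x < x & snk x = u & src x = v"
   then have "snk t = u" "src t = v" using uv(1,2) by blast+
   then show ?thesis using lim[OF t] c by blast
  qed
  then show ?thesis using uv(1-4) by blast
 qed
 have iso: "l y ~= y" if x: "l x = x" and y: "x < y" "y < x + \<epsilon>" for x y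
 proof
  assume ly: "l y = y"
  have "EX t. x < t & t < y & l t ~= t"
  proof (rule ccontr)
   assume "~ ?thesis"
   then have "F ` {x..y} <= {a, r}" using fx x ly by (force simp: less_le)
   then have "finite (F ` {x..y})" by (rule finite_subset) simp
   then show False using infinite_im[OF y(1)] by blast
  qed
  then obtain t where t: "x < t" "t < y" "l t ~= t" by blast
  obtain u v where uv: "u < t" "t < v" "l u = u" "l v = v"
   "F u = r & F v = a & (ALL x. u < x --> x < v --> x < l x) | F u = a & F v = r & (ALL x. u < x --> x < v --> l x < x)"
   using gapF[OF t(3)] by blast
  have nf: "l z ~= z" if "u < z" "z < v" for z using uv(5) that by fastforce
  have "x <= u" using nf[of x] x t uv by force
  moreover have "v <= y" using nf[of y] ly t uv by force
  ultimately have "\<bar>u - v\<bar> < \<epsilon>" using y t uv by linarith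
  then have "dist (F u) (F v) < dist a r" by (rule e(2))
  then show False using uv(5) by (auto simp: dist_commute)
 qed
 have "l y ~= y & (F x = a --> \<bar>l y - x\<bar> < \<bar>y - x\<bar>) & (F x = r --> \<bar>l' y - x\<bar> < \<bar>y - x\<bar>)"
  if x: "l x = x" and y: "0 < \<bar>y - x\<bar>" "\<bar>y - x\<bar> < \<epsilon>" for x y
 proof -
  have ly: "l y ~= y"
  proof (cases "x < y")
   case True then show ?thesis using iso[OF x True] y by auto
  next
   case False
   then have "y < x" using y by auto
   then show ?thesis using iso[of y x] x y by auto
  qed
  obtain u v where uv: "u < y" "y < v" "l u = u" "l v = v"
   "F u = r & F v = a & (ALL x. u < x --> x < v --> x < l x) | F u = a & F v = r & (ALL x. u < x --> x < v --> l x < x)"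
   using gapF[OF ly] by blast
  have nf: "l z ~= z" if "u < z" "z < v" for z using uv(5) that by fastforce
  have lx': "l' x = x" using x by (simp add: l'_fix)
  show ?thesis
  proof (cases "x < y")
   case True
   have "x <= u" using nf[of x] x True uv by force
   have "u = x"
   proof (rule ccontr)
    assume "u ~= x"
    then have "x < u" "u < x + \<epsilon>" using \<open>x <= u\<close> uv y True by auto
    then show False using iso[OF x] uv by blast
   qed
   have xl: "x < l y" using strict_monoD[OF l_mono True] x by simp
   have xl': "x < l' y" using strict_monoD[OF l'_mono True] lx' by simp
   have "\<bar>l y - x\<bar> < \<bar>y - x\<bar>" if "F x = a"
   proof -
    have "l y < y" using uv \<open>u = x\<close> that ar by auto
    then show ?thesis using xl by auto
   qed
   moreover have "\<bar>l' y - x\<bar> < \<bar>y - x\<bar>" if "F x = r"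
   proof -
    have "y < l y" using uv \<open>u = x\<close> that ar by auto
    then have "l' y < y" using strict_monoD[OF l'_mono, of y "l y"] by (simp add: l'l)
    then show ?thesis using xl' by auto
   qed
   ultimately show ?thesis using ly by blast
  next
   case False
   then have yx: "y < x" using y by auto
   have "v <= x" using nf[of x] x yx uv by force
   have "v = x"
   proof (rule ccontr)
    assume "v ~= x"
    then have "v < x" "x < v + \<epsilon>" using \<open>v <= x\<close> uv y yx by auto
    then show False using iso[OF uv(4)] x by blast
   qed
   have xl: "l y < x" using strict_monoD[OF l_mono yx] x by simp
   have xl': "l' y < x" using strict_monoD[OF l'_mono yx] lx' by simp
   have "\<bar>l y - x\<bar> < \<bar>y - x\<bar>" if "F x = a"
   proof -
    have "y < l y" using uv \<open>v = x\<close> that ar by auto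
    then show ?thesis using xl by auto
   qed
   moreover have "\<bar>l' y - x\<bar> < \<bar>y - x\<bar>" if "F x = r"
   proof -
    have "l y < y" using uv \<open>v = x\<close> that ar by auto
    then have "y < l' y" using strict_monoD[OF l'_mono, of "l y" y] by (simp add: l'l)
    then show ?thesis using xl' by auto
   qed
   ultimately show ?thesis using ly by blast
  qed
 qed
 then show thesis using that[of \<epsilon>] e(1) by blast
qed

text \<open>A non-fixed lift of a fixed point of \<open>H\<close> would have both of its limits over
  that point, against \<open>a ~= r\<close>.\<close>

lemma fibre_fixed:
 assumes ar: "a ~= r" and lim: "!!t. l t ~= t ==> F (snk t) = a & F (src t) = r" and t: "F t : {a, r}" and aH: "H a = a" "H r = r"
 shows "l t = t"
proof (rule ccontr)
 assume nt: "l t ~= t"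
 have "H (F t) = F t" using t aH by auto
 then have "F (snk t) = F (src t)" using H_fixed_limits[OF nt] by simp
 then show False using lim[OF nt] ar by simp
qed

end

subsection \<open>Source and sink with the same image\<close>

text \<open>The situation in which sources and sinks have the same image \<open>c\<close>. It is
  instantiated twice: for the power with fixed points on the circle, and for a lift of the original
  map.\<close>

locale wheel_para = wheel_fix +
 fixes c :: "real^3"
 assumes fix_c: "l t = t ==> F t = c" and Hfix_c: "H (F t) = F t ==> F t = c"
begin

lemma Hc: "H c = c" using fixp fix_c FH by metis

lemma cS: "c : S2" using fixp fix_c F_in by metis

lemma wheel_para_inverse: "wheel_para F l' l H' H c"
proof -
 interpret I: wheel_fix F l' l H' H by (rule wheel_fix_inverse)
 show ?thesis
 proof
  fix t show "F t = c" if "l' t = t" using that fix_c l'_fix by blast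
  show "F t = c" if "H' (F t) = F t"
  proof (rule Hfix_c)
   show "H (F t) = F t" using that HH' F_in by metis
  qed
 qed
qed

lemma Fl_c: "F (l t) = c \<longleftrightarrow> F t = c"
 using FH H_inj[OF F_in cS] Hc by metis

lemma Fl'_c: "F (l' t) = c \<longleftrightarrow> F t = c"
 using Fl_c[of "l' t"] by (simp add: ll')

lemma Fpow_c: "F ((l ^^ n) t) = c \<longleftrightarrow> F t = c" "F ((l' ^^ n) t) = c \<longleftrightarrow> F t = c"
 by (induction n) (simp_all add: Fl_c Fl'_c)

text \<open>The lifts \<open>s\<close>, \<open>s'\<close> of one point and their images under
  \<open>l\<close> alternate with four parameters over \<open>c\<close>. By \<open>unlinked\<close>
  the point is fixed by \<open>H\<close>, so it is \<open>c\<close>. The inequalities become strict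
  because none of the four lifts lies over \<open>c\<close>.\<close>

lemma link_contra:
 assumes q: "q1 <= s" "s <= q2" "q2 <= l s" "l s <= q3" "q3 <= s'" "s' <= q4" "q4 <= l s'" "l s' <= q1+2*pi"
  and c: "F q1 = c" "F q2 = c" "F q3 = c" "F q4 = c" and s: "F s = F s'" "F s ~= c"
 shows False
proof -
 have n: "F (l s) ~= c" "F (l s') ~= c" "F s' ~= c" using s Fl_c by auto
 have lt: "q1 < s" "s < q2" "q2 < l s" "l s < q3" "q3 < s'" "s' < q4" "q4 < l s'" "l s' < q1+2*pi"
  using q n c s per[of q1] by (auto simp: less_le)
 have e: "F (l s) = F (l s')" using s FH by simp
 have "F s = F (l s)"
 proof (rule unlinked[of q1 q2 q3 q4 c])
  show "F s : F ` {q1..q2}" using lt by auto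
  show "F s : F ` {q3..q4}" unfolding s(1) using lt by auto
  show "F (l s) : F ` {q2..q3}" using lt by auto
  show "F (l s) : F ` {q4..q1+2*pi}" unfolding e using lt by auto
 qed (use lt c n s in auto)
 then show False using Hfix_c[of s] FH s by metis
qed

text \<open>Three fixed parameters give three invariant disks with a common point \<open>d\<close>
  other than \<open>c\<close>. The image of \<open>d\<close> under \<open>H\<close> is common to
  them as well, so \<open>d\<close> would be fixed.\<close>

lemma at_most_two_fixed:
 assumes q: "q1 < q2" "q2 < q3" "q3 < q1+2*pi" and f: "l q1 = q1" "l q2 = q2" "l q3 = q3"
 shows False
proof -
 have l1: "l (q1+2*pi) = q1+2*pi" using l_per f by simp
 obtain d where d: "d ~= c" "d : F ` {q1..q2}" "d : F ` {q2..q3}" "d : F ` {q3..q1+2*pi}"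
  using third_point[OF q, of c] fix_c f by auto
 have inv: "H d : F ` {x..y}" if xy: "l x = x" "l y = y" "d : F ` {x..y}" for x y
 proof -
  obtain t where t: "x <= t" "t <= y" "d = F t" using xy(3) by auto
  have "l t : {x..y}" using l_le[of x t] l_le[of t y] t xy by simp
  moreover have "H d = F (l t)" using t FH by simp
  ultimately show ?thesis by blast
 qed
 obtain t where t: "d = F t" using d by auto
 have "H d ~= c" using Fl_c[of t] FH d t by simp
 moreover have cin: "c : F ` {q1..q2}" "c : F ` {q2..q3}" "c : F ` {q3..q1+2*pi}"
  using image_eqI[of c F q1 "{q1..q2}"] image_eqI[of c F q2 "{q2..q3}"] image_eqI[of c F q3 "{q3..q1+2*pi}"] q f fix_c by auto
 ultimately have "d = H d"
  by (intro triple_at_most_two[OF q, of c d "H d"]) (use d inv f l1 in auto)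
 then show False using Hfix_c[of t] t d by simp
qed

lemma iter_up_range:
 assumes u: "l u = u" "l v = v" "u < t" "t < v"
 shows "u < (l ^^ n) t" "(l ^^ n) t < v" "u < (l' ^^ n) t" "(l' ^^ n) t < v"
proof -
 have u': "l' u = u" "l' v = v" using u by (simp_all add: l'_fix)
 show "u < (l ^^ n) t" "(l ^^ n) t < v"
  by (induction n) (use u l_less[of u] l_less[of _ v] in auto)
 show "u < (l' ^^ n) t" "(l' ^^ n) t < v"
  by (induction n) (use u u' strict_mono_less[OF l'_mono, of u] strict_mono_less[OF l'_mono, of _ v] in auto)
qed

lemma forward_limits:
 assumes u: "l u = u" "l v = v" and up: "!!x. u < x ==> x < v ==> x < l x" and t: "u < t" "t < v"
 shows "(%n. (l ^^ n) t) \<longlonglongrightarrow> v" "(%n. (l' ^^ n) t) \<longlonglongrightarrow> u"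
proof -
 have u': "l' u = u" "l' v = v" using u by (simp_all add: l'_fix)
 show "(%n. (l ^^ n) t) \<longlonglongrightarrow> v"
  by (rule iterate_tendsto_up[OF l_cont l_mono u(2) t(2)]) (use up t in auto)
 have "l' y < y" if "u < y" "y < v" for y
 proof -
  have "u < l' y" "l' y < v" using strict_monoD[OF l'_mono that(1)] strict_monoD[OF l'_mono that(2)] u' by auto
  then show ?thesis using up[of "l' y"] by (simp add: ll')
 qed
 then show "(%n. (l' ^^ n) t) \<longlonglongrightarrow> u"
  by (intro iterate_tendsto_down[OF l'_cont l'_mono u'(1) t(1)]) (use t in auto)
qed

lemma fundamental_iterate:
 assumes u: "l u = u" "l v = v" and up: "!!x. u < x ==> x < v ==> x < l x" and t: "u < x" "x < s" "s < v"
 obtains k where "(l ^^ k) x < s" "s <= (l ^^ Suc k) x"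
proof -
 have "(%n. (l ^^ n) x) \<longlonglongrightarrow> v" by (rule forward_limits(1)[OF u up]) (use t in auto)
 then have "eventually (%n. (l ^^ n) x > s) sequentially" using t(3) by (rule order_tendstoD(1))
 then obtain n where n: "s <= (l ^^ n) x" by (metis eventually_sequentially less_imp_le order_refl)
 define N where "N = (LEAST n. s <= (l ^^ n) x)"
 have N: "s <= (l ^^ N) x" unfolding N_def using n by (rule LeastI)
 have "N ~= 0" using N t by (metis funpow_0 not_less)
 then obtain k where k: "N = Suc k" using not0_implies_Suc by blast
 have "~ s <= (l ^^ k) x" using not_less_Least[of k "%n. s <= (l ^^ n) x"] k by (simp add: N_def)
 then show thesis using that[of k] N k by auto
qed

text \<open>Once the fibre of \<open>c\<close> meets the gap at \<open>p\<close>, some iterate of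
  \<open>p\<close> lies in every fundamental interval from \<open>t\<close> to
  \<open>l t\<close>.\<close>

lemma orbit_between:
 assumes u: "l u = u" "l v = v" and up: "!!x. u < x ==> x < v ==> x < l x"
  and p: "u < p" "p < v" "F p = c" and t: "u < t" "t < v"
 obtains \<kappa> where "t < \<kappa>" "\<kappa> <= l t" "F \<kappa> = c"
proof (cases "p <= t")
 case True
 obtain k where k: "(l ^^ k) p < l t" "l t <= (l ^^ Suc k) p"
 proof (rule fundamental_iterate[OF u up])
  show "p < l t" using True up[OF t] by simp
  show "l t < v" using l_less[of t v] u t by simp
 qed (use p in auto)
 show thesis
 proof (cases "(l ^^ k) p <= t")
  case True
  then have "(l ^^ Suc k) p <= l t" by simp
  then have e: "(l ^^ Suc k) p = l t" using k by simp
  show thesis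
  proof (rule that[of "l t"])
   show "F (l t) = c" using Fpow_c(1)[of "Suc k" p] p e by metis
  qed (use up t in auto)
 next
  case False
  then show thesis using that[of "(l ^^ k) p"] k Fpow_c p by auto
 qed
next
 case False
 have "(%n. (l' ^^ n) p) \<longlonglongrightarrow> u" by (rule forward_limits(2)[OF u up]) (use p in auto)
 then have "eventually (%n. (l' ^^ n) p < t) sequentially" using t(1) by (rule order_tendstoD(2))
 from eventually_happens'[OF sequentially_bot this] obtain n where "(l' ^^ n) p < t" by blast
 then have n: "(l' ^^ n) p <= t" by simp
 define N where "N = (LEAST n. (l' ^^ n) p <= t)"
 have N: "(l' ^^ N) p <= t" using LeastI[of "%n. (l' ^^ n) p <= t", OF n] by (simp add: N_def)
 have "N ~= 0" using N False by (metis funpow_0)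
 then obtain k where k: "N = Suc k" using not0_implies_Suc by blast
 have k1: "~ (l' ^^ k) p <= t" using not_less_Least[of k "%n. (l' ^^ n) p <= t"] k by (simp add: N_def)
 have "l' ((l' ^^ k) p) <= t" using N k by simp
 then have "(l' ^^ k) p <= l t" using l_le[of "l' ((l' ^^ k) p)" t] by (simp add: ll')
 then show thesis using that[of "(l' ^^ k) p"] k1 Fpow_c p by auto
qed

text \<open>If the fibre of \<open>c\<close> missed a gap, points of \<open>F ` {u..s} \<inter> F ` {s..v}\<close> close to \<open>c\<close> would be
  carried by an iterate to points that are close to \<open>c\<close> and at the same time in a fundamental domain.\<close>

lemma fibre_meets_forward_gap:
 assumes u: "l u = u" "l v = v" "u < v" "v <= u+2*pi" and up: "!!x. u < x ==> x < v ==> x < l x"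
 shows "EX p. u < p & p < v & F p = c"
proof (rule ccontr)
 assume "~ ?thesis"
 then have nc: "F x ~= c" if "u < x" "x < v" for x using that by blast
 define s where "s = (u + v) / 2"
 have s: "u < s" "s < v" using u by (auto simp: s_def)
 have Fuv: "F u = c" "F v = c" using u fix_c by auto
 \<comment> \<open>The gap may have full length \<open>2*pi\<close>; then the intersection is the
   boundary circle of a disk.\<close>
 have con: "connected (F ` {u..s} Int F ` {s..v})"
 proof (cases "v < u+2*pi")
  case True then show ?thesis using connected_Int_consecutive s by simp
 next
  case False
  then have v: "v = u+2*pi" using u by simp
  have "closed_disk (F ` {u..s})" using disk s v by simp
  then have "connected (bdry (F ` {u..s}))" by (rule closed_disk_interior_facts(6))
  then show ?thesis using bdry_eq[of u s] s v by simp
 qed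
 have sep: "EX \<eta>>0. ALL x:{x..y}. \<eta> <= dist (F x) c" if xy: "u < x" "y < v" for x y
 proof -
  have "c ~: F ` {x..y}"
  proof
   assume "c : F ` {x..y}"
   then obtain w where "x <= w" "w <= y" "F w = c" by auto
   then show False using nc[of w] xy by simp
  qed
  moreover have "open (- (F ` {x..y}))" using closed_im by blast
  ultimately obtain e where "e > 0" "ball c e <= - (F ` {x..y})" using openE[of "- (F ` {x..y})" c] by auto
  then show ?thesis by (intro exI[of _ e]) (force simp: dist_commute not_less[symmetric])
 qed
 have ls: "l s < v" "s < l s" using l_less[of s v] u s up by auto
 obtain \<eta> where eta: "\<eta> > 0" "ALL x:{s..l s}. \<eta> <= dist (F x) c" using sep[of s "l s"] s ls by auto
 have "isCont F v" using cont by (simp add: continuous_on_eq_continuous_at)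
 then obtain \<delta> where delta: "\<delta> > 0" "!!y. dist y v < \<delta> ==> dist (F y) c < \<eta>"
  using eta(1) Fuv unfolding continuous_at_eps_delta by metis
 have "(%n. (l ^^ n) s) \<longlonglongrightarrow> v" by (rule forward_limits(1)[OF u(1,2) up]) (use s in auto)
 then obtain k0 where k0: "!!k. k >= k0 ==> dist ((l ^^ k) s) v < \<delta>" using delta(1) metric_LIMSEQ_D by blast
 have small: "dist (F ((l ^^ k) x)) c < \<eta>" if k: "k >= k0" and x: "s <= x" "x < v" for k x
 proof (rule delta(2))
  have "(l ^^ k) s <= (l ^^ k) x" using pow_mono[of k] x by (simp add: strict_mono_less_eq)
  moreover have "(l ^^ k) x < v" using iter_up_range[OF u(1,2), of x k] x s by auto
  ultimately show "dist ((l ^^ k) x) v < \<delta>" using k0[OF k] by (auto simp: dist_real_def)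
 qed
 have "u < (l' ^^ k0) s" using iter_up_range[OF u(1,2) s] by blast
 \<comment> \<open>A parameter in \<open>{u..s}\<close> whose image is closer than
   \<open>\<xi>\<close> to \<open>c\<close> lies left of \<open>(l' ^^ k0) s\<close>, so it needs
   more than \<open>k0\<close> steps to reach \<open>s\<close>.\<close>
 then obtain \<xi> where xi: "\<xi> > 0" "ALL x:{(l' ^^ k0) s..s}. \<xi> <= dist (F x) c" using sep[of "(l' ^^ k0) s" s] s by auto
 have "c islimpt (F ` {u..s} Int F ` {s..v})"
 proof (rule connected_imp_perfect[OF con])
  have "c : F ` {u..s}" "c : F ` {s..v}"
   using image_eqI[of c F u "{u..s}"] image_eqI[of c F v "{s..v}"] Fuv s by auto
  then show cin: "c : F ` {u..s} Int F ` {s..v}" by blast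
  have sin: "F s : F ` {u..s} Int F ` {s..v}" using s by auto
  show "F ` {u..s} Int F ` {s..v} ~= {x}" for x
  proof
   assume e: "F ` {u..s} Int F ` {s..v} = {x}"
   have "c = x" "F s = x" using cin sin unfolding e by auto
   then show False using nc[OF s] by simp
  qed
 qed
 then obtain z where z: "z : F ` {u..s} Int F ` {s..v}" "z ~= c" "dist z c < \<xi>"
  using xi(1) unfolding islimpt_approachable by blast
 then obtain x y where xy: "u <= x" "x <= s" "z = F x" "s <= y" "y <= v" "z = F y" by auto
 have x1: "u < x" and y1: "y < v" using xy z Fuv by (auto simp: less_le)
 have xk: "x < (l' ^^ k0) s"
 proof (rule ccontr)
  assume "~ x < (l' ^^ k0) s"
  then have "x : {(l' ^^ k0) s..s}" using xy by simp
  then have "\<xi> <= dist (F x) c" using xi(2) by blast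
  then show False using z(3) xy(3) by simp
 qed
 have "(l ^^ k0) x < s"
 proof -
  have "(l ^^ k0) ((l' ^^ k0) s) = s" using wheel_map.ll'[OF wheel_map_pow] by blast
  then show ?thesis using pow_mono[of k0] xk by (metis strict_monoD)
 qed
 moreover have "x < s"
 proof -
  have "(l ^^ j) x <= (l ^^ Suc j) x" for j
   using up[of "(l ^^ j) x"] iter_up_range[OF u(1,2) x1, of j] xy s by auto
  then have "x <= (l ^^ k0) x" using lift_Suc_mono_le[of "%j. (l ^^ j) x" 0 k0] by simp
  then show ?thesis using calculation by simp
 qed
 ultimately obtain k where k: "(l ^^ k) x < s" "s <= (l ^^ Suc k) x"
  using fundamental_iterate[OF u(1,2) up, of x s] x1 s by blast
 have "k >= k0"
 proof (rule ccontr)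
  assume "~ k >= k0"
  then have "Suc k <= k0" by simp
  have "(l ^^ j) x <= (l ^^ Suc j) x" for j
   using up[of "(l ^^ j) x"] iter_up_range[OF u(1,2) x1, of j] \<open>x < s\<close> s by auto
  then have "(l ^^ Suc k) x <= (l ^^ k0) x" using lift_Suc_mono_le[of "%j. (l ^^ j) x", OF _ \<open>Suc k <= k0\<close>] by simp
  then show False using k \<open>(l ^^ k0) x < s\<close> by simp
 qed
 have "(l ^^ Suc k) x : {s..l s}" using k l_less[of "(l ^^ k) x" s] by (simp add: less_imp_le)
 then have "\<eta> <= dist (F ((l ^^ Suc k) x)) c" using eta by blast
 moreover have "F ((l ^^ Suc k) x) = F ((l ^^ Suc k) y)" using xy pow_FH by metis
 moreover have "dist (F ((l ^^ Suc k) y)) c < \<eta>" by (rule small) (use \<open>k >= k0\<close> xy y1 in auto)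
 ultimately show False by simp
qed

text \<open>The parameters \<open>l' p\<close>, \<open>p\<close>, \<open>l p\<close> over
  \<open>c\<close> cut the circle into three intervals whose disks share a point \<open>d\<close>
  other than \<open>c\<close>. Two suitable lifts of \<open>d\<close>, together with their images
  under \<open>l\<close>, contradict \<open>link_contra\<close>.\<close>

lemma no_single_forward:
 assumes x: "l x = x" and up: "!!t. x < t ==> t < x+2*pi ==> t < l t"
 shows False
proof -
 define y where "y = x+2*pi"
 have ly: "l y = y" using x l_per by (simp add: y_def)
 have Fx: "F x = c" "F y = c" using x ly fix_c by auto
 have up': "t < l t" if "x < t" "t < y" for t using up that by (simp add: y_def)
 obtain p where p: "x < p" "p < y" "F p = c"
  using fibre_meets_forward_gap[OF x ly _ _ up'] by (auto simp: y_def)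
 have p1: "x < l' p" "l' p < p" "p < l p" "l p < y"
  using iter_up_range[OF x ly p(1,2), of 1] up'[of p] up'[of "l' p"] p by (auto simp: ll')
 have Fp: "F (l' p) = c" "F (l p) = c" using p by (simp_all add: Fl_c Fl'_c)
 obtain d where d: "d ~= c" "d : F ` {l' p..p}" "d : F ` {p..l p}" "d : F ` {l p..l' p+2*pi}"
  using third_point[of "l' p" p "l p" c] p1 p Fp by (auto simp: y_def)
 then obtain s1 s2 s3 where s: "l' p <= s1" "s1 <= p" "p <= s2" "s2 <= l p" "l p <= s3" "s3 <= l' p+2*pi"
  "d = F s1" "d = F s2" "d = F s3" by auto
 have bet: "EX \<kappa>. t < \<kappa> & \<kappa> <= l t & F \<kappa> = c" if t: "x < t" "t < y" for t
  using orbit_between[OF x ly up' p t] by blast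
 have ls1: "p <= l s1" "l s1 <= l p" using l_le[of "l' p" s1] s by (auto simp: ll')
 have "s3 ~= y" using s d Fx by auto
 then consider "s3 < y" | "y < s3" by linarith
 then show False
 proof cases
  case 1
  obtain \<kappa> where k: "s3 < \<kappa>" "\<kappa> <= l s3" "F \<kappa> = c" using bet[of s3] 1 s p1 by auto
  have "l s3 < y" using l_less[of s3 y] 1 ly by simp
  then show False
   by (intro link_contra[of "l' p" s1 p "l p" s3 \<kappa>]) (use s ls1 k p Fp p1 d in \<open>auto simp: y_def\<close>)
 next
  case 2
  \<comment> \<open>The third lift lies beyond the fixed parameter \<open>y\<close>; one turn back
    it precedes \<open>l' p\<close>, and it is paired with \<open>s2\<close> instead of
    \<open>s1\<close>.\<close>
  define s0 where "s0 = s3 - 2*pi"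
  have s0: "x < s0" "s0 <= l' p" "F s0 = d" using 2 s per_minus[of s3] by (auto simp: s0_def y_def)
  obtain \<kappa> where k: "s0 < \<kappa>" "\<kappa> <= l s0" "F \<kappa> = c" using bet[of s0] s0 p1 p by auto
  have "l s0 <= p" using l_le[of s0 "l' p"] s0 by (simp add: ll')
  moreover have "l p <= l s2" "l s2 < y" using s l_less[of s2 y] ly p1 by auto
  ultimately show False
   by (intro link_contra[of x s0 \<kappa> p s2 "l p"]) (use s s0 k p Fp Fx d in \<open>auto simp: y_def\<close>)
 qed
qed

text \<open>A boundary point of the disk over the first gap has a lift in each gap. Both lifts pass
  a parameter over \<open>c\<close> in one forward step, so they are linked with their
  images.\<close>

lemma no_double_forward:
 assumes x: "l x = x" "l y = y" "x < y" "y < x+2*pi"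
  and up1: "!!t. x < t ==> t < y ==> t < l t" and up2: "!!t. y < t ==> t < x+2*pi ==> t < l t"
 shows False
proof -
 have lx2: "l (x+2*pi) = x+2*pi" using x l_per by simp
 have Fx: "F x = c" "F y = c" "F (x+2*pi) = c" using x lx2 fix_c by auto
 have "closed_disk (F ` {x..y})" using disk x by simp
 then have "infinite (bdry (F ` {x..y}))" using closed_disk_interior_facts(5) by blast
 then obtain z where z: "z : bdry (F ` {x..y})" "z ~= c"
  by (metis finite.emptyI finite_insert finite_subset insertCI subsetI)
 then have "z : F ` {x..y}" "z : F ` {y..x+2*pi}" using bdry_eq[of x y] x by auto
 then obtain s s' where s: "x <= s" "s <= y" "z = F s" "y <= s'" "s' <= x+2*pi" "z = F s'" by auto
 have s1: "x < s" "s < y" "y < s'" "s' < x+2*pi" using s z Fx by (auto simp: less_le)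
 obtain p where p: "x < p" "p < y" "F p = c" using fibre_meets_forward_gap[OF x(1,2,3) _ up1] x by auto
 obtain p' where p': "y < p'" "p' < x+2*pi" "F p' = c" using fibre_meets_forward_gap[OF x(2) lx2 _ _ up2] x by auto
 obtain \<kappa> where k: "s < \<kappa>" "\<kappa> <= l s" "F \<kappa> = c" using orbit_between[OF x(1,2) up1 p s1(1,2)] by blast
 obtain \<kappa>' where k': "s' < \<kappa>'" "\<kappa>' <= l s'" "F \<kappa>' = c" using orbit_between[OF x(2) lx2 up2 p' s1(3,4)] by blast
 have "l s < y" "l s' < x+2*pi" using l_less[of s y] l_less[of s' "x+2*pi"] s1 x lx2 by auto
 then show False
  by (intro link_contra[of x s \<kappa> y s' \<kappa>']) (use s s1 k k' Fx z in auto)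
qed

text \<open>A single gap of full length, two gaps of equal direction and a third fixed parameter are
  all excluded. What remains is one forward and one backward gap; if they come in the other order,
  the period is started at the other fixed point.\<close>

lemma fixed_structure:
 obtains x y where "l x = x" "l y = y" "x < y" "y < x+2*pi"
  "!!t. x < t ==> t < y ==> t < l t" "!!t. y < t ==> t < x+2*pi ==> l t < t"
proof -
 interpret I: wheel_para F l' l H' H c by (rule wheel_para_inverse)
 have flip: "t < l' t" if "l t < t" for t using strict_monoD[OF l'_mono that] by (simp add: l'l)
 obtain t0 where t0: "l t0 ~= t0" using nontriv by blast
 obtain u v where uv: "u < t0" "t0 < v" "l u = u" "l v = v" "v <= u+2*pi"
  and c: "(ALL x. u < x --> x < v --> x < l x & snk x = v & src x = u) | (ALL x. u < x --> x < v --> l x < x & snk x = u & src x = v)"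
  by (rule gap_cases[OF t0])
 have d1: "(ALL x. u < x --> x < v --> x < l x) | (ALL x. u < x --> x < v --> l x < x)" using c by blast
 have u': "l' u = u" "l' v = v" using uv by (simp_all add: l'_fix)
 have lu2: "l (u+2*pi) = u+2*pi" using uv l_per by simp
 have vlt: "v < u+2*pi"
 proof (rule ccontr)
  assume "~ ?thesis"
  then have v: "v = u+2*pi" using uv by simp
  from d1 show False
  proof
   assume "ALL x. u < x --> x < v --> x < l x"
   then show False using no_single_forward[OF uv(3)] v by blast
  next
   assume "ALL x. u < x --> x < v --> l x < x"
   then have "!!t. u < t ==> t < u+2*pi ==> t < l' t" using flip v by blast
   then show False by (rule I.no_single_forward[OF u'(1)])
  qed
 qed
 have nf: "l w ~= w" if w: "v < w" "w < u+2*pi" for w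
  using at_most_two_fixed[of u v w] uv w by auto
 define t1 where "t1 = (v+(u+2*pi)) / 2"
 have t1: "v < t1" "t1 < u+2*pi" using vlt by (auto simp: t1_def)
 obtain u1 v1 where uv1: "u1 < t1" "t1 < v1" "l u1 = u1" "l v1 = v1" "v1 <= u1+2*pi"
  and c1: "(ALL x. u1 < x --> x < v1 --> x < l x & snk x = v1 & src x = u1) | (ALL x. u1 < x --> x < v1 --> l x < x & snk x = u1 & src x = v1)"
  by (rule gap_cases[OF nf[OF t1]])
 have "u1 <= v" "u+2*pi <= v1" using nf[of u1] nf[of v1] uv1 t1 by force+
 then have d2: "(ALL x. v < x --> x < u+2*pi --> x < l x) | (ALL x. v < x --> x < u+2*pi --> l x < x)"
  using c1 by (meson le_less_trans less_le_trans)
 consider (ff) "ALL x. u < x --> x < v --> x < l x" "ALL x. v < x --> x < u+2*pi --> x < l x"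
  | (bb) "ALL x. u < x --> x < v --> l x < x" "ALL x. v < x --> x < u+2*pi --> l x < x"
  | (fb) "ALL x. u < x --> x < v --> x < l x" "ALL x. v < x --> x < u+2*pi --> l x < x"
  | (bf) "ALL x. u < x --> x < v --> l x < x" "ALL x. v < x --> x < u+2*pi --> x < l x"
  using d1 d2 by blast
 then show thesis
 proof cases
  case ff
  have "u < v" using uv by simp
  have False by (rule no_double_forward[OF uv(3,4) \<open>u < v\<close> vlt]) (use ff in auto)
  then show thesis ..
 next
  case bb
  have "u < v" using uv by simp
  have False by (rule I.no_double_forward[OF u' \<open>u < v\<close> vlt]) (use bb flip in auto)
  then show thesis ..
 next
  case fb
  show thesis by (rule that[of u v]) (use fb uv vlt in auto)
 next
  case bf
  show thesis
  proof (rule that[of v "u+2*pi"])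
   fix t assume t: "u+2*pi < t" "t < v+2*pi"
   have "l (t - 2*pi) < t - 2*pi" using bf(1) t by auto
   moreover have "l t = l (t - 2*pi)+2*pi" using l_per[of "t - 2*pi"] by simp
   ultimately show "l t < t" by simp
  qed (use bf uv vlt lu2 in auto)
 qed
qed

end

subsection \<open>Extending boundary maps over disks\<close>

text \<open>A triangle matches the three boundary arcs of a tile: two shared with its neighbours,
  one with the opposite half plane.\<close>

definition Tri :: "complex set" where "Tri = {z. 0 <= Re z & 0 <= Im z & Re z + Im z <= 1}"
definition Tri_edge :: "complex set" where "Tri_edge = {z : Tri. Re z = 0 | Im z = 0 | Re z + Im z = 1}"

lemma Tri_facts: "compact Tri" "convex Tri" "interior Tri = Tri - Tri_edge" "interior Tri ~= {}"
proof -
 have eq: "Tri = {z. (1::complex) \<bullet> z >= 0} Int {z. \<i> \<bullet> z >= 0} Int {z. (1 + \<i>) \<bullet> z <= 1}"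
  by (auto simp: Tri_def inner_complex_def)
 have ne: "(1::complex) + \<i> ~= 0" by (simp add: complex_eq_iff)
 have "interior Tri = {z. (1::complex) \<bullet> z > 0} Int {z. \<i> \<bullet> z > 0} Int {z. (1 + \<i>) \<bullet> z < 1}"
  unfolding eq interior_Int interior_halfspace_ge[OF one_neq_zero] interior_halfspace_ge[OF complex_i_not_zero]
   interior_halfspace_le[OF ne] ..
 then have int: "interior Tri = {z. 0 < Re z & 0 < Im z & Re z + Im z < 1}"
  by (auto simp: inner_complex_def)
 show "interior Tri = Tri - Tri_edge" unfolding int
 proof (rule Set.set_eqI)
  fix z :: complex
  show "z : {z. 0 < Re z & 0 < Im z & Re z + Im z < 1} \<longleftrightarrow> z : Tri - Tri_edge"
   unfolding Tri_edge_def Tri_def mem_Collect_eq Diff_iff by linarith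
 qed
 have "Complex (1/4) (1/4) : interior Tri" unfolding int by simp
 then show "interior Tri ~= {}" by blast
 show "convex Tri" unfolding eq by (intro convex_Int convex_halfspace_ge convex_halfspace_le)
 have "closed Tri" unfolding eq by (intro closed_Int closed_halfspace_ge closed_halfspace_le)
 moreover have "Tri <= cball 0 2"
 proof
  fix z assume "z : Tri"
  then have "\<bar>Re z\<bar> <= 1" "\<bar>Im z\<bar> <= 1" by (auto simp: Tri_def)
  then show "z : cball 0 2" using cmod_le[of z] by simp
 qed
 ultimately show "compact Tri" using bounded_cball bounded_subset compact_eq_bounded_closed by blast
qed

lemma Tri_homeomorphism:
 obtains j k where "homeomorphism Tri (cball (0::complex) 1) j k" "j ` Tri_edge = sphere 0 1" "j ` (Tri - Tri_edge) = ball 0 1"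
proof -
 have "aff_dim Tri = 2" using aff_dim_nonempty_interior[OF Tri_facts(4)] by simp
 then have "Tri homeomorphic cball (0::complex) 1"
  by (intro homeomorphic_convex_compact_sets) (auto simp: Tri_facts aff_dim_cball)
 then obtain j k where jk: "homeomorphism Tri (cball (0::complex) 1) j k" by (auto simp: homeomorphic_def)
 have cj: "continuous_on Tri j" and ck: "continuous_on (cball 0 1) k" and im: "j ` Tri = cball 0 1" "k ` cball 0 1 = Tri"
  using jk by (auto simp: homeomorphism_def)
 have injj: "inj_on j Tri" by (metis jk homeomorphism_def inj_on_inverseI)
 have injk: "inj_on k (cball 0 1)" by (metis jk homeomorphism_def inj_on_inverseI)
 have "open (j ` interior Tri)"
  by (rule invariance_of_domain[OF continuous_on_subset[OF cj interior_subset] open_interior inj_on_subset[OF injj interior_subset]])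
 moreover have "j ` interior Tri <= cball 0 1" using im interior_subset by blast
 ultimately have s1: "j ` interior Tri <= ball 0 1" by (metis interior_cball interior_maximal)
 have "open (k ` ball 0 1)"
  by (rule invariance_of_domain[OF continuous_on_subset[OF ck ball_subset_cball] open_ball inj_on_subset[OF injk ball_subset_cball]])
 moreover have "k ` ball 0 1 <= Tri" using im ball_subset_cball by blast
 ultimately have s2: "k ` ball 0 1 <= interior Tri" by (simp add: interior_maximal)
 have "ball 0 1 <= j ` interior Tri"
 proof
  fix z :: complex assume z: "z : ball 0 1"
  then have "k z : interior Tri" using s2 by blast
  moreover have "j (k z) = z" using homeomorphism_apply2[OF jk] z ball_subset_cball by blast
  ultimately show "z : j ` interior Tri" by (metis imageI)
 qed
 then have ji: "j ` interior Tri = ball 0 1" using s1 by blast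
 have "j ` (Tri - interior Tri) = j ` Tri - j ` interior Tri"
  by (rule inj_on_image_set_diff[OF injj]) (use interior_subset in auto)
 also have "\<dots> = sphere 0 1" unfolding im ji by (auto simp: not_less)
 finally have "j ` (Tri - interior Tri) = sphere 0 1" .
 moreover have "Tri - interior Tri = Tri_edge" unfolding Tri_facts(3) by (auto simp: Tri_edge_def)
 ultimately show thesis using that[OF jk] ji Tri_facts(3) by simp
qed

text \<open>The extension is the cone over the boundary map, in coordinates where both disks are round.\<close>

lemma extend_boundary_map:
 assumes D: "closed_disk D" and b: "continuous_on Tri_edge b" "inj_on b Tri_edge" "b ` Tri_edge = bdry D"
 obtains B where "continuous_on Tri B" "inj_on B Tri" "B ` Tri = D" "!!z. z : Tri_edge ==> B z = b z"
proof -
 obtain \<phi> \<psi> where h: "homeomorphism (cball (0::complex) 1) D \<phi> \<psi>" "\<phi> ` sphere 0 1 = bdry D"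
  using closed_disk_param[OF D] by metis
 obtain j k where jk: "homeomorphism Tri (cball (0::complex) 1) j k" "j ` Tri_edge = sphere 0 1"
  using Tri_homeomorphism by metis
 define g where "g = (%w. \<psi> (b (k w)))"
 have injphi: "inj_on \<phi> (cball 0 1)" by (metis h(1) homeomorphism_def inj_on_inverseI)
 have injpsi: "inj_on \<psi> D" by (metis h(1) homeomorphism_def inj_on_inverseI)
 have injj: "inj_on j Tri" by (metis jk(1) homeomorphism_def inj_on_inverseI)
 have injk: "inj_on k (cball 0 1)" by (metis jk(1) homeomorphism_def inj_on_inverseI)
 have eT: "Tri_edge <= Tri" by (auto simp: Tri_edge_def)
 have ks: "k ` sphere 0 1 = Tri_edge"
 proof -
  have "k (j z) = z" if "z : Tri_edge" for z using homeomorphism_apply1[OF jk(1)] eT that by blast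
  then show ?thesis unfolding jk(2)[symmetric] by (simp add: image_image)
 qed
 have bD: "bdry D <= D" by (auto simp: bdry_def)
 have psis: "\<psi> ` bdry D = sphere 0 1"
 proof -
  have "\<psi> (\<phi> z) = z" if "z : sphere 0 1" for z using homeomorphism_apply1[OF h(1)] that by auto
  then show ?thesis unfolding h(2)[symmetric] by (simp add: image_image)
 qed
 have gs: "g ` sphere 0 1 = sphere 0 1"
 proof -
  have "g ` sphere 0 1 = \<psi> ` (b ` (k ` sphere 0 1))" by (simp add: g_def image_image)
  then show ?thesis using ks b(3) psis by simp
 qed
 have ginj: "inj_on g (sphere 0 1)"
 proof (rule inj_onI)
  fix v w assume vw: "v : sphere 0 1" "w : sphere 0 1" "g v = g w"
  have kv: "k v : Tri_edge" "k w : Tri_edge" using ks vw by auto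
  then have "b (k v) : D" "b (k w) : D" using b(3) bD by auto
  then have "b (k v) = b (k w)" using vw(3) injpsi by (simp add: g_def inj_on_eq_iff)
  then have "k v = k w" using b(2) kv by (simp add: inj_on_eq_iff)
  then show "v = w" using injk vw by (simp add: inj_on_eq_iff)
 qed
 have gcont: "continuous_on (sphere 0 1) g" unfolding g_def
 proof (rule continuous_on_compose2[OF homeomorphism_cont2[OF h(1)]])
  show "continuous_on (sphere 0 1) (%w. b (k w))"
   by (rule continuous_on_compose2[OF b(1)]) (use homeomorphism_cont2[OF jk(1)] ks in \<open>auto intro: continuous_on_subset\<close>)
  show "(%w. b (k w)) ` sphere 0 1 <= D" using ks b(3) bD by auto
 qed
 define C where "C = (%z. of_real (norm z) * g (z / of_real (norm z)))"
 have gn: "norm (g w) = 1" if "norm w = 1" for w using gs that by force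
 have dn: "norm (z / of_real (norm z)) = 1" if "z ~= 0" for z :: complex using that by (simp add: norm_divide)
 have Cn: "norm (C z) = norm z" for z
  using gn dn by (cases "z = 0") (auto simp: C_def norm_mult)
 have Ccont: "continuous_on (cball 0 1) C"
 proof -
  have "continuous (at z within cball 0 1) C" if z: "z : cball 0 1" for z
  proof (cases "z = 0")
   case True
   have "(C \<longlongrightarrow> 0) (at 0 within cball 0 1)"
   proof (rule tendsto_norm_zero_cancel)
    show "((%x. norm (C x)) \<longlongrightarrow> 0) (at 0 within cball 0 1)" unfolding Cn
     by (rule tendsto_norm_zero[OF tendsto_ident_at])
   qed
   moreover have "C 0 = 0" by (simp add: C_def)
   ultimately show ?thesis using True by (simp add: continuous_within)
  next
   case False
   have "continuous_on (- {0}) C" unfolding C_def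
   proof (intro continuous_on_mult continuous_on_of_real continuous_on_norm_id continuous_on_norm continuous_on_id)
    show "continuous_on (- {0}) (%x. g (x / of_real (norm x)))"
    proof (rule continuous_on_compose2[OF gcont])
     show "continuous_on (- {0}) (%x::complex. x / of_real (norm x))" by (intro continuous_intros) auto
     show "(%x::complex. x / of_real (norm x)) ` (- {0}) <= sphere 0 1"
     proof
      fix y assume "y : (%x::complex. x / of_real (norm x)) ` (- {0})"
      then obtain x :: complex where "x ~= 0" "y = x / of_real (norm x)" by blast
      then show "y : sphere 0 1" using dn by simp
     qed
    qed
   qed
   then have "continuous (at z) C" using False by (simp add: continuous_on_eq_continuous_at open_Compl)
   then show ?thesis by (rule continuous_at_imp_continuous_at_within)
  qed
  then show ?thesis by (simp add: continuous_on_eq_continuous_within)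
 qed
 have Cinj: "inj_on C (cball 0 1)"
 proof (rule inj_onI)
  fix v w assume e: "C v = C w"
  have n: "norm v = norm w" using e Cn by metis
  show "v = w"
  proof (cases "v = 0")
   case True then show ?thesis using n by simp
  next
   case False
   then have w0: "w ~= 0" using n by auto
   have "g (v / of_real (norm v)) = g (w / of_real (norm w))" using e n w0 by (simp add: C_def)
   then have "v / of_real (norm v) = w / of_real (norm w)"
    using ginj dn[OF False] dn[OF w0] by (simp add: inj_on_eq_iff)
   then show ?thesis using n w0 by simp
  qed
 qed
 have Cim: "C ` cball 0 1 = cball 0 1"
 proof
  show "C ` cball 0 1 <= cball 0 1" using Cn by auto
  show "cball 0 1 <= C ` cball 0 1"
  proof
   fix w :: complex assume w: "w : cball 0 1"
   show "w : C ` cball 0 1"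
   proof (cases "w = 0")
    case True
    have "C 0 = 0" by (simp add: C_def)
    then show ?thesis using True by (metis centre_in_cball image_eqI zero_le_one)
   next
    case False
    have "w / of_real (norm w) : g ` sphere 0 1" using gs dn[OF False] by simp
    then obtain v where v: "v : sphere 0 1" "g v = w / of_real (norm w)" by auto
    define z where "z = of_real (norm w) * v"
    have nz: "norm z = norm w" using v by (simp add: z_def norm_mult)
    have "z / of_real (norm z) = v" unfolding nz using False by (simp add: z_def)
    then have "C z = of_real (norm w) * g v" by (simp add: C_def nz)
    then have "C z = w" using v False by simp
    moreover have "z : cball 0 1" using nz w by simp
    ultimately show ?thesis by blast
   qed
  qed
 qed
 have CS: "C z = g z" if "z : sphere 0 1" for z using that by (simp add: C_def)
 define B where "B = (%z. \<phi> (C (j z)))"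
 have jim: "j ` Tri = cball 0 1" by (rule homeomorphism_image1[OF jk(1)])
 show thesis
 proof (rule that[of B])
  show "continuous_on Tri B" unfolding B_def
   by (rule continuous_on_compose2[OF homeomorphism_cont1[OF h(1)]],
     rule continuous_on_compose2[OF Ccont homeomorphism_cont1[OF jk(1)]])
     (use jim Cim in auto)
  have Cj: "inj_on (C \<circ> j) Tri" by (rule comp_inj_on[OF injj]) (simp add: jim Cinj)
  have "(C \<circ> j) ` Tri = cball 0 1" by (simp only: image_comp[symmetric] jim Cim)
  then have "inj_on (\<phi> \<circ> (C \<circ> j)) Tri" using comp_inj_on[OF Cj, of \<phi>] injphi by simp
  then show "inj_on B Tri" by (simp add: B_def o_def)
  have "B ` Tri = \<phi> ` (C ` (j ` Tri))" by (simp add: B_def image_image)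
  then show "B ` Tri = D" using jim Cim homeomorphism_image1[OF h(1)] by simp
  fix z assume z: "z : Tri_edge"
  then have "j z : sphere 0 1" using jk(2) by blast
  then have "B z = \<phi> (g (j z))" by (simp add: B_def CS)
  moreover have "k (j z) = z" using homeomorphism_apply1[OF jk(1)] z eT by blast
  moreover have "\<phi> (\<psi> (b z)) = b z" using homeomorphism_apply2[OF h(1)] b(3) z bD by blast
  ultimately show "B z = b z" by (simp add: g_def)
 qed
qed

text \<open>A projective map from the half strip of width 1 to the triangle. The vertical sides go
  to the edges meeting at \<open>\<i>\<close>, and the infinite end goes to this missing
  vertex.\<close>

definition strip_to_Tri :: "complex => complex" where
 "strip_to_Tri z = Complex (Re z / (1 + Im z)) (Im z / (1 + Im z))"

lemma strip_to_Tri: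
 defines "S \<equiv> {z. 0 <= Im z & 0 <= Re z & Re z <= 1}"
 shows "continuous_on S strip_to_Tri" "inj_on strip_to_Tri S" "strip_to_Tri ` S = Tri - {\<i>}"
proof -
 have e: "strip_to_Tri = (%z. of_real (Re z / (1 + Im z)) + \<i> * of_real (Im z / (1 + Im z)))"
  by (rule ext) (simp add: strip_to_Tri_def complex_eq_iff)
 show "continuous_on S strip_to_Tri" unfolding e S_def by (intro continuous_intros) auto
 show "inj_on strip_to_Tri S"
 proof (rule inj_onI)
  fix z w assume zw: "z : S" "w : S" "strip_to_Tri z = strip_to_Tri w"
  have p: "0 < 1 + Im z" "0 < 1 + Im w" using zw by (auto simp: S_def)
  have "Im z / (1 + Im z) = Im w / (1 + Im w)" "Re z / (1 + Im z) = Re w / (1 + Im w)" using zw by (auto simp: strip_to_Tri_def)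
  then have "Im z = Im w" using p by (simp add: field_simps)
  then show "z = w" using \<open>Re z / (1 + Im z) = Re w / (1 + Im w)\<close> p by (simp add: complex_eq_iff)
 qed
 show "strip_to_Tri ` S = Tri - {\<i>}"
 proof
  show "strip_to_Tri ` S <= Tri - {\<i>}"
  proof
   fix w assume "w : strip_to_Tri ` S"
   then obtain z where z: "z : S" "w = strip_to_Tri z" by blast
   have p: "0 < 1 + Im z" using z by (auto simp: S_def)
   have "Re w + Im w = (Re z + Im z) / (1 + Im z)" by (simp add: z strip_to_Tri_def add_divide_distrib)
   also have "\<dots> <= 1" using z p by (simp add: S_def field_simps)
   finally have "Re w + Im w <= 1" .
   moreover have "0 <= Re w" "0 <= Im w" "Im w < 1" using z p by (auto simp: strip_to_Tri_def S_def field_simps)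
   ultimately show "w : Tri - {\<i>}" by (auto simp: Tri_def complex_eq_iff)
  qed
  show "Tri - {\<i>} <= strip_to_Tri ` S"
  proof
   fix w assume w: "w : Tri - {\<i>}"
   have i1: "Im w < 1"
   proof (rule ccontr)
    assume "~ Im w < 1"
    then have "Im w = 1" "Re w = 0" using w by (auto simp: Tri_def)
    then show False using w by (simp add: complex_eq_iff)
   qed
   define z where "z = Complex (Re w / (1 - Im w)) (Im w / (1 - Im w))"
   have "1 + Im z = 1 / (1 - Im w)" using i1 by (simp add: z_def field_simps)
   then have "strip_to_Tri z = w" using i1 by (simp add: strip_to_Tri_def z_def complex_eq_iff)
   moreover have "z : S" using w i1 by (auto simp: S_def z_def Tri_def field_simps)
   ultimately show "w : strip_to_Tri ` S" by blast
  qed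
 qed
qed

subsection \<open>Integer powers and equivariant gluing\<close>

context wheel_map
begin

definition lz :: "int => real => real" where "lz j = (if 0 <= j then l ^^ nat j else l' ^^ nat (- j))"
definition Hz :: "int => real^3 => real^3" where "Hz j = (if 0 <= j then H ^^ nat j else H' ^^ nat (- j))"

lemma lz_Suc: "lz (j+1) t = l (lz j t)"
proof (cases "0 <= j")
 case True
 then have "nat (j+1) = Suc (nat j)" by simp
 then show ?thesis using True by (simp add: lz_def)
next
 case False
 define n where "n = nat (- j) - 1"
 then have n: "j = - int (Suc n)" using False by simp
 have "nat (- j) = Suc n" by (simp add: n)
 moreover have "lz (j+1) = l' ^^ n" by (auto simp: lz_def n)
 ultimately show ?thesis using False by (simp add: lz_def ll')
qed

lemma lz_0 [simp]: "lz 0 t = t" by (simp add: lz_def)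

lemma lz_pred: "lz (j - 1) t = l' (lz j t)" using lz_Suc[of "j - 1" t] l'l by simp

lemma lz_add: "lz (i + j) t = lz i (lz j t)"
proof (induction i rule: int_induct[where k = 0])
 case base then show ?case by simp
next
 case (step1 i) then show ?case using lz_Suc[of "i + j" t] lz_Suc[of i "lz j t"] by (simp add: algebra_simps)
next
 case (step2 i) then show ?case using lz_pred[of "i + j" t] lz_pred[of i "lz j t"] by (simp add: algebra_simps)
qed

lemma Hz_F: "Hz j (F t) = F (lz j t)"
 unfolding Hz_def lz_def using pow_FH wheel_map.pow_FH[OF wheel_map_inverse] by auto

lemma S2_F: "y : S2 ==> EX t. y = F t" using surj by blast

lemma Hz_add: "y : S2 ==> Hz (i + j) y = Hz i (Hz j y)"
 using S2_F[of y] lz_add Hz_F by metis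

lemma Hz_in: "y : S2 ==> Hz j y : S2" using S2_F[of y] Hz_F F_in by metis

lemma Hz_0 [simp]: "Hz 0 y = y" by (simp add: Hz_def)

lemma Hz_1: "y : S2 ==> Hz 1 y = H y" by (simp add: Hz_def)

lemma Hz_inv: "y : S2 ==> Hz (- j) (Hz j y) = y" using Hz_add[of y "- j" j] by simp

lemma Hz_inj: "x : S2 ==> y : S2 ==> Hz j x = Hz j y \<longleftrightarrow> x = y" using Hz_inv by metis

lemma Hz_cont: "continuous_on S2 (Hz j)"
 using homeomorphism_cont1[OF wheel_map.hom[OF wheel_map_pow]] homeomorphism_cont2[OF wheel_map.hom[OF wheel_map_pow]]
 by (auto simp: Hz_def)

lemma lz_mono: "strict_mono (lz j)"
 using pow_mono wheel_map.pow_mono[OF wheel_map_inverse] by (auto simp: lz_def)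

text \<open>Powers of \<open>H\<close> copy \<open>\<psi>\<close> from the fundamental strip to its
  translates; the condition on the edge \<open>Re z = u0\<close> makes neighbouring copies agree.
  For injectivity \<open>far\<close> and \<open>near\<close> let copies overlap along common edges
  only. It serves both for the boundary line and for the half plane.\<close>

lemma equivariant_extension:
 fixes W :: "complex set" and u0 :: real
 defines "W0 \<equiv> {z : W. u0 <= Re z & Re z <= u0+1}"
 assumes W: "closed W" "!!z (j::int). z : W ==> z + of_int j : W"
  and \<psi>: "continuous_on W0 \<psi>" "inj_on \<psi> W0" "\<psi> ` W0 <= S2" "!!z. z : W ==> Re z = u0 ==> \<psi> (z+1) = H (\<psi> z)"
  and far: "!!j. \<bar>j\<bar> >= 2 ==> \<psi> ` W0 Int Hz j ` (\<psi> ` W0) = {}"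
  and near: "!!z. z : W0 ==> \<psi> z : H ` (\<psi> ` W0) ==> Re z = u0+1"
 obtains \<Psi> where "continuous_on W \<Psi>" "inj_on \<Psi> W" "\<Psi> ` W = (\<Union>j. Hz j ` (\<psi> ` W0))"
  "!!z. z : W ==> \<Psi> (z+1) = H (\<Psi> z)" "!!z. z : W0 ==> \<Psi> z = \<psi> z"
  "!!z. z : W ==> EX w:W0. EX j::int. z = w + of_int j & \<Psi> z = Hz j (\<psi> w)"
proof -
 define \<Psi> where "\<Psi> = (%z. Hz \<lfloor>Re z - u0\<rfloor> (\<psi> (z - of_int \<lfloor>Re z - u0\<rfloor>)))"
 have inS: "\<psi> z : S2" if "z : W0" for z using \<psi>(3) that by blast
 have Wm: "z - of_int j : W" if "z : W" for z and j :: int using W(2)[OF that, of "- j"] by simp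
 have base: "z - of_int \<lfloor>Re z - u0\<rfloor> : W0" "Re (z - of_int \<lfloor>Re z - u0\<rfloor>) < u0+1" if "z : W" for z
 proof -
  define m where "m = \<lfloor>Re z - u0\<rfloor>"
  have "u0 <= Re z - of_int m" "Re z - of_int m < u0+1" unfolding m_def by linarith+
  then have "z - of_int m : W0" "Re (z - of_int m) < u0+1"
   using Wm[OF that, of m] by (auto simp: W0_def)
  then show "z - of_int \<lfloor>Re z - u0\<rfloor> : W0" "Re (z - of_int \<lfloor>Re z - u0\<rfloor>) < u0+1" unfolding m_def .
 qed
 have onstrip: "\<Psi> z = Hz j (\<psi> (z - of_int j))" if z: "z : W" "u0 + of_int j <= Re z" "Re z <= u0 + of_int j+1" for z j
 proof (cases "Re z = u0 + of_int j+1")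
  case True
  then have fl: "\<lfloor>Re z - u0\<rfloor> = j+1" by (simp add: floor_eq_iff)
  define w where "w = z - of_int (j+1)"
  have w: "w : W" "Re w = u0" using Wm[OF z(1), of "j+1"] True by (auto simp: w_def)
  then have w0: "w : W0" by (simp add: W0_def)
  have "z - of_int j = w+1" by (simp add: w_def)
  then have "Hz j (\<psi> (z - of_int j)) = Hz j (H (\<psi> w))" using \<psi>(4)[OF w] by simp
  also have "\<dots> = Hz (j+1) (\<psi> w)" using Hz_add[of "\<psi> w" j 1] Hz_1 inS[OF w0] by simp
  finally show ?thesis unfolding \<Psi>_def fl by (simp add: w_def)
 next
  case False
  then have "\<lfloor>Re z - u0\<rfloor> = j" using z by (simp add: floor_eq_iff)
  then show ?thesis by (simp add: \<Psi>_def)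
 qed
 have cstrip: "continuous_on (W Int {z. u0 + of_int j <= Re z & Re z <= u0 + of_int j+1}) \<Psi>" for j
 proof -
  have "continuous_on (W Int {z. u0 + of_int j <= Re z & Re z <= u0 + of_int j+1}) (%z. Hz j (\<psi> (z - of_int j)))"
  proof (rule continuous_on_compose2[OF Hz_cont])
   show "continuous_on (W Int {z. u0 + of_int j <= Re z & Re z <= u0 + of_int j+1}) (%z. \<psi> (z - of_int j))"
    by (rule continuous_on_compose2[OF \<psi>(1)]) (use Wm in \<open>auto intro!: continuous_intros simp: W0_def\<close>)
   show "(%z. \<psi> (z - of_int j)) ` (W Int {z. u0 + of_int j <= Re z & Re z <= u0 + of_int j+1}) <= S2"
    using inS Wm by (auto simp: W0_def)
  qed
  then show ?thesis by (rule continuous_on_eq) (use onstrip in auto)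
 qed
 have clos: "closed (W Int {z. u0 + of_int j <= Re z & Re z <= u0 + of_int j+1})" for j :: int
  unfolding Collect_conj_eq by (intro closed_Int W closed_Collect_le continuous_intros)
 have "continuous (at z within W) \<Psi>" if z: "z : W" for z
 proof -
  define j where "j = \<lfloor>Re z - u0\<rfloor>"
  have j: "u0 + of_int j <= Re z" "Re z < u0 + of_int j+1" unfolding j_def by linarith+
  \<comment> \<open>The two strips numbered \<open>j - 1\<close> and \<open>j\<close> cover a
    neighbourhood of \<open>z\<close>, also if \<open>z\<close> lies on their common edge.\<close>
  define V where "V = {w. u0 + of_int j - 1 < Re w & Re w < u0 + of_int j+1}"
  have "open V" unfolding V_def Collect_conj_eq by (intro open_Int open_Collect_less continuous_intros)
  have "continuous_on ((W Int {z. u0 + of_int (j - 1) <= Re z & Re z <= u0 + of_int (j - 1)+1}) Un (W Int {z. u0 + of_int j <= Re z & Re z <= u0 + of_int j+1})) \<Psi>"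
   by (intro continuous_on_closed_Un clos cstrip)
  then have "continuous_on (W Int V) \<Psi>" by (rule continuous_on_subset) (auto simp: V_def)
  then have "continuous (at z within (W Int V)) \<Psi>" using z j by (auto simp: continuous_on_eq_continuous_within V_def)
  moreover have "at z within (W Int V) = at z within W"
   by (rule at_within_nhd[of z V]) (use \<open>open V\<close> j in \<open>auto simp: V_def\<close>)
  ultimately show ?thesis by simp
 qed
 then have c: "continuous_on W \<Psi>" by (simp add: continuous_on_eq_continuous_within)
 have i: "inj_on \<Psi> W"
 proof (rule inj_onI)
  have key: "j = j' & w = w'" if ww: "w : W0" "w' : W0" "Re w < u0+1" "Re w' < u0+1" "Hz j (\<psi> w) = Hz j' (\<psi> w')" for w w' j j'
  proof -
   have a: "\<psi> w = Hz (j' - j) (\<psi> w')"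
    using Hz_inv[OF inS[OF ww(1)], of j] ww(5) Hz_add[OF inS[OF ww(2)], of "- j" j'] by simp
   have b: "\<psi> w' = Hz (j - j') (\<psi> w)"
    using Hz_inv[OF inS[OF ww(2)], of j'] ww(5) Hz_add[OF inS[OF ww(1)], of "- j'" j] by simp
   consider "\<bar>j' - j\<bar> >= 2" | "j' - j = 1" | "j - j' = 1" | "j = j'" by linarith
   then show ?thesis
   proof cases
    case 1
    have "\<psi> w : \<psi> ` W0" "\<psi> w : Hz (j' - j) ` (\<psi> ` W0)"
     using ww(1) image_eqI[of "\<psi> w" "Hz (j' - j)" "\<psi> w'" "\<psi> ` W0"] a ww(2) by blast+
    then show ?thesis using far[OF 1] by blast
   next
    case 2
    then have "\<psi> w = H (\<psi> w')" using a Hz_1 inS ww by simp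
    then have "\<psi> w : H ` (\<psi> ` W0)" using ww(2) by (metis imageI)
    then show ?thesis using near[OF ww(1)] ww(3) by simp
   next
    case 3
    then have "\<psi> w' = H (\<psi> w)" using b Hz_1 inS ww by simp
    then have "\<psi> w' : H ` (\<psi> ` W0)" using ww(1) by (metis imageI)
    then show ?thesis using near[OF ww(2)] ww(4) by simp
   next
    case 4
    then show ?thesis using a \<psi>(2) ww by (simp add: inj_on_eq_iff)
   qed
  qed
  fix z z' assume zz: "z : W" "z' : W" "\<Psi> z = \<Psi> z'"
  have "\<lfloor>Re z - u0\<rfloor> = \<lfloor>Re z' - u0\<rfloor> & z - of_int \<lfloor>Re z - u0\<rfloor> = z' - of_int \<lfloor>Re z' - u0\<rfloor>"
   by (rule key) (use base[OF zz(1)] base[OF zz(2)] zz(3) in \<open>auto simp: \<Psi>_def\<close>)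
  then show "z = z'" by (metis diff_add_cancel)
 qed
 have rep: "EX w:W0. EX j::int. z = w + of_int j & \<Psi> z = Hz j (\<psi> w)" if "z : W" for z
  using base(1)[OF that] by (intro bexI[of _ "z - of_int \<lfloor>Re z - u0\<rfloor>"] exI[of _ "\<lfloor>Re z - u0\<rfloor>"]) (auto simp: \<Psi>_def)
 have sh: "\<Psi> (w + of_int j) = Hz j (\<psi> w)" if w: "w : W0" for w and j :: int
  using onstrip[of "w + of_int j" j] W(2)[of w j] w by (auto simp: W0_def)
 show thesis
 proof (rule that[OF c i])
  show "\<Psi> ` W = (\<Union>j. Hz j ` (\<psi> ` W0))"
  proof
   show "\<Psi> ` W <= (\<Union>j. Hz j ` (\<psi> ` W0))"
   proof
    fix y assume "y : \<Psi> ` W"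
    then obtain z where "z : W" "y = \<Psi> z" by blast
    then obtain w and j :: int where "w : W0" "y = Hz j (\<psi> w)" using rep[of z] by auto
    then show "y : (\<Union>j. Hz j ` (\<psi> ` W0))" by blast
   qed
   show "(\<Union>j. Hz j ` (\<psi> ` W0)) <= \<Psi> ` W"
   proof
    fix y assume "y : (\<Union>j. Hz j ` (\<psi> ` W0))"
    then obtain j w where jw: "w : W0" "y = Hz j (\<psi> w)" by blast
    then have "y = \<Psi> (w + of_int j)" using sh by simp
    moreover have "w + of_int j : W" using W(2) jw by (simp add: W0_def)
    ultimately show "y : \<Psi> ` W" by blast
   qed
  qed
  show "\<Psi> (z+1) = H (\<Psi> z)" if z: "z : W" for z
  proof -
   obtain w and j :: int where w: "w : W0" "z = w + of_int j" "\<Psi> z = Hz j (\<psi> w)" using rep[OF z] by blast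
   have "z+1 = w + of_int (j+1)" using w by simp
   then have "\<Psi> (z+1) = Hz (j+1) (\<psi> w)" using sh[OF w(1), of "j+1"] by metis
   also have "\<dots> = Hz 1 (Hz j (\<psi> w))" using Hz_add[OF inS[OF w(1)], of 1 j] by (simp add: add.commute)
   finally show ?thesis using w Hz_1 Hz_in inS by simp
  qed
  show "\<Psi> z = \<psi> z" if "z : W0" for z using sh[OF that, of 0] by simp
 qed (use rep in blast)
qed

end

subsection \<open>Conjugation to a translation\<close>

text \<open>The parameter \<open>p\<close> over \<open>c\<close> cuts the forward gap into
  fundamental intervals, whose images are the tiles: \<open>D0\<close> begins at \<open>p\<close>,
  and \<open>Dm\<close>, \<open>Dp\<close> are its neighbours. \<open>U\<close> is the disk they
  fill, \<open>D'\<close> the disk of the rest of the circle.\<close>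

locale wheel_tile = wheel_para +
 fixes x y p :: real
 assumes fx: "l x = x" "l y = y" and xy: "x < y" "y < x+2*pi"
  and up: "!!t. x < t ==> t < y ==> t < l t" and p: "x < p" "p < y" "F p = c"
begin

abbreviation "D0 \<equiv> F ` {p..l p}"
abbreviation "Dm \<equiv> F ` {l' p..p}"
abbreviation "Dp \<equiv> F ` {l p..l (l p)}"
abbreviation "U \<equiv> F ` {x..y}"
abbreviation "D' \<equiv> F ` {y..x+2*pi}"

lemma lp: "x < l' p" "l' p < p" "p < l p" "l p < l (l p)" "l (l p) < y" "l p < y"
 using iter_up_range[OF fx p(1,2), of 1] iter_up_range[OF fx p(1,2), of 2] up[of p] up[of "l p"] up[of "l' p"] p
 by (auto simp: ll' numeral_2_eq_2)

lemma Fx: "F x = c" "F y = c" "F (x+2*pi) = c" using fx fix_c per by auto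

lemma Fp: "F (l p) = c" "F (l' p) = c" "F (l (l p)) = c" using p by (simp_all add: Fl_c Fl'_c)

text \<open>A full fundamental interval from \<open>q\<close> to \<open>l q\<close> between
  \<open>s\<close> and \<open>s'\<close> leaves enough parameters over \<open>c\<close> to separate
  both lifts from their images, so \<open>link_contra\<close> applies.\<close>

lemma sep:
 assumes "x < s" "s <= q" "l q <= s'" "s' < y" "x < q" "q < y" "F q = c" "F s = F s'"
 shows "F s = c"
proof (rule ccontr)
 assume n: "F s ~= c"
 have ss: "s < y" "x < s'" using assms up[of q] by auto
 obtain \<kappa> where k: "s < \<kappa>" "\<kappa> <= l s" "F \<kappa> = c" using orbit_between[OF fx up p] assms ss by blast
 obtain \<kappa>' where k': "s' < \<kappa>'" "\<kappa>' <= l s'" "F \<kappa>' = c" using orbit_between[OF fx up p] assms ss by blast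
 have "l s' < y" using l_less[of s' y] assms fx by simp
 moreover have "F (l q) = c" using assms Fl_c by simp
 ultimately show False
  by (intro link_contra[of x s \<kappa> "l q" s' \<kappa>']) (use k k' assms Fx xy n in auto)
qed

lemma far_right:
 assumes "z : D0" "z : F ` {l (l p)..y}" shows "z = c"
proof -
 obtain s s' where s: "p <= s" "s <= l p" "z = F s" "l (l p) <= s'" "s' <= y" "z = F s'" using assms by auto
 show ?thesis
 proof (cases "s' = y")
  case True then show ?thesis using s Fx by simp
 next
  case False
  then have "F s = c" by (intro sep[of s "l p" s']) (use s lp p Fp in auto)
  then show ?thesis using s by simp
 qed
qed

lemma far_left:
 assumes "z : D0" "z : F ` {x..l' p}" shows "z = c"
proof -
 obtain s s' where s: "p <= s" "s <= l p" "z = F s" "x <= s'" "s' <= l' p" "z = F s'" using assms by auto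
 show ?thesis
 proof (cases "s' = x")
  case True then show ?thesis using s Fx by simp
 next
  case False
  then have "F s' = c" by (intro sep[of s' "l' p" s]) (use s lp p Fp in \<open>auto simp: ll'\<close>)
  then show ?thesis using s by simp
 qed
qed

lemma Dm_Dp: assumes "z : Dm" "z : Dp" shows "z = c"
proof -
 obtain s s' where s: "l' p <= s" "s <= p" "z = F s" "l p <= s'" "s' <= l (l p)" "z = F s'" using assms by auto
 then have "F s = c" by (intro sep[of s p s']) (use s lp p Fp in auto)
 then show ?thesis using s by simp
qed

lemma c_in: "c : Dm" "c : D0" "c : Dp" "c : D'" "c : U"
 using image_eqI[of c F p "{l' p..p}"] image_eqI[of c F p "{p..l p}"] image_eqI[of c F "l p" "{l p..l (l p)}"]
  image_eqI[of c F y "{y..x+2*pi}"] image_eqI[of c F y "{x..y}"] lp p Fp Fx xy by auto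

lemma HDm: "H ` Dm = D0" "H ` D0 = Dp" "H ` D' = D'" "H ` U = U"
proof -
 have im: "H ` (F ` {s..t}) = F ` {l s..l t}" for s t
 proof -
  have "l ` {s..t} = {l s..l t}"
  proof
   show "{l s..l t} <= l ` {s..t}"
   proof
    fix w assume w: "w : {l s..l t}"
    then have "l' w : {s..t}" using l_le[of s "l' w"] l_le[of "l' w" t] by (simp add: ll')
    then show "w : l ` {s..t}" by (metis imageI ll')
   qed
  qed auto
  then have "F ` {l s..l t} = F ` (l ` {s..t})" by simp
  then show ?thesis by (simp add: image_image FH)
 qed
 show "H ` Dm = D0" "H ` D0 = Dp" "H ` D' = D'" "H ` U = U" unfolding im using fx l_per by (simp_all add: ll')
qed

lemma H_Int: "A <= S2 ==> B <= S2 ==> H ` (A Int B) = H ` A Int H ` B"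
 using H_inj by (intro inj_on_image_Int[of H S2]) (auto simp: inj_on_def)

lemma D0_disk: "closed_disk D0" "c : bdry D0"
 using disk[of p "l p"] ends[of p "l p"] lp p xy by auto

text \<open>The interval complementary to the tile is cut at the neighbouring tiles and at both
  fixed parameters; the parts of \<open>U\<close> beyond the neighbours meet \<open>D0\<close> only
  in \<open>c\<close>.\<close>

lemma tile_boundary: "bdry D0 = (Dm Int D0) Un (D0 Int Dp) Un (D0 Int D')"
proof -
 have "bdry D0 = D0 Int F ` {l p..p+2*pi}" using bdry_eq[of p "l p"] lp p xy by simp
 also have "F ` {l p..p+2*pi} = Dp Un F ` {l (l p)..y} Un D' Un F ` {x+2*pi..l' p+2*pi} Un F ` {l' p+2*pi..p+2*pi}"
  using image_split[of "l p" "l (l p)" "p+2*pi"] image_split[of "l (l p)" y "p+2*pi"]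
   image_split[of y "x+2*pi" "p+2*pi"] image_split[of "x+2*pi" "l' p+2*pi" "p+2*pi"] lp p xy by auto
 also have "\<dots> = Dp Un F ` {l (l p)..y} Un D' Un F ` {x..l' p} Un Dm" by (simp only: shift_image)
 finally have b: "bdry D0 = D0 Int (Dp Un F ` {l (l p)..y} Un D' Un F ` {x..l' p} Un Dm)" .
 have "D0 Int F ` {l (l p)..y} <= {c}" "D0 Int F ` {x..l' p} <= {c}" using far_right far_left by blast+
 then show ?thesis unfolding b using c_in by blast
qed

lemma triples:
 assumes "w ~= c" "w : Dm" "w : D0" "w : D'" "v ~= c" "v : Dm" "v : D0" "v : D'" shows "v = w"
proof -
 have sub: "D' <= F ` {l p..l' p+2*pi}" using lp xy by (intro image_mono) auto
 show ?thesis
  by (rule triple_at_most_two[of "l' p" p "l p" c v w]) (use assms sub c_in lp p xy in auto)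
qed

lemma triples':
 assumes "w ~= c" "w : D0" "w : Dp" "w : D'" "v ~= c" "v : D0" "v : Dp" "v : D'" shows "v = w"
proof -
 have sub: "D' <= F ` {l (l p)..p+2*pi}" using lp xy p by (intro image_mono) auto
 show ?thesis
  by (rule triple_at_most_two[of p "l p" "l (l p)" c v w]) (use assms sub c_in lp p xy in auto)
qed

text \<open>The intersections with the two neighbours meet only in \<open>c\<close>, so they occupy
  opposite ends of a boundary loop from \<open>c\<close>, after reversal if necessary; the middle
  arc borders \<open>D'\<close>. Each corner is the only point besides \<open>c\<close> common to
  \<open>D0\<close>, that neighbour and \<open>D'\<close>, whence \<open>H\<close> takes
  \<open>gm a\<close> to \<open>gm b\<close>.\<close>

lemma tile_loop:
 obtains gm a b where "simple_path gm" "pathstart gm = c" "pathfinish gm = c" "path_image gm = bdry D0"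
  "0 < a" "a < b" "b < 1" "Dm Int D0 = gm ` {0..a}" "D0 Int Dp = gm ` {b..1}" "D0 Int D' - {c} = gm ` {a..b}" "H (gm a) = gm b"
proof -
 have con0: "connected (Dm Int D0)" using connected_Int_consecutive[of "l' p" p "l p"] lp p xy by simp
 have con1: "connected (D0 Int Dp)" using connected_Int_consecutive[of p "l p" "l (l p)"] lp p xy by simp
 have nt0: "Dm Int D0 ~= {c}"
  using consecutive_Int_nontrivial[of "l' p" p "l p"] ends[of "l' p" "l p"] lp p xy Fp by auto
 have nt1: "D0 Int Dp ~= {c}"
  using consecutive_Int_nontrivial[of p "l p" "l (l p)"] ends[of p "l (l p)"] lp p xy Fp by auto
 have cap: "(Dm Int D0) Int (D0 Int Dp) <= {c}" using Dm_Dp by blast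
 have cl: "closed (Dm Int D0)" "closed (D0 Int Dp)" "closed (D0 Int D')" by (intro closed_Int closed_im)+
 have main: "EX a b. 0 < a & a < b & b < 1 & Dm Int D0 = gm ` {0..a} & D0 Int Dp = gm ` {b..1}"
  if g: "simple_path gm" "pathstart gm = c" "pathfinish gm = c" "path_image gm = bdry D0"
   and A: "0 < a0" "a0 <= b0" "b0 <= 1" "Dm Int D0 = gm ` ({0..a0} Un {b0..1})"
   and B: "0 <= a1" "a1 <= b1" "b1 <= 1" "D0 Int Dp = gm ` ({0..a1} Un {b1..1})" for gm a0 b0 a1 b1
 proof -
  have g01: "gm 0 = c" "gm 1 = c" using g by (auto simp: pathstart_def pathfinish_def)
  have gc: "gm t ~= c" if "0 < t" "t < 1" for t
   using simple_loop_inj[OF g(1), of 0 t] g01 that by auto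
  have no: False if "0 < t" "t < 1" "t : {0..a0} Un {b0..1}" "t : {0..a1} Un {b1..1}" for t
  proof -
   have "gm t : (Dm Int D0) Int (D0 Int Dp)" unfolding A(4) B(4) using that by blast
   then show False using cap gc that by blast
  qed
  have a10: "a1 = 0"
  proof (rule ccontr)
   assume "a1 ~= 0"
   then have a1: "0 < a1" using B by auto
   define t where "t = min (min a0 a1) (1/2)"
   have "0 < t" "t < 1" "t <= a0" "t <= a1" using a1 A(1) unfolding t_def by linarith+
   then show False using no[of t] by auto
  qed
  have b1: "b1 < 1"
  proof (rule ccontr)
   assume "~ b1 < 1"
   then have "b1 = 1" using B by simp
   then have "D0 Int Dp = {c}" using B(4) a10 g01 by auto
   then show False using nt1 by simp
  qed
  have b0: "b0 = 1"
  proof (rule ccontr)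
   assume "b0 ~= 1"
   then have b0: "b0 < 1" using A by auto
   define t where "t = max (max b0 b1) (1/2)"
   have "0 < t" "t < 1" "b0 <= t" "b1 <= t" using b0 b1 unfolding t_def by linarith+
   then show False using no[of t] by auto
  qed
  have a0b: "a0 < b1"
  proof (rule ccontr)
   assume n: "~ a0 < b1"
   show False
   proof (cases "b1 = 0")
    case True
    define t where "t = min a0 (1/2)"
    have "0 < t" "t < 1" "t <= a0" using A(1) unfolding t_def by linarith+
    then show False using no[of t] True by auto
   next
    case False
    then show False using no[of b1] n A B b1 by auto
   qed
  qed
  have "Dm Int D0 = gm ` {0..a0}"
  proof -
   have "c : gm ` {0..a0}" using image_eqI[of c gm 0 "{0..a0}"] g01(1) A(1) by simp
   then have "gm ` {1..1} <= gm ` {0..a0}" using g01(2) by simp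
   then show ?thesis unfolding A(4) b0 image_Un by blast
  qed
  moreover have "D0 Int Dp = gm ` {b1..1}"
  proof -
   have "c : gm ` {b1..1}" using image_eqI[of c gm 1 "{b1..1}"] g01(2) b1 by simp
   then have "gm ` {0..0} <= gm ` {b1..1}" using g01(1) by simp
   then show ?thesis unfolding B(4) a10 image_Un by blast
  qed
  ultimately show ?thesis using A a0b b1 by blast
 qed
 obtain gm0 where g0: "simple_path gm0" "pathstart gm0 = c" "pathfinish gm0 = c" "path_image gm0 = bdry D0"
  using closed_disk_boundary_loop[OF D0_disk] by blast
 have "EX gm a b. simple_path gm & pathstart gm = c & pathfinish gm = c & path_image gm = bdry D0 &
   0 < a & a < b & b < 1 & Dm Int D0 = gm ` {0..a} & D0 Int Dp = gm ` {b..1}"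
 proof -
  have sub: "Dm Int D0 <= path_image gm0" "D0 Int Dp <= path_image gm0" using g0(4) tile_boundary by auto
  obtain a0 b0 where A: "0 <= a0" "a0 <= b0" "b0 <= 1" "Dm Int D0 = gm0 ` ({0..a0} Un {b0..1})"
   using simple_loop_subcontinuum[OF g0(1-3) cl(1) con0 sub(1)] c_in by blast
  obtain a1 b1 where B: "0 <= a1" "a1 <= b1" "b1 <= 1" "D0 Int Dp = gm0 ` ({0..a1} Un {b1..1})"
   using simple_loop_subcontinuum[OF g0(1-3) cl(2) con1 sub(2)] c_in by blast
  show ?thesis
  proof (cases "a0 = 0")
   case False
   then have "0 < a0" using A by simp
   from main[OF g0 this A(2-4) B] g0 show ?thesis by blast
  next
   case True
   have "b0 < 1"
   proof (rule ccontr)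
    assume "~ b0 < 1"
    then have "b0 = 1" using A by simp
    then have "Dm Int D0 = {c}" using A(4) True g0 by (auto simp: pathstart_def pathfinish_def)
    then show False using nt0 by simp
   qed
   define gm where "gm = reversepath gm0"
   have g: "simple_path gm" "pathstart gm = c" "pathfinish gm = c" "path_image gm = bdry D0"
    using g0 by (auto simp: gm_def simple_path_reversepath)
   have rev: "gm0 ` ({0..s} Un {t..1}) = gm ` ({0..1 - t} Un {1 - s..1})" if "0 <= s" "t <= 1" for s t
   proof -
    have "(%u. 1 - u) ` ({0..1 - t} Un {1 - s..1}) = {t..1} Un {0..s}" using that by (simp add: image_Un image_diff_atLeastAtMost)
    then have "gm0 ` ({t..1} Un {0..s}) = gm ` ({0..1 - t} Un {1 - s..1})"
     unfolding gm_def reversepath_def by (metis image_image)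
    then show ?thesis by (simp add: Un_commute)
   qed
   have A': "Dm Int D0 = gm ` ({0..1 - b0} Un {1 - a0..1})" using A rev by simp
   have B': "D0 Int Dp = gm ` ({0..1 - b1} Un {1 - a1..1})" using B rev by simp
   have "0 < 1 - b0" using \<open>b0 < 1\<close> by simp
   have "EX a b. 0 < a & a < b & b < 1 & Dm Int D0 = gm ` {0..a} & D0 Int Dp = gm ` {b..1}"
    by (rule main[OF g \<open>0 < 1 - b0\<close> _ _ A' _ _ _ B']) (use A B in auto)
   then show ?thesis using g by blast
  qed
 qed
 then obtain gm a b where g: "simple_path gm" "pathstart gm = c" "pathfinish gm = c" "path_image gm = bdry D0"
   and ab: "0 < a" "a < b" "b < 1" and k0: "Dm Int D0 = gm ` {0..a}" and k1: "D0 Int Dp = gm ` {b..1}"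
  by (elim exE conjE) (rule that)
 have g01: "gm 0 = c" "gm 1 = c" using g by (auto simp: pathstart_def pathfinish_def)
 have gc: "gm t ~= c" if "0 < t" "t < 1" for t
  using simple_loop_inj[OF g(1), of 0 t] g01 that by auto
 have contg: "continuous_on {0..1} gm" using g(1) by (simp add: simple_path_def path_def)
 have mem: "t : {s..s'}" if "gm t : gm ` {s..s'}" and t: "0 < t" "t < 1" "0 <= s" "s' <= 1" for t s s'
 proof -
  from that(1) obtain u where u: "u : {s..s'}" "gm t = gm u" by blast
  have "u = t" by (rule simple_loop_inj[OF g(1) u(2)[symmetric]]) (use u t in auto)
  then show ?thesis using u by simp
 qed
 have mid: "gm t : D0 Int D'" if t: "a < t" "t < b" for t
 proof -
  have "gm t : bdry D0" unfolding g(4)[symmetric] path_image_def using t ab by auto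
  moreover have "gm t ~: gm ` {0..a}" "gm t ~: gm ` {b..1}"
   using mem[of t 0 a] mem[of t b 1] t ab by fastforce+
  ultimately show ?thesis using tile_boundary k0 k1 by blast
 qed
 have closure_in: "gm ` {a..b} <= D0 Int D'"
 proof -
  have "gm ` closure {a<..<b} <= D0 Int D'"
   by (rule image_closure_subset) (use mid cl ab in \<open>auto intro: continuous_on_subset[OF contg]\<close>)
  then show ?thesis using ab by simp
 qed
 have ga: "gm a : Dm Int D0" "gm a : D'" "gm a ~= c" using k0 closure_in gc[of a] ab by auto
 have gb: "gm b : D0 Int Dp" "gm b : D'" "gm b ~= c" using k1 closure_in gc[of b] ab by auto
 have bet: "D0 Int D' - {c} = gm ` {a..b}"
 proof
  have "c ~: gm ` {a..b}"
  proof
   assume "c : gm ` {a..b}"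
   then obtain t where "a <= t" "t <= b" "gm t = c" by auto
   then show False using gc[of t] ab by simp
  qed
  then show "gm ` {a..b} <= D0 Int D' - {c}" using closure_in by blast
  show "D0 Int D' - {c} <= gm ` {a..b}"
  proof
   fix w assume w: "w : D0 Int D' - {c}"
   then have "w : path_image gm" using tile_boundary g(4) by blast
   then obtain t where t: "0 <= t" "t <= 1" "w = gm t" by (auto simp: path_image_def)
   consider "t : {0..a}" | "t : {b..1}" | "t : {a..b}" using t by fastforce
   then show "w : gm ` {a..b}"
   proof cases
    case 1
    then have "w : Dm" using k0 t by blast
    then have "w = gm a" using triples[of "gm a" w] w ga by blast
    then show ?thesis using ab by auto
   next
    case 2
    then have "w : Dp" using k1 t by blast
    then have "w = gm b" using triples'[of "gm b" w] w gb by blast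
    then show ?thesis using ab by auto
   qed (use t in blast)
  qed
 qed
 have "H (gm a) = gm b"
 proof (rule triples'[of "gm b" "H (gm a)"])
  show "H (gm a) : D0" "H (gm a) : Dp" "H (gm a) : D'" using ga HDm by blast+
  have "gm a : S2" using ga F_in by auto
  then show "H (gm a) ~= c" using H_inj[of "gm a" c] cS Hc ga by auto
 qed (use gb in auto)
 then show thesis using that[OF g ab k0 k1 bet] by blast
qed

lemma Hz_image: "Hz j ` (F ` {s..t}) = F ` {lz j s..lz j t}"
proof -
 have "lz j ` {s..t} = {lz j s..lz j t}"
 proof
  show "lz j ` {s..t} <= {lz j s..lz j t}" using lz_mono[of j] by (auto simp: strict_mono_less_eq)
  show "{lz j s..lz j t} <= lz j ` {s..t}"
  proof
   fix w assume w: "w : {lz j s..lz j t}"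
   have e: "lz j (lz (- j) w) = w" "lz (- j) (lz j v) = v" for v using lz_add[of j "- j" w] lz_add[of "- j" j v] by auto
   have "lz (- j) w : {s..t}" using w lz_mono[of "- j"] e(2)[of s] e(2)[of t] strict_mono_less_eq[of "lz (- j)"] by (metis atLeastAtMost_iff)
   then show "w : lz j ` {s..t}" using e(1) by (metis imageI)
  qed
 qed
 then have "F ` {lz j s..lz j t} = F ` (lz j ` {s..t})" by simp
 then show ?thesis by (simp add: image_image Hz_F)
qed

lemma Hz_c: "Hz j c = c"
proof -
 have "l' x = x" using fx by (simp add: l'_fix)
 then have "(l ^^ n) x = x" "(l' ^^ n) x = x" for n by (induction n) (simp_all add: fx)
 then have "lz j x = x" by (simp add: lz_def)
 then show ?thesis using Hz_F[of j x] Fx by simp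
qed

end

section \<open>The tiling, its boundary line and the half plane it fills\<close>

context wheel_tile
begin

lemma lz_range: "x < t ==> t < y ==> x < lz j t & lz j t < y"
 using iter_up_range[OF fx] by (auto simp: lz_def)

lemma lz_p_mono: "i <= j ==> lz i p <= lz j p"
proof (induction j rule: int_ge_induct)
 case (step j)
 have "lz j p < l (lz j p)" using up[of "lz j p"] lz_range[OF p(1,2), of j] by blast
 then show ?case using step by (simp add: lz_Suc)
qed simp

lemma lz_tile: "lz j (l p) = lz (j+1) p" using lz_add[of j 1 p] lz_Suc[of 0 p] by simp

lemma tile_index:
 assumes t: "x < t" "t < y" shows "EX j. lz j p <= t & t <= lz (j+1) p"
proof -
 consider "p < t" | "t = p" | "t < p" by linarith
 then show ?thesis
 proof cases
  case 1
  obtain k where k: "(l ^^ k) p < t" "t <= (l ^^ Suc k) p" by (rule fundamental_iterate[OF fx up p(1) 1 t(2)])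
  have "lz (int k) p = (l ^^ k) p" "lz (int k+1) p = (l ^^ Suc k) p"
   by (simp_all add: lz_def nat_add_distrib)
  then show ?thesis using k by (intro exI[of _ "int k"]) auto
 next
  case 2
  then show ?thesis using lp by (intro exI[of _ 0]) (simp add: lz_Suc[of 0, simplified])
 next
  case 3
  obtain k where k: "(l ^^ k) t < p" "p <= (l ^^ Suc k) t" by (rule fundamental_iterate[OF fx up t(1) 3 p(2)])
  have e: "lz (int k) t = (l ^^ k) t" "lz (int k+1) t = (l ^^ Suc k) t" by (simp_all add: lz_def nat_add_distrib)
  have "lz (- int k) (lz (int k) t) < lz (- int k) p" using k e lz_mono[of "- int k"] by (simp add: strict_mono_less)
  then have "t < lz (- int k) p" using lz_add[of "- int k" "int k" t] by simp
  moreover have "lz (- (int k+1)) p <= lz (- (int k+1)) (lz (int k+1) t)"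
   using k e lz_mono[of "- (int k+1)"] by (simp add: strict_mono_less_eq)
  then have "lz (- (int k+1)) p <= t" using lz_add[of "- (int k+1)" "int k+1" t] by simp
  ultimately show ?thesis by (intro exI[of _ "- (int k+1)"]) auto
 qed
qed

lemma Hz_D': "Hz j ` D' = D'"
proof -
 have "lz j y = y & lz j (x+2*pi) = x+2*pi"
 proof -
  have "l (x+2*pi) = x+2*pi" using fx l_per by simp
  then have "l' y = y" "l' (x+2*pi) = x+2*pi" using fx by (simp_all add: l'_fix)
  then have "(l ^^ n) y = y" "(l' ^^ n) y = y" "(l ^^ n) (x+2*pi) = x+2*pi" "(l' ^^ n) (x+2*pi) = x+2*pi" for n
   using fx \<open>l (x+2*pi) = x+2*pi\<close> by (induction n) simp_all
  then show ?thesis by (simp add: lz_def)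
 qed
 then show ?thesis using Hz_image by simp
qed

lemma D0_S2: "D0 <= S2" "D' <= S2" using F_in by auto

lemma tiles_cover: "(\<Union>j. Hz j ` (D0 - {c})) = U - {c}"
proof
 show "(\<Union>j. Hz j ` (D0 - {c})) <= U - {c}"
 proof
  fix z assume "z : (\<Union>j. Hz j ` (D0 - {c}))"
  then obtain j w where w: "w : D0" "w ~= c" "z = Hz j w" by blast
  have "w : S2" using w D0_S2 by blast
  then have "z ~= c" using Hz_inj[OF _ cS, of w j] Hz_c w by metis
  moreover obtain t where t: "p <= t" "t <= l p" "w = F t" using w by auto
  have "x < lz j t" "lz j t < y" using lz_range[of t j] t p lp by auto
  then have "z : U" using w t Hz_F by auto
  ultimately show "z : U - {c}" by blast
 qed
 show "U - {c} <= (\<Union>j. Hz j ` (D0 - {c}))"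
 proof
  fix z assume z: "z : U - {c}"
  then obtain t where t: "x <= t" "t <= y" "z = F t" by auto
  then have "x < t" "t < y" using z Fx by (auto simp: less_le)
  then obtain j where j: "lz j p <= t" "t <= lz (j+1) p" using tile_index by blast
  then have "z : Hz j ` D0" unfolding Hz_image lz_tile using t by auto
  then obtain w where w: "w : D0" "z = Hz j w" by blast
  then have "w ~= c" using Hz_c z by auto
  then show "z : (\<Union>j. Hz j ` (D0 - {c}))" using w by blast
 qed
qed

lemma tiles_far:
 assumes "\<bar>j\<bar> >= 2" shows "(D0 - {c}) Int Hz j ` (D0 - {c}) = {}"
proof (rule ccontr)
 assume "~ ?thesis"
 then obtain z w where z: "z : D0" "z ~= c" "w : D0" "z = Hz j w" by blast
 then have zj: "z : F ` {lz j p..lz (j+1) p}" unfolding lz_tile[symmetric] Hz_image[symmetric] by blast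
 consider "j >= 2" | "j+1 <= -1" using assms by linarith
 then show False
 proof cases
  case 1
  have "lz 2 p <= lz j p" by (rule lz_p_mono[OF 1])
  moreover have "lz 2 p = l (l p)" using lz_Suc[of 1 p] lz_Suc[of 0 p] by simp
  moreover have "lz (j+1) p < y" using lz_range p by blast
  ultimately have "{lz j p..lz (j+1) p} <= {l (l p)..y}" by auto
  then have "z : F ` {l (l p)..y}" using zj by blast
  then show False using far_right z by blast
 next
  case 2
  have "lz (j+1) p <= lz (-1) p" by (rule lz_p_mono[OF 2])
  moreover have "lz (-1) p = l' p" using lz_pred[of 0 p] by simp
  moreover have "x < lz j p" using lz_range p by blast
  ultimately have "{lz j p..lz (j+1) p} <= {x..l' p}" by auto
  then have "z : F ` {x..l' p}" using zj by blast
  then show False using far_left z by blast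
 qed
qed

text \<open>Tiles of large index come from parameters near \<open>x\<close> or \<open>y\<close>,
  both of which lie over \<open>c\<close>.\<close>

lemma tiles_shrink:
 assumes "e > 0" obtains N :: nat where "!!j z. \<bar>j\<bar> >= int N ==> z : Hz j ` D0 ==> dist z c < e"
proof -
 obtain d where d: "d > 0" "!!s t. \<bar>s - t\<bar> < d ==> dist (F s) (F t) < e" using F_uniform[OF assms] by metis
 obtain N1 where N1: "!!n. n >= N1 ==> dist ((l ^^ n) p) y < d"
  using forward_limits(1)[OF fx up p(1,2)] d(1) metric_LIMSEQ_D by blast
 obtain N2 where N2: "!!n. n >= N2 ==> dist ((l' ^^ n) p) x < d"
  using forward_limits(2)[OF fx up p(1,2)] d(1) metric_LIMSEQ_D by blast
 define N where "N = N1 + N2+1"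
 have "dist z c < e" if j: "\<bar>j\<bar> >= int N" and z: "z : Hz j ` D0" for j z
 proof -
  obtain t where t: "lz j p <= t" "t <= lz (j+1) p" "z = F t" using z unfolding Hz_image lz_tile by auto
  have r: "x < lz j p" "lz (j+1) p < y" using lz_range p by blast+
  show ?thesis
  proof (cases "0 <= j")
   case True
   then have "nat j >= N1" using j by (simp add: N_def)
   then have "dist (lz j p) y < d" using N1 True by (simp add: lz_def)
   then have "dist (F t) (F y) < e" using t r by (intro d(2)) (auto simp: dist_real_def)
   then show ?thesis using t Fx by simp
  next
   case False
   then have n: "nat (- (j+1)) >= N2" "j+1 <= 0" using j by (auto simp: N_def)
   have "lz (j+1) p = (l' ^^ nat (- (j+1))) p" using n(2) by (cases "j+1 = 0") (auto simp: lz_def)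
   then have "dist (lz (j+1) p) x < d" using N2 n by simp
   then have "dist (F t) (F x) < e" using t r by (intro d(2)) (auto simp: dist_real_def)
   then show ?thesis using t Fx by simp
  qed
 qed
 then show thesis using that[of N] by blast
qed

text \<open>The common border of the two half planes, parametrised so that \<open>H\<close> acts as
  the unit shift. The notion is symmetric in \<open>U\<close> and \<open>D'\<close>, so one line can
  serve both sides. The last clause says that it is proper in the sphere without
  \<open>c\<close>.\<close>

definition equivariant_line :: "(real => real^3) => bool" where
 "equivariant_line lam \<longleftrightarrow> continuous_on UNIV lam & inj lam & range lam = U Int D' - {c} & (ALL u. lam (u+1) = H (lam u)) &
   (ALL e>0. EX n. ALL u. \<bar>u\<bar> >= n --> dist (lam u) c < e)"

lemma equivariant_line_exists: "EX lam. equivariant_line lam"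
proof -
 obtain gm a b where g: "simple_path gm" "pathstart gm = c" "pathfinish gm = c" "path_image gm = bdry D0"
  and ab: "0 < a" "a < b" "b < 1" and k0: "Dm Int D0 = gm ` {0..a}" and k1: "D0 Int Dp = gm ` {b..1}"
  and bt: "D0 Int D' - {c} = gm ` {a..b}" and Hg: "H (gm a) = gm b"
  by (rule tile_loop)
 have contg: "continuous_on {0..1} gm" using g(1) by (simp add: simple_path_def path_def)
 define W where "W = {z::complex. Im z = 0}"
 define \<psi> where "\<psi> = (%z::complex. gm (a+(b - a) * Re z))"
 let ?W0 = "{z : W. 0 <= Re z & Re z <= 0+1}"
 have rng: "a+(b - a) * u : {a..b}" if "0 <= u" "u <= 1" for u
  
 proof -
  have 1: "(b - a) * u <= (b - a) * 1" using that ab by (intro mult_left_mono) auto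
  have "0 <= (b - a) * u" using that ab by simp
  then have "a <= a+(b - a) * u" by simp
  moreover have "a+(b - a) * u <= a+(b - a) * 1" using 1 by (rule add_left_mono)
  ultimately show ?thesis by simp
 qed
 have im: "\<psi> ` ?W0 = D0 Int D' - {c}"
 proof
  show "\<psi> ` ?W0 <= D0 Int D' - {c}" unfolding bt \<psi>_def using rng by auto
  show "D0 Int D' - {c} <= \<psi> ` ?W0"
  proof
   fix z assume "z : D0 Int D' - {c}"
   then obtain t where t: "a <= t" "t <= b" "z = gm t" unfolding bt by auto
   define u where "u = (t - a) / (b - a)"
   have "0 <= u" "u <= 1" "a+(b - a) * u = t" using t ab by (auto simp: u_def field_simps)
   then have "z = \<psi> (of_real u)" "of_real u : ?W0" using t by (auto simp: \<psi>_def W_def)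
   then show "z : \<psi> ` ?W0" by blast
  qed
 qed
 have far: "\<psi> ` ?W0 Int Hz j ` (\<psi> ` ?W0) = {}" if "\<bar>j\<bar> >= 2" for j
  unfolding im using tiles_far[OF that] by blast
 have near: "Re z = 0+1" if z: "z : ?W0" "\<psi> z : H ` (\<psi> ` ?W0)" for z
 proof -
  have "\<psi> z : D0 Int D' - {c}" using im z(1) by blast
  moreover have "\<psi> z : Dp" using z(2) im HDm(2) by blast
  moreover have "gm b : D0 Int Dp" using k1 ab by auto
  moreover have "gm b : D0 Int D' - {c}" unfolding bt using ab by auto
  ultimately have "\<psi> z = gm b" using triples'[of "gm b" "\<psi> z"] by blast
  then have "gm (a+(b - a) * Re z) = gm b" by (simp add: \<psi>_def)
  then have "a+(b - a) * Re z = b" by (rule simple_loop_inj[OF g(1)]) (use rng[of "Re z"] z ab in auto)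
  then have "(b - a) * Re z = (b - a) * 1" by (simp only: mult_1_right eq_diff_eq add.commute)
  then show ?thesis using ab by simp
 qed
 obtain \<Psi> where P: "continuous_on W \<Psi>" "inj_on \<Psi> W" "\<Psi> ` W = (\<Union>j. Hz j ` (\<psi> ` ?W0))"
  "!!z. z : W ==> \<Psi> (z+1) = H (\<Psi> z)" "!!z. z : ?W0 ==> \<Psi> z = \<psi> z"
  "!!z. z : W ==> EX w:?W0. EX j::int. z = w + of_int j & \<Psi> z = Hz j (\<psi> w)"
 proof (rule equivariant_extension[of W 0 \<psi>])
  show "closed W" unfolding W_def by (intro closed_Collect_eq continuous_intros)
  show "z + of_int j : W" if "z : W" for z and j :: int using that by (simp add: W_def)
  show "continuous_on ?W0 \<psi>" unfolding \<psi>_def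
  proof (rule continuous_on_compose2[OF contg])
   show "continuous_on ?W0 (%z. a+(b - a) * Re z)" by (intro continuous_intros)
   show "(%z. a+(b - a) * Re z) ` ?W0 <= {0..1}" using rng ab by fastforce
  qed
  show "inj_on \<psi> ?W0"
  proof (rule inj_onI)
   fix z w assume zw: "z : ?W0" "w : ?W0" "\<psi> z = \<psi> w"
   have "a+(b - a) * Re z = a+(b - a) * Re w"
   proof (rule simple_loop_inj[OF g(1)])
    show "gm (a+(b - a) * Re z) = gm (a+(b - a) * Re w)" using zw(3) by (simp add: \<psi>_def)
    have "a+(b - a) * Re z : {a..b}" "a+(b - a) * Re w : {a..b}" using zw by (auto intro!: rng simp del: atLeastAtMost_iff)
    then show "a+(b - a) * Re z : {0..1}" "a+(b - a) * Re w : {0..1}"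
     "a+(b - a) * Re w ~= 0" "a+(b - a) * Re w ~= 1" using ab unfolding atLeastAtMost_iff by linarith+
   qed
   then show "z = w" using zw ab by (auto simp: complex_eq_iff W_def)
  qed
  show "\<psi> ` ?W0 <= S2" unfolding im using D0_S2 by blast
  show "\<psi> (z+1) = H (\<psi> z)" if "z : W" "Re z = 0" for z using that Hg by (simp add: \<psi>_def)
  show "\<psi> ` ?W0 Int Hz j ` (\<psi> ` ?W0) = {}" if "\<bar>j\<bar> >= 2" for j using that by (rule far)
  show "Re z = 0+1" if "z : ?W0" "\<psi> z : H ` (\<psi> ` ?W0)" for z using that by (rule near)
 qed (rule that)
 define lam where "lam = (%u::real. \<Psi> (of_real u))"
 have ofW: "of_real u : W" for u :: real by (simp add: W_def)
 have "continuous_on UNIV lam" unfolding lam_def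
  by (rule continuous_on_compose2[OF P(1)]) (use ofW in \<open>auto intro: continuous_intros\<close>)
 moreover have "inj lam"
 proof (rule injI)
  fix u v assume "lam u = lam v"
  then have "complex_of_real u = of_real v" using inj_onD[OF P(2) _ ofW ofW] by (simp add: lam_def)
  then show "u = v" by simp
 qed
 moreover have "range lam = U Int D' - {c}"
 proof -
  have "W = range of_real"
  proof
   show "W <= range of_real"
   proof
    fix z assume "z : W"
    then have "z = of_real (Re z)" by (simp add: W_def complex_eq_iff)
    then show "z : range of_real" by (rule range_eqI)
   qed
  qed (use ofW in blast)
  then have "range lam = \<Psi> ` W" by (simp add: lam_def image_image)
  also have "\<dots> = (\<Union>j. Hz j ` (D0 Int D' - {c}))" using P(3) im by simp
  also have "\<dots> = U Int D' - {c}"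
  proof
   show "(\<Union>j. Hz j ` (D0 Int D' - {c})) <= U Int D' - {c}"
    using tiles_cover Hz_D' by blast
   show "U Int D' - {c} <= (\<Union>j. Hz j ` (D0 Int D' - {c}))"
   proof
    fix z assume z: "z : U Int D' - {c}"
    then obtain j w where w: "w : D0 - {c}" "z = Hz j w" using tiles_cover by blast
    have "w : S2" using w D0_S2 by blast
    then have "w = Hz (- j) z" using Hz_inv w by simp
    then have "w : D'" using Hz_D'[of "- j"] z by blast
    then show "z : (\<Union>j. Hz j ` (D0 Int D' - {c}))" using w by blast
   qed
  qed
  finally show ?thesis .
 qed
 moreover have "lam (u+1) = H (lam u)" for u using P(4)[OF ofW[of u]] by (simp add: lam_def)
 moreover have "EX n. ALL u. \<bar>u\<bar> >= n --> dist (lam u) c < e" if e0: "e > 0" for e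
 proof -
  obtain N :: nat where N: "!!j z. \<bar>j\<bar> >= int N ==> z : Hz j ` D0 ==> dist z c < e" by (rule tiles_shrink[OF e0]) (rule that)
  have "dist (lam u) c < e" if u: "\<bar>u\<bar> >= real N+1" for u
  proof -
   obtain w and j :: int where w: "w : ?W0" "of_real u = w + of_int j" "lam u = Hz j (\<psi> w)"
    using P(6)[OF ofW[of u]] by (auto simp: lam_def)
   have "u = Re w + of_int j" using arg_cong[OF w(2), of Re] by simp
   then have "\<bar>of_int j\<bar> >= real N" using u w(1) by auto
   then have "\<bar>j\<bar> >= int N" by linarith
   moreover have "lam u : Hz j ` D0" using w im by blast
   ultimately show ?thesis by (rule N)
  qed
  then show ?thesis by blast
 qed
 ultimately have "equivariant_line lam" by (simp add: equivariant_line_def)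
 then show ?thesis by blast
qed

lemma line_int: "equivariant_line lam ==> lam (u + of_int j) = Hz j (lam u)"
proof -
 assume L: "equivariant_line lam"
 have S: "lam v : S2" for v
 proof -
  have "lam v : U Int D' - {c}" using L by (auto simp: equivariant_line_def)
  then obtain t where "lam v = F t" by blast
  then show ?thesis using F_in by simp
 qed
 have H1: "lam (v+1) = Hz 1 (lam v)" for v using L Hz_1[OF S] by (simp add: equivariant_line_def)
 show ?thesis
 proof (induction j rule: int_induct[where k = 0])
  case base then show ?case by simp
 next
  case (step1 i)
  have "lam (u + of_int (i+1)) = lam ((u + of_int i)+1)" by (simp add: algebra_simps)
  also have "\<dots> = Hz 1 (Hz i (lam u))" using H1 step1 by simp
  finally show ?case using Hz_add[OF S, of 1 i u] by (simp add: add.commute)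
 next
  case (step2 i)
  have "Hz 1 (lam (u + of_int (i - 1))) = lam ((u + of_int (i - 1))+1)" by (rule H1[symmetric])
  also have "\<dots> = Hz i (lam u)" using step2 by simp
  finally have "Hz (-1) (Hz 1 (lam (u + of_int (i - 1)))) = Hz (-1) (Hz i (lam u))" by simp
  then show ?case using Hz_inv[OF S, of 1] Hz_add[OF S, of "-1" i u] by simp
 qed
qed

text \<open>The line may stem from the tiling of the other side, so its relation to this tiling has
  to be shown. Properness makes the parameters over \<open>\<beta>\<close> a compact interval
  containing \<open>u0\<close> and \<open>u0+1\<close>. By uniqueness of the corner,
  \<open>v\<close> and \<open>v+1\<close> both belong to it only for \<open>v = u0\<close>, so it
  has length 1.\<close>

lemma line_tile:
 assumes L: "equivariant_line lam" and bet: "D0 Int D' - {c} = \<beta>" "compact \<beta>" "connected \<beta>"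
  and e0: "lam u0 : Dm" "lam u0 : \<beta>" "lam (u0+1) : \<beta>" "lam (u0+1) : Dp"
 shows "lam ` {u0..u0+1} = \<beta>"
proof -
 have cl: "continuous_on UNIV lam" "inj lam" "range lam = U Int D' - {c}" and H1: "!!u. lam (u+1) = H (lam u)"
  and far: "!!e. e > 0 ==> EX n. ALL u. \<bar>u\<bar> >= n --> dist (lam u) c < e"
  using L by (auto simp: equivariant_line_def)
 have "c ~: \<beta>" using bet by blast
 moreover have "open (- \<beta>)" using bet compact_imp_closed by blast
 ultimately obtain e where e: "e > 0" "ball c e <= - \<beta>" using openE[of "- \<beta>" c] by auto
 obtain n where n: "ALL u. \<bar>u\<bar> >= n --> dist (lam u) c < e" using far[OF e(1)] by blast
 define V where "V = {u. lam u : \<beta>}"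
 have Vn: "V <= {- n..n}"
 proof
  fix u assume "u : V"
  then have "lam u ~: ball c e" using e by (auto simp: V_def)
  then have "~ \<bar>u\<bar> >= n" using n by (auto simp: dist_commute)
  then show "u : {- n..n}" by auto
 qed
 have "EX g. homeomorphism {- n..n} (lam ` {- n..n}) lam g"
  by (rule homeomorphism_compact) (use cl in \<open>auto intro: continuous_on_subset inj_on_subset\<close>)
 then obtain g where g: "homeomorphism {- n..n} (lam ` {- n..n}) lam g" ..
 have D0U: "D0 <= U" using p lp by (intro image_mono) auto
 have bl: "\<beta> <= lam ` V"
 proof
  fix z assume z: "z : \<beta>"
  then have "z : range lam" using bet cl(3) D0U by blast
  then show "z : lam ` V" using z by (auto simp: V_def)
 qed
 have lV: "lam ` V = \<beta>" using bl by (auto simp: V_def)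
 have "g ` \<beta> = V"
 proof -
  have "g (lam v) = v" if "v : V" for v using homeomorphism_apply1[OF g] Vn that by blast
  then show ?thesis unfolding lV[symmetric] by (simp add: image_image)
 qed
 moreover have "continuous_on \<beta> g"
  by (rule continuous_on_subset[OF homeomorphism_cont2[OF g]]) (use lV Vn in blast)
 ultimately have "connected V" "compact V"
  using connected_continuous_image[of \<beta> g] compact_continuous_image[of \<beta> g] bet by auto
 then obtain m M where mM: "V = {m..M}" using connected_compact_interval_1[of V] by auto
 have "u0 : V" "u0+1 : V" using e0 by (auto simp: V_def)
 then have mu: "m <= u0" "u0+1 <= M" unfolding mM by auto
 have key: "v = u0" if v: "v : V" "v+1 : V" for v
 proof -
  have "lam (v+1) : D0 Int D' - {c}" using v bet by (simp add: V_def)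
  moreover have "lam (v+1) : Dp" using H1 v(1) bet HDm(2) by (auto simp: V_def)
  moreover have "lam (u0+1) : D0 Int D' - {c}" using e0 bet by simp
  ultimately have "lam (v+1) = lam (u0+1)" using triples'[of "lam (u0+1)" "lam (v+1)"] e0 by blast
  then show ?thesis using cl(2) by (simp add: inj_eq)
 qed
 have "m = u0" using key[of m] mu unfolding mM by auto
 moreover have "M - 1 = u0" using key[of "M - 1"] mu unfolding mM by auto
 ultimately show ?thesis using lV mM by auto
qed

text \<open>The map sends one side of a tile along the arc shared with the previous tile;
  equivariance then dictates its image under \<open>H\<close> on the opposite side, and the given
  line supplies the third. The boundary map is extended over the tile and repeated by powers of
  \<open>H\<close>.\<close>

lemma half_plane:
 assumes L: "equivariant_line lam"
 obtains \<Psi> where "continuous_on {z::complex. 0 <= Im z} \<Psi>" "inj_on \<Psi> {z. 0 <= Im z}" "\<Psi> ` {z. 0 <= Im z} = U - {c}"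
  "!!z. 0 <= Im z ==> \<Psi> (z+1) = H (\<Psi> z)" "!!u. \<Psi> (of_real u) = lam u"
proof -
 obtain gm a b where g: "simple_path gm" "pathstart gm = c" "pathfinish gm = c" "path_image gm = bdry D0"
  and ab: "0 < a" "a < b" "b < 1" and k0: "Dm Int D0 = gm ` {0..a}" and k1: "D0 Int Dp = gm ` {b..1}"
  and bt: "D0 Int D' - {c} = gm ` {a..b}" and Hg: "H (gm a) = gm b"
  by (rule tile_loop)
 have contg: "continuous_on {0..1} gm" using g(1) by (simp add: simple_path_def path_def)
 have g01: "gm 0 = c" "gm 1 = c" using g by (auto simp: pathstart_def pathfinish_def)
 have gc: "gm t ~= c" if "0 < t" "t < 1" for t
  using simple_loop_inj[OF g(1), of 0 t] g01 that by auto
 have cl: "continuous_on UNIV lam" "inj lam" "range lam = U Int D' - {c}" and H1: "!!u. lam (u+1) = H (lam u)"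
  using L by (auto simp: equivariant_line_def)
 have D0U: "D0 <= U" using p lp by (intro image_mono) auto
 have ga: "gm a : Dm Int D0" "gm a : D0 Int D' - {c}" "gm b : D0 Int Dp" "gm b : D0 Int D' - {c}"
  unfolding k0 bt k1 using ab by auto
 then have "gm a : range lam" using cl(3) D0U by blast
 then obtain u0 where u0: "lam u0 = gm a" by auto
 have u1: "lam (u0+1) = gm b" using H1 u0 Hg by simp
 have cab: "continuous_on {a..b} gm" using contg ab by (auto intro: continuous_on_subset)
 have lb: "lam ` {u0..u0+1} = gm ` {a..b}"
 proof (rule line_tile[OF L bt])
  show "compact (gm ` {a..b})" "connected (gm ` {a..b})"
   by (intro compact_continuous_image connected_continuous_image cab compact_Icc connected_Icc)+
  show "lam u0 : Dm" "lam (u0+1) : Dp" unfolding u0 u1 using ga by blast+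
  show "lam u0 : gm ` {a..b}" "lam (u0+1) : gm ` {a..b}" unfolding u0 u1 using ab by auto
 qed
 have k1H: "D0 Int Dp = H ` (gm ` {0..a})"
 proof -
  have "Dm <= S2" using F_in by auto
  then show ?thesis unfolding k0[symmetric] using H_Int[of Dm D0] D0_S2 HDm by simp
 qed
 have gS: "gm t : S2" if "0 <= t" "t <= a" for t
 proof -
  have "gm t : Dm Int D0" unfolding k0 using that by auto
  then show ?thesis using D0_S2 by blast
 qed
 \<comment> \<open>The vertical edge runs from the corner \<open>gm a\<close> at 0 up to
   \<open>c\<close> at \<open>\<i>\<close>, the bottom edge follows \<open>lam\<close> from
   \<open>gm a\<close> to \<open>gm b\<close>, and the slanted edge is the image under
   \<open>H\<close> of the vertical one.\<close>
 define b' where "b' = (%z. if Re z = 0 then gm (a * (1 - Im z)) else if Im z = 0 then lam (u0 + Re z) else H (gm (a * (1 - Im z))))"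
 define E1 where "E1 = {z : Tri. Re z = 0}"
 define E2 where "E2 = {z : Tri. Im z = 0}"
 define E3 where "E3 = {z : Tri. Re z + Im z = 1}"
 have E: "Tri_edge = E1 Un E2 Un E3" by (auto simp: Tri_edge_def E1_def E2_def E3_def)
 have clT: "closed Tri" using Tri_facts compact_imp_closed by blast
 have clE: "closed E1" "closed E2" "closed E3"
  unfolding E1_def E2_def E3_def Collect_conj_eq Collect_mem_eq
  by (intro closed_Int clT closed_Collect_eq continuous_intros)+
 have b1: "b' z = gm (a * (1 - Im z))" if "z : E1" for z using that by (simp add: b'_def E1_def)
 have b2: "b' z = lam (u0 + Re z)" if "z : E2" for z using that u0 by (auto simp: b'_def E2_def)
 have b3: "b' z = H (gm (a * (1 - Im z)))" if "z : E3" for z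
  using that u0 u1 Hg g01 Hc by (auto simp: b'_def E3_def)
 have ar: "0 <= a * (1 - Im z)" "a * (1 - Im z) <= a" if "z : Tri" for z
  using that ab mult_left_le[of "1 - Im z" a] by (auto simp: Tri_def)
 have cga: "continuous_on Tri (%z. gm (a * (1 - Im z)))"
 proof (rule continuous_on_compose2[OF contg])
  show "(%z. a * (1 - Im z)) ` Tri <= {0..1}"
  proof
   fix u assume "u : (%z. a * (1 - Im z)) ` Tri"
   then obtain z where "z : Tri" "u = a * (1 - Im z)" by blast
   then show "u : {0..1}" using order_trans[OF ar(2)[of z], of 1] ar(1)[of z] ab by simp
  qed
 qed (intro continuous_intros)
 have c1: "continuous_on E1 b'"
  by (rule continuous_on_eq[OF continuous_on_subset[OF cga]]) (auto simp: E1_def b1[unfolded E1_def])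
 have c2: "continuous_on E2 b'"
 proof -
  have "continuous_on E2 (%z. lam (u0 + Re z))" by (rule continuous_on_compose2[OF cl(1)]) (auto intro!: continuous_intros)
  then show ?thesis by (rule continuous_on_eq) (simp add: b2)
 qed
 have c3: "continuous_on E3 b'"
 proof -
  have "continuous_on E3 (%z. H (gm (a * (1 - Im z))))"
   by (rule continuous_on_compose2[OF homeomorphism_cont1[OF hom] continuous_on_subset[OF cga]])
     (use gS ar in \<open>auto simp: E3_def\<close>)
  then show ?thesis by (rule continuous_on_eq) (simp add: b3)
 qed
 have cb: "continuous_on Tri_edge b'" unfolding E
  by (intro continuous_on_closed_Un closed_Un clE c1 c2 c3)
 have im1: "b' ` E1 = gm ` {0..a}"
 proof
  show "b' ` E1 <= gm ` {0..a}" using b1 ar by (auto simp: E1_def)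
  show "gm ` {0..a} <= b' ` E1"
  proof
   fix w assume "w : gm ` {0..a}"
   then obtain t where t: "0 <= t" "t <= a" "w = gm t" by auto
   define z where "z = Complex 0 (1 - t / a)"
   have "z : E1" using t ab by (auto simp: z_def E1_def Tri_def field_simps)
   moreover have "b' z = w" unfolding b1[OF \<open>z : E1\<close>] using t ab by (simp add: z_def)
   ultimately show "w : b' ` E1" by blast
  qed
 qed
 have im2: "b' ` E2 = gm ` {a..b}"
 proof -
  have "b' ` E2 = lam ` ((%z. u0 + Re z) ` E2)" using b2 by (simp add: image_image)
  moreover have "(%z. u0 + Re z) ` E2 = {u0..u0+1}"
  proof
   show "{u0..u0+1} <= (%z. u0 + Re z) ` E2"
   proof
    fix u assume "u : {u0..u0+1}"
    then show "u : (%z. u0 + Re z) ` E2" by (intro image_eqI[of _ _ "of_real (u - u0)"]) (auto simp: E2_def Tri_def)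
   qed
  qed (auto simp: E2_def Tri_def)
  ultimately show ?thesis using lb by simp
 qed
 have im3: "b' ` E3 = D0 Int Dp"
 proof
  show "b' ` E3 <= D0 Int Dp" unfolding k1H using b3 ar by (auto simp: E3_def)
  show "D0 Int Dp <= b' ` E3"
  proof
   fix w assume "w : D0 Int Dp"
   then obtain t where t: "0 <= t" "t <= a" "w = H (gm t)" unfolding k1H by auto
   define z where "z = Complex (t / a) (1 - t / a)"
   have "z : E3" using t ab by (auto simp: z_def E3_def Tri_def field_simps)
   moreover have "b' z = w" unfolding b3[OF \<open>z : E3\<close>] using t ab by (simp add: z_def)
   ultimately show "w : b' ` E3" by blast
  qed
 qed
 have imb: "b' ` Tri_edge = bdry D0"
 proof -
  have "b' ` Tri_edge = gm ` {0..a} Un gm ` {a..b} Un (D0 Int Dp)" unfolding E image_Un im1 im2 im3 ..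
  also have "\<dots> = (Dm Int D0) Un (D0 Int D' - {c}) Un (D0 Int Dp)" unfolding k0 bt ..
  also have "\<dots> = bdry D0" unfolding tile_boundary using c_in by blast
  finally show ?thesis .
 qed
 have i1: "z = w" if zw: "z : E1" "w : E1" "b' z = b' w" for z w
 proof -
  have T: "z : Tri" "w : Tri" using zw by (auto simp: E1_def)
  have "a * (1 - Im z) < 1" "a * (1 - Im w) < 1" using le_less_trans[OF ar(2)[OF T(1)], of 1] le_less_trans[OF ar(2)[OF T(2)], of 1] ab by auto
  then have r: "a * (1 - Im z) : {0..1}" "a * (1 - Im w) : {0..1}" "a * (1 - Im w) ~= 1" "a * (1 - Im z) ~= 1"
   using ar(1)[OF T(1)] ar(1)[OF T(2)] unfolding atLeastAtMost_iff by linarith+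
  have "gm (a * (1 - Im z)) = gm (a * (1 - Im w))" using zw b1 by simp
  then have "a * (1 - Im z) = a * (1 - Im w)"
   using g(1) r unfolding simple_path_def loop_free_def by blast
  then show ?thesis using zw ab by (auto simp: complex_eq_iff E1_def)
 qed
 have i2: "z = w" if zw: "z : E2" "w : E2" "b' z = b' w" for z w
  using zw b2[OF zw(1)] b2[OF zw(2)] cl(2) by (auto simp: inj_eq complex_eq_iff E2_def)
 have i3: "z = w" if zw: "z : E3" "w : E3" "b' z = b' w" for z w
 proof -
  have T: "z : Tri" "w : Tri" using zw by (auto simp: E3_def)
  have "a * (1 - Im z) < 1" "a * (1 - Im w) < 1" using le_less_trans[OF ar(2)[OF T(1)], of 1] le_less_trans[OF ar(2)[OF T(2)], of 1] ab by auto
  then have r: "a * (1 - Im z) : {0..1}" "a * (1 - Im w) : {0..1}" "a * (1 - Im w) ~= 1" "a * (1 - Im z) ~= 1"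
   using ar(1)[OF T(1)] ar(1)[OF T(2)] unfolding atLeastAtMost_iff by linarith+
  have "H (gm (a * (1 - Im z))) = H (gm (a * (1 - Im w)))" using zw b3 by simp
  then have "gm (a * (1 - Im z)) = gm (a * (1 - Im w))" using H_inj gS ar T by blast
  then have "a * (1 - Im z) = a * (1 - Im w)"
   using g(1) r unfolding simple_path_def loop_free_def by blast
  then have "Im z = Im w" using ab by simp
  moreover have "Re z = 1 - Im z" "Re w = 1 - Im w" using zw by (auto simp: E3_def)
  ultimately show ?thesis by (simp add: complex_eq_iff)
 qed
 have v1: "0 : E1" "0 : E2" "b' 0 = gm a" using b1[of 0] by (auto simp: E1_def E2_def Tri_def)
 have v2: "1 : E2" "1 : E3" "b' 1 = gm b" using b2[of 1] u1 by (auto simp: E2_def E3_def Tri_def)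
 have v3: "\<i> : E1" "\<i> : E3" "b' \<i> = c" using b1[of \<i>] g01 by (auto simp: E1_def E3_def Tri_def)
 \<comment> \<open>Different edges have common values only at a shared vertex: by uniqueness of the
   corners here and in \<open>x23\<close>, and by \<open>Dm_Dp\<close> in
   \<open>x13\<close>.\<close>
 have x12: "z = 0 & w = 0" if zw: "z : E1" "w : E2" "b' z = b' w" for z w
 proof -
  have "b' z : Dm Int D0" "b' w : D0 Int D' - {c}" using im1 im2 zw unfolding k0 bt by blast+
  then have e: "b' z = gm a" using triples[of "gm a" "b' z"] ga zw(3) by auto
  then show ?thesis using i1[OF zw(1) v1(1)] i2[OF zw(2) v1(2)] v1(3) zw(3) by simp
 qed
 have x23: "z = 1 & w = 1" if zw: "z : E2" "w : E3" "b' z = b' w" for z w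
 proof -
  have "b' w : D0 Int Dp" "b' z : D0 Int D' - {c}" using im3 im2 zw unfolding bt by blast+
  then have e: "b' w = gm b" using triples'[of "gm b" "b' w"] ga zw(3) by auto
  then show ?thesis using i2[OF zw(1) v2(1)] i3[OF zw(2) v2(2)] v2(3) zw(3) by simp
 qed
 have x13: "z = \<i> & w = \<i>" if zw: "z : E1" "w : E3" "b' z = b' w" for z w
 proof -
  have "b' w : D0 Int Dp" "b' z : Dm Int D0" using im3 im1 zw unfolding k0 by blast+
  then have e: "b' w = c" using Dm_Dp[of "b' w"] zw(3) by auto
  then show ?thesis using i1[OF zw(1) v3(1)] i3[OF zw(2) v3(2)] v3(3) zw(3) by simp
 qed
 have ib: "inj_on b' Tri_edge"
 proof (rule inj_onI)
  fix z w assume zw: "z : Tri_edge" "w : Tri_edge" "b' z = b' w"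
  have z: "z : E1 | z : E2 | z : E3" and w: "w : E1 | w : E2 | w : E3" using zw unfolding E by auto
  show "z = w"
   using z w i1[of z w] i2[of z w] i3[of z w] x12[of z w] x12[of w z] x23[of z w] x23[of w z] x13[of z w] x13[of w z] zw(3) by metis
 qed
 obtain B where B: "continuous_on Tri B" "inj_on B Tri" "B ` Tri = D0" "!!z. z : Tri_edge ==> B z = b' z"
  using extend_boundary_map[OF D0_disk(1) cb ib imb] by metis
 define W where "W = {z::complex. 0 <= Im z}"
 define \<psi> where "\<psi> = (%z. B (strip_to_Tri (z - of_real u0)))"
 let ?W0 = "{z : W. u0 <= Re z & Re z <= u0+1}"
 let ?S = "{z::complex. 0 <= Im z & 0 <= Re z & Re z <= 1}"
 have W0S: "(%z. z - of_real u0) ` ?W0 = ?S"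
 proof
  show "?S <= (%z. z - of_real u0) ` ?W0"
  proof
   fix z assume "z : ?S"
   then show "z : (%z. z - of_real u0) ` ?W0" by (intro image_eqI[of _ _ "z + of_real u0"]) (auto simp: W_def)
  qed
 qed (auto simp: W_def)
 have im: "\<psi> ` ?W0 = D0 - {c}"
 proof -
  have "\<psi> ` ?W0 = B ` (strip_to_Tri ` ((%z. z - of_real u0) ` ?W0))" by (simp add: \<psi>_def image_image)
  also have "\<dots> = B ` (Tri - {\<i>})" unfolding W0S strip_to_Tri(3) ..
  also have "\<dots> = B ` Tri - B ` {\<i>}" by (rule inj_on_image_set_diff[OF B(2)]) (auto simp: Tri_def)
  also have "B ` {\<i>} = {c}" using B(4)[of \<i>] v3 E by auto
  finally show ?thesis using B(3) by simp
 qed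
 have sT: "strip_to_Tri (z - of_real u0) : Tri - {\<i>}" if "z : ?W0" for z
 proof -
  have "z - of_real u0 : ?S" using W0S that by blast
  then show ?thesis using strip_to_Tri(3) by blast
 qed
 have near: "Re z = u0+1" if z: "z : ?W0" "\<psi> z : H ` (\<psi> ` ?W0)" for z
 proof -
  have "\<psi> z : D0 Int Dp" using z im HDm(2) by blast
  then obtain w where w: "w : E3" "\<psi> z = b' w" using im3 by blast
  then have "B (strip_to_Tri (z - of_real u0)) = B w" using B(4)[of w] unfolding E by (simp add: \<psi>_def)
  moreover have "w : Tri" using w by (simp add: E3_def)
  ultimately have "strip_to_Tri (z - of_real u0) = w" using B(2) sT[OF z(1)] by (auto simp: inj_on_eq_iff)
  then have "Re (strip_to_Tri (z - of_real u0)) + Im (strip_to_Tri (z - of_real u0)) = 1" using w by (simp add: E3_def)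
  then have "(Re z - u0) / (1 + Im z) + Im z / (1 + Im z) = 1" by (simp add: strip_to_Tri_def)
  then have "(Re z - u0 + Im z) / (1 + Im z) = 1" by (simp only: add_divide_distrib)
  moreover have "1 + Im z > 0" using z by (simp add: W_def)
  ultimately have "Re z - u0 + Im z = 1 + Im z" by (simp only: divide_eq_1_iff)
  then show ?thesis by linarith
 qed
 obtain \<Psi> where P: "continuous_on W \<Psi>" "inj_on \<Psi> W" "\<Psi> ` W = (\<Union>j. Hz j ` (\<psi> ` ?W0))"
  "!!z. z : W ==> \<Psi> (z+1) = H (\<Psi> z)" "!!z. z : ?W0 ==> \<Psi> z = \<psi> z"
  "!!z. z : W ==> EX w:?W0. EX j::int. z = w + of_int j & \<Psi> z = Hz j (\<psi> w)"
 proof (rule equivariant_extension[of W u0 \<psi>])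
  show "closed W" unfolding W_def by (intro closed_Collect_le continuous_intros)
  show "z + of_int j : W" if "z : W" for z and j :: int using that by (simp add: W_def)
  show "continuous_on ?W0 \<psi>" unfolding \<psi>_def
  proof (rule continuous_on_compose2[OF B(1)])
   show "continuous_on ?W0 (%z. strip_to_Tri (z - of_real u0))"
    by (rule continuous_on_compose2[OF strip_to_Tri(1)]) (use W0S in \<open>auto intro!: continuous_intros\<close>)
   show "(%z. strip_to_Tri (z - of_real u0)) ` ?W0 <= Tri" using sT by blast
  qed
  show "inj_on \<psi> ?W0"
  proof (rule inj_onI)
   fix z w assume zw: "z : ?W0" "w : ?W0" "\<psi> z = \<psi> w"
   have "strip_to_Tri (z - of_real u0) = strip_to_Tri (w - of_real u0)"
    using B(2) sT[OF zw(1)] sT[OF zw(2)] zw(3) by (simp add: \<psi>_def inj_on_eq_iff)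
   moreover have "z - of_real u0 : ?S" "w - of_real u0 : ?S" using W0S zw by blast+
   ultimately have "z - of_real u0 = w - of_real u0" using strip_to_Tri(2) by (simp only: inj_on_eq_iff)
   then show "z = w" by simp
  qed
  show "\<psi> ` ?W0 <= S2" unfolding im using D0_S2 by blast
  show "\<psi> (z+1) = H (\<psi> z)" if z: "z : W" "Re z = u0" for z
  proof -
   have q: "1 + Im z > 0" using z by (simp add: W_def)
   have a1: "strip_to_Tri (z - of_real u0) = Complex 0 (Im z / (1 + Im z))" using z by (simp add: strip_to_Tri_def)
   have a2: "strip_to_Tri (z+1 - of_real u0) = Complex (1 / (1 + Im z)) (Im z / (1 + Im z))" using z by (simp add: strip_to_Tri_def)
   have m1: "Complex 0 (Im z / (1 + Im z)) : E1" using q z by (auto simp: E1_def Tri_def W_def field_simps)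
   have m2: "Complex (1 / (1 + Im z)) (Im z / (1 + Im z)) : E3"
    using q z by (auto simp: E3_def Tri_def W_def add_divide_distrib[symmetric])
   show ?thesis unfolding \<psi>_def a1 a2 using B(4)[of "Complex 0 (Im z / (1 + Im z))"] B(4)[of "Complex (1 / (1 + Im z)) (Im z / (1 + Im z))"] m1 m2 b1[OF m1] b3[OF m2] unfolding E by simp
  qed
  show "\<psi> ` ?W0 Int Hz j ` (\<psi> ` ?W0) = {}" if "\<bar>j\<bar> >= 2" for j unfolding im by (rule tiles_far[OF that])
  show "Re z = u0+1" if "z : ?W0" "\<psi> z : H ` (\<psi> ` ?W0)" for z using that by (rule near)
 qed (rule that)
 show thesis
 proof (rule that[of \<Psi>])
  show "continuous_on {z. 0 <= Im z} \<Psi>" "inj_on \<Psi> {z. 0 <= Im z}" using P by (simp_all add: W_def)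
  have "\<Psi> ` W = U - {c}" unfolding P(3) im by (rule tiles_cover)
  then show "\<Psi> ` {z. 0 <= Im z} = U - {c}" by (simp add: W_def)
  show "\<Psi> (z+1) = H (\<Psi> z)" if "0 <= Im z" for z using P(4) that by (simp add: W_def)
  fix u :: real
  have uW: "complex_of_real u : W" by (simp add: W_def)
  obtain w and j :: int where w: "w : ?W0" "of_real u = w + of_int j" "\<Psi> (of_real u) = Hz j (\<psi> w)" using P(6)[OF uW] by blast
  have Iw: "Im w = 0" using arg_cong[OF w(2), of Im] by simp
  have uw: "u = Re w + of_int j" using arg_cong[OF w(2), of Re] by simp
  have m: "Complex (Re w - u0) 0 : E2" using w(1) by (auto simp: E2_def Tri_def)
  have "strip_to_Tri (w - of_real u0) = Complex (Re w - u0) 0" using Iw by (simp add: strip_to_Tri_def)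
  then have "\<psi> w = lam (Re w)" using B(4)[of "Complex (Re w - u0) 0"] m b2[OF m] unfolding E by (simp add: \<psi>_def)
  then show "\<Psi> (of_real u) = lam u" using w(3) line_int[OF L] uw by simp
 qed
qed

end

lemma (in wheel_para) wheel_para_reflect: "wheel_para (%t. F (- t)) (%t. - l (- t)) (%t. - l' (- t)) H H' c"
proof -
 interpret R: wheel_map "%t. F (- t)" "%t. - l (- t)" "%t. - l' (- t)" H H' by (rule wheel_map_reflect)
 obtain u v where "l u = u" "l v ~= v" using fixp nontriv by blast
 then have "- l (- (- u)) = - u" "- l (- (- v)) ~= - v" by auto
 then have 1: "EX u. - l (- u) = u" "EX u. - l (- u) ~= u" by blast+
 show ?thesis
 proof
  show "EX x. - l (- x) = x" "EX x. - l (- x) ~= x" using 1 by blast+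
  show "F (- t) = c" if "- l (- t) = t" for t using fix_c[of "- t"] that by simp
  show "F (- t) = c" if "H (F (- t)) = F (- t)" for t using Hfix_c that by blast
 qed
qed

text \<open>Reversing the parameter turns the backward gap into a forward one and leaves
  \<open>H\<close> unchanged, so one construction fills both half planes. They are glued along a
  single equivariant line, the second after complex conjugation, and \<open>H\<close> becomes
  translation by 1.\<close>

theorem (in wheel_para) conjugate_translation:
 assumes fx: "l x = x" "l y = y" and xy: "x < y" "y < x+2*pi"
  and up: "!!t. x < t ==> t < y ==> t < l t" and dn: "!!t. y < t ==> t < x+2*pi ==> l t < t"
 shows "EX \<phi> \<phi>'. homeomorphism (S2 - {c}) (UNIV::complex set) \<phi> \<phi>' & (EX v. ALL z. \<phi> (H (\<phi>' z)) = z + v)"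
proof -
 obtain p where p: "x < p" "p < y" "F p = c" using fibre_meets_forward_gap[OF fx xy(1) _ up] xy by auto
 interpret A: wheel_tile F l l' H H' c x y p by unfold_locales (use fx xy up p in auto)
 interpret R: wheel_para "%t. F (- t)" "%t. - l (- t)" "%t. - l' (- t)" H H' c by (rule wheel_para_reflect)
 define x' y' where "x' = - (x+2*pi)" and "y' = - y"
 have lx2: "l (x+2*pi) = x+2*pi" using fx l_per by simp
 have fx': "- l (- x') = x'" "- l (- y') = y'" unfolding x'_def y'_def minus_minus fx(2) lx2 by simp_all
 have xy': "x' < y'" "y' < x'+2*pi" using xy by (auto simp: x'_def y'_def)
 have up': "t < - l (- t)" if "x' < t" "t < y'" for t using dn[of "- t"] that by (auto simp: x'_def y'_def)
 obtain p' where p': "x' < p'" "p' < y'" "F (- p') = c" using R.fibre_meets_forward_gap[OF fx' xy'(1) _ up'] xy' by auto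
 interpret B: wheel_tile "%t. F (- t)" "%t. - l (- t)" "%t. - l' (- t)" H H' c x' y' p'
  by unfold_locales (use fx' xy' up' p' in auto)
 have neg: "(%t. F (- t)) ` {s..t} = F ` {- t..- s}" for s t
 proof -
  have "uminus ` {s..t} = {- t..- s}" by simp
  then show ?thesis by (metis image_image)
 qed
 have UB: "(%t. F (- t)) ` {x'..y'} = F ` {y..x+2*pi}" "(%t. F (- t)) ` {y'..x'+2*pi} = F ` {x..y}"
  unfolding neg by (simp_all add: x'_def y'_def add.commute)
 obtain lam where L: "A.equivariant_line lam" using A.equivariant_line_exists by blast
 then have L': "B.equivariant_line lam"
  unfolding A.equivariant_line_def B.equivariant_line_def UB by (simp add: Int_commute)
 obtain \<Psi>1 where P1: "continuous_on {z::complex. 0 <= Im z} \<Psi>1" "inj_on \<Psi>1 {z. 0 <= Im z}" "\<Psi>1 ` {z. 0 <= Im z} = F ` {x..y} - {c}"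
  "!!z. 0 <= Im z ==> \<Psi>1 (z+1) = H (\<Psi>1 z)" "!!u. \<Psi>1 (of_real u) = lam u"
  using A.half_plane[OF L] by metis
 obtain \<Psi>2 where P2: "continuous_on {z::complex. 0 <= Im z} \<Psi>2" "inj_on \<Psi>2 {z. 0 <= Im z}" "\<Psi>2 ` {z. 0 <= Im z} = F ` {y..x+2*pi} - {c}"
  "!!z. 0 <= Im z ==> \<Psi>2 (z+1) = H (\<Psi>2 z)" "!!u. \<Psi>2 (of_real u) = lam u"
  using B.half_plane[OF L'] unfolding UB by metis
 have rl: "range lam = F ` {x..y} Int F ` {y..x+2*pi} - {c}" using L by (simp add: A.equivariant_line_def)
 define \<Psi> where "\<Psi> = (%z. if 0 <= Im z then \<Psi>1 z else \<Psi>2 (cnj z))"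
 have low: "\<Psi> z = \<Psi>2 (cnj z)" if "Im z <= 0" for z
 proof (cases "Im z = 0")
  case True
  then have "z = of_real (Re z)" "cnj z = of_real (Re z)" by (simp_all add: complex_eq_iff)
  then show ?thesis using P1(5)[of "Re z"] P2(5)[of "Re z"] True by (simp add: \<Psi>_def)
 qed (use that in \<open>simp add: \<Psi>_def\<close>)
 have "continuous_on ({z. 0 <= Im z} Un {z. Im z <= 0}) \<Psi>"
 proof (rule continuous_on_closed_Un)
  show "closed {z. 0 <= Im z}" "closed {z. Im z <= 0}" by (intro closed_Collect_le continuous_intros)+
  show "continuous_on {z. 0 <= Im z} \<Psi>" using P1(1) by (rule continuous_on_eq) (simp add: \<Psi>_def)
  have "continuous_on {z. Im z <= 0} (%z. \<Psi>2 (cnj z))"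
   by (rule continuous_on_compose2[OF P2(1)]) (auto intro!: continuous_intros)
  then show "continuous_on {z. Im z <= 0} \<Psi>" by (rule continuous_on_eq) (simp add: low)
 qed
 moreover have "{z. 0 <= Im z} Un {z. Im z <= 0} = UNIV" by auto
 ultimately have cont\<Psi>: "continuous_on UNIV \<Psi>" by simp
 have mix: "z = w" if zw: "0 <= Im z" "Im w <= 0" "\<Psi> z = \<Psi> w" for z w
 proof -
  have "\<Psi>1 z : F ` {x..y} - {c}" unfolding P1(3)[symmetric] using zw by simp
  then have "\<Psi> z : F ` {x..y} - {c}" using zw by (simp add: \<Psi>_def)
  moreover have "\<Psi> w : F ` {y..x+2*pi} - {c}" unfolding low[OF zw(2)] P2(3)[symmetric] using zw(2) by simp
  ultimately have "\<Psi> z : range lam" using rl zw(3) by auto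
  then obtain u where u: "\<Psi> z = lam u" by auto
  have "\<Psi>1 z = \<Psi>1 (of_real u)" using u P1(5) zw by (simp add: \<Psi>_def)
  then have "z = of_real u" using P1(2) zw by (simp add: inj_on_eq_iff)
  moreover have "\<Psi>2 (cnj w) = \<Psi>2 (of_real u)" using u P2(5) zw low by simp
  then have "cnj w = of_real u" using P2(2) zw by (simp add: inj_on_eq_iff)
  then have "w = of_real u" by (metis complex_cnj_cnj complex_cnj_complex_of_real)
  ultimately show ?thesis by simp
 qed
 have inj: "inj \<Psi>"
 proof (rule injI)
  fix z w assume e: "\<Psi> z = \<Psi> w"
  consider "0 <= Im z" "0 <= Im w" | "Im z <= 0" "Im w <= 0" | "0 <= Im z" "Im w <= 0" | "0 <= Im w" "Im z <= 0" by linarith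
  then show "z = w"
  proof cases
   case 1 then show ?thesis using e P1(2) by (simp add: \<Psi>_def inj_on_eq_iff)
  next
   case 2
   then have "\<Psi>2 (cnj z) = \<Psi>2 (cnj w)" using e low by simp
   then have "cnj z = cnj w" using P2(2) 2 by (simp add: inj_on_eq_iff)
   then show ?thesis by simp
  next
   case 3 then show ?thesis using mix e by blast
  next
   case 4 then show ?thesis using mix[of w z] e by simp
  qed
 qed
 have img: "range \<Psi> = S2 - {c}"
 proof -
  have "range \<Psi> = \<Psi> ` {z. 0 <= Im z} Un \<Psi> ` {z. Im z <= 0}"
   unfolding image_Un[symmetric] \<open>{z. 0 <= Im z} Un {z. Im z <= 0} = UNIV\<close> ..
  also have U1: "\<Psi> ` {z. 0 <= Im z} = F ` {x..y} - {c}" using P1(3) by (simp add: \<Psi>_def)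
  also have "\<Psi> ` {z. Im z <= 0} = F ` {y..x+2*pi} - {c}"
  proof -
   have "\<Psi> ` {z. Im z <= 0} = \<Psi>2 ` (cnj ` {z. Im z <= 0})" using low by (simp add: image_image)
   moreover have "cnj ` {z. Im z <= 0} = {z. 0 <= Im z}"
   proof
    show "{z. 0 <= Im z} <= cnj ` {z. Im z <= 0}"
    proof
     fix z assume "z : {z. 0 <= Im z}"
     then show "z : cnj ` {z. Im z <= 0}" by (intro image_eqI[of _ _ "cnj z"]) auto
    qed
   qed auto
   ultimately show ?thesis using P2(3) by simp
  qed
  also have "(F ` {x..y} - {c}) Un (F ` {y..x+2*pi} - {c}) = (F ` {x..y} Un F ` {y..x+2*pi}) - {c}" by (rule Un_Diff[symmetric])
  also have "F ` {x..y} Un F ` {y..x+2*pi} = S2" using image_split[of x y "x+2*pi"] full_image xy by simp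
  finally show ?thesis .
 qed
 obtain sg tu where st: "homeomorphism (S2 - {c}) (UNIV::complex set) sg tu" using punctured_S2_homeomorphism[OF cS] by blast
 have injs: "inj_on sg (S2 - {c})" by (metis st homeomorphism_def inj_on_inverseI)
 have cs: "continuous_on UNIV (sg \<circ> \<Psi>)"
  by (rule continuous_on_compose[OF cont\<Psi>]) (use img homeomorphism_cont1[OF st] in simp)
 have injc: "inj (sg \<circ> \<Psi>)" using comp_inj_on[OF inj, of sg] injs img by simp
 have ims: "range (sg \<circ> \<Psi>) = UNIV" unfolding image_comp[symmetric] img by (rule homeomorphism_image1[OF st])
 obtain g where g: "homeomorphism UNIV (range (sg \<circ> \<Psi>)) (sg \<circ> \<Psi>) g"
  using invariance_of_domain_homeomorphism[of UNIV "sg \<circ> \<Psi>"] cs injc by auto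
 have hg: "homeomorphism (S2 - {c}) UNIV (g \<circ> sg) \<Psi>"
 proof (rule homeomorphismI)
  show "continuous_on (S2 - {c}) (g \<circ> sg)"
   by (rule continuous_on_compose[OF homeomorphism_cont1[OF st]])
     (use homeomorphism_cont2[OF g] ims in \<open>auto intro: continuous_on_subset\<close>)
  show "continuous_on UNIV \<Psi>" by (rule cont\<Psi>)
  show "\<Psi> ` UNIV <= S2 - {c}" using img by simp
  show a: "(g \<circ> sg) (\<Psi> z) = z" for z using homeomorphism_apply1[OF g, of z] by simp
  fix v assume "v : S2 - {c}"
  then obtain z where "v = \<Psi> z" using img by auto
  then show "\<Psi> ((g \<circ> sg) v) = v" using a by simp
 qed simp
 have tr: "\<Psi> (z+1) = H (\<Psi> z)" for z
 proof (cases "0 <= Im z")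
  case True then show ?thesis using P1(4) by (simp add: \<Psi>_def)
 next
  case False then show ?thesis using P2(4)[of "cnj z"] by (simp add: \<Psi>_def)
 qed
 have "(g \<circ> sg) (H (\<Psi> z)) = z+1" for z
  using homeomorphism_apply2[OF hg, of "z+1"] tr[of z] by simp
 then show ?thesis using hg by blast
qed

subsection \<open>Boundary orientation does not depend on the stereographic chart\<close>

text \<open>The difference of the two sides is a polynomial combination of the four hypotheses. In
  the application \<open>Q\<close>, \<open>Q'\<close>, \<open>m\<close>, \<open>q\<close>,
  \<open>k\<close> encode the entries of a rotation matrix, and \<open>z\<close>, \<open>V\<close> a
  point of the sphere.\<close>

lemma moebius_identity:
 fixes Q Q' q qc m k z zc V :: complex
 assumes "Q * (1 - k) = - (m * q)" "q * Q' = m * (1 - k)" "q * qc = (1 - k) * (1 + k)" "z * zc = (1 - V) * (1 + V)"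
 shows "(Q * z + Q' * zc+2 * m * V) * (q * (z * (1 - k) - qc * (1 - V)))
  = m * (2 - q * z - qc * zc - 2 * k * V) * ((1 - k) * (1 - V) + q * z)"
proof -
 have "(Q * z + Q' * zc+2 * m * V) * (q * (z * (1 - k) - qc * (1 - V))) - m * (2 - q * z - qc * zc - 2 * k * V) * ((1 - k) * (1 - V) + q * z)
  = (Q * (1 - k) - - (m * q)) * (q * z * z - z * (1 - V) * (1 + k))+(q * Q' - m * (1 - k)) * (z * zc * (1 - k) - qc * zc * (1 - V))
   + (q * qc - (1 - k) * (1 + k)) * (m * z * zc - Q * z * (1 - V) - 2 * m * V * (1 - V))
   + (z * zc - (1 - V) * (1 + V)) * (m * (1 - k) * (1 - k) + m * (1 - k) * (1 + k))"
  by (simp add: algebra_simps)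
 then show ?thesis unfolding assms by simp
qed

text \<open>Away from the poles, the change between two stereographic charts is the Moebius map
  with pole at the image of the new centre of projection and zero at its antipode.\<close>

lemma stereo_rotation:
 fixes T :: "real^3 => real^3"
 assumes T: "orthogonal_transformation T" "det (matrix T) = 1"
  and n: "n : S2" "T n = north" "n ~= north" "n ~= - north"
 obtains \<kappa> where "\<kappa> ~= 0" "!!v. v : S2 ==> v ~= north ==> v ~= n ==>
  stereo v ~= stereo n & stereo (T v) = \<kappa> * (1 + cnj (stereo n) * stereo v) / (stereo v - stereo n)"
proof -
 have bT: "bij T" using T orthogonal_transformation_bij by blast
 have iT: "T v \<bullet> T w = v \<bullet> w" for v w using T(1) by (simp add: orthogonal_transformation_def)
 have cT: "cross3 (T v) (T w) = T (cross3 v w)" for v w using cross_orthogonal_transformation[OF T(1), of v w] T(2) by simp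
 have ax3: "T n = axis 3 1" using n(2) by (simp add: vec3_eq_iff north_def axis_def)
 \<comment> \<open>The rows of \<open>T\<close> are \<open>a\<close>, \<open>b\<close>,
   \<open>n\<close>; as the determinant is 1 they form a right-handed frame, and its cross products
   give the needed relations between entries.\<close>
 obtain a b where ab: "T a = axis 1 1" "T b = axis 2 1" using bT by (metis bij_pointE)
 have "T (cross3 n a) = T b" unfolding cT[symmetric] ab ax3 by (rule cross_basis)
 then have nb: "cross3 n a = b" using bT by (simp add: bij_is_inj inj_eq)
 have "T (cross3 b n) = T a" unfolding cT[symmetric] ab ax3 by (rule cross_basis)
 then have na: "cross3 b n = a" using bT by (simp add: bij_is_inj inj_eq)
 have B: "b$1 = n$2 * a$3 - n$3 * a$2" "b$2 = n$3 * a$1 - n$1 * a$3" "b$3 = n$1 * a$2 - n$2 * a$1"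
  unfolding nb[symmetric] by (simp_all add: cross_components)
 have A: "a$1 = b$2 * n$3 - b$3 * n$2" "a$2 = b$3 * n$1 - b$1 * n$3" "a$3 = b$1 * n$2 - b$2 * n$1"
  unfolding na[symmetric] by (simp_all add: cross_components)
 have comp: "T v $ 1 = v$1 * a$1 + v$2 * a$2 + v$3 * a$3" "T v $ 2 = v$1 * b$1 + v$2 * b$2 + v$3 * b$3"
  "T v $ 3 = v$1 * n$1 + v$2 * n$2 + v$3 * n$3" for v
  using iT[of v a] iT[of v b] iT[of v n] unfolding ab ax3 inner_axis by (simp_all add: inner_vec_def sum_3)
 have n1: "(n$1)\<^sup>2+(n$2)\<^sup>2+(n$3)\<^sup>2 = 1" using n(1) by (simp add: S2_iff)
 define q where "q = Complex (n$1) (n$2)"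
 define m where "m = Complex (a$3) (- b$3)"
 define Q where "Q = Complex (a$1 + b$2) (a$2 - b$1)"
 define Q' where "Q' = Complex (a$1 - b$2) (- a$2 - b$1)"
 define k where "k = complex_of_real (n$3)"
 have qq: "q * cnj q = (1 - k) * (1 + k)"
  using n1 by (simp add: q_def k_def complex_eq_iff power2_eq_square algebra_simps)
 have q0: "q ~= 0"
 proof
  assume "q = 0"
  then have z: "n$1 = 0" "n$2 = 0" by (simp_all add: q_def complex_eq_iff)
  then have "n$3 = 1 | n$3 = -1" using n1 by (simp add: power2_eq_1_iff)
  then show False using n(3,4) z by (auto simp: vec3_eq_iff north_def)
 qed
 have k1: "1 - k ~= 0" "1 + k ~= 0" using qq q0 by auto
 have A': "a$1 - b$2 * n$3 = - (b$3 * n$2)" "a$2 + b$1 * n$3 = b$3 * n$1" using A(1,2) by linarith+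
 have B': "b$2 - n$3 * a$1 = - (n$1 * a$3)" "b$1 + n$3 * a$2 = n$2 * a$3" using B(1,2) by linarith+
 have h1: "Q * (1 - k) = - (m * q)"
 proof -
  have "(a$1 + b$2) * (1 - n$3) = - (a$3 * n$1 + b$3 * n$2)"
  proof -
   have "(a$1 + b$2) * (1 - n$3) = (a$1 - b$2 * n$3)+(b$2 - n$3 * a$1)" by (simp add: algebra_simps)
   then show ?thesis unfolding A' B' by (simp add: algebra_simps)
  qed
  moreover have "(a$2 - b$1) * (1 - n$3) = - (a$3 * n$2 - b$3 * n$1)"
  proof -
   have "(a$2 - b$1) * (1 - n$3) = (a$2 + b$1 * n$3) - (b$1 + n$3 * a$2)" by (simp add: algebra_simps)
   then show ?thesis unfolding A' B' by (simp add: algebra_simps)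
  qed
  ultimately show ?thesis by (simp add: Q_def k_def m_def q_def complex_eq_iff)
 qed
 have "Q' * (1 + k) = m * cnj q"
 proof -
  have "(a$1 - b$2) * (1 + n$3) = a$3 * n$1 - b$3 * n$2"
  proof -
   have "(a$1 - b$2) * (1 + n$3) = (a$1 - b$2 * n$3) - (b$2 - n$3 * a$1)" by (simp add: algebra_simps)
   then show ?thesis unfolding A' B' by (simp add: algebra_simps)
  qed
  moreover have "(- a$2 - b$1) * (1 + n$3) = - (a$3 * n$2) - b$3 * n$1"
  proof -
   have "(- a$2 - b$1) * (1 + n$3) = - (a$2 + b$1 * n$3) - (b$1 + n$3 * a$2)" by (simp add: algebra_simps)
   then show ?thesis unfolding A' B' by (simp add: algebra_simps)
  qed
  ultimately show ?thesis by (simp add: Q'_def k_def m_def q_def complex_eq_iff)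
 qed
 then have "(q * Q') * (1 + k) = (m * (1 - k)) * (1 + k)" using qq by (metis mult.assoc mult.left_commute)
 then have h2: "q * Q' = m * (1 - k)" using k1 by simp
 have m0: "m ~= 0"
 proof
  assume "m = 0"
  then have "Q = 0" "Q' = 0" using h1 h2 k1 q0 by simp_all
  then have "a$1 = 0" "a$2 = 0" "a$3 = 0" using \<open>m = 0\<close> by (simp_all add: Q_def Q'_def m_def complex_eq_iff)
  then have "a = 0" by (simp add: vec3_eq_iff)
  then have "T a = 0" using iT[of a a] by simp
  then show False unfolding ab by (simp add: axis_eq_0_iff)
 qed
 have sn: "stereo n = cnj q / (1 - k)" by (simp add: stereo_def q_def k_def complex_eq_iff)
 show thesis
 proof (rule that[of "m / q"])
  show "m / q ~= 0" using m0 q0 by simp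
  fix v :: "real^3" assume v: "v : S2" "v ~= north" "v ~= n"
  have ne: "stereo v ~= stereo n" using v n stereo_homeomorphism
   by (metis Diff_iff homeomorphism_apply1 singletonD)
  define z where "z = Complex (v$1) (- v$2)"
  define V where "V = complex_of_real (v$3)"
  have v1: "(v$1)\<^sup>2+(v$2)\<^sup>2+(v$3)\<^sup>2 = 1" using v(1) by (simp add: S2_iff)
  have V1: "1 - V ~= 0" using S2_third_lt_1[OF v(1,2)] by (simp add: V_def complex_eq_iff)
  have zz: "z * cnj z = (1 - V) * (1 + V)"
   using v1 by (simp add: z_def V_def complex_eq_iff power2_eq_square algebra_simps)
  have sv: "stereo v = z / (1 - V)" by (simp add: stereo_def z_def V_def)
  have "T v : S2" using v homeomorphism_image1[OF orthogonal_transformation_homeomorphism_S2[OF T(1)]] by blast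
  moreover have "T v ~= north" using v n injD[OF bij_is_inj[OF bT]] by metis
  ultimately have W1: "1 - T v $ 3 ~= 0" using S2_third_lt_1 by force
  have P: "2 * Complex (T v $ 1) (- (T v $ 2)) = Q * z + Q' * cnj z+2 * m * V"
   unfolding comp by (simp add: Q_def Q'_def z_def m_def V_def complex_eq_iff algebra_simps)
  have W: "2 * (1 - complex_of_real (T v $ 3)) = 2 - q * z - cnj q * cnj z - 2 * k * V"
   unfolding comp by (simp add: q_def z_def k_def V_def complex_eq_iff algebra_simps)
  have W0: "2 - q * z - cnj q * cnj z - 2 * k * V ~= 0"
   unfolding W[symmetric] using W1 by (simp add: complex_eq_iff)
  have d1: "stereo v - stereo n = (z * (1 - k) - cnj q * (1 - V)) / ((1 - k) * (1 - V))"
   unfolding sv sn using V1 k1 by (simp add: field_simps)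
  then have d0: "z * (1 - k) - cnj q * (1 - V) ~= 0" using ne by auto
  have ck: "cnj (1 - k) = 1 - k" by (simp add: k_def)
  have d2: "1 + cnj (stereo n) * stereo v = ((1 - k) * (1 - V) + q * z) / ((1 - k) * (1 - V))"
   unfolding sv sn complex_cnj_divide ck complex_cnj_cnj times_divide_times_eq add_divide_distrib using V1 k1 by simp
  have "stereo (T v) = (2 * Complex (T v $ 1) (- (T v $ 2))) / (2 * (1 - complex_of_real (T v $ 3)))"
   unfolding stereo_def of_real_diff of_real_1 by (rule mult_divide_mult_cancel_left[symmetric]) simp
  also have "\<dots> = (Q * z + Q' * cnj z+2 * m * V) / (2 - q * z - cnj q * cnj z - 2 * k * V)"
   unfolding P W ..
  also have "\<dots> = m * ((1 - k) * (1 - V) + q * z) / (q * (z * (1 - k) - cnj q * (1 - V)))"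
  proof -
   have sw: "m * A * B = m * B * A" for A B by simp
   have qd: "q * (z * (1 - k) - cnj q * (1 - V)) ~= 0" using q0 d0 by (simp only: mult_eq_0_iff) simp
   show ?thesis unfolding frac_eq_eq[OF W0 qd] by (rule trans[OF moebius_identity[OF h1 h2 qq zz] sw])
  qed
  also have "\<dots> = m / q * (1 + cnj (stereo n) * stereo v) / (stereo v - stereo n)"
  proof -
   have gen: "m * X / (q * Y) = m / q * (X / C) / (Y / C)" if "C ~= 0" for X Y C using that by simp
   show ?thesis unfolding d1 d2 by (rule gen) (use V1 k1 in simp)
  qed
  finally show "stereo v ~= stereo n & stereo (T v) = m / q * (1 + cnj (stereo n) * stereo v) / (stereo v - stereo n)"
   using ne by blast
 qed
qed

text \<open>The Moebius map minus its value at \<open>w\<close> is a constant times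
  \<open>(g t - w) / (g t - p)\<close>, with one zero and one pole. The condition
  \<open>1 + e * p ~= 0\<close> says that the map is not constant.\<close>

lemma winding_number_moebius:
 fixes g :: "real => complex"
 assumes g: "path g" "w ~: path_image g" "p ~: path_image g" "w ~= p" and c: "\<kappa> ~= 0" "1 + e * p ~= 0"
 shows "winding_number (%t. \<kappa> * (1 + e * g t) / (g t - p)) (\<kappa> * (1 + e * w) / (w - p)) = winding_number g w - winding_number g p"
proof -
 obtain q1 where q1: "path q1" "pathfinish q1 - pathstart q1 = 2 * of_real pi * \<i> * winding_number g w" "!!t. t : {0..1} ==> g t = w + exp (q1 t)"
  by (rule winding_number_as_continuous_log[OF g(1,2)]) (rule that)
 obtain q2 where q2: "path q2" "pathfinish q2 - pathstart q2 = 2 * of_real pi * \<i> * winding_number g p" "!!t. t : {0..1} ==> g t = p + exp (q2 t)"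
  by (rule winding_number_as_continuous_log[OF g(1,3)]) (rule that)
 define C where "C = - \<kappa> * (1 + e * p) / (w - p)"
 have "C ~= 0" using c g(4) by (simp add: C_def)
 then obtain d where d: "C = exp d" by (metis exp_Ln)
 define Q where "Q = (%t. d + q1 t - q2 t)"
 have pQ: "path Q" using q1(1) q2(1) unfolding path_def Q_def by (intro continuous_intros)
 have eq: "\<kappa> * (1 + e * g t) / (g t - p) - \<kappa> * (1 + e * w) / (w - p) = (exp \<circ> Q) t" if t: "0 <= t" "t <= 1" for t
 proof -
  have n: "g t - p ~= 0" "w - p ~= 0" using q2(3)[of t] t g(4) by auto
  have "\<kappa> * (1 + e * g t) / (g t - p) - \<kappa> * (1 + e * w) / (w - p) = C * (g t - w) / (g t - p)"
   unfolding C_def using n by (simp add: divide_simps) (simp add: algebra_simps)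
  also have "\<dots> = C * exp (q1 t) / exp (q2 t)"
  proof -
   have "g t - w = exp (q1 t)" "g t - p = exp (q2 t)" using arg_cong[OF q1(3)[of t], of "%x. x - w"] arg_cong[OF q2(3)[of t], of "%x. x - p"] t by auto
   then show ?thesis by simp
  qed
  finally show ?thesis by (simp add: Q_def d exp_add exp_diff)
 qed
 have "winding_number (%t. \<kappa> * (1 + e * g t) / (g t - p)) (\<kappa> * (1 + e * w) / (w - p)) = winding_number (exp \<circ> Q) 0"
  unfolding winding_number_offset[of "%t. \<kappa> * (1 + e * g t) / (g t - p)"] by (rule winding_number_cong) (rule eq)
 also have "\<dots> = (pathfinish Q - pathstart Q) / (2 * of_real pi * \<i>)" by (rule winding_number_compose_exp[OF pQ])
 also have "pathfinish Q - pathstart Q = (pathfinish q1 - pathstart q1) - (pathfinish q2 - pathstart q2)"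
  by (simp add: Q_def pathfinish_def pathstart_def)
 also have "\<dots> / (2 * of_real pi * \<i>) = winding_number g w - winding_number g p"
  unfolding q1(2) q2(2) by (simp add: diff_divide_distrib)
 finally show ?thesis .
qed

definition chart :: "(real^3 => real^3) => real^3 => bool" where
 "chart R N \<longleftrightarrow> orthogonal_transformation R & det (matrix R) = 1 & R N = north"

text \<open>The number tested in \<open>pos_oriented\<close>, for an arbitrary loop on the
  sphere.\<close>

definition chart_winding :: "(real^3 => real^3) => (real => real^3) => real^3 => complex" where
 "chart_winding R gm w = winding_number (%t. stereo (R (gm t))) (stereo (R w))"

lemma chart_exists: assumes "N : S2" obtains R where "chart R N"
 by (rule stereographic_chart[OF assms]) (use that in \<open>auto simp: chart_def\<close>)

lemma chart_homeo:
 assumes "chart R N" "N : S2"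
 shows "homeomorphism (S2 - {N}) UNIV (%v. stereo (R v)) (%z. inv_into UNIV R (unstereo z))"
 using rotated_stereo_homeomorphism assms by (simp add: chart_def)

lemma chart_path:
 assumes "chart R N" "N : S2" "path gm" "path_image gm <= S2 - {N}"
 shows "path (%t. stereo (R (gm t)))" "path_image (%t. stereo (R (gm t))) = (%v. stereo (R v)) ` path_image gm"
proof -
 have "path ((%v. stereo (R v)) \<circ> gm)"
  by (rule path_continuous_image[OF assms(3)]) (rule continuous_on_subset[OF homeomorphism_cont1[OF chart_homeo[OF assms(1,2)]] assms(4)])
 then show "path (%t. stereo (R (gm t)))" by (simp add: o_def)
qed (simp add: path_image_def image_image)

lemma chart_inj:
 assumes "chart R N" "N : S2" "v : S2 - {N}" "w : S2 - {N}" "stereo (R v) = stereo (R w)" shows "v = w"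
 using homeomorphism_apply1[OF chart_homeo[OF assms(1,2)]] assms(3-5) by metis

lemma chart_notin:
 assumes "chart R N" "N : S2" "path_image gm <= S2 - {N}" "w : S2 - {N}" "w ~: path_image gm"
 shows "stereo (R w) ~: (%v. stereo (R v)) ` path_image gm"
proof
 assume "stereo (R w) : (%v. stereo (R v)) ` path_image gm"
 then obtain v where v: "v : path_image gm" "stereo (R w) = stereo (R v)" by blast
 then have "w = v" using chart_inj[OF assms(1,2,4), of v] assms(3) by blast
 then show False using v assms(5) by blast
qed

lemma chart_transition:
 assumes "chart R N" "chart R' N'"
 shows "orthogonal_transformation (R' \<circ> inv_into UNIV R)" "det (matrix (R' \<circ> inv_into UNIV R)) = 1" "(R' \<circ> inv_into UNIV R) (R v) = R' v"
proof -
 have R: "orthogonal_transformation R" "det (matrix R) = 1" and R': "orthogonal_transformation R'" "det (matrix R') = 1"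
  using assms by (auto simp: chart_def)
 have b: "bij R" using R orthogonal_transformation_bij by blast
 have oi: "orthogonal_transformation (inv_into UNIV R)" by (rule orthogonal_transformation_inv[OF R(1)])
 show "orthogonal_transformation (R' \<circ> inv_into UNIV R)" using orthogonal_transformation_compose[OF R'(1) oi] .
 have l: "linear R" "linear R'" "linear (inv_into UNIV R)" using R R' oi by (auto simp: orthogonal_transformation_def)
 have "R \<circ> inv_into UNIV R = id" using bij_is_surj[OF b] unfolding surj_iff .
 then have "matrix R ** matrix (inv_into UNIV R) = mat 1" using matrix_compose[OF l(3) l(1)] by (simp add: matrix_id_mat_1)
 then have "det (matrix R) * det (matrix (inv_into UNIV R)) = 1" by (metis det_mul det_I)
 then show "det (matrix (R' \<circ> inv_into UNIV R)) = 1" using matrix_compose[OF l(3) l(2)] R R' by (simp add: det_mul)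
 show "(R' \<circ> inv_into UNIV R) (R v) = R' v" using b by (simp add: bij_is_inj)
qed

context wheel
begin

lemma connected_complement_punctured:
 assumes "s < t" "t < s+2*pi" shows "connected (S2 - F ` {s..t} - {N})"
 using closed_disk_interior_facts(2)[OF disk[of t "s+2*pi"], of N] complement_eq[OF assms] assms by simp

text \<open>In the chart the rest of the sphere without \<open>N\<close> is connected and unbounded,
  so \<open>w\<close> is outside every loop in the image of \<open>{s..t}\<close>.\<close>

lemma chart_winding_zero:
 assumes st: "s < t" "t < s+2*pi" and R: "chart R N" and N: "N : S2 - F ` {s..t}" and w: "w : S2 - F ` {s..t}" "w ~= N"
  and g: "path gm" "pathfinish gm = pathstart gm" "path_image gm <= F ` {s..t}"
 shows "chart_winding R gm w = 0"
proof -
 let ?s = "%v. stereo (R v)" and ?K = "F ` {s..t}"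
 have NS: "N : S2" using N by blast
 have h: "homeomorphism (S2 - {N}) UNIV ?s (%z. inv_into UNIV R (unstereo z))" using R NS by (rule chart_homeo)
 have KS: "?K <= S2 - {N}" using F_in N by blast
 have gS: "path_image gm <= S2 - {N}" using g(3) KS by blast
 have bK: "bounded (?s ` ?K)"
  by (intro compact_imp_bounded compact_continuous_image compact_im continuous_on_subset[OF homeomorphism_cont1[OF h] KS])
 let ?X = "?s ` (S2 - ?K - {N})"
 have cX: "connected ?X"
  by (rule connected_continuous_image[OF _ connected_complement_punctured[OF st]]) (rule continuous_on_subset[OF homeomorphism_cont1[OF h]], blast)
 have "?s ` (S2 - {N}) = ?X Un ?s ` ?K" unfolding image_Un[symmetric] using KS by (intro arg_cong[where f = "(`) ?s"]) blast
 then have "?X Un ?s ` ?K = UNIV" using homeomorphism_image1[OF h] by simp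
 then have uX: "~ bounded ?X" using bK bounded_Un[of ?X "?s ` ?K"] not_bounded_UNIV by metis
 have "?X Int ?s ` path_image gm = {}"
 proof (rule ccontr)
  assume "~ ?thesis"
  then obtain u v where uv: "u : S2 - ?K - {N}" "v : path_image gm" "?s u = ?s v" by blast
  have "u = v" by (rule chart_inj[OF R NS _ _ uv(3)]) (use uv gS in blast)+
  then show False using uv g(3) by blast
 qed
 then have "?X <= outside (?s ` path_image gm)" by (rule connected_unbounded_subset_outside[OF cX uX])
 then have "?s w : outside (path_image (%t. ?s (gm t)))" unfolding chart_path(2)[OF R NS g(1) gS] using w by blast
 then show ?thesis unfolding chart_winding_def
  by (intro winding_number_zero_in_outside chart_path(1)[OF R NS g(1) gS]) (use g(2) in \<open>simp_all add: pathfinish_def pathstart_def\<close>)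
qed

lemma chart_winding_interior:
 assumes st: "s < t" "t < s+2*pi" and R: "chart R N" and N: "N : S2 - F ` {s..t}"
  and w: "w : F ` {s..t} - bdry (F ` {s..t})" "w' : F ` {s..t} - bdry (F ` {s..t})"
  and g: "path gm" "pathfinish gm = pathstart gm" "path_image gm <= bdry (F ` {s..t})"
 shows "chart_winding R gm w = chart_winding R gm w'"
proof -
 let ?s = "%v. stereo (R v)" and ?D = "F ` {s..t}"
 have NS: "N : S2" using N by blast
 have h: "homeomorphism (S2 - {N}) UNIV ?s (%z. inv_into UNIV R (unstereo z))" using R NS by (rule chart_homeo)
 have KS: "?D <= S2 - {N}" using F_in N by blast
 have gS: "path_image gm <= S2 - {N}" using g(3) KS unfolding bdry_def by blast
 let ?X = "?s ` (?D - bdry ?D)"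
 have cX: "connected ?X"
  by (rule connected_continuous_image[OF _ closed_disk_interior_facts(1)[OF disk[OF st]]]) (rule continuous_on_subset[OF homeomorphism_cont1[OF h]], use KS in blast)
 have "?X Int ?s ` path_image gm = {}"
 proof (rule ccontr)
  assume "~ ?thesis"
  then obtain u v where uv: "u : ?D - bdry ?D" "v : path_image gm" "?s u = ?s v" by blast
  have "u = v" by (rule chart_inj[OF R NS _ _ uv(3)]) (use uv gS KS in blast)+
  then show False using uv g(3) by blast
 qed
 then have d: "?X Int path_image (%t. ?s (gm t)) = {}" unfolding chart_path(2)[OF R NS g(1) gS] .
 show ?thesis unfolding chart_winding_def
  by (rule winding_number_eq[OF chart_path(1)[OF R NS g(1) gS] _ _ _ cX d])
   (use g(2) w in \<open>simp_all add: pathfinish_def pathstart_def\<close>)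
qed

text \<open>The pole of the Moebius transition is the image of the new centre \<open>N'\<close>. As
  \<open>N'\<close> lies off the disk, the winding number about it vanishes, and with it the
  correction term of \<open>winding_number_moebius\<close>.\<close>

lemma chart_winding_generic:
 assumes st: "s < t" "t < s+2*pi" and R: "chart R N" "chart R' N'" and N: "N : S2 - F ` {s..t}" "N' : S2 - F ` {s..t}" "N' ~= N" "N' ~= - N"
  and w: "w : F ` {s..t} - bdry (F ` {s..t})"
  and g: "path gm" "pathfinish gm = pathstart gm" "path_image gm <= bdry (F ` {s..t})"
 shows "chart_winding R' gm w = chart_winding R gm w"
proof -
 let ?D = "F ` {s..t}" and ?T = "R' \<circ> inv_into UNIV R"
 note tr = chart_transition[OF R]
 have oR: "orthogonal_transformation R" "R N = north" "R' N' = north" using R by (auto simp: chart_def)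
 have NS: "N : S2" "N' : S2" using N by blast+
 have iR: "R u = R v \<longleftrightarrow> u = v" for u v using orthogonal_transformation_bij[OF oR(1)] by (simp add: bij_is_inj inj_eq)
 have RS: "R v : S2" if "v : S2" for v using homeomorphism_image1[OF orthogonal_transformation_homeomorphism_S2[OF oR(1)]] that by blast
 have neg: "- north = R (- N)" using oR by (simp add: orthogonal_transformation_def linear_neg)
 have DS: "?D <= S2 - {N}" "?D <= S2 - {N'}" using F_in N by blast+
 have gD: "path_image gm <= ?D" using g(3) by (auto simp: bdry_def)
 have gS: "path_image gm <= S2 - {N}" using gD DS by blast
 obtain \<kappa> where k: "\<kappa> ~= 0" "!!v. v : S2 ==> v ~= north ==> v ~= R N' ==>
  stereo v ~= stereo (R N') & stereo (?T v) = \<kappa> * (1 + cnj (stereo (R N')) * stereo v) / (stereo v - stereo (R N'))"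
 proof (rule stereo_rotation[OF tr(1,2), of "R N'"])
  show "R N' : S2" using RS NS by blast
  show "?T (R N') = north" using tr(3) oR by simp
  show "R N' ~= north" "R N' ~= - north" unfolding neg using iR N oR by metis+
 qed (rule that)
 let ?p = "stereo (R N')" and ?u = "%t. stereo (R (gm t))"
 have M: "?p ~= stereo (R v) & stereo (R' v) = \<kappa> * (1 + cnj ?p * stereo (R v)) / (stereo (R v) - ?p)" if "v : ?D" for v
 proof -
  have "v : S2" "v ~= N" "v ~= N'" using that DS by blast+
  then show ?thesis using k(2)[of "R v"] RS iR oR tr(3)[of v] by (metis)
 qed
 have ci: "1 + cnj ?p * ?p ~= 0"
 proof -
  have "1 + cnj ?p * ?p = of_real (1+(norm ?p)\<^sup>2)" using complex_norm_square[of ?p] by (simp add: mult.commute)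
  moreover have "1+(norm ?p)\<^sup>2 > 0" by (simp add: add_pos_nonneg)
  ultimately show ?thesis by (metis of_real_eq_0_iff less_irrefl)
 qed
 have wD: "w : ?D" "w ~: path_image gm" using w g(3) by blast+
 have pu: "path ?u" "path_image ?u = (%v. stereo (R v)) ` path_image gm" using chart_path[OF R(1) NS(1) g(1) gS] by blast+
 have wn: "stereo (R w) ~: path_image ?u" unfolding pu(2) by (rule chart_notin[OF R(1) NS(1) gS]) (use wD DS in blast)+
 have pn: "?p ~: path_image ?u" unfolding pu(2) by (rule chart_notin[OF R(1) NS(1) gS]) (use gD N in blast)+
 have "chart_winding R' gm w = winding_number (%t. stereo (R' (gm t))) (\<kappa> * (1 + cnj ?p * stereo (R w)) / (stereo (R w) - ?p))"
  unfolding chart_winding_def using M[OF wD(1)] by simp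
 also have "\<dots> = winding_number (%t. \<kappa> * (1 + cnj ?p * ?u t) / (?u t - ?p)) (\<kappa> * (1 + cnj ?p * stereo (R w)) / (stereo (R w) - ?p))"
 proof (rule winding_number_cong)
  fix t :: real assume "0 <= t" "t <= 1"
  then have "gm t : ?D" using gD by (auto simp: path_image_def)
  then show "stereo (R' (gm t)) = \<kappa> * (1 + cnj ?p * ?u t) / (?u t - ?p)" using M by blast
 qed
 also have "\<dots> = winding_number ?u (stereo (R w)) - winding_number ?u ?p"
  by (rule winding_number_moebius[OF pu(1) wn pn _ k(1) ci]) (use M[OF wD(1)] in \<open>metis\<close>)
 also have "winding_number ?u ?p = 0"
  using chart_winding_zero[OF st R(1) N(1) N(2) N(3) g(1,2) gD] by (simp add: chart_winding_def)
 finally show ?thesis by (simp add: chart_winding_def)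
qed

text \<open>The Moebius computation excludes equal and antipodal centres, so the comparison passes
  through a third centre \<open>M\<close>, for which the infinite complement of the disk leaves
  room.\<close>

lemma chart_winding_independent:
 assumes st: "s < t" "t < s+2*pi" and R: "chart R N" "chart R' N'" and N: "N : S2 - F ` {s..t}" "N' : S2 - F ` {s..t}"
  and w: "w : F ` {s..t} - bdry (F ` {s..t})" "w' : F ` {s..t} - bdry (F ` {s..t})"
  and g: "path gm" "pathfinish gm = pathstart gm" "path_image gm <= bdry (F ` {s..t})"
 shows "chart_winding R' gm w' = chart_winding R gm w"
proof -
 have "infinite (S2 - F ` {s..t})"
 proof -
  have d: "closed_disk (F ` {t..s+2*pi})" using disk[of t "s+2*pi"] st by simp
  obtain \<phi> \<psi> where p: "homeomorphism (cball (0::complex) 1) (F ` {t..s+2*pi}) \<phi> \<psi>"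
   "\<phi> ` ball 0 1 = F ` {t..s+2*pi} - bdry (F ` {t..s+2*pi})" using closed_disk_param[OF d] by metis
  have "inj_on \<phi> (ball 0 1)" by (rule inj_on_inverseI[of _ \<psi>]) (use homeomorphism_apply1[OF p(1)] in auto)
  moreover have "infinite (ball (0::complex) 1)" using uncountable_ball[of 1 "0::complex"] countable_finite by auto
  ultimately have "infinite (\<phi> ` ball 0 1)" using finite_imageD by blast
  then show ?thesis unfolding p(2) complement_eq[OF st] .
 qed
 then obtain M where "M : (S2 - F ` {s..t}) - {N, - N, N', - N'}"
  by (metis Diff_infinite_finite finite.emptyI finite_insert infinite_imp_nonempty all_not_in_conv)
 then have M: "M : S2 - F ` {s..t}" "M ~= N" "M ~= - N" "N' ~= M" "N' ~= - M" by auto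
 obtain R'' where R'': "chart R'' M" using M(1) chart_exists by blast
 have "chart_winding R' gm w' = chart_winding R' gm w" by (rule chart_winding_interior[OF st R(2) N(2) w(2) w(1) g])
 also have "\<dots> = chart_winding R'' gm w" by (rule chart_winding_generic[OF st R'' R(2) M(1) N(2) M(4,5) w(1) g])
 also have "\<dots> = chart_winding R gm w" by (rule chart_winding_generic[OF st R(1) R'' N(1) M(1,2,3) w(1) g])
 finally show ?thesis .
qed

text \<open>The point is inside the Jordan curve: otherwise the connected outside would be split by
  two disjoint open sets, the images of the open disk and of the complement of the closed
  disk.\<close>

lemma chart_winding_boundary:
 assumes st: "s < t" "t < s+2*pi" and R: "chart R N" and N: "N : S2 - F ` {s..t}"
  and w: "w : F ` {s..t} - bdry (F ` {s..t})"
  and g: "simple_path gm" "pathfinish gm = pathstart gm" "path_image gm = bdry (F ` {s..t})"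
 shows "chart_winding R gm w = 1 | chart_winding R gm w = -1"
proof -
 let ?s = "%v. stereo (R v)" and ?D = "F ` {s..t}" and ?i = "%z. inv_into UNIV R (unstereo z)"
 have NS: "N : S2" using N by blast
 have h: "homeomorphism (S2 - {N}) UNIV ?s ?i" using R NS by (rule chart_homeo)
 have KS: "?D <= S2 - {N}" using F_in N by blast
 have BD: "bdry ?D <= ?D" by (auto simp: bdry_def)
 have gS: "path_image gm <= S2 - {N}" using g(3) KS BD by blast
 have pg: "path gm" using g(1) by (rule simple_path_imp_path)
 note cp = chart_path[OF R NS pg gS]
 have sp: "simple_path (%t. ?s (gm t))"
 proof -
  have "simple_path (?s \<circ> gm)"
  proof (rule simple_path_continuous_image[OF g(1)])
   show "continuous_on (path_image gm) ?s" by (rule continuous_on_subset[OF homeomorphism_cont1[OF h] gS])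
   show "inj_on ?s (path_image gm)" by (rule inj_onI, rule chart_inj[OF R NS]) (use gS in blast)+
  qed
  then show ?thesis by (simp add: o_def)
 qed
 have bD: "bounded (?s ` ?D)"
  by (intro compact_imp_bounded compact_continuous_image compact_im continuous_on_subset[OF homeomorphism_cont1[OF h] KS])
 let ?B = "?s ` bdry ?D"
 have bB: "bounded ?B" by (rule bounded_subset[OF bD]) (use BD in blast)
 have ims: "openin (top_of_set (S2 - {N})) U ==> open (?s ` U)" for U
  using homeomorphism_imp_open_map[OF h] by simp
 let ?U = "?s ` (?D - bdry ?D)" and ?V = "?s ` (S2 - ?D - {N})"
 have "openin (top_of_set S2) (?D - bdry ?D)" by (rule closed_disk_interior_facts(4)[OF disk[OF st]])
 then have oU: "open ?U" by (intro ims) (rule openin_subset_trans[of S2], use KS in auto)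
 have "openin (top_of_set (S2 - {N})) (S2 - {N} - ?D)"
  by (rule openin_diff) (simp_all add: closedin_closed_Int[OF closed_im] closed_subset[OF KS closed_im])
 moreover have "S2 - {N} - ?D = S2 - ?D - {N}" by blast
 ultimately have oV: "open ?V" using ims by simp
 have UV: "?U Int ?V = {}"
 proof (rule ccontr)
  assume "~ ?thesis"
  then obtain u v where uv: "u : ?D - bdry ?D" "v : S2 - ?D - {N}" "?s u = ?s v" by blast
  have "u = v" by (rule chart_inj[OF R NS _ _ uv(3)]) (use uv KS in blast)+
  then show False using uv by blast
 qed
 have cov: "z : ?U Un ?V Un ?B" for z
 proof -
  have "z : ?s ` (S2 - {N})" using homeomorphism_image1[OF h] by simp
  then show ?thesis using KS by blast
 qed
 have wB: "?s w ~: ?B" using chart_notin[OF R NS gS, of w] w KS unfolding g(3) by blast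
 have "?s w ~: outside ?B"
 proof
  assume o: "?s w : outside ?B"
  have cO: "connected (outside ?B)" by (rule connected_outside[OF bB]) simp
  have "outside ?B Int ?V ~= {}"
  proof
   assume e: "outside ?B Int ?V = {}"
   have "z : ?s ` ?D" if z: "z : outside ?B" for z
   proof -
    have "z ~: ?B" "z ~: ?V" using z e outside_no_overlap[of ?B] by (metis IntI empty_iff)+
    then have "z : ?U" using cov[of z] by (simp only: Un_iff) simp
    then show ?thesis by (rule rev_subsetD) (rule image_mono, rule Diff_subset)
   qed
   then have "outside ?B <= ?s ` ?D" by (rule subsetI)
   then have "bounded (outside ?B)" by (rule bounded_subset[OF bD])
   then show False using unbounded_outside[OF bB] by simp
  qed
  moreover have "outside ?B Int ?U ~= {}"
  proof -
   have "?s w : ?U" using w by (rule imageI)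
   then show ?thesis using o by (metis IntI empty_iff)
  qed
  moreover have "outside ?B <= ?U Un ?V"
  proof
   fix z assume "z : outside ?B"
   then have "z ~: ?B" using outside_no_overlap[of ?B] by (metis IntI empty_iff)
   then show "z : ?U Un ?V" using cov[of z] by (simp only: Un_iff) simp
  qed
  moreover have "?U Int ?V Int outside ?B = {}" unfolding UV by simp
  ultimately show False using connectedD[OF cO oU oV] by (simp add: Int_commute)
 qed
 then have "?s w : inside (path_image (%t. ?s (gm t)))" unfolding cp(2) g(3) using wB inside_Un_outside[of ?B] by (metis ComplI UnE)
 then show ?thesis unfolding chart_winding_def using simple_closed_path_winding_number_inside[OF sp] by metis
qed

end

subsection \<open>Interleaved fibres have opposite orientations\<close>

lemma reversepath_image: "reversepath gm ` {u..v} = gm ` {1 - v..1 - u}"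
proof -
 have "(%x. 1 - x) ` {u..v} = {1 - v..1 - u}" by simp
 then show ?thesis unfolding reversepath_def by (metis image_image)
qed

lemma chart_winding_join:
 assumes R: "chart R N" "N : S2" and p: "path p" "path_image p <= S2 - {N}" and q: "path q" "path_image q <= S2 - {N}"
  and w: "w : S2 - {N}" "w ~: path_image p" "w ~: path_image q" and e: "pathfinish p = pathstart q"
 shows "chart_winding R (p +++ q) w = chart_winding R p w + chart_winding R q w"
proof -
 have "(%t. stereo (R ((p +++ q) t))) = (%t. stereo (R (p t))) +++ (%t. stereo (R (q t)))"
  by (auto simp: joinpaths_def)
 then show ?thesis unfolding chart_winding_def using e
  by (simp add: winding_number_join chart_path[OF R p] chart_path[OF R q] chart_notin[OF R p(2) w(1,2)] chart_notin[OF R q(2) w(1,3)] pathfinish_def pathstart_def)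
qed

lemma chart_winding_split:
 assumes R: "chart R N" "N : S2" and p: "path p" "path_image p <= S2 - {N}"
  and w: "w : S2 - {N}" "w ~: path_image p" and u: "0 <= u" "u <= 1"
 shows "chart_winding R p w = chart_winding R (subpath 0 u p) w + chart_winding R (subpath u 1 p) w"
proof -
 have s: "(%t. stereo (R (subpath x y p t))) = subpath x y (%t. stereo (R (p t)))" for x y
  by (simp add: subpath_def)
 have n: "stereo (R w) ~: path_image (%t. stereo (R (p t)))"
  unfolding chart_path(2)[OF R p] by (rule chart_notin[OF R p(2) w])
 show ?thesis unfolding chart_winding_def s
  using winding_number_subpath_combine[OF chart_path(1)[OF R p] n, of 0 u 1] u by simp
qed

lemma chart_winding_reverse:
 assumes R: "chart R N" "N : S2" and p: "path p" "path_image p <= S2 - {N}" and w: "w : S2 - {N}" "w ~: path_image p"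
 shows "chart_winding R (reversepath p) w = - chart_winding R p w"
proof -
 have s: "(%t. stereo (R (reversepath p t))) = reversepath (%t. stereo (R (p t)))" by (simp add: reversepath_def)
 have n: "stereo (R w) ~: path_image (%t. stereo (R (p t)))"
  unfolding chart_path(2)[OF R p] by (rule chart_notin[OF R p(2) w])
 show ?thesis unfolding chart_winding_def s by (rule winding_number_reversepath[OF chart_path(1)[OF R p] n])
qed

text \<open>The starting angle \<open>2*pi * af\<close> is variable because loops must begin at a
  prescribed boundary point.\<close>

definition circle_loop :: "real => (complex => real^3) => real => real^3" where
 "circle_loop af \<delta> t = \<delta> (cis (2*pi * (af + t)))"

lemma cis_shift_int: "cis (x+2*pi * of_int k) = cis x" using cis_eq_iff by blast

lemma circle_loop:
 assumes h: "homeomorphism S1 B \<delta> \<delta>'"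
 shows "simple_path (circle_loop af \<delta>)" "path_image (circle_loop af \<delta>) = B"
  "pathstart (circle_loop af \<delta>) = \<delta> (cis (2*pi * af))" "pathfinish (circle_loop af \<delta>) = \<delta> (cis (2*pi * af))"
proof -
 have inj: "cis x = cis y" if "\<delta> (cis x) = \<delta> (cis y)" for x y
  using homeomorphism_apply1[OF h] that by (metis cis_in_S1)
 have p: "path (circle_loop af \<delta>)" unfolding path_def circle_loop_def
  by (rule continuous_on_compose2[OF homeomorphism_cont1[OF h]]) (auto intro!: continuous_intros)
 have "x = y | x = 0 & y = 1 | x = 1 & y = 0" if xy: "x : {0..1}" "y : {0..1}" "circle_loop af \<delta> x = circle_loop af \<delta> y" for x y
 proof -
  have "cis (2*pi * (af + x)) = cis (2*pi * (af + y))" using xy(3) by (intro inj) (simp add: circle_loop_def)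
  then obtain k :: int where "2*pi * (af + x) = 2*pi * (af + y)+2*pi * of_int k" using cis_eq_iff by blast
  then have "2*pi * (af + x) = 2*pi * (af + y + of_int k)" by (simp add: algebra_simps)
  then have "af + x = af + y + of_int k" by (simp only: mult_cancel_left) simp
  then have k: "x - y = of_int k" by simp
  moreover have "-1 <= x - y" "x - y <= 1" using xy by auto
  ultimately have "of_int (-1) <= (of_int k :: real)" "(of_int k :: real) <= of_int 1" by simp_all
  then have "k = -1 | k = 0 | k = 1" unfolding of_int_le_iff by linarith
  then show ?thesis using k xy by auto
 qed
 then show "simple_path (circle_loop af \<delta>)" using p unfolding simple_path_def loop_free_def by blast
 show "path_image (circle_loop af \<delta>) = B"
 proof
  show "path_image (circle_loop af \<delta>) <= B" using homeomorphism_image1[OF h] by (auto simp: path_image_def circle_loop_def)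
  show "B <= path_image (circle_loop af \<delta>)"
  proof
   fix b assume "b : B"
   then obtain z where z: "z : S1" "b = \<delta> z" using homeomorphism_image1[OF h] by blast
   then obtain x where x: "z = cis x" using S1_iff_cis by blast
   define y where "y = frac (x / (2*pi) - af)"
   have y: "0 <= y" "y <= 1" unfolding y_def using frac_lt_1[of "x / (2*pi) - af"] by auto
   have "2*pi * (af + y) = x+2*pi * of_int (- \<lfloor>x / (2*pi) - af\<rfloor>)"
    unfolding y_def frac_def by (simp add: algebra_simps)
   then have "cis (2*pi * (af + y)) = z" unfolding x by (simp only: cis_shift_int)
   then have "b = circle_loop af \<delta> y" using z by (simp add: circle_loop_def)
   then show "b : path_image (circle_loop af \<delta>)" unfolding path_image_def using y by (intro image_eqI[of _ _ y]) auto
  qed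
 qed
 show "pathstart (circle_loop af \<delta>) = \<delta> (cis (2*pi * af))" by (simp add: circle_loop_def pathstart_def)
 have "cis (2*pi * (af+1)) = cis (2*pi * af)" using cis_periodic[of "2*pi * af"] by (simp add: algebra_simps)
 then show "pathfinish (circle_loop af \<delta>) = \<delta> (cis (2*pi * af))" by (simp add: circle_loop_def pathfinish_def)
qed

lemma circle_loop_angle:
 assumes "z : S1" obtains af where "0 <= af" "af < 1" "z = cis (2*pi * af)"
proof -
 obtain x where x: "z = cis x" using assms S1_iff_cis by blast
 define y where "y = frac (x / (2*pi))"
 have "2*pi * y = x+2*pi * of_int (- \<lfloor>x / (2*pi)\<rfloor>)" unfolding y_def frac_def by (simp add: algebra_simps)
 then have "z = cis (2*pi * y)" unfolding x by (simp only: cis_shift_int)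
 then show thesis using that[of y] frac_ge_0[of "x / (2*pi)"] frac_lt_1[of "x / (2*pi)"] by (simp add: y_def)
qed

text \<open>Independence of the chart and of the interior point turns the existential choice in
  \<open>pos_oriented\<close> into a test in one fixed chart; shifting the start of the loop changes
  nothing either.\<close>

lemma (in wheel) pos_oriented_iff:
 assumes st: "s < t" "t < s+2*pi" and R: "chart R N" and N: "N : S2 - F ` {s..t}"
  and w: "w : F ` {s..t} - bdry (F ` {s..t})"
  and h: "homeomorphism S1 (bdry (F ` {s..t})) \<delta> \<delta>'" and al: "af : {0..1}"
 shows "pos_oriented (F ` {s..t}) \<delta> \<longleftrightarrow> chart_winding R (circle_loop af \<delta>) w = 1"
proof -
 let ?D = "F ` {s..t}"
 have cl: "path (circle_loop af \<delta>)" "pathfinish (circle_loop af \<delta>) = pathstart (circle_loop af \<delta>)" "path_image (circle_loop af \<delta>) = bdry ?D" for af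
  using circle_loop[OF h, of af] simple_path_imp_path by auto
 have BD: "bdry ?D <= ?D" by (auto simp: bdry_def)
 have DS: "?D <= S2" using F_in by blast
 have sh: "circle_loop af \<delta> = shiftpath af (circle_loop 0 \<delta>)"
 proof
  fix x
  have "cis (2*pi * (af + x)) = cis (2*pi * (af + x - 1))"
   using cis_periodic[of "2*pi * (af + x - 1)"] by (simp add: algebra_simps)
  then show "circle_loop af \<delta> x = shiftpath af (circle_loop 0 \<delta>) x" by (simp add: shiftpath_def circle_loop_def)
 qed
 have same: "chart_winding R' (circle_loop 0 \<delta>) w' = chart_winding R (circle_loop af \<delta>) w"
  if R': "chart R' N'" "N' : S2 - ?D" "w' : ?D - bdry ?D" for R' N' w'
 proof -
  have gS: "path_image (circle_loop 0 \<delta>) <= S2 - {N'}" unfolding cl(3) using BD DS R' by blast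
  have NS: "N' : S2" using R' by blast
  have n: "stereo (R' w') ~: path_image (%t. stereo (R' (circle_loop 0 \<delta> t)))"
   unfolding chart_path(2)[OF R'(1) NS cl(1) gS] by (rule chart_notin[OF R'(1) NS gS]) (use R' DS cl(3) in blast)+
  have "chart_winding R' (circle_loop af \<delta>) w' = winding_number (shiftpath af (%t. stereo (R' (circle_loop 0 \<delta> t)))) (stereo (R' w'))"
   unfolding chart_winding_def sh by (rule arg_cong2[where f = winding_number]) (auto simp: shiftpath_def)
  also have "\<dots> = chart_winding R' (circle_loop 0 \<delta>) w'" unfolding chart_winding_def
   by (rule winding_number_shiftpath[OF chart_path(1)[OF R'(1) NS cl(1) gS] n _ al]) (use cl(2)[of 0] in \<open>simp add: pathfinish_def pathstart_def\<close>)
  finally show ?thesis using chart_winding_independent[OF st R R'(1) N R'(2) w R'(3) cl(1,2), of af] cl(3) by simp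
 qed
 have "pos_oriented ?D \<delta> \<longleftrightarrow> (EX N':S2 - ?D. EX R'. chart R' N' & (EX w':?D - bdry ?D. chart_winding R' (circle_loop 0 \<delta>) w' = 1))"
  unfolding pos_oriented_def chart_def chart_winding_def circle_loop_def by simp
 also have "\<dots> \<longleftrightarrow> chart_winding R (circle_loop af \<delta>) w = 1"
  using same R N w by (metis (no_types, lifting))
 finally show ?thesis .
qed

text \<open>Two interleaved pairs with different images. Rotating the four parameters exchanges
  \<open>a\<close> and \<open>r\<close>, so a fact about one diagonal also holds for the
  other.\<close>

locale wheel_quad = wheel F for F :: "real => real^3" +
 fixes t1 t2 t3 t4 :: real and a r :: "real^3"
 assumes ord: "t1 < t2" "t2 < t3" "t3 < t4" "t4 < t1+2*pi"
  and Fa: "F t1 = a" "F t3 = a" and Fr: "F t2 = r" "F t4 = r" and ar: "a ~= r"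
begin

abbreviation "E1 \<equiv> F ` {t1..t2}"
abbreviation "E2 \<equiv> F ` {t2..t3}"
abbreviation "E3 \<equiv> F ` {t3..t4}"
abbreviation "E4 \<equiv> F ` {t4..t1+2*pi}"
abbreviation "D1 \<equiv> F ` {t1..t3}"
abbreviation "X1 \<equiv> F ` {t3..t1+2*pi}"

lemma wheel_quad_rotate: "wheel_quad F t2 t3 t4 (t1+2*pi) r a"
 by unfold_locales (use ord Fa Fr ar per[of t1] in auto)

lemma corners: "a : E1" "r : E1" "a : E2" "r : E2" "a : E3" "r : E3" "a : E4" "r : E4"
proof -
 have F1: "F (t1+2*pi) = a" using per[of t1] Fa by simp
 show "a : E1" by (rule image_eqI[of _ _ t1]) (use ord Fa in auto)
 show "r : E1" by (rule image_eqI[of _ _ t2]) (use ord Fr in auto)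
 show "a : E2" by (rule image_eqI[of _ _ t3]) (use ord Fa in auto)
 show "r : E2" by (rule image_eqI[of _ _ t2]) (use ord Fr in auto)
 show "a : E3" by (rule image_eqI[of _ _ t3]) (use ord Fa in auto)
 show "r : E3" by (rule image_eqI[of _ _ t4]) (use ord Fr in auto)
 show "a : E4" by (rule image_eqI[of _ _ "t1+2*pi"]) (use ord F1 in auto)
 show "r : E4" by (rule image_eqI[of _ _ t4]) (use ord Fr in auto)
qed

text \<open>A third common point, reached at \<open>s\<close> between \<open>t3\<close> and
  \<open>t4\<close>, would belong together with \<open>a\<close> and \<open>r\<close> to all three
  disks over \<open>{t1..t2}\<close>, \<open>{t2..s}\<close> and
  \<open>{s..t1+2*pi}\<close>.\<close>

lemma opposite_tiles: "E1 Int E3 <= {a, r}"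
proof
 fix z assume z: "z : E1 Int E3"
 then obtain s where s: "t3 <= s" "s <= t4" "z = F s" by auto
 show "z : {a, r}"
 proof (rule ccontr)
  assume n: "z ~: {a, r}"
  then have s': "t3 < s" "s < t4" using s Fa Fr by (auto simp: less_le)
  have m: "b : F ` {u..v}" if "F x = b" "u <= x" "x <= v" for b x u v using that by auto
  have F1: "F (t1+2*pi) = a" using per[of t1] Fa by simp
  have "a : F ` {t2..s}" by (rule m[OF Fa(2)]) (use s' ord in auto)
  moreover have "r : F ` {t2..s}" by (rule m[OF Fr(1)]) (use s' ord in auto)
  moreover have "z : F ` {t2..s}" by (rule m[OF s(3)[symmetric]]) (use s' ord in auto)
  moreover have "r : F ` {s..t1+2*pi}" by (rule m[OF Fr(2)]) (use s' ord in auto)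
  moreover have "z : F ` {s..t1+2*pi}" by (rule m[OF s(3)[symmetric]]) (use s' ord in auto)
  moreover have "a : F ` {s..t1+2*pi}" by (rule m[OF F1]) (use s' ord in auto)
  moreover have "a : E1" "r : E1" "z : E1" using corners z by blast+
  ultimately have "{a, r, z} <= E1 Int F ` {t2..s} Int F ` {s..t1+2*pi}" by (simp only: insert_subset Int_iff empty_subsetI simp_thms)
  then have "r = z" by (rule triple_at_most_two[rotated 3]) (use ord s' ar n in auto)
  then show False using n by simp
 qed
qed

lemma X1_split: "X1 = E3 Un E4" using image_split[of t3 t4 "t1+2*pi"] ord by simp

lemma halves: "E1 Int X1 = E1 Int E4" "E2 Int X1 = E2 Int E3"
proof -
 interpret Q: wheel_quad F t2 t3 t4 "t1+2*pi" r a by (rule wheel_quad_rotate)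
 have *: "A Int (C Un D) = A Int D" if "A Int C <= {a, r}" "a : D" "r : D" for A C D :: "(real^3) set" using that by blast
 show "E1 Int X1 = E1 Int E4" unfolding X1_split by (rule *[OF opposite_tiles corners(7,8)])
 have "E2 Int E4 <= {a, r}" using Q.opposite_tiles by (simp only: insert_commute)
 then show "E2 Int X1 = E2 Int E3" unfolding X1_split Un_commute[of E3] by (rule *) (rule corners)+
qed

lemma bdry_D1: "bdry D1 = D1 Int X1" by (rule bdry_eq) (use ord in auto)

lemma boundary_arcs:
 assumes g: "simple_path gm" "pathstart gm = a" "pathfinish gm = a" "path_image gm = bdry D1"
  and s: "t1 < s" "s < t3" "F s : X1" "F s ~= a"
 obtains tu where "0 < tu" "tu < 1" "gm tu = F s"
  "F ` {t1..s} Int X1 = gm ` {0..tu} & F ` {s..t3} Int X1 = gm ` {tu..1} | F ` {t1..s} Int X1 = gm ` {tu..1} & F ` {s..t3} Int X1 = gm ` {0..tu}"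
proof -
 let ?P = "F ` {t1..s} Int X1" and ?Q = "F ` {s..t3} Int X1"
 have aX: "a : X1" unfolding X1_split using corners by blast
 have m: "F s : F ` {t1..s}" "F s : F ` {s..t3}" using s by auto
 have a1: "a : F ` {t1..s}" by (rule image_eqI[of _ _ t1]) (use s Fa in auto)
 have a2: "a : F ` {s..t3}" by (rule image_eqI[of _ _ t3]) (use s Fa in auto)
 have cP: "connected ?P" by (rule connected_Int_consecutive') (use s ord in auto)
 have cQ: "connected ?Q" by (rule connected_Int_consecutive) (use s ord in auto)
 have un: "?P Un ?Q = path_image gm" unfolding g(4) bdry_D1 using image_split[of t1 s t3] s by auto
 have tr: "?P Int ?Q <= {a, F s}"
 proof
  fix x assume x: "x : ?P Int ?Q"
  show "x : {a, F s}"
  proof (rule ccontr)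
   assume n: "x ~: {a, F s}"
   have "{a, F s, x} <= F ` {t1..s} Int F ` {s..t3} Int X1" using x a1 a2 m aX s(3) by blast
   then have "F s = x" by (rule triple_at_most_two[rotated 3]) (use ord s n in auto)
   then show False using n by simp
  qed
 qed
 show thesis
 proof (rule simple_loop_two_arcs[OF g(1-3) _ cP _ _ _ cQ _ _ un tr])
  show "closed ?P" "closed ?Q" by (intro closed_Int closed_im)+
  show "a : ?P" "a : ?Q" using a1 a2 aX by simp_all
  have "F s : ?P" "F s : ?Q" using m s(3) by simp_all
  then show "?P ~= {a}" "?Q ~= {a}" using s(4) by (metis singletonD)+
 qed (rule that)
qed

text \<open>A boundary loop of \<open>D1\<close> compatible with the order of the interval: from
  \<open>a\<close> along \<open>E4\<close> to \<open>r\<close>, then along \<open>E3\<close> back to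
  \<open>a\<close>.\<close>

definition cmp :: "(real => real^3) => real => bool" where
 "cmp gm tu \<longleftrightarrow> simple_path gm & pathstart gm = a & pathfinish gm = a & path_image gm = bdry D1 &
  0 < tu & tu < 1 & gm tu = r & gm ` {0..tu} = E1 Int E4 & gm ` {tu..1} = E2 Int E3"

lemma cmp_cases:
 assumes g: "simple_path gm" "pathstart gm = a" "pathfinish gm = a" "path_image gm = bdry D1"
 obtains tu where "cmp gm tu" | tu where "cmp (reversepath gm) tu"
proof -
 have rX: "F t2 : X1" "F t2 ~= a" unfolding X1_split using corners Fr ar by auto
 obtain tu where t: "0 < tu" "tu < 1" "gm tu = F t2"
  and c: "E1 Int X1 = gm ` {0..tu} & E2 Int X1 = gm ` {tu..1} | E1 Int X1 = gm ` {tu..1} & E2 Int X1 = gm ` {0..tu}"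
  by (rule boundary_arcs[OF g ord(1,2) rX]) (rule that)
 from c show thesis
 proof
  assume "E1 Int X1 = gm ` {0..tu} & E2 Int X1 = gm ` {tu..1}"
  then have "cmp gm tu" unfolding halves cmp_def using g t Fr by simp
  then show thesis by (rule that(1))
 next
  assume "E1 Int X1 = gm ` {tu..1} & E2 Int X1 = gm ` {0..tu}"
  then have "reversepath gm ` {0..1 - tu} = E1 Int E4" "reversepath gm ` {1 - tu..1} = E2 Int E3"
   unfolding halves reversepath_image by simp_all
  moreover have "reversepath gm (1 - tu) = r" using t Fr by (simp add: reversepath_def)
  ultimately have "cmp (reversepath gm) (1 - tu)" unfolding cmp_def using g t by (simp add: simple_path_reversepath)
  then show thesis by (rule that(2))
 qed
qed

text \<open>Compatibility at \<open>r\<close> propagates to every other cut point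
  \<open>F s\<close>: a reversed splitting would force the end of the loop into its first part, or
  its beginning into the second.\<close>

lemma cmp_initial_arc:
 assumes c: "cmp gm tu" and s: "t1 < s" "s < t3" "F s : X1" "F s ~= a"
 obtains u where "0 < u" "u < 1" "gm u = F s" "F ` {t1..s} Int X1 = gm ` {0..u}"
proof -
 have g: "simple_path gm" "pathstart gm = a" "pathfinish gm = a" "path_image gm = bdry D1" and t: "0 < tu" "tu < 1"
  and im: "gm ` {0..tu} = E1 Int X1" "gm ` {tu..1} = E2 Int X1" using c unfolding cmp_def halves by auto
 obtain u where u: "0 < u" "u < 1" "gm u = F s"
  and cs: "F ` {t1..s} Int X1 = gm ` {0..u} & F ` {s..t3} Int X1 = gm ` {u..1} | F ` {t1..s} Int X1 = gm ` {u..1} & F ` {s..t3} Int X1 = gm ` {0..u}"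
  by (rule boundary_arcs[OF g s]) (rule that)
 have "False" if h: "F ` {t1..s} Int X1 = gm ` {u..1}" "F ` {s..t3} Int X1 = gm ` {0..u}"
 proof (cases "s <= t2")
  case True
  define x where "x = (max u tu+1) / 2"
  have x: "u <= x" "tu < x" "0 < x" "x < 1" unfolding x_def using u t by (auto simp: max_def)
  have "F ` {t1..s} Int X1 <= E1 Int X1" using True by auto
  moreover have "gm x : F ` {t1..s} Int X1" unfolding h using x by auto
  ultimately have "gm x : gm ` {0..tu}" unfolding im by blast
  then obtain y where y: "0 <= y" "y <= tu" "gm y = gm x" by auto
  then have "y = x" by (intro simple_loop_inj[OF g(1)]) (use x t in auto)
  then show False using x y by simp
 next
  case False
  define x where "x = min u tu / 2"
  have x: "x <= u" "x < tu" "0 < x" "x < 1" unfolding x_def using u t by (auto simp: min_def)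
  have "F ` {s..t3} Int X1 <= E2 Int X1" using False by auto
  moreover have "gm x : F ` {s..t3} Int X1" unfolding h using x by auto
  ultimately have "gm x : gm ` {tu..1}" unfolding im by blast
  then obtain y where y: "tu <= y" "y <= 1" "gm y = gm x" by auto
  then have "y = x" by (intro simple_loop_inj[OF g(1)]) (use x t in auto)
  then show False using x y by simp
 qed
 then have "F ` {t1..s} Int X1 = gm ` {0..u}" using cs by blast
 then show thesis by (rule that[OF u])
qed

lemma cmp_mono:
 assumes c: "cmp gm tu" and s: "t1 <= s1" "s1 <= s2" "s2 <= t3" "F s1 : X1" "F s1 ~= a" "F s2 : X1" "F s2 ~= a"
  and u: "u1 : {0..1}" "gm u1 = F s1" "u2 : {0..1}" "gm u2 = F s2"
 shows "u1 <= u2"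
proof -
 have g: "simple_path gm" "gm 0 = a" "gm 1 = a" using c unfolding cmp_def pathstart_def pathfinish_def by auto
 have s': "t1 < s2" "s2 < t3" using s Fa by (auto simp: less_le)
 obtain v where v: "0 < v" "v < 1" "gm v = F s2" "F ` {t1..s2} Int X1 = gm ` {0..v}"
  by (rule cmp_initial_arc[OF c s' s(6,7)]) (rule that)
 have "u2 = v" by (rule simple_loop_inj[OF g(1)]) (use u v in auto)
 have "F s1 : gm ` {0..v}" unfolding v(4)[symmetric] using s by auto
 then obtain y where y: "0 <= y" "y <= v" "F s1 = gm y" by auto
 have "u1 = y" by (rule simple_loop_inj[OF g(1)]) (use u y v g s in auto)
 then show ?thesis using y \<open>u2 = v\<close> by simp
qed

text \<open>The first parts of the two loops close up to a loop in \<open>E1\<close>, the second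
  parts to a loop in \<open>E3\<close>. The centre \<open>N\<close> lies in the interior of
  \<open>E4\<close> and \<open>w\<close> in that of \<open>E2\<close>, so both recombined loops have
  winding number zero.\<close>

lemma cmp_opposite:
 assumes c1: "cmp gm1 tu1" and c2: "wheel_quad.cmp F t2 t3 t4 (t1+2*pi) r a gm2 tu2"
  and R: "chart R N" and N: "N : S2 - F ` {t1..t4}" and w: "w : S2 - F ` {t3..t2+2*pi}"
 shows "chart_winding R gm1 w = - chart_winding R gm2 w"
proof -
 interpret Q: wheel_quad F t2 t3 t4 "t1+2*pi" r a by (rule wheel_quad_rotate)
 have g1: "path gm1" "gm1 0 = a" "gm1 1 = a" "gm1 tu1 = r" "0 < tu1" "tu1 < 1" "path_image gm1 = bdry D1"
  and i1: "gm1 ` {0..tu1} = E1 Int E4" "gm1 ` {tu1..1} = E2 Int E3"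
  using c1 simple_path_imp_path unfolding cmp_def pathstart_def pathfinish_def by auto
 have g2: "path gm2" "gm2 0 = r" "gm2 1 = r" "gm2 tu2 = a" "0 < tu2" "tu2 < 1" "path_image gm2 = bdry (F ` {t2..t4})"
  and i2: "gm2 ` {0..tu2} = E2 Int E1" "gm2 ` {tu2..1} = E3 Int E4"
  using c2 simple_path_imp_path unfolding Q.cmp_def pathstart_def pathfinish_def shift_image by auto
 have sub: "E1 <= F ` {t1..t4}" "E2 <= F ` {t1..t4}" "E3 <= F ` {t1..t4}" by (intro image_mono, use ord in auto)+
 have "F ` {t1+2*pi..t2+2*pi} <= F ` {t3..t2+2*pi}" by (intro image_mono) (use ord in auto)
 then have E1s: "E1 <= F ` {t3..t2+2*pi}" unfolding shift_image .
 have sub': "E3 <= F ` {t3..t2+2*pi}" "E4 <= F ` {t3..t2+2*pi}" by (intro image_mono, use ord in auto)+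
 have NE: "N : S2 - E1" "N : S2 - E3" "N ~: E2" using N sub by blast+
 have wE: "w : S2 - E1" "w : S2 - E3" "w ~: E4" using w E1s sub' by blast+
 have "F ` {t2..t3} Un F ` {t3..t2+2*pi} = S2" using image_split[of t2 t3 "t2+2*pi"] full_image[of t2] ord by simp
 then have wN: "w ~= N" using NE w by blast
 have NS: "N : S2" using N by blast
 have gi: "path_image gm1 = gm1 ` {0..tu1} Un gm1 ` {tu1..1}" "path_image gm2 = gm2 ` {0..tu2} Un gm2 ` {tu2..1}"
  unfolding path_image_def image_Un[symmetric] using g1 g2 by (simp_all add: ivl_disj_un_two_touch)
 have FS: "F ` A <= S2" for A using F_in by blast
 have s1: "path_image gm1 <= S2 - {N}" unfolding gi i1 using FS NE by blast
 have s2: "path_image gm2 <= S2 - {N}" unfolding gi i2 using FS NE by blast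
 have w1: "w ~: path_image gm1" unfolding gi i1 using wE by blast
 have w2: "w ~: path_image gm2" unfolding gi i2 using wE by blast
 have wS: "w : S2 - {N}" using w wN by blast
 have pi1: "path_image (subpath 0 tu1 gm1) = E1 Int E4" "path_image (subpath tu1 1 gm1) = E2 Int E3"
  using g1 i1 by (simp_all add: path_image_subpath)
 have pi2: "path_image (subpath 0 tu2 gm2) = E2 Int E1" "path_image (subpath tu2 1 gm2) = E3 Int E4"
  using g2 i2 by (simp_all add: path_image_subpath)
 have pp: "path (subpath 0 tu1 gm1)" "path (subpath tu1 1 gm1)" "path (subpath 0 tu2 gm2)" "path (subpath tu2 1 gm2)"
  using g1 g2 by (auto intro!: path_subpath)
 have A: "chart_winding R (subpath 0 tu1 gm1) w + chart_winding R (subpath 0 tu2 gm2) w = 0"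
 proof -
  have "chart_winding R (subpath 0 tu1 gm1 +++ subpath 0 tu2 gm2) w = 0"
  proof (rule chart_winding_zero[OF _ _ R NE(1) wE(1) wN])
   show "path (subpath 0 tu1 gm1 +++ subpath 0 tu2 gm2)" using pp g1 g2 by simp
   show "path_image (subpath 0 tu1 gm1 +++ subpath 0 tu2 gm2) <= E1"
    by (rule subset_path_image_join) (unfold pi1 pi2, blast+)
  qed (use ord g1 g2 in auto)
  moreover have "chart_winding R (subpath 0 tu1 gm1 +++ subpath 0 tu2 gm2) w = chart_winding R (subpath 0 tu1 gm1) w + chart_winding R (subpath 0 tu2 gm2) w"
   by (rule chart_winding_join[OF R NS pp(1) _ pp(3) _ wS]) (use FS NE wE g1 g2 in \<open>auto simp: pi1 pi2\<close>)
  ultimately show ?thesis by simp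
 qed
 have B: "chart_winding R (subpath tu2 1 gm2) w + chart_winding R (subpath tu1 1 gm1) w = 0"
 proof -
  have "chart_winding R (subpath tu2 1 gm2 +++ subpath tu1 1 gm1) w = 0"
  proof (rule chart_winding_zero[OF _ _ R NE(2) wE(2) wN])
   show "path (subpath tu2 1 gm2 +++ subpath tu1 1 gm1)" using pp g1 g2 by simp
   show "path_image (subpath tu2 1 gm2 +++ subpath tu1 1 gm1) <= E3"
    by (rule subset_path_image_join) (unfold pi1 pi2, blast+)
  qed (use ord g1 g2 in auto)
  moreover have "chart_winding R (subpath tu2 1 gm2 +++ subpath tu1 1 gm1) w = chart_winding R (subpath tu2 1 gm2) w + chart_winding R (subpath tu1 1 gm1) w"
   by (rule chart_winding_join[OF R NS pp(4) _ pp(2) _ wS]) (use FS NE wE g1 g2 in \<open>auto simp: pi1 pi2\<close>)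
  ultimately show ?thesis by simp
 qed
 have "chart_winding R gm1 w + chart_winding R gm2 w = 0"
  using chart_winding_split[OF R NS g1(1) s1 wS w1, of tu1] chart_winding_split[OF R NS g2(1) s2 wS w2, of tu2] A B g1 g2
  by (simp add: algebra_simps)
 then show ?thesis by (rule eq_neg_iff_add_eq_0[THEN iffD2])
qed

lemma cmp_exists: "EX gm tu. cmp gm tu"
proof -
 have d: "closed_disk D1" by (rule disk) (use ord in auto)
 have ab: "a : bdry D1" using ends[of t1 t3] ord Fa by simp
 obtain gm where "simple_path gm" "pathstart gm = a" "pathfinish gm = a" "path_image gm = bdry D1"
  by (rule closed_disk_boundary_loop[OF d ab])
 then show ?thesis by (rule cmp_cases) blast+
qed

text \<open>Both equal the negative of the winding number of one compatible loop for the other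
  diagonal.\<close>

lemma cmp_same:
 assumes "cmp gm tu" "cmp gm' tu'" "chart R N" "N : S2 - F ` {t1..t4}" "w : S2 - F ` {t3..t2+2*pi}"
 shows "chart_winding R gm w = chart_winding R gm' w"
proof -
 interpret Q: wheel_quad F t2 t3 t4 "t1+2*pi" r a by (rule wheel_quad_rotate)
 obtain gm2 tu2 where "Q.cmp gm2 tu2" using Q.cmp_exists by blast
 then show ?thesis using cmp_opposite[OF assms(1) _ assms(3-5)] cmp_opposite[OF assms(2) _ assms(3-5)] by simp
qed

lemma arc_D1: "arc (cis t1) (cis t3) = cis ` {t1..t3}" by (rule arc_cis) (use ord in auto)

lemma anti_not_canonical:
 assumes F: "F = (%t. f (cis t))" and h: "homeomorphism S1 (bdry D1) \<delta> \<delta>'" and po: "pos_oriented D1 \<delta>"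
  and al: "\<delta> (cis (2*pi * af)) = a" and anti: "cmp (reversepath (circle_loop af \<delta>)) tu"
 shows "~ canon_agrees f (cis t1) (cis t3) (bdry D1 - {a})"
proof
 assume ca: "canon_agrees f (cis t1) (cis t3) (bdry D1 - {a})"
 let ?g = "circle_loop af \<delta>"
 have im: "f ` arc (cis t1) (cis t3) = D1" unfolding arc_D1 F by (simp add: image_image)
 have g: "simple_path ?g" "path_image ?g = bdry D1" "?g 0 = a" using circle_loop[OF h, of af] al by (auto simp: pathstart_def)
 have t: "0 < tu" "tu < 1" "?g (1 - tu) = r" "reversepath ?g ` {0..tu} = E1 Int E4"
  using anti unfolding cmp_def by (auto simp: reversepath_def)
 \<comment> \<open>A witness strictly inside the first arc: in the order of the interval it does not
   come after \<open>t2\<close>, but on the circle, read from \<open>a\<close>, it comes after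
   \<open>r\<close>.\<close>
 have "reversepath ?g (tu / 2) : E1 Int E4" unfolding t(4)[symmetric] using t by auto
 then obtain s where s: "t1 <= s" "s <= t2" "F s = ?g (1 - tu / 2)" by (auto simp: reversepath_def)
 have Fs: "F s ~= a"
 proof
  assume "F s = a"
  then have "?g 0 = ?g (1 - tu / 2)" using g s by simp
  then have "0 = 1 - tu / 2" by (rule simple_loop_inj[OF g(1)]) (use t in auto)
  then show False using t by simp
 qed
 have gB: "?g x : bdry D1" if "x : {0..1}" for x using g(2) that by (auto simp: path_image_def)
 have d': "\<delta>' (?g x) = cis (2*pi * (af + x))" for x unfolding circle_loop_def by (rule homeomorphism_apply1[OF h]) simp
 have aB: "a : bdry D1" using gB[of 0] g by simp
 have da: "\<delta>' a = cis (2*pi * af)" using d'[of 0] g by simp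
 have p: "cis s : arc (cis t1) (cis t3)" "cis t2 : arc (cis t1) (cis t3)" unfolding arc_D1 using s ord by auto
 have p2: "cis s : arc (cis t1) (cis t2)" using arc_cis(1)[of t1 t2] s ord by auto
 have fs: "f (cis s) = ?g (1 - tu / 2)" "f (cis t2) = ?g (1 - tu)" using s(3) Fr(1) t(3) unfolding F by auto
 have Y: "f (cis s) : bdry D1 - {a}" "f (cis t2) : bdry D1 - {a}" unfolding fs
  using gB[of "1 - tu / 2"] gB[of "1 - tu"] t Fs s ar by auto
 have "\<delta>' (f (cis s)) : arc (\<delta>' a) (\<delta>' (f (cis t2)))"
  using ca h po aB p p2 Y unfolding canon_agrees_def im Let_def by blast
 then have "cis (2*pi * (af+(1 - tu / 2))) : arc (cis (2*pi * af)) (cis (2*pi * (af+(1 - tu))))"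
  unfolding fs d' da .
 moreover have "arc (cis (2*pi * af)) (cis (2*pi * (af+(1 - tu)))) = cis ` {2*pi * af..2*pi * (af+(1 - tu))}"
 proof (rule arc_cis)
  show "2*pi * af <= 2*pi * (af+(1 - tu))" using t by (intro mult_left_mono) auto
  have "2*pi * (af+(1 - tu)) < 2*pi * (af+1)" using t by (intro mult_strict_left_mono) auto
  then show "2*pi * (af+(1 - tu)) < 2*pi * af+2*pi" by (simp add: algebra_simps)
 qed
 ultimately obtain y where y: "2*pi * af <= y" "y <= 2*pi * (af+(1 - tu))" "cis (2*pi * (af+(1 - tu / 2))) = cis y" by auto
 have b: "2*pi * (af+(1 - tu)) < 2*pi * (af+(1 - tu / 2))" using t by (intro mult_strict_left_mono) auto
 have b2: "2*pi * (af+(1 - tu / 2)) < 2*pi * (af+1)" using t by (intro mult_strict_left_mono) auto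
 have "2*pi * (af+(1 - tu / 2)) = y"
 proof (rule cis_eq_near[OF y(3)])
  have "2*pi * (af+1) = 2*pi * af+2*pi" by (simp add: algebra_simps)
  then show "\<bar>2*pi * (af+(1 - tu / 2)) - y\<bar> < 2*pi" using y b b2 by linarith
 qed
 then show False using y b by linarith
qed

text \<open>A positive parametrisation started at \<open>a\<close> is itself compatible; were its
  reversal compatible, \<open>cmp_same\<close> would give the reversal winding number 1 too. Order
  preservation is then \<open>cmp_mono\<close>.\<close>

lemma canonical_if_positive:
 assumes F: "F = (%t. f (cis t))" and c: "cmp gm tu" and R: "chart R N" and N: "N : S2 - F ` {t1..t4}" and w: "w : S2 - F ` {t3..t2+2*pi}"
  and one: "chart_winding R gm w = 1"
 shows "canon_agrees f (cis t1) (cis t3) (bdry D1 - {a})"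
proof -
 have im: "f ` arc (cis t1) (cis t3) = D1" unfolding arc_D1 F by (simp add: image_image)
 have st: "t1 < t3" "t3 < t1+2*pi" using ord by auto
 have "D1 <= F ` {t1..t4}" by (intro image_mono) (use ord in auto)
 then have N1: "N : S2 - D1" using N by blast
 have "X1 <= F ` {t3..t2+2*pi}" by (intro image_mono) (use ord in auto)
 then have w1: "w : D1 - bdry D1" unfolding interior_eq[OF st] using w by blast
 have NS: "N : S2" and wS: "w : S2 - {N}" using N1 w1 F_in by blast+
 have D1S: "bdry D1 <= S2 - {N}" using N1 F_in unfolding bdry_def by blast
 show ?thesis unfolding canon_agrees_def im Let_def
 proof (intro allI impI ballI)
  fix \<delta> \<delta>' z p1 p2
  assume hp: "homeomorphism S1 (bdry D1) \<delta> \<delta>' & pos_oriented D1 \<delta>" and z: "z : bdry D1 - (bdry D1 - {a})"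
   and pp: "p1 : arc (cis t1) (cis t3) & p2 : arc (cis t1) (cis t3) & f p1 : bdry D1 - {a} & f p2 : bdry D1 - {a} & p1 : arc (cis t1) p2"
  then have h: "homeomorphism S1 (bdry D1) \<delta> \<delta>'" and po: "pos_oriented D1 \<delta>" and za: "z = a" and aB: "a : bdry D1" by auto
  obtain s1 s2 where s: "t1 <= s1" "s1 <= t3" "p1 = cis s1" "t1 <= s2" "s2 <= t3" "p2 = cis s2" using pp unfolding arc_D1 by auto
  have Fs: "F s1 : bdry D1" "F s1 ~= a" "F s2 : bdry D1" "F s2 ~= a" using pp s unfolding F by auto
  have "arc (cis t1) (cis s2) = cis ` {t1..s2}" by (rule arc_cis) (use s ord in auto)
  then obtain y where y: "t1 <= y" "y <= s2" "cis s1 = cis y" using pp s by auto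
  have "s1 = y" by (rule cis_eq_near[OF y(3)]) (use s y ord in linarith)
  then have s12: "s1 <= s2" using y by simp
  have "\<delta>' a : S1" using homeomorphism_image2[OF h] aB by blast
  then obtain af where al: "0 <= af" "af < 1" "\<delta>' a = cis (2*pi * af)" by (rule circle_loop_angle)
  have dal: "\<delta> (cis (2*pi * af)) = a" using homeomorphism_apply2[OF h aB] al by simp
  let ?g = "circle_loop af \<delta>"
  have g: "simple_path ?g" "pathstart ?g = a" "pathfinish ?g = a" "path_image ?g = bdry D1"
   using circle_loop[OF h, of af] dal by auto
  have pg: "path ?g" "path_image ?g <= S2 - {N}" "w ~: path_image ?g" using g D1S w1 simple_path_imp_path by auto
  have g1: "chart_winding R ?g w = 1" using pos_oriented_iff[OF st R N1 w1 h, of af] al po by simp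
  obtain tu' where cg: "cmp ?g tu'"
  proof (rule cmp_cases[OF g])
   fix tu'' assume "cmp (reversepath ?g) tu''"
   then have "chart_winding R (reversepath ?g) w = 1" using cmp_same[OF c _ R N w] one by simp
   moreover have "chart_winding R (reversepath ?g) w = - 1" using chart_winding_reverse[OF R NS pg(1,2) wS pg(3)] g1 by simp
   ultimately show thesis by simp
  qed
  obtain u1 where u1: "u1 : {0..1}" "?g u1 = F s1" using Fs(1) g(4) unfolding path_image_def by (metis image_iff)
  obtain u2 where u2: "u2 : {0..1}" "?g u2 = F s2" using Fs(3) g(4) unfolding path_image_def by (metis image_iff)
  have le: "u1 <= u2" by (rule cmp_mono[OF cg s(1) s12 s(5) _ Fs(2) _ Fs(4) u1 u2]) (use Fs bdry_D1 in blast)+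
  have "u2 ~= 1" using u2 g(3) Fs(4) by (auto simp: pathfinish_def)
  then have u: "0 <= u1" "u1 <= u2" "0 <= u2" "u2 < 1" using u1 u2 le by auto
  have d': "\<delta>' (?g x) = cis (2*pi * (af + x))" for x unfolding circle_loop_def by (rule homeomorphism_apply1[OF h]) simp
  have "arc (cis (2*pi * af)) (cis (2*pi * (af + u2))) = cis ` {2*pi * af..2*pi * (af + u2)}"
  proof (rule arc_cis)
   show "2*pi * af <= 2*pi * (af + u2)" using u by (intro mult_left_mono) auto
   have "2*pi * (af + u2) < 2*pi * (af+1)" using u by (intro mult_strict_left_mono) auto
   then show "2*pi * (af + u2) < 2*pi * af+2*pi" by (simp add: algebra_simps)
  qed
  moreover have "2*pi * (af + u1) : {2*pi * af..2*pi * (af + u2)}" using u by simp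
  ultimately have "cis (2*pi * (af + u1)) : arc (cis (2*pi * af)) (cis (2*pi * (af + u2)))" by blast
  then have "\<delta>' (F s1) : arc (\<delta>' a) (\<delta>' (F s2))" unfolding u1(2)[symmetric] u2(2)[symmetric] d' al(3) .
  then show "\<delta>' (f p1) : arc (\<delta>' z) (\<delta>' (f p2))" unfolding za s F .
 qed
qed

lemma canonical_iff:
 assumes F: "F = (%t. f (cis t))" and c: "cmp gm tu" and R: "chart R N" and N: "N : S2 - F ` {t1..t4}" and w: "w : S2 - F ` {t3..t2+2*pi}"
 shows "canon_agrees f (cis t1) (cis t3) (bdry D1 - {a}) \<longleftrightarrow> chart_winding R gm w = 1"
proof
 show "chart_winding R gm w = 1 ==> canon_agrees f (cis t1) (cis t3) (bdry D1 - {a})"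
  by (rule canonical_if_positive[OF F c R N w])
 assume ca: "canon_agrees f (cis t1) (cis t3) (bdry D1 - {a})"
 have st: "t1 < t3" "t3 < t1+2*pi" using ord by auto
 have "D1 <= F ` {t1..t4}" by (intro image_mono) (use ord in auto)
 then have N1: "N : S2 - D1" using N by blast
 have "X1 <= F ` {t3..t2+2*pi}" by (intro image_mono) (use ord in auto)
 then have w1: "w : D1 - bdry D1" unfolding interior_eq[OF st] using w by blast
 have NS: "N : S2" and wS: "w : S2 - {N}" using N1 w1 F_in by blast+
 have D1S: "bdry D1 <= S2 - {N}" using N1 F_in unfolding bdry_def by blast
 show "chart_winding R gm w = 1"
 proof (rule ccontr)
  assume "chart_winding R gm w ~= 1"
  then have m1: "chart_winding R gm w = -1"
   using chart_winding_boundary[OF st R N1 w1, of gm] c unfolding cmp_def by auto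
  \<comment> \<open>\<open>canon_agrees\<close> would hold vacuously if no positive parametrisation
    existed, so one is produced: some boundary parametrisation or its complex conjugate. With
    winding number -1 the positive one runs against the interval.\<close>
  obtain \<delta> \<delta>' where hd: "homeomorphism (cball (0::complex) 1) D1 \<delta> \<delta>'" "\<delta> ` sphere 0 1 = bdry D1"
   using closed_disk_param[OF disk[OF st]] by metis
  have h: "homeomorphism S1 (bdry D1) \<delta> \<delta>'"
   by (rule homeomorphism_of_subsets[OF hd(1)]) (use hd(2) in \<open>auto simp: S1_def bdry_def\<close>)
  have hc: "homeomorphism S1 S1 cnj cnj"
  proof (rule homeomorphismI)
   show "continuous_on S1 cnj" "continuous_on S1 cnj" by (intro continuous_intros)+
  qed (auto simp: S1_def)
  have h1: "homeomorphism S1 (bdry D1) (\<delta> \<circ> cnj) (cnj \<circ> \<delta>')" by (rule homeomorphism_compose[OF hc h])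
  have aB: "a : bdry D1" using ends[of t1 t3] st Fa by simp
  have "\<delta>' a : S1" using homeomorphism_image2[OF h] aB by blast
  then obtain af where al: "0 <= af" "af < 1" "\<delta>' a = cis (2*pi * af)" by (rule circle_loop_angle)
  have dal: "\<delta> (cis (2*pi * af)) = a" using homeomorphism_apply2[OF h aB] al by simp
  let ?g = "circle_loop af \<delta>" and ?g' = "circle_loop (1 - af) (\<delta> \<circ> cnj)"
  have g: "simple_path ?g" "pathstart ?g = a" "pathfinish ?g = a" "path_image ?g = bdry D1"
   using circle_loop[OF h, of af] dal by auto
  have pg: "path ?g" "path_image ?g <= S2 - {N}" "w ~: path_image ?g" using g D1S w1 simple_path_imp_path by auto
  note rev = chart_winding_reverse[OF R NS pg(1,2) wS pg(3)]
  have g': "?g' = reversepath ?g"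
  proof
   fix x
   have e: "2*pi * (af+(1 - x)) = - (2*pi * (1 - af + x))+2*pi * of_int 2" by (simp add: algebra_simps)
   have "cnj (cis (2*pi * (1 - af + x))) = cis (- (2*pi * (1 - af + x)))" by (simp add: cis_cnj)
   also have "\<dots> = cis (2*pi * (af+(1 - x)))" unfolding e by (rule cis_shift_int[symmetric])
   finally show "?g' x = reversepath ?g x" by (simp add: circle_loop_def reversepath_def)
  qed
  show False
  proof (rule cmp_cases[OF g])
   fix tu' assume c': "cmp (reversepath ?g) tu'"
   then have "chart_winding R (reversepath ?g) w = -1" using cmp_same[OF c c' R N w] m1 by simp
   then have "chart_winding R ?g w = 1" using rev by simp
   then have "pos_oriented D1 \<delta>" using pos_oriented_iff[OF st R N1 w1 h, of af] al by simp
   then show False using anti_not_canonical[OF F h _ dal c'] ca by blast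
  next
   fix tu' assume c': "cmp ?g tu'"
   then have "chart_winding R ?g w = -1" using cmp_same[OF c c' R N w] m1 by simp
   then have "chart_winding R ?g' w = 1" unfolding g' using rev by simp
   then have po: "pos_oriented D1 (\<delta> \<circ> cnj)" using pos_oriented_iff[OF st R N1 w1 h1, of "1 - af"] al by simp
   have c'': "cmp (reversepath ?g') tu'" unfolding g' using c' by simp
   have "pathstart ?g' = a" unfolding g' using g by simp
   then have "(\<delta> \<circ> cnj) (cis (2*pi * (1 - af))) = a" by (simp add: pathstart_def circle_loop_def)
   then show False using anti_not_canonical[OF F h1 po _ c''] ca by blast
  qed
 qed
qed

text \<open>Compatible loops of the two diagonals have opposite signs. Each criterion uses its own
  chart and interior point, so the second is first moved to those of the first.\<close>

lemma canonical_alternate: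
 assumes F: "F = (%t. f (cis t))"
 shows "canon_agrees f (cis t1) (cis t3) (bdry D1 - {a}) \<longleftrightarrow> ~ canon_agrees f (cis t2) (cis t4) (bdry (F ` {t2..t4}) - {r})"
proof -
 interpret Q: wheel_quad F t2 t3 t4 "t1+2*pi" r a by (rule wheel_quad_rotate)
 have ne: "S2 - F ` {s..t} ~= {}" if "s < t" "t < s+2*pi" for s t
  using closed_disk_interior_facts(3)[OF disk[of t "s+2*pi"]] complement_eq[OF that] that by simp
 obtain N where N: "N : S2 - F ` {t1..t4}" using ne[of t1 t4] ord by auto
 obtain w where w: "w : S2 - F ` {t3..t2+2*pi}" using ne[of t3 "t2+2*pi"] ord by auto
 obtain N' where N': "N' : S2 - F ` {t2..t1+2*pi}" using ne[of t2 "t1+2*pi"] ord by auto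
 obtain w' where w': "w' : S2 - F ` {t4..t3+2*pi}" using ne[of t4 "t3+2*pi"] ord by auto
 obtain R where R: "chart R N" using N chart_exists by blast
 obtain R' where R': "chart R' N'" using N' chart_exists by blast
 obtain gm tu where c: "cmp gm tu" using cmp_exists by blast
 obtain gm2 tu2 where c2: "Q.cmp gm2 tu2" using Q.cmp_exists by blast
 have st: "t2 < t4" "t4 < t2+2*pi" using ord by auto
 have g2: "path gm2" "simple_path gm2" "pathfinish gm2 = pathstart gm2" "path_image gm2 = bdry (F ` {t2..t4})"
  using c2 simple_path_imp_path unfolding Q.cmp_def by auto
 have sub: "F ` {t2..t4} <= F ` {t1..t4}" "F ` {t2..t4} <= F ` {t2..t1+2*pi}"
  "F ` {t4..t2+2*pi} <= F ` {t3..t2+2*pi}" "F ` {t4..t2+2*pi} <= F ` {t4..t3+2*pi}"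
  by (intro image_mono, use ord in auto)+
 have NN: "N : S2 - F ` {t2..t4}" "N' : S2 - F ` {t2..t4}" using N N' sub by blast+
 have ww: "w : F ` {t2..t4} - bdry (F ` {t2..t4})" "w' : F ` {t2..t4} - bdry (F ` {t2..t4})"
  unfolding interior_eq[OF st] using w w' sub by blast+
 have "chart_winding R' gm2 w' = chart_winding R gm2 w"
  by (rule chart_winding_independent[OF st R R' NN ww g2(1,3)]) (use g2 in simp)
 moreover have "chart_winding R gm w = - chart_winding R gm2 w" by (rule cmp_opposite[OF c c2 R N w])
 moreover have "chart_winding R gm2 w = 1 | chart_winding R gm2 w = -1"
  by (rule chart_winding_boundary[OF st R NN(1) ww(1) g2(2-4)])
 ultimately show ?thesis unfolding canonical_iff[OF F c R N w] Q.canonical_iff[OF F c2 R' N' w'] by auto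
qed

text \<open>Both ends of the interval lie over \<open>a\<close>, so the boundary without
  \<open>a\<close> is one component and \<open>Zplus_empty\<close> reduces to a single test.\<close>

lemma pos_degenerate_iff:
 assumes F: "F = (%t. f (cis t))"
 shows "pos_degenerate f (cis t1) (cis t3) \<longleftrightarrow> ~ canon_agrees f (cis t1) (cis t3) (bdry D1 - {a})"
  "neg_degenerate f (cis t1) (cis t3) \<longleftrightarrow> canon_agrees f (cis t1) (cis t3) (bdry D1 - {a})"
proof -
 have im: "f ` arc (cis t1) (cis t3) = D1" unfolding arc_D1 F by (simp add: image_image)
 have fa: "f (cis t1) = a" "f (cis t3) = a" using Fa unfolding F by auto
 have "cis t1 ~= cis t3" using cis_eq_near[of t1 t3] ord by auto
 then have dg: "degenerate f (cis t1) (cis t3)" using fa by (simp add: degenerate_def)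
 obtain gm tu where c: "cmp gm tu" using cmp_exists by blast
 then have g: "simple_path gm" "gm 0 = a" "gm 1 = a" "gm ` {0..1} = bdry D1" "0 < tu" "tu < 1" "gm tu = r"
  unfolding cmp_def pathstart_def pathfinish_def path_image_def by auto
 have ne: "gm x ~= a" if "0 < x" "x < 1" for x
 proof
  assume "gm x = a"
  then have "gm 0 = gm x" using g by simp
  then have "0 = x" by (rule simple_loop_inj[OF g(1)]) (use that in auto)
  then show False using that by simp
 qed
 have "bdry D1 - {a} = gm ` {0<..<1}"
 proof
  show "bdry D1 - {a} <= gm ` {0<..<1}"
  proof
   fix y assume y: "y : bdry D1 - {a}"
   then have "y : gm ` {0..1}" "y ~= a" unfolding g(4) by simp_all
   then obtain x where x: "0 <= x" "x <= 1" "y = gm x" by auto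
   have "x ~= 0" "x ~= 1" using \<open>y ~= a\<close> x(3) g(2,3) by auto
   then have "0 < x" "x < 1" using x by auto
   then show "y : gm ` {0<..<1}" using x by auto
  qed
  show "gm ` {0<..<1} <= bdry D1 - {a}"
  proof
   fix y assume "y : gm ` {0<..<1}"
   then obtain x where x: "0 < x" "x < 1" "y = gm x" by auto
   then have "y : gm ` {0..1}" by auto
   then show "y : bdry D1 - {a}" unfolding g(4) using ne[OF x(1,2)] x(3) by simp
  qed
 qed
 moreover have "connected (gm ` {0<..<1})"
  by (rule connected_continuous_image) (use g(1) in \<open>auto simp: simple_path_def path_def intro: continuous_on_subset\<close>)
 moreover have "r : bdry D1 - {a}" 
 proof -
  have "gm tu : gm ` {0..1}" using g(5,6) by simp
  then show ?thesis unfolding g(4,7) using ar by simp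
 qed
 ultimately have cm: "components (bdry D1 - {a}) = {bdry D1 - {a}}" unfolding components_eq_sing_iff by auto
 have "Zplus_empty f (cis t1) (cis t3) \<longleftrightarrow> ~ canon_agrees f (cis t1) (cis t3) (bdry D1 - {a})"
  unfolding Zplus_empty_def im fa by (simp add: cm)
 then show "pos_degenerate f (cis t1) (cis t3) \<longleftrightarrow> ~ canon_agrees f (cis t1) (cis t3) (bdry D1 - {a})"
  "neg_degenerate f (cis t1) (cis t3) \<longleftrightarrow> canon_agrees f (cis t1) (cis t3) (bdry D1 - {a})"
  using dg by (auto simp: pos_degenerate_def neg_degenerate_def)
qed

lemma degenerate_alternate:
 assumes F: "F = (%t. f (cis t))"
 shows "pos_degenerate f (cis t1) (cis t3) \<longleftrightarrow> neg_degenerate f (cis t2) (cis t4)"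
  "neg_degenerate f (cis t1) (cis t3) \<longleftrightarrow> pos_degenerate f (cis t2) (cis t4)"
  "pos_degenerate f (cis t1) (cis t3) \<longleftrightarrow> ~ neg_degenerate f (cis t1) (cis t3)"
proof -
 interpret Q: wheel_quad F t2 t3 t4 "t1+2*pi" r a by (rule wheel_quad_rotate)
 show "pos_degenerate f (cis t1) (cis t3) \<longleftrightarrow> neg_degenerate f (cis t2) (cis t4)"
  "neg_degenerate f (cis t1) (cis t3) \<longleftrightarrow> pos_degenerate f (cis t2) (cis t4)"
  "pos_degenerate f (cis t1) (cis t3) \<longleftrightarrow> ~ neg_degenerate f (cis t1) (cis t3)"
  unfolding pos_degenerate_iff[OF F] Q.pos_degenerate_iff[OF F] using canonical_alternate[OF F] by blast+
qed

end

subsection \<open>Leaves between consecutive sinks and sources\<close>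

text \<open>Crossing pairs have opposite types by \<open>degenerate_alternate\<close>. Pairs that do
  not cross are joined by a chain of three crossings, through a point of \<open>YR\<close> inside
  the first and a point of \<open>YA\<close> inside the second; as three is odd, the types still
  differ.\<close>

lemma (in wheel) interleaved_leaves:
 assumes F: "F = (%t. f (cis t))" and ar: "a ~= r"
  and YA: "!!y. y : YA ==> F y = a" "!!y (k::int). y : YA ==> y+2*pi * of_int k : YA"
  and YR: "!!y. y : YR ==> F y = r" "!!y (k::int). y : YR ==> y+2*pi * of_int k : YR"
  and btA: "!!y y'. y : YA ==> y' : YA ==> y < y' ==> EX x:YR. y < x & x < y'"
  and btR: "!!y y'. y : YR ==> y' : YR ==> y < y' ==> EX x:YA. y < x & x < y'"
  and y: "y1 : YA" "y2 : YA" "y1 < y2" "y2 < y1+2*pi" "!!w. y1 < w ==> w < y2 ==> w ~: YA"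
  and x: "x1 : YR" "x2 : YR" "x1 < x2" "x2 < x1+2*pi" "!!w. x1 < w ==> w < x2 ==> w ~: YR"
 shows "(pos_degenerate f (cis y1) (cis y2) \<longleftrightarrow> neg_degenerate f (cis x1) (cis x2)) &
  (neg_degenerate f (cis y1) (cis y2) \<longleftrightarrow> pos_degenerate f (cis x1) (cis x2))"
proof -
 have qA: "(pos_degenerate f (cis t1) (cis t3) \<longleftrightarrow> neg_degenerate f (cis t2) (cis t4)) & (neg_degenerate f (cis t1) (cis t3) \<longleftrightarrow> pos_degenerate f (cis t2) (cis t4))"
  if "t1 < t2" "t2 < t3" "t3 < t4" "t4 < t1+2*pi" "t1 : YA" "t3 : YA" "t2 : YR" "t4 : YR" for t1 t2 t3 t4
 proof -
  interpret Q: wheel_quad F t1 t2 t3 t4 a r by unfold_locales (use that YA(1) YR(1) ar in auto)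
  show ?thesis using Q.degenerate_alternate[OF F] by blast
 qed
 have qR: "(pos_degenerate f (cis t1) (cis t3) \<longleftrightarrow> neg_degenerate f (cis t2) (cis t4)) & (neg_degenerate f (cis t1) (cis t3) \<longleftrightarrow> pos_degenerate f (cis t2) (cis t4))"
  if "t1 < t2" "t2 < t3" "t3 < t4" "t4 < t1+2*pi" "t1 : YR" "t3 : YR" "t2 : YA" "t4 : YA" for t1 t2 t3 t4
 proof -
  interpret Q: wheel_quad F t1 t2 t3 t4 r a by unfold_locales (use that YA(1) YR(1) ar in auto)
  show ?thesis using Q.degenerate_alternate[OF F] by blast
 qed
 have ne: "u ~= v" if "u : YA" "v : YR" for u v using YA(1)[OF that(1)] YR(1)[OF that(2)] ar by auto
 obtain k where k: "y1 <= x1+2*pi * of_int k" "x1+2*pi * of_int k < y1+2*pi" using representative by blast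
 define z1 z2 where "z1 = x1+2*pi * of_int k" and "z2 = x2+2*pi * of_int k"
 have c: "cis z1 = cis x1" "cis z2 = cis x2" by (simp_all add: z1_def z2_def cis_shift_int)
 have z: "z1 : YR" "z2 : YR" "z1 < z2" "z2 < z1+2*pi" using x YR(2) by (auto simp: z1_def z2_def)
 have nz: "w ~: YR" if "z1 < w" "w < z2" for w
 proof
  assume "w : YR"
  then have "w+2*pi * of_int (- k) : YR" by (rule YR(2))
  moreover have "x1 < w+2*pi * of_int (- k)" "w+2*pi * of_int (- k) < x2" using that by (auto simp: z1_def z2_def)
  ultimately show False using x(5) by blast
 qed
 have y1z: "y1 < z1" "z1 < y1+2*pi" using k ne[OF y(1) z(1)] unfolding z1_def by auto
 have py: "y1+2*pi : YA" "y2+2*pi : YA" using YA(2)[OF y(1), of 1] YA(2)[OF y(2), of 1] by simp_all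
 obtain x where xx: "x : YR" "y1 < x" "x < y2" using btA[OF y(1-3)] by blast
 have px: "x+2*pi : YR" using YR(2)[OF xx(1), of 1] by simp
 obtain y' where y': "y' : YA" "z1 < y'" "y' < z2" using btR[OF z(1-3)] by blast
 have "(pos_degenerate f (cis y1) (cis y2) \<longleftrightarrow> neg_degenerate f (cis z1) (cis z2)) &
  (neg_degenerate f (cis y1) (cis y2) \<longleftrightarrow> pos_degenerate f (cis z1) (cis z2))"
 proof (cases "z1 < y2")
  case True
  have "y2 <= y'" using y(5)[of y'] y' y1z by force
  obtain x3 where x3: "x3 : YR" "y2 < x3" "x3 < y1+2*pi" using btA[OF y(2) py(1) y(4)] by blast
  have "z2 <= x3" using nz[of x3] x3 True by force
  then show ?thesis by (intro qA) (use y1z True \<open>y2 <= y'\<close> y' x3 y z in auto)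
 next
  case False
  then have gt: "y2 < z1" using ne[OF y(2) z(1)] by auto
  show ?thesis
  proof (cases "z2 < y1+2*pi")
   case True
   have 1: "(pos_degenerate f (cis y1) (cis y2) \<longleftrightarrow> neg_degenerate f (cis x) (cis z1)) & (neg_degenerate f (cis y1) (cis y2) \<longleftrightarrow> pos_degenerate f (cis x) (cis z1))"
    by (intro qA) (use xx gt y1z y z in auto)
   have 2: "(pos_degenerate f (cis x) (cis z1) \<longleftrightarrow> neg_degenerate f (cis y2) (cis y')) & (neg_degenerate f (cis x) (cis z1) \<longleftrightarrow> pos_degenerate f (cis y2) (cis y'))"
    by (intro qR) (use xx gt y1z y z y' True in auto)
   have 3: "(pos_degenerate f (cis y2) (cis y') \<longleftrightarrow> neg_degenerate f (cis z1) (cis z2)) & (neg_degenerate f (cis y2) (cis y') \<longleftrightarrow> pos_degenerate f (cis z1) (cis z2))"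
    by (intro qA) (use xx gt y1z y z y' True in auto)
   show ?thesis using 1 2 3 by blast
  next
   case False
   then have g2: "y1+2*pi < z2" using ne[OF py(1) z(2)] by auto
   have "z2 <= x+2*pi" using nz[of "x+2*pi"] px xx y1z by force
   then have "(pos_degenerate f (cis z1) (cis z2) \<longleftrightarrow> neg_degenerate f (cis (y1+2*pi)) (cis (y2+2*pi))) &
    (neg_degenerate f (cis z1) (cis z2) \<longleftrightarrow> pos_degenerate f (cis (y1+2*pi)) (cis (y2+2*pi)))"
    by (intro qR) (use xx gt y1z y z g2 py in auto)
   then show ?thesis unfolding cis_periodic by blast
  qed
 qed
 then show ?thesis unfolding c .
qed

lemma consecutive_lift:
 assumes c: "consecutive S p q" and S: "S <= S1"
 obtains x y where "p = cis x" "q = cis y" "x < y" "y < x+2*pi" "!!w. x < w ==> w < y ==> cis w ~: S" "cis x : S" "cis y : S"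
proof -
 have pq: "p : S" "q : S" "p ~= q" and nb: "ALL w:S. w : arc p q --> w = p | w = q" using c by (auto simp: consecutive_def)
 obtain x where x: "p = cis x" using pq S S1_iff_cis by blast
 obtain y0 where y0: "q = cis y0" using pq S S1_iff_cis by blast
 define d where "d = (y0 - x) / (2*pi)"
 define k where "k = - \<lfloor>d\<rfloor>"
 define y where "y = y0+2*pi * of_int k"
 have "2*pi * d = y0 - x" by (simp add: d_def)
 then have "y - x = 2*pi * frac d" unfolding y_def k_def frac_def right_diff_distrib by simp
 moreover have "0 <= 2*pi * frac d" by simp
 moreover have "2*pi * frac d < 2*pi * 1" by (intro mult_strict_left_mono frac_lt_1) simp
 ultimately have b: "x <= y" "y < x+2*pi" by linarith+
 have y: "q = cis y" unfolding y0 y_def by (simp add: cis_shift_int)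
 have "x ~= y" using pq x y by auto
 then have xy: "x < y" using b by simp
 have "cis w ~: S" if w: "x < w" "w < y" for w
 proof
  assume "cis w : S"
  moreover have "cis w : arc p q" unfolding x y using arc_cis(1)[of x y] b w by simp
  ultimately have "cis w = cis x | cis w = cis y" using nb x y by blast
  then have "w = x | w = y" using cis_eq_near[of w x] cis_eq_near[of w y] w b by auto
  then show False using w by simp
 qed
 then show thesis using that[OF x y xy b(2)] pq x y by simp
qed

subsection \<open>Dynamics of the induced circle map\<close>

lemma periodic_lift_surj:
 assumes c: "continuous_on UNIV L" and per: "!!t. L (t+2*pi) = L t+2*pi"
 shows "EX t::real. L t = y"
proof -
 have pn: "L (t+2*pi * real n) = L t+2*pi * real n" for t n
 proof (induction n)
  case (Suc n)
  have "t+2*pi * real (Suc n) = (t+2*pi * real n)+2*pi" by (simp add: algebra_simps)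
  then show ?case using Suc per[of "t+2*pi * real n"] by (simp add: algebra_simps)
 qed simp
 obtain n where n: "\<bar>y - L 0\<bar> / (2*pi) < real n" using reals_Archimedean2 by blast
 then have n': "\<bar>y - L 0\<bar> < 2*pi * real n" by (simp add: divide_less_eq mult.commute)
 define m where "m = 2*pi * real n"
 have m: "\<bar>y - L 0\<bar> < m" "0 <= m" using n' by (auto simp: m_def)
 have e: "L m = L 0 + m" "L 0 = L (- m) + m" using pn[of 0 n] pn[of "- m" n] by (simp_all add: m_def)
 have "EX t. - m <= t & t <= m & L t = y"
  by (rule IVT') (use e m c in \<open>auto intro: continuous_on_subset\<close>)
 then show ?thesis by blast
qed

text \<open>Since fixed parameters are isolated there is a gap directly to the right of
  \<open>x\<close>, and the ends of every gap map to \<open>a\<close> and \<open>r\<close>.\<close>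

lemma (in wheel_fix) next_fixed:
 assumes ar: "a ~= r" and lim: "!!t. l t ~= t ==> F (snk t) = a & F (src t) = r" and fx: "!!t. l t = t ==> F t : {a, r}" and x: "l x = x"
 shows "EX v. x < v & v <= x+2*pi & l v = v & (ALL t. x < t --> t < v --> l t ~= t) & (F x = a \<longleftrightarrow> F v = r) & (F x = r \<longleftrightarrow> F v = a)"
proof -
 obtain \<epsilon> where e: "\<epsilon> > 0" "!!x y. l x = x ==> 0 < \<bar>y - x\<bar> ==> \<bar>y - x\<bar> < \<epsilon> ==>
  l y ~= y & (F x = a --> \<bar>l y - x\<bar> < \<bar>y - x\<bar>) & (F x = r --> \<bar>l' y - x\<bar> < \<bar>y - x\<bar>)"
  by (rule fix_isolated[OF ar lim fx], assumption, assumption, rule that)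
 define t where "t = x + \<epsilon> / 2"
 have t: "x < t" "t < x + \<epsilon>" using e(1) by (auto simp: t_def)
 have nt: "l t ~= t" using e(2)[OF x, of t] t by auto
 obtain u v where uv: "u < t" "t < v" "l u = u" "l v = v" "v <= u+2*pi"
  and c: "(ALL x. u < x --> x < v --> x < l x & snk x = v & src x = u) | (ALL x. u < x --> x < v --> l x < x & snk x = u & src x = v)"
  by (rule gap_cases[OF nt])
 have nf: "l z ~= z" if "u < z" "z < v" for z using c that by (metis less_irrefl)
 have "~ u < x" using nf[of x] x t uv by auto
 moreover have "~ x < u" using e(2)[OF x, of u] uv t by auto
 ultimately have "u = x" by simp
 moreover have "F v = a & F u = r | F u = a & F v = r" using c lim[OF nt] uv by metis
 ultimately show ?thesis using nf uv t ar by (intro exI[of _ v]) auto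
qed

text \<open>\<open>L\<close> lifts the circle map and \<open>l\<close> its power \<open>g\<close>,
  normalised to have fixed points. Both are kept because the circle dynamics concerns the power, the
  sphere dynamics the original \<open>H\<close>.\<close>

locale wheel_root = wheel_fix F l l' G G' + B: wheel_map F L L' H H' for F l l' G G' L L' H H' +
 fixes n :: nat and k :: int and f :: "complex => real^3" and g :: "complex => complex"
 assumes n1: "n >= 1" and ln: "l t = (L ^^ n) t+2*pi * of_int k" and Gn: "G = H ^^ n" "G' = H' ^^ n"
  and Ff: "F = (%t. f (cis t))" and g_lift: "g (cis t) = cis (l t)"
begin

lemma l_commute: "l (L t) = L (l t)"
 unfolding ln B.l_per_int B.pow_commute ..

lemma fix_L: "l (L t) = L t \<longleftrightarrow> l t = t" unfolding l_commute by simp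

text \<open>A fixed point of \<open>g\<close> could lift to a point moved by full turns; since
  \<open>l\<close> has a fixed point, every displacement is less than one turn.\<close>

lemma g_fix: "g (cis t) = cis t \<longleftrightarrow> l t = t"
proof
 assume "g (cis t) = cis t"
 then obtain j :: int where j: "l t = t+2*pi * of_int j" unfolding g_lift using cis_eq_iff by blast
 obtain x0 where x0: "l x0 = x0" using fixp by blast
 obtain m where m: "x0 <= t+2*pi * of_int m" "t+2*pi * of_int m < x0+2*pi" using representative by blast
 have "l x0 <= l (t+2*pi * of_int m)" "l (t+2*pi * of_int m) < l (x0+2*pi)" using m by auto
 then have "x0 <= t+2*pi * of_int j+2*pi * of_int m" "t+2*pi * of_int j+2*pi * of_int m < x0+2*pi"
  unfolding l_per_int l_per x0 j by auto
 then have "\<bar>(t+2*pi * of_int j) - t\<bar> < 2*pi" using m by linarith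
 then have "t+2*pi * of_int j = t" by (intro cis_eq_near) (simp_all add: cis_shift_int)
 then show "l t = t" using j by simp
qed (simp add: g_lift)

lemma fixed_set: "{x : S1. g x = x} = cis ` {t. l t = t}"
proof
 show "{x : S1. g x = x} <= cis ` {t. l t = t}"
 proof
  fix x assume x: "x : {x : S1. g x = x}"
  then obtain t where t: "x = cis t" using S1_iff_cis by blast
  then have "l t = t" using x g_fix by simp
  then show "x : cis ` {t. l t = t}" using t by blast
 qed
 show "cis ` {t. l t = t} <= {x : S1. g x = x}" using g_fix by auto
qed

lemma g_inj: "inj_on g S1"
proof (rule inj_onI)
 fix x y assume xy: "x : S1" "y : S1" "g x = g y"
 obtain s where s: "x = cis s" using xy S1_iff_cis by blast
 obtain t where t: "y = cis t" using xy S1_iff_cis by blast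
 obtain j :: int where "l s = l t+2*pi * of_int j" using xy unfolding s t g_lift using cis_eq_iff by blast
 then have "l s = l (t+2*pi * of_int j)" by (simp add: l_per_int)
 then have "s = t+2*pi * of_int j" by simp
 then show "x = y" unfolding s t using cis_shift_int by simp
qed

lemma g_S1: "g ` S1 <= S1"
proof
 fix x assume "x : g ` S1"
 then obtain s where s: "s : S1" "x = g s" by blast
 then obtain t where "s = cis t" using S1_iff_cis by blast
 then show "x : S1" using s by (simp add: g_lift)
qed

lemma g_inverse: "inv_into S1 g (cis t) = cis (l' t)"
 by (rule inv_into_f_eq[OF g_inj]) (simp_all add: g_lift ll')

lemma not_attracting_repelling:
 assumes "attracting S1 g (cis x)" "repelling S1 g (cis x)" shows False
proof (rule attracting_not_repelling[OF assms g_inj g_S1])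
 fix d :: real assume d: "d > 0"
 define e where "e = min (d / 2) 1"
 have e: "0 < e" "e < d" "e <= 1" using d by (auto simp: e_def min_def)
 have "cis (x + e) ~= cis x" using cis_eq_near[of "x + e" x] e pi_gt3 by auto
 moreover have "dist (cis (x + e)) (cis x) <= \<bar>x + e - x\<bar>" by (rule dist_cis_le)
 ultimately show "EX y:S1. y ~= cis x & dist y (cis x) < d" using e by (intro bexI[of _ "cis (x + e)"]) auto
qed

lemma attracting_lift:
 assumes "l x = x" "e > 0" "!!y. 0 < \<bar>y - x\<bar> ==> \<bar>y - x\<bar> < e ==> \<bar>l y - x\<bar> < \<bar>y - x\<bar>"
 shows "attracting S1 g (cis x)"
 by (rule attracting_S1_lift[OF l_cont l_mono assms(1) g_lift assms(2,3)])

lemma repelling_lift: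
 assumes "l x = x" "e > 0" "!!y. 0 < \<bar>y - x\<bar> ==> \<bar>y - x\<bar> < e ==> \<bar>l' y - x\<bar> < \<bar>y - x\<bar>"
 shows "repelling S1 g (cis x)"
 unfolding repelling_def
 by (rule attracting_S1_lift[OF l'_cont l'_mono _ g_inverse assms(2,3)]) (use assms(1) l'_fix in auto)

lemma H_fix_G: "H y = y ==> G y = y" unfolding Gn by (induction n) auto

text \<open>The alternative of the final statement for a power other than the identity, shared by
  the two cases below.\<close>

definition "conclusion \<longleftrightarrow>
  (let F = {x : S1. g x = x};
     A = {x : F. attracting S1 g x};
     R = {x : F. repelling S1 g x};
     FH = {y : S2. H y = y}
   in (finite F & even (card F) & card F > 0 &
     (ALL x:F. (attracting S1 g x | repelling S1 g x) &
          ~ (attracting S1 g x & repelling S1 g x)) &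
     (ALL x y. consecutive F x y --> (x : A & y : R) | (x : R & y : A)) &
     ((  (ALL x y. consecutive A x y --> {x, y} : Lplus f)
      & (ALL x y. consecutive R x y --> {x, y} : Lminus f))
     |
     (  (ALL x y. consecutive R x y --> {x, y} : Lplus f)
      & (ALL x y. consecutive A x y --> {x, y} : Lminus f))) &
     (card F >= 4 -->
      (EX a r. a ~= r & f ` A = {a} & f ` R = {r} & FH = {a, r} &
          attracting S2 H a & repelling S2 H r)) &
     (card F = 2 -->
      FH = f ` F &
      ((card (f ` F) = 2 & (ALL x:A. attracting S2 H (f x)) &
                 (ALL x:R. repelling S2 H (f x)))
       |
       (EX c. f ` F = {c} &
         (EX \<phi> \<phi>'. homeomorphism (S2 - {c}) (UNIV :: complex set) \<phi> \<phi>' &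
           (EX v. ALL z. \<phi> (H (\<phi>' z)) = z + v)))))))"

text \<open>The successor map on fixed points takes attracting ones injectively to repelling ones
  and conversely, so their numbers agree and the total is even. \<open>H\<close> itself fixes
  \<open>a\<close> because \<open>L\<close> commutes with \<open>l\<close> and therefore respects
  forward limits.\<close>

lemma hyperbolic_case:
 assumes ar: "a ~= r" and aS: "a : S2" "r : S2"
  and lim: "!!t. l t ~= t ==> F (snk t) = a & F (src t) = r" and fx: "!!t. l t = t ==> F t : {a, r}"
 shows conclusion
proof -
 obtain \<epsilon> where e: "\<epsilon> > 0" "!!x y. l x = x ==> 0 < \<bar>y - x\<bar> ==> \<bar>y - x\<bar> < \<epsilon> ==>
  l y ~= y & (F x = a --> \<bar>l y - x\<bar> < \<bar>y - x\<bar>) & (F x = r --> \<bar>l' y - x\<bar> < \<bar>y - x\<bar>)"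
  by (rule fix_isolated[OF ar lim fx], assumption, assumption, rule that)
 define Fx where "Fx = {x : S1. g x = x}"
 define A where "A = {x : Fx. attracting S1 g x}"
 define R where "R = {x : Fx. repelling S1 g x}"
 define YA where "YA = {t. l t = t & F t = a}"
 define YR where "YR = {t. l t = t & F t = r}"
 have FxI: "cis t : Fx \<longleftrightarrow> l t = t" for t unfolding Fx_def using g_fix by simp
 have FxS: "Fx <= S1" by (auto simp: Fx_def)
 have att: "attracting S1 g (cis t)" if "t : YA" for t
  by (rule attracting_lift[OF _ e(1)]) (use that e(2) in \<open>auto simp: YA_def\<close>)
 have rep: "repelling S1 g (cis t)" if "t : YR" for t
  by (rule repelling_lift[OF _ e(1)]) (use that e(2) in \<open>auto simp: YR_def\<close>)
 have AI: "cis t : A \<longleftrightarrow> t : YA" for t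
 proof
  assume h: "cis t : A"
  then have t: "l t = t" using FxI by (simp add: A_def)
  have "t ~: YR" using h rep[of t] not_attracting_repelling by (auto simp: A_def)
  then show "t : YA" using fx[OF t] t by (auto simp: YA_def YR_def)
 qed (use att FxI in \<open>auto simp: A_def YA_def\<close>)
 have RI: "cis t : R \<longleftrightarrow> t : YR" for t
 proof
  assume h: "cis t : R"
  then have t: "l t = t" using FxI by (simp add: R_def)
  have "t ~: YA" using h att[of t] not_attracting_repelling by (auto simp: R_def)
  then show "t : YR" using fx[OF t] t by (auto simp: YA_def YR_def)
 qed (use rep FxI in \<open>auto simp: R_def YR_def\<close>)
 have ARS: "A <= S1" "R <= S1" using FxS by (auto simp: A_def R_def)
 have repr: "EX t. z = cis t" if "z : Fx" for z using that FxS S1_iff_cis by blast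
 have nx: "EX v. x < v & v <= x+2*pi & l v = v & (ALL t. x < t --> t < v --> l t ~= t) & (F x = a \<longleftrightarrow> F v = r) & (F x = r \<longleftrightarrow> F v = a)"
  if "l x = x" for x by (rule next_fixed[OF ar lim fx that])
 have perA: "y+2*pi * of_int j : YA" if "y : YA" for y and j :: int using that fix_per per_int by (simp add: YA_def)
 have perR: "y+2*pi * of_int j : YR" if "y : YR" for y and j :: int using that fix_per per_int by (simp add: YR_def)
 have btA: "EX x:YR. y < x & x < y'" if h: "y : YA" "y' : YA" "y < y'" for y y'
 proof -
  have ly: "l y = y" "F y = a" using h by (auto simp: YA_def)
  obtain v where v: "y < v" "l v = v" "ALL t. y < t --> t < v --> l t ~= t" "F v = r" using nx[OF ly(1)] ly(2) by blast
  have "~ y' < v" "y' ~= v" using v h ar by (auto simp: YA_def)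
  then show ?thesis using v by (intro bexI[of _ v]) (auto simp: YR_def)
 qed
 have btR: "EX x:YA. y < x & x < y'" if h: "y : YR" "y' : YR" "y < y'" for y y'
 proof -
  have ly: "l y = y" "F y = r" using h by (auto simp: YR_def)
  obtain v where v: "y < v" "l v = v" "ALL t. y < t --> t < v --> l t ~= t" "F v = a" using nx[OF ly(1)] ly(2) by blast
  have "~ y' < v" "y' ~= v" using v h ar by (auto simp: YR_def)
  then show ?thesis using v by (intro bexI[of _ v]) (auto simp: YA_def)
 qed
 obtain x0 where x0: "l x0 = x0" using fixp by blast
 have finF: "finite Fx"
 proof -
  have "finite ({x0..x0+2*pi} Int {t. l t = t})"
  proof (rule finite_not_islimpt_in_compact)
   fix z assume "z : {x0..x0+2*pi}"
   show "~ z islimpt {t. l t = t}"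
   proof
    assume lp: "z islimpt {t. l t = t}"
    then have "l z = z" using closed_fix closed_limpt by blast
    moreover obtain y where "l y = y" "y ~= z" "dist y z < \<epsilon>" using lp e(1) unfolding islimpt_approachable by blast
    ultimately show False using e(2)[of z y] by (auto simp: dist_real_def)
   qed
  qed simp
  moreover have "Fx <= cis ` ({x0..x0+2*pi} Int {t. l t = t})"
  proof
   fix z assume z: "z : Fx"
   then obtain t where t: "z = cis t" using repr by blast
   obtain m where m: "x0 <= t+2*pi * of_int m" "t+2*pi * of_int m < x0+2*pi" using representative by blast
   have "l (t+2*pi * of_int m) = t+2*pi * of_int m" using fix_per z t FxI by blast
   moreover have "z = cis (t+2*pi * of_int m)" unfolding t by (simp add: cis_shift_int)
   ultimately show "z : cis ` ({x0..x0+2*pi} Int {t. l t = t})" using m by (intro image_eqI[of _ _ "t+2*pi * of_int m"]) auto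
  qed
  ultimately show ?thesis using finite_surj by blast
 qed
 have FAR: "Fx = A Un R" "A Int R = {}"
 proof -
  show "Fx = A Un R"
  proof
   show "Fx <= A Un R"
   proof
    fix z assume z: "z : Fx"
    then obtain t where t: "z = cis t" using repr by blast
    then have "l t = t" using z FxI by simp
    then have "t : YA | t : YR" using fx[of t] by (auto simp: YA_def YR_def)
    then show "z : A Un R" unfolding t using AI RI by blast
   qed
  qed (auto simp: A_def R_def)
  show "A Int R = {}"
  proof (rule ccontr)
   assume "A Int R ~= {}"
   then obtain z where z: "z : A" "z : R" by blast
   then obtain t where "z = cis t" using repr by (auto simp: A_def)
   then show False using z not_attracting_repelling by (auto simp: A_def R_def)
  qed
 qed
 define ang where "ang = (%z. SOME t. z = cis t)"
 have ang: "z = cis (ang z)" if "z : Fx" for z unfolding ang_def using repr[OF that] by (rule someI_ex)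
 define sc where "sc = (%x. SOME v. x < v & v <= x+2*pi & l v = v & (ALL t. x < t --> t < v --> l t ~= t) & (F x = a \<longleftrightarrow> F v = r) & (F x = r \<longleftrightarrow> F v = a))"
 have sc: "x < sc x & sc x <= x+2*pi & l (sc x) = sc x & (ALL t. x < t --> t < sc x --> l t ~= t) & (F x = a \<longleftrightarrow> F (sc x) = r) & (F x = r \<longleftrightarrow> F (sc x) = a)"
  if "l x = x" for x unfolding sc_def using nx[OF that] by (rule someI_ex)
 have inj: "inj_on (%z. cis (sc (ang z))) Fx"
 proof (rule inj_onI)
  fix z w assume zw: "z : Fx" "w : Fx" "cis (sc (ang z)) = cis (sc (ang w))"
  define s t where "s = ang z" and "t = ang w"
  have st: "z = cis s" "w = cis t" using ang zw unfolding s_def t_def by blast+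
  have ls: "l s = s" "l t = t" using FxI zw st by auto
  obtain j :: int where j: "sc s = sc t+2*pi * of_int j" using zw(3) cis_eq_iff unfolding s_def t_def by blast
  define t' where "t' = t+2*pi * of_int j"
  have lt': "l t' = t'" unfolding t'_def by (rule fix_per[OF ls(2)])
  have "s < sc s" "t' < sc s" using sc[OF ls(1)] sc[OF ls(2)] j by (auto simp: t'_def)
  moreover have "~ s < t'" using sc[OF ls(1)] lt' \<open>t' < sc s\<close> by blast
  moreover have "~ t' < s"
  proof
   assume "t' < s"
   then have "t < s - 2*pi * of_int j" "s - 2*pi * of_int j < sc t" using j \<open>s < sc s\<close> by (auto simp: t'_def)
   moreover have "l (s - 2*pi * of_int j) = s - 2*pi * of_int j" using fix_per[OF ls(1), of "- j"] by simp
   ultimately show False using sc[OF ls(2)] by blast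
  qed
  ultimately have "s = t'" by simp
  then show "z = w" unfolding st t'_def by (simp add: cis_shift_int)
 qed
 have imA: "(%z. cis (sc (ang z))) ` A <= R"
 proof
  fix w assume "w : (%z. cis (sc (ang z))) ` A"
  then obtain z where z: "z : A" "w = cis (sc (ang z))" by blast
  then have "z = cis (ang z)" using ang FAR by blast
  then have "ang z : YA" using z AI by metis
  then have "sc (ang z) : YR" using sc[of "ang z"] by (auto simp: YA_def YR_def)
  then show "w : R" using z RI by simp
 qed
 have imR: "(%z. cis (sc (ang z))) ` R <= A"
 proof
  fix w assume "w : (%z. cis (sc (ang z))) ` R"
  then obtain z where z: "z : R" "w = cis (sc (ang z))" by blast
  then have "z = cis (ang z)" using ang FAR by blast
  then have "ang z : YR" using z RI by metis
  then have "sc (ang z) : YA" using sc[of "ang z"] by (auto simp: YA_def YR_def)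
  then show "w : A" using z AI by simp
 qed
 have finAR: "finite A" "finite R" using finF FAR by auto
 have "card A <= card R" by (rule card_inj_on_le[OF inj_on_subset[OF inj] imA finAR(2)]) (use FAR in blast)
 moreover have "card R <= card A" by (rule card_inj_on_le[OF inj_on_subset[OF inj] imR finAR(1)]) (use FAR in blast)
 ultimately have cardF: "card Fx = 2 * card A" unfolding FAR(1) using card_Un_disjoint[OF finAR FAR(2)] by simp
 have posF: "card Fx > 0" using finF FxI[of x0] x0 card_gt_0_iff by blast
 have neA: "A ~= {}" using cardF posF by auto
 then obtain za where "za : A" by blast
 then have neR: "R ~= {}" using imA by blast
 have dich: "(attracting S1 g z | repelling S1 g z) & ~ (attracting S1 g z & repelling S1 g z)" if "z : Fx" for z
  using FAR that unfolding A_def R_def by blast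
 have alt: "(p : A & q : R) | (p : R & q : A)" if cq: "consecutive Fx p q" for p q
 proof -
  obtain x y where xy: "p = cis x" "q = cis y" "x < y" "y < x+2*pi" "!!w. x < w ==> w < y ==> cis w ~: Fx" "cis x : Fx" "cis y : Fx"
   by (rule consecutive_lift[OF cq FxS]) (rule that)
  have ls: "l x = x" "l y = y" using xy FxI by auto
  have "~ sc x < y" using xy(5)[of "sc x"] sc[OF ls(1)] FxI by auto
  moreover have "~ y < sc x" using sc[OF ls(1)] ls xy(3) by blast
  ultimately have "sc x = y" by simp
  then have "F x = a & F y = r | F x = r & F y = a" using sc[OF ls(1)] fx[OF ls(1)] by auto
  then show ?thesis unfolding xy AI RI using ls by (auto simp: YA_def YR_def)
 qed
 have leaf: "(pos_degenerate f (cis y1) (cis y2) \<longleftrightarrow> neg_degenerate f (cis x1) (cis x2)) & (neg_degenerate f (cis y1) (cis y2) \<longleftrightarrow> pos_degenerate f (cis x1) (cis x2))"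
  if "y1 : YA" "y2 : YA" "y1 < y2" "y2 < y1+2*pi" "!!w. y1 < w ==> w < y2 ==> w ~: YA"
   "x1 : YR" "x2 : YR" "x1 < x2" "x2 < x1+2*pi" "!!w. x1 < w ==> w < x2 ==> w ~: YR" for y1 y2 x1 x2
  by (rule interleaved_leaves[OF Ff ar _ perA _ perR btA btR that]) (auto simp: YA_def YR_def)
 \<comment> \<open>The successors of \<open>y1\<close> and \<open>y2\<close> are neighbours of the
   other kind, and this pair crosses the given one.\<close>
 have next_pair: "EX v1 v2. v1 : Y' & v2 : Y' & v1 < v2 & v2 < v1+2*pi & (ALL w. v1 < w --> w < v2 --> w ~: Y')"
  if Y: "Y = YA & Y' = YR | Y = YR & Y' = YA" and y: "y1 : Y" "y2 : Y" "y1 < y2" "y2 < y1+2*pi" "!!w. y1 < w ==> w < y2 ==> w ~: Y" for Y Y' y1 y2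
 proof -
  have l1: "l y1 = y1" and l2: "l y2 = y2" using Y y by (auto simp: YA_def YR_def)
  have sY: "sc t : Y'" if "t : Y" for t using Y that sc[of t] by (auto simp: YA_def YR_def)
  have sY': "sc t : Y" if "t : Y'" for t using Y that sc[of t] by (auto simp: YA_def YR_def)
  have dj: "t ~: Y'" if "t : Y" for t using Y that ar by (auto simp: YA_def YR_def)
  have lY: "l t = t" if "t : Y'" for t using Y that by (auto simp: YA_def YR_def)
  have py: "y1+2*pi : Y" using Y y perA[of y1 1] perR[of y1 1] by auto
  let ?v = "sc y1"
  have v: "?v : Y'" "y1 < ?v" using sY y sc[OF l1] by auto
  have "~ y2 < ?v" "?v ~= y2" using sc[OF l1] l2 y dj[OF y(2)] v by auto
  then have vy: "?v < y2" by simp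
  have s1: "sc ?v = y2"
  proof -
   have "~ y2 < sc ?v" using sc[OF lY[OF v(1)]] l2 vy by blast
   moreover have "~ sc ?v < y2" using y(5)[of "sc ?v"] sY'[OF v(1)] sc[OF lY[OF v(1)]] v by auto
   ultimately show ?thesis by simp
  qed
  let ?u = "sc y2"
  have u: "?u : Y'" "y2 < ?u" using sY y sc[OF l2] by auto
  have lp: "l (y1+2*pi) = y1+2*pi" using l1 l_per[of y1] by simp
  have "~ y1+2*pi < ?u" using sc[OF l2] y(4) lp by blast
  moreover have "?u ~= y1+2*pi" using dj[OF py] u by auto
  ultimately have uy: "?u < y1+2*pi" by simp
  have "w ~: Y'" if w: "?v < w" "w < ?u" for w
  proof
   assume h: "w : Y'"
   consider "w < y2" | "w = y2" | "y2 < w" by linarith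
   then show False
   proof cases
    case 1 then show False using sc[OF lY[OF v(1)]] s1 w lY[OF h] by auto
   next
    case 2 then show False using dj[OF y(2)] h by simp
   next
    case 3 then show False using sc[OF l2] w lY[OF h] by blast
   qed
  qed
  then show ?thesis using v u vy uy by (intro exI[of _ ?v] exI[of _ ?u]) auto
 qed
 have degen: "degenerate f (cis s) (cis t)" if "s < t" "t < s+2*pi" "F s = F t" for s t
  using cis_eq_near[of s t] that unfolding Ff by (auto simp: degenerate_def)
 have liftA: "EX y1 y2. p = cis y1 & q = cis y2 & y1 : YA & y2 : YA & y1 < y2 & y2 < y1+2*pi & (ALL w. y1 < w --> w < y2 --> w ~: YA)"
  if cq: "consecutive A p q" for p q
 proof -
  obtain x y where "p = cis x" "q = cis y" "x < y" "y < x+2*pi" "!!w. x < w ==> w < y ==> cis w ~: A" "cis x : A" "cis y : A"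
   by (rule consecutive_lift[OF cq ARS(1)]) (rule that)
  then show ?thesis unfolding AI by blast
 qed
 have liftR: "EX y1 y2. p = cis y1 & q = cis y2 & y1 : YR & y2 : YR & y1 < y2 & y2 < y1+2*pi & (ALL w. y1 < w --> w < y2 --> w ~: YR)"
  if cq: "consecutive R p q" for p q
 proof -
  obtain x y where "p = cis x" "q = cis y" "x < y" "y < x+2*pi" "!!w. x < w ==> w < y ==> cis w ~: R" "cis x : R" "cis y : R"
   by (rule consecutive_lift[OF cq ARS(2)]) (rule that)
  then show ?thesis unfolding RI by blast
 qed
 define prA where "prA = (%y1 y2. y1 : YA & y2 : YA & y1 < y2 & y2 < y1+2*pi & (ALL w. y1 < w --> w < y2 --> w ~: YA))"
 define prR where "prR = (%y1 y2. y1 : YR & y2 : YR & y1 < y2 & y2 < y1+2*pi & (ALL w. y1 < w --> w < y2 --> w ~: YR))"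
 have opp: "(pos_degenerate f (cis y1) (cis y2) \<longleftrightarrow> neg_degenerate f (cis x1) (cis x2)) & (neg_degenerate f (cis y1) (cis y2) \<longleftrightarrow> pos_degenerate f (cis x1) (cis x2))"
  if "prA y1 y2" "prR x1 x2" for y1 y2 x1 x2
  by (rule leaf) (use that in \<open>auto simp: prA_def prR_def\<close>)
 have pnA: "pos_degenerate f (cis y1) (cis y2) | neg_degenerate f (cis y1) (cis y2)" if "prA y1 y2" for y1 y2
  using degen[of y1 y2] that by (auto simp: prA_def YA_def pos_degenerate_def neg_degenerate_def)
 have exR: "EX x1 x2. prR x1 x2" if "prA y1 y2" for y1 y2
  unfolding prR_def by (rule next_pair[of YA YR y1 y2]) (use that in \<open>auto simp: prA_def\<close>)
 have exA: "EX x1 x2. prA x1 x2" if "prR y1 y2" for y1 y2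
  unfolding prA_def by (rule next_pair[of YR YA y1 y2]) (use that in \<open>auto simp: prR_def\<close>)
 have cA: "EX y1 y2. p = cis y1 & q = cis y2 & prA y1 y2" if "consecutive A p q" for p q
  unfolding prA_def using liftA[OF that] by blast
 have cR: "EX y1 y2. p = cis y1 & q = cis y2 & prR y1 y2" if "consecutive R p q" for p q
  unfolding prR_def using liftR[OF that] by blast
 have leaves: "((ALL x y. consecutive A x y --> {x, y} : Lplus f) & (ALL x y. consecutive R x y --> {x, y} : Lminus f))
  | ((ALL x y. consecutive R x y --> {x, y} : Lplus f) & (ALL x y. consecutive A x y --> {x, y} : Lminus f))"
 proof (cases "EX y1 y2. prA y1 y2 & neg_degenerate f (cis y1) (cis y2)")
  case True
  then obtain y1 y2 where y: "prA y1 y2" "neg_degenerate f (cis y1) (cis y2)" by blast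
  have r: "pos_degenerate f (cis x1) (cis x2)" if "prR x1 x2" for x1 x2 using opp[OF y(1) that] y(2) by blast
  obtain x1 x2 where x: "prR x1 x2" using exR[OF y(1)] by blast
  have "neg_degenerate f (cis z1) (cis z2)" if "prA z1 z2" for z1 z2 using opp[OF that x] r[OF x] by blast
  then have "(ALL x y. consecutive R x y --> {x, y} : Lplus f) & (ALL x y. consecutive A x y --> {x, y} : Lminus f)"
   using r cA cR unfolding Lplus_def Lminus_def by blast
  then show ?thesis by (rule disjI2)
 next
  case False
  then have p: "pos_degenerate f (cis z1) (cis z2)" if "prA z1 z2" for z1 z2 using pnA that by blast
  have "neg_degenerate f (cis x1) (cis x2)" if x: "prR x1 x2" for x1 x2
  proof -
   obtain z1 z2 where z: "prA z1 z2" using exA[OF x] by blast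
   then show ?thesis using opp[OF z x] p by blast
  qed
  then have "(ALL x y. consecutive A x y --> {x, y} : Lplus f) & (ALL x y. consecutive R x y --> {x, y} : Lminus f)"
   using p cA cR unfolding Lplus_def Lminus_def by blast
  then show ?thesis by (rule disjI1)
 qed
 have fcis: "f (cis t) = F t" for t unfolding Ff ..
 have fA: "f z = a" if z: "z : A" for z
 proof -
  obtain t where t: "z = cis t" using z repr by (auto simp: A_def)
  then have "t : YA" using z AI by simp
  then show ?thesis unfolding t fcis by (simp add: YA_def)
 qed
 have fR: "f z = r" if z: "z : R" for z
 proof -
  obtain t where t: "z = cis t" using z repr by (auto simp: R_def)
  then have "t : YR" using z RI by simp
  then show ?thesis unfolding t fcis by (simp add: YR_def)
 qed
 have imfA: "f ` A = {a}" and imfR: "f ` R = {r}" using fA fR neA neR by auto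
 have imfF: "f ` Fx = {a, r}" unfolding FAR(1) image_Un imfA imfR by auto
 obtain t0 where t0: "l t0 ~= t0" using nontriv by blast
 have contL: "isCont L x" for x using B.l_cont by (simp add: continuous_on_eq_continuous_at)
 have lpow: "(l ^^ j) (L t) = L ((l ^^ j) t)" for j t by (induction j) (auto simp: l_commute)
 have Ha: "H a = a"
 proof -
  have nL: "l (L t0) ~= L t0" using t0 fix_L by simp
  have "(%j. L ((l ^^ j) t0)) \<longlonglongrightarrow> L (snk t0)" by (rule isCont_tendsto_compose[OF contL orbit_limits(1)[OF t0]])
  then have "(%j. (l ^^ j) (L t0)) \<longlonglongrightarrow> L (snk t0)" unfolding lpow .
  then have "snk (L t0) = L (snk t0)" using orbit_limits(1)[OF nL] LIMSEQ_unique by blast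
  then have "F (L (snk t0)) = a" using lim[OF nL] by simp
  then show ?thesis using lim[OF t0] B.FH by simp
 qed
 \<comment> \<open>\<open>L\<close> preserves fixed parameters, so \<open>H r\<close> is
   \<open>a\<close> or \<open>r\<close>; injectivity and \<open>H a = a\<close> leave only
   \<open>r\<close>.\<close>
 have Hr: "H r = r"
 proof -
  have "l (src t0) = src t0" using orbit_limits[OF t0] by blast
  then have "F (L (src t0)) : {a, r}" by (intro fx) (simp add: fix_L)
  then have "H r = a | H r = r" using lim[OF t0] B.FH by auto
  then show ?thesis using Ha B.H_inj[OF aS] ar by auto
 qed
 have Ga: "G a = a" "G r = r" using H_fix_G Ha Hr by blast+
 have FixH: "{y : S2. H y = y} = {a, r}"
 proof
  show "{a, r} <= {y : S2. H y = y}" using aS Ha Hr by auto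
  show "{y : S2. H y = y} <= {a, r}"
  proof
   fix y assume y: "y : {y : S2. H y = y}"
   then obtain t where t: "y = F t" using surj by (metis (mono_tags, lifting) imageE mem_Collect_eq)
   have Gy: "G (F t) = F t" using H_fix_G y t by simp
   show "y : {a, r}"
   proof (cases "l t = t")
    case True then show ?thesis using fx t by simp
   next
    case False
    then have "F (snk t) = F (src t)" using H_fixed_limits[OF False Gy] by simp
    then show ?thesis using lim[OF False] ar by simp
   qed
  qed
 qed
 have contH: "continuous_on S2 H" "continuous_on S2 H'" using B.hom by (auto simp: homeomorphism_def)
 have attH: "attracting S2 H a"
 proof (rule attracting_power[OF _ n1 contH(1) _ Ha])
  show "H ` S2 <= S2" using B.H_in by blast
  show "attracting S2 (H ^^ n) a" unfolding Gn(1)[symmetric]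
  proof (rule attracting_S2_lift[OF l_cont l_mono _ aS(1) e(1)])
   show "G (F t) = F (l t)" for t by (simp add: FH)
   show fxa: "l x = x" if "F x = a" for x by (rule fibre_fixed[OF ar lim _ Ga]) (use that in auto)
   show "\<bar>l y - x\<bar> < \<bar>y - x\<bar>" if "F x = a" "0 < \<bar>y - x\<bar>" "\<bar>y - x\<bar> < \<epsilon>" for x y
    using e(2)[OF fxa[OF that(1)] that(2,3)] that(1) by blast
  qed
 qed
 define HI where "HI = inv_into S2 H"
 have HI: "HI y = H' y" if "y : S2" for y unfolding HI_def
  by (rule inv_into_f_eq) (use that B.H'_in B.HH' B.H_inj in \<open>auto simp: inj_on_def\<close>)
 have HIn: "(HI ^^ j) y = (H' ^^ j) y & (H' ^^ j) y : S2" if "y : S2" for j y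
  by (induction j) (use that HI B.H'_in in auto)
 have repH: "repelling S2 H r" unfolding repelling_def HI_def[symmetric]
 proof (rule attracting_power[OF _ n1])
  show "continuous_on S2 HI" using contH(2) by (rule continuous_on_eq) (simp add: HI)
  show "HI ` S2 <= S2" using HI B.H'_in by auto
  show "HI r = r" using HI[OF aS(2)] Hr B.H'H[OF aS(2)] by simp
  show "attracting S2 (HI ^^ n) r"
  proof (rule attracting_S2_lift[OF l'_cont l'_mono _ aS(2) e(1)])
   show "(HI ^^ n) (F t) = F (l' t)" for t using HIn[OF F_in, of n t] FH' unfolding Gn by simp
   have fxr: "l x = x" if "F x = r" for x by (rule fibre_fixed[OF ar lim _ Ga]) (use that in auto)
   then show "l' x = x" if "F x = r" for x using that l'_fix by blast
   show "\<bar>l' y - x\<bar> < \<bar>y - x\<bar>" if "F x = r" "0 < \<bar>y - x\<bar>" "\<bar>y - x\<bar> < \<epsilon>" for x y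
    using e(2)[OF fxr[OF that(1)] that(2,3)] that(1) by blast
  qed
 qed
 have c2: "card (f ` Fx) = 2" unfolding imfF using ar by simp
 show ?thesis unfolding conclusion_def Let_def Fx_def[symmetric] A_def[symmetric] R_def[symmetric]
 proof (intro conjI impI ballI allI)
  show "finite Fx" "0 < card Fx" by fact+
  show "even (card Fx)" using cardF by simp
  show "attracting S1 g z | repelling S1 g z" "~ (attracting S1 g z & repelling S1 g z)" if "z : Fx" for z using dich[OF that] by blast+
  show "p : A & q : R | p : R & q : A" if "consecutive Fx p q" for p q by (rule alt[OF that])
  show "EX a r. a ~= r & f ` A = {a} & f ` R = {r} & {y : S2. H y = y} = {a, r} & attracting S2 H a & repelling S2 H r"
   using ar imfA imfR FixH attH repH by blast
  show "{y : S2. H y = y} = f ` Fx" unfolding FixH imfF ..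
  have "card (f ` Fx) = 2 & (ALL x:A. attracting S2 H (f x)) & (ALL x:R. repelling S2 H (f x))"
   using c2 fA fR attH repH by simp
  then show "card (f ` Fx) = 2 & (ALL x:A. attracting S2 H (f x)) & (ALL x:R. repelling S2 H (f x)) |
   (EX c. f ` Fx = {c} & (EX \<phi> \<phi>'. homeomorphism (S2 - {c}) (UNIV :: complex set) \<phi> \<phi>' & (EX v. ALL z. \<phi> (H (\<phi>' z)) = z + v)))" by (rule disjI1)
 qed (rule leaves)
qed

text \<open>The conjugacy concerns \<open>H\<close> and not its power, so a lift of the original
  circle map fixing \<open>x\<close> is needed. \<open>L\<close> permutes the fixed parameters of
  \<open>l\<close> and, commuting with \<open>l\<close>, cannot send the source \<open>x\<close> to
  a sink. A shift by full turns then gives such a lift \<open>E\<close>, and its power of exponent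
  \<open>n\<close> is \<open>l\<close>.\<close>

lemma parabolic_case:
 assumes lim: "!!t. l t ~= t ==> F (snk t) = c & F (src t) = c" and fx: "!!t. l t = t ==> F t = c"
 shows conclusion
proof -
 have Gc: "F t = c" if "G (F t) = F t" for t
 proof (cases "l t = t")
  case True then show ?thesis by (rule fx)
 next
  case False
  then show ?thesis using H_fixed_limits(1)[OF False that] lim[OF False] by simp
 qed
 interpret P: wheel_para F l l' G G' c by unfold_locales (use fx Gc in auto)
 obtain x y where lx: "l x = x" "l y = y" and xy: "x < y" "y < x+2*pi"
  and up: "!!t. x < t ==> t < y ==> t < l t" and dn: "!!t. y < t ==> t < x+2*pi ==> l t < t"
  by (rule P.fixed_structure) (rule that)
 have per2: "l (x+2*pi) = x+2*pi" "l (y - 2*pi) = y - 2*pi" using lx l_per fix_per[OF lx(2), of "-1"] by simp_all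
 have dn': "l t < t" if "y - 2*pi < t" "t < x" for t using dn[of "t+2*pi"] that l_per by simp
 have only: "EX j::int. t = x+2*pi * of_int j | t = y+2*pi * of_int j" if t: "l t = t" for t
 proof -
  obtain m where m: "x <= t+2*pi * of_int m" "t+2*pi * of_int m < x+2*pi" using representative by blast
  have f: "l (t+2*pi * of_int m) = t+2*pi * of_int m" by (rule fix_per[OF t])
  then have "t+2*pi * of_int m = x | t+2*pi * of_int m = y"
   using up[of "t+2*pi * of_int m"] dn[of "t+2*pi * of_int m"] m by force
  then show ?thesis by (intro exI[of _ "- m"]) auto
 qed
 have cxy: "cis x ~= cis y" using cis_eq_near[of x y] xy by auto
 have Fx: "{x : S1. g x = x} = {cis x, cis y}"
 proof
  show "{cis x, cis y} <= {x : S1. g x = x}" using lx g_fix by auto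
  show "{x : S1. g x = x} <= {cis x, cis y}" unfolding fixed_set
  proof
   fix z assume "z : cis ` {t. l t = t}"
   then obtain t where t: "z = cis t" "l t = t" by blast
   obtain j :: int where "t = x+2*pi * of_int j | t = y+2*pi * of_int j" using only[OF t(2)] by blast
   then show "z : {cis x, cis y}" unfolding t(1) using cis_shift_int by auto
  qed
 qed
 define e where "e = min (y - x) (x+2*pi - y)"
 have e: "e > 0" "e <= y - x" "e <= x+2*pi - y" using xy by (auto simp: e_def)
 have atty: "attracting S1 g (cis y)"
 proof (rule attracting_lift[OF lx(2) e(1)])
  fix t assume t: "0 < \<bar>t - y\<bar>" "\<bar>t - y\<bar> < e"
  show "\<bar>l t - y\<bar> < \<bar>t - y\<bar>"
  proof (cases "t < y")
   case True
   have "t < l t" using up[of t] True t e by auto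
   moreover have "l t < l y" using True by simp
   ultimately show ?thesis using lx True by simp
  next
   case False
   then have ty: "y < t" using t by auto
   have "l t < t" using dn[of t] ty t e by auto
   moreover have "l y < l t" using ty by simp
   ultimately show ?thesis using lx ty by simp
  qed
 qed
 have repx: "repelling S1 g (cis x)"
 proof (rule repelling_lift[OF lx(1) e(1)])
  fix t assume t: "0 < \<bar>t - x\<bar>" "\<bar>t - x\<bar> < e"
  have lx': "l' x = x" using lx l'_fix by simp
  show "\<bar>l' t - x\<bar> < \<bar>t - x\<bar>"
  proof (cases "t < x")
   case True
   have "l t < t" using dn'[of t] True t e by auto
   then have "l' (l t) < l' t" using l'_mono by (simp add: strict_mono_less)
   moreover have "l' t < l' x" using l'_mono True by (simp add: strict_mono_less)
   ultimately show ?thesis using lx' True l'l by simp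
  next
   case False
   then have tx: "x < t" using t by auto
   have "t < l t" using up[of t] tx t e by auto
   then have "l' t < l' (l t)" using l'_mono by (simp add: strict_mono_less)
   moreover have "l' x < l' t" using l'_mono tx by (simp add: strict_mono_less)
   ultimately show ?thesis using lx' tx l'l by simp
  qed
 qed
 have nx: "~ attracting S1 g (cis x)" "~ repelling S1 g (cis y)" using not_attracting_repelling atty repx by blast+
 have A: "{z : {cis x, cis y}. attracting S1 g z} = {cis y}" using atty nx by auto
 have R: "{z : {cis x, cis y}. repelling S1 g z} = {cis x}" using repx nx by auto
 have fc: "f (cis x) = c" "f (cis y) = c" using fx[OF lx(1)] fx[OF lx(2)] unfolding Ff by auto
 have Lfix: "l (L t) = L t" if "l t = t" for t using that fix_L by simp
 have Hc: "H c = c" using fx[OF Lfix[OF lx(1)]] B.FH fx[OF lx(1)] by simp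
 have cS: "c : S2" by (rule P.cS)
 have FixH: "{y : S2. H y = y} = {c}"
 proof
  show "{y : S2. H y = y} <= {c}"
  proof
   fix z assume z: "z : {y : S2. H y = y}"
   then obtain t where t: "z = F t" using surj by (metis (mono_tags, lifting) imageE mem_Collect_eq)
   then have "F t = c" using Gc H_fix_G z by simp
   then show "z : {c}" using t by simp
  qed
 qed (use Hc cS in auto)
 have Lup: "L t < l (L t)" if "x < t" "t < y" for t unfolding l_commute using up[OF that] by simp
 \<comment> \<open>If \<open>x\<close> went to a sink, a point of the forward gap would go into a
   backward gap, although \<open>L\<close> commutes with \<open>l\<close>.\<close>
 have noy: "L x ~= y+2*pi * of_int j" for j :: int
 proof
  assume j: "L x = y+2*pi * of_int j"
  define s where "s = x+2*pi+2*pi * of_int j"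
  have ls: "l s = s" unfolding s_def by (rule fix_per[OF per2(1)])
  have "L y <= s"
  proof (rule ccontr)
   assume "~ L y <= s"
   then have 1: "L x < s" "s < L y" using j xy by (auto simp: s_def)
   have "L' (L x) < L' s" "L' s < L' (L y)"
    using B.l_less[of "L' (L x)" "L' s"] B.l_less[of "L' s" "L' (L y)"] 1 by (simp_all add: B.ll')
   then have 2: "x < L' s" "L' s < y" by (simp_all add: B.l'l)
   have "l (L' s) = L' s" using fix_L[of "L' s"] ls by (simp add: B.ll')
   then show False using up[OF 2] by simp
  qed
  define t where "t = (x + y) / 2"
  have t: "x < t" "t < y" using xy by (auto simp: t_def)
  have "L x < L t" "L t < L y" using t by simp_all
  then have b: "y < L t - 2*pi * of_int j" "L t - 2*pi * of_int j < x+2*pi" using j \<open>L y <= s\<close> unfolding s_def by linarith+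
  have "l (L t - 2*pi * of_int j) = l (L t) - 2*pi * of_int j" using l_per_int[of "L t" "- j"] by simp
  then show False using dn[OF b] Lup[OF t] by simp
 qed
 obtain j :: int where j: "L x = x+2*pi * of_int j" using only[OF Lfix[OF lx(1)]] noy by blast
 define E where "E = (%t. L t+2*pi * of_int (- j))"
 define E' where "E' = (%t. L' (t - 2*pi * of_int (- j)))"
 interpret E: wheel_map F E E' H H' unfolding E_def E'_def by (rule B.wheel_map_shift)
 have Ex: "E x = x" by (simp add: E_def j)
 have En: "(E ^^ i) t = (L ^^ i) t+2*pi * of_int (- j * int i)" for i t
 proof (induction i)
  case (Suc i)
  have "(E ^^ Suc i) t = L ((L ^^ i) t+2*pi * of_int (- j * int i))+2*pi * of_int (- j)" using Suc by (simp add: E_def)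
  also have "\<dots> = L ((L ^^ i) t)+2*pi * of_int (- j * int i)+2*pi * of_int (- j)" unfolding B.l_per_int ..
  finally show ?case by (simp add: algebra_simps)
 qed simp
 have Enl: "(E ^^ n) t = l t" for t
 proof -
  have "(E ^^ i) x = x" for i by (induction i) (auto simp: Ex)
  then have "2*pi * of_int (- j * int n) = 2*pi * of_int k" using En[of n x] ln[of x] lx(1) by simp
  then show ?thesis unfolding En ln by simp
 qed
 have Efix: "l t = t" if "E t = t" for t
 proof -
  have "(E ^^ i) t = t" for i by (induction i) (auto simp: that)
  then show ?thesis using Enl[of t] by simp
 qed
 have Ele: "(E ^^ i) t <= t" if "E t <= t" for i t
 proof (induction i)
  case (Suc i)
  then have "E ((E ^^ i) t) <= E t" by simp
  then have "E ((E ^^ i) t) <= t" using that by (rule order_trans)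
  then show ?case by simp
 qed simp
 have Ege: "t <= (E ^^ i) t" if "t <= E t" for i t
 proof (induction i)
  case (Suc i)
  then have "E t <= E ((E ^^ i) t)" by simp
  with that have "t <= E ((E ^^ i) t)" by (rule order_trans)
  then show ?case by simp
 qed simp
 have Eup: "t < E t" if "x < t" "t < y" for t using Ele[of t n] up[OF that] Enl[of t] by force
 have Edn: "E t < t" if "y < t" "t < x+2*pi" for t using Ege[of t n] dn[OF that] Enl[of t] by force
 have Ey: "E y = y"
 proof -
  have "l (E y) = E y" using fix_per[OF Lfix[OF lx(2)], of "- j"] by (simp add: E_def)
  moreover have "E x < E y" "E y < E (x+2*pi)" using xy by simp_all
  ultimately show ?thesis using up[of "E y"] dn[of "E y"] Ex E.l_per[of x] by force
 qed
 have "wheel_para F E E' H H' c"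
 proof
  show "EX x. E x = x" using Ex by blast
  show "EX x. E x ~= x" using Eup[of "(x + y) / 2"] xy by (intro exI[of _ "(x + y) / 2"]) auto
  show "F t = c" if "E t = t" for t by (rule fx[OF Efix[OF that]])
  show "F t = c" if "H (F t) = F t" for t by (rule Gc[OF H_fix_G[OF that]])
 qed
 then have conj: "EX \<phi> \<phi>'. homeomorphism (S2 - {c}) (UNIV::complex set) \<phi> \<phi>' & (EX v. ALL z. \<phi> (H (\<phi>' z)) = z + v)"
  by (rule wheel_para.conjugate_translation[OF _ Ex Ey xy Eup Edn])
 \<comment> \<open>There is one attracting and one repelling point, so no two of a kind are
   consecutive and the leaf conditions hold trivially.\<close>
 have sing: "~ consecutive {z} p q" for z p q by (auto simp: consecutive_def)
 have two: "(p = cis y & q = cis x) | (p = cis x & q = cis y)" if "consecutive {cis x, cis y} p q" for p q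
  using that by (auto simp: consecutive_def)
 show ?thesis unfolding conclusion_def Let_def Fx A R
  using cxy two sing atty repx nx FixH fc conj by auto
qed

lemma conclusion_holds: conclusion
proof -
 obtain a r where ar: "a : S2" "r : S2" "!!t. l t ~= t ==> F (snk t) = a & F (src t) = r" "!!t. l t = t ==> F t : {a, r}"
  by (rule source_sink) (rule that)
 show ?thesis
 proof (cases "a = r")
  case True
  show ?thesis by (rule parabolic_case[of a]) (use ar True in auto)
 next
  case False
  then show ?thesis by (rule hyperbolic_case[OF _ ar])
 qed
qed

end

theorem theorem6p3:
  fixes f :: "complex \<Rightarrow> real^3" and h :: "complex \<Rightarrow> complex" and H :: "real^3 \<Rightarrow> real^3"
  assumes "catherine_wheel f"
    and "op_homeo_S1 h" and "op_homeo_S2 H"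
    and "\<forall>z \<in> S1. f (h z) = H (f z)"
  shows "\<exists>n::nat. n \<ge> 1 \<and>
    (let g = h ^^ n;
         F = {x \<in> S1. g x = x};
         A = {x \<in> F. attracting S1 g x};
         R = {x \<in> F. repelling S1 g x};
         FH = {y \<in> S2. H y = y}
     in (\<forall>x \<in> S1. g x = x) \<or>
        (finite F \<and> even (card F) \<and> card F > 0 \<and>
         (\<forall>x \<in> F. (attracting S1 g x \<or> repelling S1 g x) \<and>
                   \<not> (attracting S1 g x \<and> repelling S1 g x)) \<and>
         (\<forall>x y. consecutive F x y \<longrightarrow> (x \<in> A \<and> y \<in> R) \<or> (x \<in> R \<and> y \<in> A)) \<and>
         ((  (\<forall>x y. consecutive A x y \<longrightarrow> {x, y} \<in> Lplus f)
           \<and> (\<forall>x y. consecutive R x y \<longrightarrow> {x, y} \<in> Lminus f))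
          \<or>
          (  (\<forall>x y. consecutive R x y \<longrightarrow> {x, y} \<in> Lplus f)
           \<and> (\<forall>x y. consecutive A x y \<longrightarrow> {x, y} \<in> Lminus f))) \<and>
         (card F \<ge> 4 \<longrightarrow>
            (\<exists>a r. a \<noteq> r \<and> f ` A = {a} \<and> f ` R = {r} \<and> FH = {a, r} \<and>
                   attracting S2 H a \<and> repelling S2 H r)) \<and>
         (card F = 2 \<longrightarrow>
            FH = f ` F \<and>
            ((card (f ` F) = 2 \<and> (\<forall>x \<in> A. attracting S2 H (f x)) \<and>
                                 (\<forall>x \<in> R. repelling S2 H (f x)))
             \<or>
             (\<exists>c. f ` F = {c} \<and>
                  (\<exists>\<phi> \<phi>'. homeomorphism (S2 - {c}) (UNIV :: complex set) \<phi> \<phi>' \<and>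
                     (\<exists>v. \<forall>z. \<phi> (H (\<phi>' z)) = z + v)))))))"
proof -
 define F where "F = (%t. f (cis t))"
 interpret W: wheel F unfolding F_def by (rule catherine_wheel_lift[OF assms(1)])
 obtain h' where h': "homeomorphism S1 S1 h h'" and "deg1 h = 1"
  using assms(2) by (auto simp: op_homeo_S1_def deg1_def)
 then obtain L where L: "continuous_on UNIV L" "strict_mono L" "!!t. L (t+2*pi) = L t+2*pi" "!!t. h (cis t) = cis (L t)"
  using homeomorphism_S1_lift by metis
 obtain H' where H': "homeomorphism S2 S2 H H'" using assms(3) by (auto simp: op_homeo_S2_def)
 define L' where "L' = inv_into UNIV L"
 have sL: "surj L" using periodic_lift_surj[OF L(1,3)] by (metis surjI)
 have iL: "inj L" using L(2) by (rule strict_mono_imp_inj_on)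
 interpret M: wheel_map F L L' H H'
 proof
  show "L' (L t) = t" for t unfolding L'_def using iL by simp
  show "L (L' t) = t" for t unfolding L'_def using sL by (simp add: surj_f_inv_f)
  show "F (L t) = H (F t)" for t using assms(4) L(4)[of t] unfolding F_def by (metis cis_in_S1)
 qed (use L H' in auto)
 obtain c where c: "c : S2" "H c = c" by (rule op_homeo_S2_fixed_point[OF assms(3)])
 obtain n x0 and k :: int where n: "n >= 1" and x0: "(L ^^ n) x0 = x0+2*pi * of_int k"
  using M.periodic_point_exists[OF c] by blast
 \<comment> \<open>Removing \<open>k\<close> full turns makes the periodic point \<open>x0\<close> a
   fixed point of the lift.\<close>
 define l where "l = (%t. (L ^^ n) t+2*pi * of_int (- k))"
 define l' where "l' = (%t. (L' ^^ n) (t - 2*pi * of_int (- k)))"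
 interpret G: wheel_map F l l' "H ^^ n" "H' ^^ n" unfolding l_def l'_def
  by (rule wheel_map.wheel_map_shift[OF M.wheel_map_pow])
 have hn: "(h ^^ i) (cis t) = cis ((L ^^ i) t)" for i t by (induction i) (auto simp: L(4))
 have gl: "(h ^^ n) (cis t) = cis (l t)" for t unfolding hn l_def by (rule cis_shift_int[symmetric])
 show ?thesis
 proof (cases "ALL t. l t = t")
  case True
  have "ALL x:S1. (h ^^ n) x = x"
  proof
   fix x assume "x : S1"
   then obtain t where "x = cis t" using S1_iff_cis by blast
   then show "(h ^^ n) x = x" using gl[of t] True by simp
  qed
  then show ?thesis using n unfolding Let_def by blast
 next
  case False
  interpret X: wheel_root F l l' "H ^^ n" "H' ^^ n" L L' H H' n "- k" f "h ^^ n"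
  proof
   have "l x0 = x0" by (simp add: l_def x0)
   then show "EX x. l x = x" by blast
   show "EX x. l x ~= x" using False by blast
  qed (use n gl in \<open>auto simp: l_def F_def\<close>)
  show ?thesis
   by (rule exI[of _ n], rule conjI[OF n], unfold Let_def, rule disjI2)
    (rule X.conclusion_holds[unfolded X.conclusion_def Let_def])
 qed
qed

end
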